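(* For the space-times admitting a null conformal Killing-Yano tensor $A$ such that $Z_1\equiv\delta A$ and $Z_2\equiv\delta{*A}$ are Killing vectors verifying $Z_1\wedge Z_2=0$, the metric line element is given by $$ds^2=\omega^{-2}\left[-2\,du\,dv-2H\,du^2+dx^2+dy^2\right],\qquad H=H(u,x,y),\qquad \omega=1+\gamma x .$$ Moreover the metric admits the Killing-Yano tensor $*F$, where $$F=\ell\wedge p=\omega^{-3}\,du\wedge dx,$$ and the Ricci and Weyl tensors take the expressions $$Ric=\sigma\,\ell\otimes\ell+\Lambda g,\quad \sigma=\omega^4[H_{xx}+H_{yy}]-2\gamma\omega^3H_x,\quad \Lambda=-3\gamma^2;$$ $$\mathcal W=\psi\,\mathcal F\otimes\mathcal F,\quad \psi=\omega^4[H_{xx}-H_{yy}-2\mathrm i H_{xy}].$$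
   Context: A space-time is an oriented 4-dimensional manifold with metric $g$ of signature $(-,+,+,+)$ and volume element $\eta$; vectors and 1-forms are identified through $g$; considerations are local. $\nabla$ is the Levi-Civita connection, $*$ the Hodge dual, and the codifferential is $(\delta\omega)_{\underline p}=-\nabla_\alpha\omega^{\alpha}{}_{\underline p}$. $W$ is the Weyl tensor and $\mathcal W=\frac12(W-\mathrm i*W)$ the self-dual Weyl tensor. For a real two-form $A$ put $\mathcal A=\frac1{\sqrt2}(A-\mathrm i*A)$. $A$ is a conformal Killing-Yano (CKY) tensor if $3\nabla\mathcal A=2\,i(\mathcal Z)\mathcal G$ with $\mathcal Z=\delta\mathcal A$, where $i(\mathcal Z)$ is the inner product, $\mathcal G=\frac12(G-\mathrm i\eta)$, $G_{\alpha\beta\gamma\delta}=g_{\alpha\gamma}g_{\beta\delta}-g_{\alpha\delta}g_{\beta\gamma}$. A Killing-Yano tensor is a CKY tensor with vanishing codifferential. $A$ is null if $A\neq0$ and $\mathcal A_{\alpha\beta}\mathcal A^{\alpha\beta}=0$. "Killing vector" is understood to include the possibility that $Z_1,Z_2$ vanish. In the claim, $u,v,x,y$ are real coordinates, $H$ is a real function, $\gamma=\sqrt{-\Lambda/3}$ is a constant (the case $\gamma=0$, i.e. pp-waves, is included), $\ell=\omega^{-2}du$, $p=\omega^{-1}dx$, subscripts on $H$ denote partial derivatives, and $\mathcal F=\frac1{\sqrt2}(F-\mathrm i*F)=\ell\wedge m$ with $m=\frac1{\sqrt2}(p+\mathrm i q)$, $q=\omega^{-1}dy$.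
   Formalization: The Weyl formula is corrected to 𝒲 = (ψ/2) 𝓕⊗𝓕 with ψ as printed: under the stated conventions the printed 𝒲 = ψ 𝓕⊗𝓕 is off by a factor 2 (e.g. γ=0, H=x²−y² gives 𝒲_uxux=1 but ψ𝓕_ux𝓕_ux=2). *)

theory Defs
  imports "HOL-Analysis.Analysis"
begin

text \<open>
  Since all considerations are local, a space-time is a connected open subset of \<open>real^4\<close>
  carrying a metric and a volume element.  A tensor field is represented by the family of its
  covariant components in the standard coordinates; frames and other coordinate systems are
  functions on this domain.
\<close>

subsection \<open>Smooth functions\<close>

definition pd :: "'n::finite \<Rightarrow> (real^'n \<Rightarrow> 'a::real_normed_vector) \<Rightarrow> real^'n \<Rightarrow> 'a" where
  "pd i f z = frechet_derivative f (at z) (axis i 1)"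

primrec Ck_on :: "nat \<Rightarrow> (real^'n::finite) set \<Rightarrow> (real^'n \<Rightarrow> 'a::real_normed_vector) \<Rightarrow> bool" where
  "Ck_on 0 S f \<longleftrightarrow> continuous_on S f"
| "Ck_on (Suc k) S f \<longleftrightarrow> (\<forall>z\<in>S. f differentiable (at z)) \<and> (\<forall>i. Ck_on k S (pd i f))"

text \<open>This is the usual notion for open \<open>S\<close>, the only case in which it is used.\<close>

definition smooth_on :: "(real^'n::finite) set \<Rightarrow> (real^'n \<Rightarrow> 'a::real_normed_vector) \<Rightarrow> bool" where
  "smooth_on S f \<longleftrightarrow> (\<forall>k. Ck_on k S f)"

subsection \<open>Tensor fields\<close>

type_synonym 'a tensor1 = "real^4 \<Rightarrow> 4 \<Rightarrow> 'a"
type_synonym 'a tensor2 = "real^4 \<Rightarrow> 4 \<Rightarrow> 4 \<Rightarrow> 'a"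
type_synonym 'a tensor3 = "real^4 \<Rightarrow> 4 \<Rightarrow> 4 \<Rightarrow> 4 \<Rightarrow> 'a"
type_synonym 'a tensor4 = "real^4 \<Rightarrow> 4 \<Rightarrow> 4 \<Rightarrow> 4 \<Rightarrow> 4 \<Rightarrow> 'a"

definition two_form :: "(real^4) set \<Rightarrow> real tensor2 \<Rightarrow> bool" where
  "two_form U A \<longleftrightarrow>
     (\<forall>a b. smooth_on U (\<lambda>z. A z a b)) \<and> (\<forall>z\<in>U. \<forall>a b. A z a b = - A z b a)"

definition differential :: "(real^4 \<Rightarrow> real) \<Rightarrow> real tensor1" where
  "differential f = (\<lambda>z a. pd a f z)"

definition wedge :: "('a::comm_ring) tensor1 \<Rightarrow> 'a tensor1 \<Rightarrow> 'a tensor2" where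
  "wedge w1 w2 = (\<lambda>z a b. w1 z a * w2 z b - w1 z b * w2 z a)"

subsection \<open>Space-times\<close>

definition metric_matrix :: "real tensor2 \<Rightarrow> real^4 \<Rightarrow> real^4^4" where
  "metric_matrix g z = (\<chi> a b. g z a b)"

text \<open>Signature \<open>(-,+,+,+)\<close>: the columns of \<open>P\<close> form an orthonormal frame.\<close>

definition lorentzian :: "real^4^4 \<Rightarrow> bool" where
  "lorentzian M \<longleftrightarrow> (\<exists>P :: real^4^4. invertible P \<and>
     transpose P ** M ** P = (\<chi> i j. if i = j then (if i = 1 then -1 else 1) else 0))"

text \<open>
  The function \<open>vol\<close> is the component of the volume element \<open>\<eta>\<close> along the standard coordinate
  basis in the order 1, 2, 3, 4; its sign is the orientation.
\<close>

definition spacetime :: "(real^4) set \<Rightarrow> real tensor2 \<Rightarrow> (real^4 \<Rightarrow> real) \<Rightarrow> bool" where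
  "spacetime U g vol \<longleftrightarrow> open U \<and> connected U \<and>
     (\<forall>a b. smooth_on U (\<lambda>z. g z a b)) \<and> (\<forall>z\<in>U. lorentzian (metric_matrix g z)) \<and>
     smooth_on U vol \<and> (\<forall>z\<in>U. (vol z)\<^sup>2 = - det (metric_matrix g z))"

definition inv_metric :: "real tensor2 \<Rightarrow> real tensor2" where
  "inv_metric g = (\<lambda>z a b. matrix_inv (metric_matrix g z) $ a $ b)"

definition volume_form :: "(real^4 \<Rightarrow> real) \<Rightarrow> real tensor4" where
  "volume_form vol = (\<lambda>z a b c d.
     vol z * det (vector [axis a 1, axis b 1, axis c 1, axis d 1] :: real^4^4))"

definition raise1 :: "real tensor2 \<Rightarrow> ('a::real_normed_vector) tensor1 \<Rightarrow> 'a tensor1" where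
  "raise1 g w = (\<lambda>z a. \<Sum>b\<in>UNIV. inv_metric g z a b *\<^sub>R w z b)"

definition raise2 :: "real tensor2 \<Rightarrow> ('a::real_normed_vector) tensor2 \<Rightarrow> 'a tensor2" where
  "raise2 g A = (\<lambda>z a b.
     \<Sum>c\<in>UNIV. \<Sum>d\<in>UNIV. (inv_metric g z a c * inv_metric g z b d) *\<^sub>R A z c d)"

subsection \<open>Levi-Civita connection and codifferential\<close>

text \<open>\<open>christoffel g z c a b\<close> is \<open>\<Gamma>\<close> with upper index \<open>c\<close> and lower indices \<open>a\<close>, \<open>b\<close>.\<close>

definition christoffel :: "real tensor2 \<Rightarrow> real tensor3" where
  "christoffel g = (\<lambda>z c a b. (\<Sum>d\<in>UNIV. inv_metric g z c d *
     (pd a (\<lambda>w. g w d b) z + pd b (\<lambda>w. g w d a) z - pd d (\<lambda>w. g w a b) z)) / 2)"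

text \<open>The first index of \<open>nabla1\<close> and \<open>nabla2\<close> is the index of the derivative.\<close>

definition nabla1 :: "real tensor2 \<Rightarrow> ('a::real_normed_vector) tensor1 \<Rightarrow> 'a tensor2" where
  "nabla1 g w = (\<lambda>z c a. pd c (\<lambda>y. w y a) z - (\<Sum>d\<in>UNIV. christoffel g z d c a *\<^sub>R w z d))"

definition nabla2 :: "real tensor2 \<Rightarrow> ('a::real_normed_vector) tensor2 \<Rightarrow> 'a tensor3" where
  "nabla2 g A = (\<lambda>z c a b. pd c (\<lambda>y. A y a b) z
     - (\<Sum>d\<in>UNIV. christoffel g z d c a *\<^sub>R A z d b)
     - (\<Sum>d\<in>UNIV. christoffel g z d c b *\<^sub>R A z a d))"

definition codifferential :: "real tensor2 \<Rightarrow> ('a::real_normed_vector) tensor2 \<Rightarrow> 'a tensor1" where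
  "codifferential g A = (\<lambda>z b.
     - (\<Sum>c\<in>UNIV. \<Sum>a\<in>UNIV. inv_metric g z c a *\<^sub>R nabla2 g A z c a b))"

definition killing :: "(real^4) set \<Rightarrow> real tensor2 \<Rightarrow> real tensor1 \<Rightarrow> bool" where
  "killing U g Z \<longleftrightarrow> (\<forall>z\<in>U. \<forall>a b. nabla1 g Z z a b + nabla1 g Z z b a = 0)"

subsection \<open>Hodge dual and conformal Killing-Yano tensors\<close>

definition hodge :: "real tensor2 \<Rightarrow> (real^4 \<Rightarrow> real) \<Rightarrow> real tensor2 \<Rightarrow> real tensor2" where
  "hodge g vol A = (\<lambda>z a b.
     (\<Sum>c\<in>UNIV. \<Sum>d\<in>UNIV. volume_form vol z a b c d * raise2 g A z c d) / 2)"

definition self_dual :: "real tensor2 \<Rightarrow> (real^4 \<Rightarrow> real) \<Rightarrow> real tensor2 \<Rightarrow> complex tensor2" where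
  "self_dual g vol A = (\<lambda>z a b.
     (of_real (A z a b) - \<i> * of_real (hodge g vol A z a b)) / of_real (sqrt 2))"

definition self_dual_metric :: "real tensor2 \<Rightarrow> (real^4 \<Rightarrow> real) \<Rightarrow> complex tensor4" where
  "self_dual_metric g vol = (\<lambda>z a b c d.
     (of_real (g z a c * g z b d - g z a d * g z b c) - \<i> * of_real (volume_form vol z a b c d)) / 2)"

definition conformal_killing_yano ::
    "(real^4) set \<Rightarrow> real tensor2 \<Rightarrow> (real^4 \<Rightarrow> real) \<Rightarrow> real tensor2 \<Rightarrow> bool" where
  "conformal_killing_yano U g vol A \<longleftrightarrow> two_form U A \<and>
     (\<forall>z\<in>U. \<forall>c a b. 3 * nabla2 g (self_dual g vol A) z c a b =
        2 * (\<Sum>d\<in>UNIV. raise1 g (codifferential g (self_dual g vol A)) z d *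
               self_dual_metric g vol z d c a b))"

definition killing_yano ::
    "(real^4) set \<Rightarrow> real tensor2 \<Rightarrow> (real^4 \<Rightarrow> real) \<Rightarrow> real tensor2 \<Rightarrow> bool" where
  "killing_yano U g vol A \<longleftrightarrow>
     conformal_killing_yano U g vol A \<and> (\<forall>z\<in>U. \<forall>b. codifferential g A z b = 0)"

definition null_two_form ::
    "(real^4) set \<Rightarrow> real tensor2 \<Rightarrow> (real^4 \<Rightarrow> real) \<Rightarrow> real tensor2 \<Rightarrow> bool" where
  "null_two_form U g vol A \<longleftrightarrow> (\<forall>z\<in>U. (\<exists>a b. A z a b \<noteq> 0) \<and>
     (\<Sum>a\<in>UNIV. \<Sum>b\<in>UNIV. self_dual g vol A z a b * raise2 g (self_dual g vol A) z a b) = 0)"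

subsection \<open>Curvature\<close>

text \<open>
  \<open>riemann_up g z a b c d\<close> has upper index \<open>a\<close>.  With these signs the Ricci tensor of a round
  sphere is positive.
\<close>

definition riemann_up :: "real tensor2 \<Rightarrow> real tensor4" where
  "riemann_up g = (\<lambda>z a b c d.
     pd c (\<lambda>w. christoffel g w a d b) z - pd d (\<lambda>w. christoffel g w a c b) z
     + (\<Sum>e\<in>UNIV. christoffel g z a c e * christoffel g z e d b
                - christoffel g z a d e * christoffel g z e c b))"

definition riemann :: "real tensor2 \<Rightarrow> real tensor4" where
  "riemann g = (\<lambda>z a b c d. \<Sum>e\<in>UNIV. g z a e * riemann_up g z e b c d)"

definition ricci :: "real tensor2 \<Rightarrow> real tensor2" where
  "ricci g = (\<lambda>z b d. \<Sum>a\<in>UNIV. riemann_up g z a b a d)"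

definition scalar_curvature :: "real tensor2 \<Rightarrow> real^4 \<Rightarrow> real" where
  "scalar_curvature g z = (\<Sum>a\<in>UNIV. \<Sum>b\<in>UNIV. inv_metric g z a b * ricci g z a b)"

definition weyl :: "real tensor2 \<Rightarrow> real tensor4" where
  "weyl g = (\<lambda>z a b c d. riemann g z a b c d
     - (g z a c * ricci g z b d - g z a d * ricci g z b c
        - g z b c * ricci g z a d + g z b d * ricci g z a c) / 2
     + scalar_curvature g z / 6 * (g z a c * g z b d - g z a d * g z b c))"

text \<open>
  The dual is taken on the first index pair; for the Weyl tensor both pairs give the same.

  On normalisation: for the pp-wave \<open>-2 du dv - 2 H du^2 + dx^2 + dy^2\<close> the component \<open>uxux\<close> of
  the Weyl tensor is \<open>(H_xx - H_yy) / 2\<close>, so that of \<open>self_dual_weyl\<close> has real part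
  \<open>(H_xx - H_yy) / 4\<close>, while that of \<open>\<F> \<otimes> \<F>\<close> with \<open>\<F> = du \<and> (dx + i dy) / sqrt 2\<close> is 1/2.
  Hence \<open>self_dual_weyl\<close> is \<open>\<psi>/2\<close> times \<open>\<F> \<otimes> \<F>\<close> for \<open>\<psi> = H_xx - H_yy - 2 i H_xy\<close>.
\<close>

definition self_dual_weyl :: "real tensor2 \<Rightarrow> (real^4 \<Rightarrow> real) \<Rightarrow> complex tensor4" where
  "self_dual_weyl g vol = (\<lambda>z a b c d. (of_real (weyl g z a b c d)
     - \<i> * of_real (hodge g vol (\<lambda>w a b. weyl g w a b c d) z a b)) / 2)"

subsection \<open>Adapted coordinates\<close>

definition oriented_coordinates :: "(real^4) set \<Rightarrow> (real^4 \<Rightarrow> real) \<Rightarrow>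
    (real^4 \<Rightarrow> real) \<Rightarrow> (real^4 \<Rightarrow> real) \<Rightarrow> (real^4 \<Rightarrow> real) \<Rightarrow> (real^4 \<Rightarrow> real) \<Rightarrow> bool" where
  "oriented_coordinates V vol u v x y \<longleftrightarrow> open V \<and>
     smooth_on V u \<and> smooth_on V v \<and> smooth_on V x \<and> smooth_on V y \<and>
     inj_on (\<lambda>z. vector [u z, v z, x z, y z] :: real^4) V \<and>
     (\<forall>z\<in>V. 0 < vol z * det (vector
        [\<chi> a. pd a u z, \<chi> a. pd a v z, \<chi> a. pd a x z, \<chi> a. pd a y z] :: real^4^4))"

text \<open>
  The function \<open>H\<close> has the three arguments \<open>u\<close>, \<open>x\<close>, \<open>y\<close>, in this order.  The positive
  orientation of the coordinates is what makes \<open>F - i *F\<close> proportional to \<open>\<ell> \<and> (p + i q)\<close> rather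
  than to its conjugate.
\<close>

definition adapted_coordinates :: "(real^4) set \<Rightarrow> real tensor2 \<Rightarrow> (real^4 \<Rightarrow> real) \<Rightarrow> real \<Rightarrow>
    (real^4 \<Rightarrow> real) \<Rightarrow> (real^4 \<Rightarrow> real) \<Rightarrow> (real^4 \<Rightarrow> real) \<Rightarrow> (real^4 \<Rightarrow> real) \<Rightarrow>
    (real^3 \<Rightarrow> real) \<Rightarrow> bool" where
  "adapted_coordinates V g vol \<gamma> u v x y H \<longleftrightarrow>
     oriented_coordinates V vol u v x y \<and>
     smooth_on ((\<lambda>z. vector [u z, x z, y z]) ` V) H \<and>
     (\<forall>z\<in>V. 1 + \<gamma> * x z \<noteq> 0) \<and>
     (\<forall>z\<in>V. \<forall>a b. g z a b = inverse ((1 + \<gamma> * x z)\<^sup>2) *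
        (- (pd a u z * pd b v z + pd a v z * pd b u z)
         - 2 * H (vector [u z, x z, y z]) * pd a u z * pd b u z
         + pd a x z * pd b x z + pd a y z * pd b y z))"

end

theory Submission
  imports Defs
begin

text \<open>
  A null two-form is \<open>l \<and> p\<close> in a suitable null coframe \<open>(l, n, p, q)\<close>.  The conformal
  Killing-Yano equation and \<open>Z\<^sub>1 \<and> Z\<^sub>2 = 0\<close> force \<open>Z\<^sub>1 = \<alpha> l\<close> and
  \<open>Z\<^sub>2 = \<beta> l\<close>, and make \<open>l\<close> a Killing form; since \<open>Z\<^sub>1\<close> and \<open>Z\<^sub>2\<close> are
  Killing, \<open>\<alpha>\<close> and \<open>\<beta>\<close> are constant, and \<open>\<alpha>\<^sup>2 + \<beta>\<^sup>2 = 9 \<gamma>\<^sup>2\<close> does not depend on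
  the coframe.  A duality rotation with constant angle then achieves \<open>\<alpha> = - 3 \<gamma>\<close>, \<open>\<beta> = 0\<close>.
  The structure equations imply \<open>dl \<and> l = dp \<and> l = 0\<close>, so that a null rotation makes
  \<open>p = d\<phi>\<close> by the Poincare lemma along the leaves of \<open>l = 0\<close>.  With \<open>\<omega> = exp (\<gamma> \<phi>)\<close>
  the same argument gives \<open>q = dy / \<omega>\<close> and \<open>n = dv + H du\<close>, while \<open>\<omega>\<^sup>2 l = du\<close> is closed, and
  \<open>\<omega> = 1 + \<gamma> x\<close> defines \<open>x\<close> (with \<open>x = \<phi>\<close> if \<open>\<gamma> = 0\<close>).  Conversely, the Ricci and Weyl
  tensors follow from the connection forms of the coframe \<open>l = du / \<omega>\<^sup>2\<close>, \<open>n = dv + H du\<close>,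
  \<open>p = dx / \<omega>\<close>, \<open>q = dy / \<omega>\<close> and the Ricci identity.
\<close>

subsection \<open>Partial derivatives\<close>

text \<open>The exponential is an integrating factor: \<open>dl = - 2 \<gamma> p \<and> l\<close>,
  and modulo \<open>l\<close> also \<open>dq = - \<gamma> p \<and> q\<close>; so once
  \<open>p = d\<phi>\<close>, the form \<open>exp (2 \<gamma> \<phi>) l\<close> is closed and
  \<open>exp (\<gamma> \<phi>) q\<close> is closed along the leaves. The coordinate \<open>x\<close>
  is the primitive of \<open>exp (\<gamma> \<phi>)\<close> with respect to \<open>\<phi>\<close>,
  which makes \<open>\<omega>\<close> affine in \<open>x\<close>. Null rotations about
  \<open>l\<close> preserve \<open>l \<and> p\<close>. They are the freedom left by the Killing-Yano
  equation, which determines the connection up to two one-forms \<open>s\<close>, \<open>t\<close>.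
  Making \<open>p\<close> and \<open>\<omega> q\<close> exact uses up this freedom; the rest of
  \<open>s\<close> and \<open>t\<close> is \<open>dn\<close>, that is, the first derivatives of
  \<open>H\<close>. That \<open>H\<close> does not depend on \<open>v\<close> is the absence of
  \<open>l \<and> n\<close> in \<open>dn\<close>. Two obstacles shape the proof. Normal forms at
  single points involve arbitrary choices, so a smooth coframe has to be rebuilt by formulas in
  \<open>A\<close> and its dual. And integration along leaves needs coordinates that straighten
  them, hence smooth dependence of a total differential system on its initial value; this rests on a
  contraction and a Gronwall estimate.\<close>

lemma has_derivative_pd:
  assumes "(f has_derivative f') (at z)"
  shows "pd i f z = f' (axis i 1)"
  using frechet_derivative_at[OF assms] by (simp add: pd_def)

lemma differentiable_has_derivative_pd:
  fixes f :: "real^'n::finite \<Rightarrow> 'a::real_normed_vector"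
  assumes "f differentiable (at z)"
  shows "(f has_derivative (\<lambda>h. \<Sum>i\<in>UNIV. (h $ i) *\<^sub>R pd i f z)) (at z)"
proof -
  obtain f' where f': "(f has_derivative f') (at z)"
    using assms by (auto simp: differentiable_def)
  have "f' h = (\<Sum>i\<in>UNIV. (h $ i) *\<^sub>R pd i f z)" for h
  proof -
    have "linear f'" using f' by (rule has_derivative_linear)
    moreover have "h = (\<Sum>i\<in>UNIV. (h $ i) *\<^sub>R axis i 1)"
      by (simp add: basis_expansion flip: scalar_mult_eq_scaleR)
    ultimately have "f' h = (\<Sum>i\<in>UNIV. (h $ i) *\<^sub>R f' (axis i 1))"
      by (metis (no_types, lifting) linear_sum linear_cmul sum.cong)
    then show ?thesis by (simp only: has_derivative_pd[OF f'])
  qed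
  then have "f' = (\<lambda>h. \<Sum>i\<in>UNIV. (h $ i) *\<^sub>R pd i f z)" by (rule ext)
  with f' show ?thesis by simp
qed

text \<open>Fields are total functions whose properties are known only on an open set; this is what
  allows an identity valid on that set to be differentiated.\<close>

lemma pd_cong:
  assumes "open S" "z \<in> S" "\<And>w. w \<in> S \<Longrightarrow> f w = g w"
  shows "pd i f z = pd i g z"
proof -
  \<comment> \<open>\<open>frechet_derivative\<close> is a choice among derivatives, so equivalence
    of the two predicates gives equality even where no derivative exists.\<close>
  have "(f has_derivative D) (at z) \<longleftrightarrow> (g has_derivative D) (at z)" for D
    using has_derivative_transform_within_open[of f D z UNIV S g]
      has_derivative_transform_within_open[of g D z UNIV S f] assms by auto
  then show ?thesis unfolding pd_def frechet_derivative_def by simp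
qed

lemma differentiable_cong:
  assumes "f differentiable (at z)" "open S" "z \<in> S" "\<And>w. w \<in> S \<Longrightarrow> f w = g w"
  shows "g differentiable (at z)"
  using assms has_derivative_transform_within_open[of f _ z UNIV S g]
  unfolding differentiable_def by blast

lemma pd_const [simp]: "pd i (\<lambda>w. c) z = 0"
  by (simp add: has_derivative_pd[OF has_derivative_const])

lemma pd_bounded_linear:
  assumes "bounded_linear L" "f differentiable (at z)"
  shows "pd i (\<lambda>w. L (f w)) z = L (pd i f z)"
proof -
  obtain f' where f': "(f has_derivative f') (at z)"
    using assms by (auto simp: differentiable_def)
  from has_derivative_pd[OF bounded_linear.has_derivative[OF assms(1) f']] has_derivative_pd[OF f']
  show ?thesis by simp
qed

lemma pd_add:
  assumes "f differentiable (at z)" "g differentiable (at z)"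
  shows "pd i (\<lambda>w. f w + g w) z = pd i f z + pd i g z"
proof -
  obtain f' g' where f': "(f has_derivative f') (at z)" and g': "(g has_derivative g') (at z)"
    using assms by (auto simp: differentiable_def)
  from has_derivative_pd[OF has_derivative_add[OF f' g']] has_derivative_pd[OF f'] has_derivative_pd[OF g']
  show ?thesis by simp
qed

lemma pd_minus:
  assumes "f differentiable (at z)"
  shows "pd i (\<lambda>w. - f w) z = - pd i f z"
  using pd_bounded_linear[OF bounded_linear_minus[OF bounded_linear_ident] assms] by simp

lemma pd_diff:
  assumes "f differentiable (at z)" "g differentiable (at z)"
  shows "pd i (\<lambda>w. f w - g w) z = pd i f z - pd i g z"
proof -
  obtain f' g' where f': "(f has_derivative f') (at z)" and g': "(g has_derivative g') (at z)"
    using assms by (auto simp: differentiable_def)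
  from has_derivative_pd[OF has_derivative_diff[OF f' g']] has_derivative_pd[OF f'] has_derivative_pd[OF g']
  show ?thesis by simp
qed

lemma pd_mult:
  fixes f g :: "real^'n::finite \<Rightarrow> real"
  assumes "f differentiable (at z)" "g differentiable (at z)"
  shows "pd i (\<lambda>w. f w * g w) z = f z * pd i g z + pd i f z * g z"
proof -
  obtain f' g' where f': "(f has_derivative f') (at z)" and g': "(g has_derivative g') (at z)"
    using assms by (auto simp: differentiable_def)
  from has_derivative_pd[OF has_derivative_mult[OF f' g']] has_derivative_pd[OF f'] has_derivative_pd[OF g']
  show ?thesis by simp
qed

lemma pd_sum:
  assumes "finite I" "\<And>j. j \<in> I \<Longrightarrow> f j differentiable (at z)"
  shows "pd i (\<lambda>w. \<Sum>j\<in>I. f j w) z = (\<Sum>j\<in>I. pd i (f j) z)"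
  using assms
proof (induction I rule: finite_induct)
  case (insert x F)
  then show ?case by (simp add: pd_add differentiable_sum)
qed simp

lemma pd_real_compose:
  fixes f :: "real^'n::finite \<Rightarrow> real"
  assumes "(\<phi> has_real_derivative d) (at (f z))" "f differentiable (at z)"
  shows "pd i (\<lambda>w. \<phi> (f w)) z = d * pd i f z"
proof -
  obtain f' where f': "(f has_derivative f') (at z)"
    using assms by (auto simp: differentiable_def)
  have "((\<lambda>w. \<phi> (f w)) has_derivative (\<lambda>h. f' h * d)) (at z)"
    using DERIV_compose_FDERIV[OF assms(1) f'] .
  from has_derivative_pd[OF this] has_derivative_pd[OF f'] show ?thesis by simp
qed

lemma pd_inverse:
  fixes f :: "real^'n::finite \<Rightarrow> real"
  assumes "f differentiable (at z)" "f z \<noteq> 0"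
  shows "pd i (\<lambda>w. inverse (f w)) z = - (inverse (f z) * inverse (f z) * pd i f z)"
  using pd_real_compose[OF DERIV_inverse[OF assms(2)] assms(1), of i]
  by (simp add: power2_eq_square)

lemma pd_divide:
  fixes f h :: "real^'n::finite \<Rightarrow> real"
  assumes "f differentiable (at z)" "h differentiable (at z)" "h z \<noteq> 0"
  shows "pd i (\<lambda>w. f w / h w) z = (pd i f z * h z - f z * pd i h z) / (h z)\<^sup>2"
proof -
  have "(\<lambda>w. inverse (h w)) differentiable (at z)" using assms by (auto intro: differentiable_inverse)
  then have "pd i (\<lambda>w. f w * inverse (h w)) z =
      f z * - (inverse (h z) * inverse (h z) * pd i h z) + pd i f z * inverse (h z)"
    using assms by (simp add: pd_mult pd_inverse)
  then show ?thesis using assms(3) by (simp add: field_simps power2_eq_square)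
qed

lemma differentiable_coords:
  fixes h :: "real^'m::finite \<Rightarrow> real^'n::finite"
  assumes "\<And>j. (\<lambda>w. h w $ j) differentiable (at z)"
  shows "(h has_derivative (\<lambda>v. \<chi> j. \<Sum>i\<in>UNIV. v $ i * pd i (\<lambda>w. h w $ j) z)) (at z)"
proof (subst has_derivative_componentwise_within, intro ballI)
  fix b :: "real^'n" assume "b \<in> Basis"
  then obtain j where b: "b = axis j 1" by (auto simp: Basis_vec_def)
  show "((\<lambda>x. h x \<bullet> b) has_derivative
      (\<lambda>v. (\<chi> j. \<Sum>i\<in>UNIV. v $ i * pd i (\<lambda>w. h w $ j) z) \<bullet> b)) (at z)"
    using differentiable_has_derivative_pd[OF assms, of j] by (simp add: b inner_axis)
qed

lemma pd_compose:
  fixes h :: "real^'m::finite \<Rightarrow> real^'n::finite" and f :: "real^'n \<Rightarrow> real"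
  assumes "f differentiable (at (h z))" "\<And>j. (\<lambda>w. h w $ j) differentiable (at z)"
  shows "(\<lambda>w. f (h w)) differentiable (at z)"
    and "pd i (\<lambda>w. f (h w)) z = (\<Sum>j\<in>UNIV. pd j f (h z) * pd i (\<lambda>w. h w $ j) z)"
proof -
  have D: "((\<lambda>w. f (h w)) has_derivative (\<lambda>v. \<Sum>j\<in>UNIV.
      (\<Sum>i\<in>UNIV. v $ i * pd i (\<lambda>w. h w $ j) z) *\<^sub>R pd j f (h z))) (at z)"
    using has_derivative_compose[OF differentiable_coords[OF assms(2)] 
        differentiable_has_derivative_pd[OF assms(1)]] by simp
  then show "(\<lambda>w. f (h w)) differentiable (at z)" by (auto simp: differentiable_def)
  have *: "(\<Sum>k\<in>UNIV. axis i 1 $ k * c k) = c i" for c :: "'m \<Rightarrow> real"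
    by (simp add: axis_def if_distrib[where f="\<lambda>x. x * _"] cong: if_cong)
  show "pd i (\<lambda>w. f (h w)) z = (\<Sum>j\<in>UNIV. pd j f (h z) * pd i (\<lambda>w. h w $ j) z)"
    unfolding has_derivative_pd[OF D, of i] * by (simp add: mult.commute)
qed

lemma differentiable_pd_eqI:
  assumes "(f has_derivative f') (at z)" "f' (axis i 1) = d"
  shows "pd i f z = d"
  using assms has_derivative_pd by blast

lemma has_derivative_vec_nth_at: "((\<lambda>w::real^'n::finite. w $ j) has_derivative (\<lambda>v. v $ j)) (at z)"
  by (rule bounded_linear.has_derivative[OF bounded_linear_vec_nth has_derivative_ident])

lemma differentiable_vec_nth [simp]: "(\<lambda>w::real^'n::finite. w $ j) differentiable (at z)"
  using has_derivative_vec_nth_at differentiable_def by blast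

lemma pd_vec_nth [simp]: "pd i (\<lambda>w::real^'n::finite. w $ j) z = (if i = j then 1 else 0)"
  by (subst has_derivative_pd[OF has_derivative_vec_nth_at]) (simp add: axis_def)

subsection \<open>Smooth functions\<close>

lemma Ck_on_cong:
  assumes "open S" "\<And>z. z \<in> S \<Longrightarrow> f z = g z" "Ck_on k S f"
  shows "Ck_on k S g"
  using assms(2,3)
proof (induction k arbitrary: f g)
  case 0
  then show ?case by (simp cong: continuous_on_cong)
next
  case (Suc k)
  have "g differentiable (at z)" if "z \<in> S" for z
    using Suc.prems differentiable_cong[OF _ assms(1) that, of f g] that by auto
  moreover have "Ck_on k S (pd i g)" for i
  proof (rule Suc.IH)
    show "Ck_on k S (pd i f)" using Suc.prems by simp
    show "pd i f z = pd i g z" if "z \<in> S" for z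
      using pd_cong[OF assms(1) that] Suc.prems by blast
  qed
  ultimately show ?case by simp
qed

lemma Ck_on_SucD: "Ck_on (Suc k) S f \<Longrightarrow> Ck_on k S f"
proof (induction k arbitrary: f)
  case 0
  then show ?case
    by (auto intro!: continuous_at_imp_continuous_on differentiable_imp_continuous_within)
next
  case (Suc k)
  then show ?case by (metis Ck_on.simps(2))
qed

lemma Ck_on_le: "m \<le> k \<Longrightarrow> Ck_on k S f \<Longrightarrow> Ck_on m S f"
  by (induction rule: inc_induct) (auto dest: Ck_on_SucD simp del: Ck_on.simps)

lemma Ck_on_subset: "Ck_on k S f \<Longrightarrow> T \<subseteq> S \<Longrightarrow> Ck_on k T f"
  by (induction k arbitrary: f) (auto intro: continuous_on_subset)

lemma smooth_on_subset: "smooth_on S f \<Longrightarrow> T \<subseteq> S \<Longrightarrow> smooth_on T f"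
  unfolding smooth_on_def using Ck_on_subset by blast

lemma smooth_on_differentiable: "smooth_on S f \<Longrightarrow> z \<in> S \<Longrightarrow> f differentiable (at z)"
  unfolding smooth_on_def by (drule spec[of _ "Suc 0"]) simp

lemma smooth_on_pd: "smooth_on S f \<Longrightarrow> smooth_on S (pd i f)"
  unfolding smooth_on_def using Ck_on.simps(2) by blast

lemma smooth_on_continuous: "smooth_on S f \<Longrightarrow> continuous_on S f"
  unfolding smooth_on_def by (drule spec[of _ 0]) simp

lemma smooth_on_cong:
  "open S \<Longrightarrow> smooth_on S f \<Longrightarrow> (\<And>z. z \<in> S \<Longrightarrow> f z = g z) \<Longrightarrow> smooth_on S g"
  unfolding smooth_on_def using Ck_on_cong by blast

lemma Ck_on_const: "Ck_on k S (\<lambda>z::real^'a::finite. c)"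
proof (induction k arbitrary: c)
  case (Suc k)
  have "pd i (\<lambda>z::real^'a. c) = (\<lambda>z. 0)" for i by (rule ext) simp
  then show ?case using Suc by simp
qed simp

text \<open>The closure properties share one induction: on the open set the partial derivative of
  the compound is replaced through \<open>Ck_on_cong\<close> by its formula, whose ingredients are
  known to order \<open>k\<close>.\<close>

lemma Ck_on_add:
  assumes "open S"
  shows "Ck_on k S f \<Longrightarrow> Ck_on k S g \<Longrightarrow> Ck_on k S (\<lambda>z. f z + g z)"
proof (induction k arbitrary: f g)
  case (Suc k)
  have "Ck_on k S (pd i (\<lambda>z. f z + g z))" for i
    by (rule Ck_on_cong[OF assms, where f="\<lambda>z. pd i f z + pd i g z"])
      (use Suc in \<open>auto simp: pd_add\<close>)
  then show ?case using Suc.prems by auto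
qed (auto intro: continuous_on_add)

lemma Ck_on_mult:
  fixes f g :: "real^'n::finite \<Rightarrow> real"
  assumes "open S"
  shows "Ck_on k S f \<Longrightarrow> Ck_on k S g \<Longrightarrow> Ck_on k S (\<lambda>z. f z * g z)"
proof (induction k arbitrary: f g)
  case (Suc k)
  have "Ck_on k S (pd i (\<lambda>z. f z * g z))" for i
  proof (rule Ck_on_cong[OF assms, where f="\<lambda>z. f z * pd i g z + pd i f z * g z"])
    show "Ck_on k S (\<lambda>z. f z * pd i g z + pd i f z * g z)"
      using Suc.prems Ck_on_SucD[of k S f] Ck_on_SucD[of k S g]
      by (intro Ck_on_add assms Suc.IH) auto
  qed (use Suc.prems in \<open>auto simp: pd_mult\<close>)
  then show ?case using Suc.prems by auto
qed (auto intro: continuous_on_mult)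

lemma Ck_on_minus:
  fixes f :: "real^'n::finite \<Rightarrow> real"
  shows "open S \<Longrightarrow> Ck_on k S f \<Longrightarrow> Ck_on k S (\<lambda>z. - f z)"
  using Ck_on_mult[OF _ Ck_on_const[of k S "-1"]] by auto

lemma Ck_on_sum:
  assumes "open S" "finite I"
  shows "(\<And>j. j \<in> I \<Longrightarrow> Ck_on k S (f j)) \<Longrightarrow> Ck_on k S (\<lambda>z. \<Sum>j\<in>I. f j z)"
  using assms(2) by (induction I rule: finite_induct) (auto simp: Ck_on_const intro: Ck_on_add[OF assms(1)])

lemma Ck_on_inverse:
  fixes f :: "real^'n::finite \<Rightarrow> real"
  assumes "open S" "\<And>z. z \<in> S \<Longrightarrow> f z \<noteq> 0"
  shows "Ck_on k S f \<Longrightarrow> Ck_on k S (\<lambda>z. inverse (f z))"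
proof (induction k)
  case (Suc k)
  have "Ck_on k S (pd i (\<lambda>z. inverse (f z)))" for i
  proof (rule Ck_on_cong[OF assms(1), where f="\<lambda>z. - (inverse (f z) * inverse (f z) * pd i f z)"])
    show "Ck_on k S (\<lambda>z. - (inverse (f z) * inverse (f z) * pd i f z))"
      using Suc.prems Suc.IH[OF Ck_on_SucD] by (intro Ck_on_minus Ck_on_mult assms) auto
  qed (use Suc.prems assms in \<open>auto simp: pd_inverse\<close>)
  then show ?case using Suc.prems assms by (auto intro: differentiable_inverse)
qed (use assms in \<open>auto intro: continuous_on_inverse\<close>)

lemma Ck_on_exp:
  fixes f :: "real^'n::finite \<Rightarrow> real"
  assumes "open S"
  shows "Ck_on k S f \<Longrightarrow> Ck_on k S (\<lambda>z. exp (f z))"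
proof (induction k)
  case (Suc k)
  have D: "pd i (\<lambda>w. exp (f w)) z = exp (f z) * pd i f z" if "z \<in> S" for i z
    using Suc.prems that by (intro pd_real_compose DERIV_exp) auto
  have "Ck_on k S (pd i (\<lambda>z. exp (f z)))" for i
    by (rule Ck_on_cong[OF assms(1), where f="\<lambda>z. exp (f z) * pd i f z"])
      (use Suc.prems Suc.IH[OF Ck_on_SucD] D in \<open>auto intro: Ck_on_mult[OF assms]\<close>)
  moreover have "(\<lambda>w. exp (f w)) differentiable (at z)" if "z \<in> S" for z
  proof -
    have "f differentiable (at z)" using Suc.prems that by simp
    then obtain f' where "(f has_derivative f') (at z)" unfolding differentiable_def by blast
    from DERIV_compose_FDERIV[OF DERIV_exp this] show ?thesis by (auto simp: differentiable_def)
  qed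
  ultimately show ?case by auto
qed (auto intro: continuous_on_exp)

lemma Ck_on_sqrt:
  fixes f :: "real^'n::finite \<Rightarrow> real"
  assumes "open S" "\<And>z. z \<in> S \<Longrightarrow> f z > 0"
  shows "Ck_on k S f \<Longrightarrow> Ck_on k S (\<lambda>z. sqrt (f z))"
proof (induction k)
  case (Suc k)
  have D: "pd i (\<lambda>w. sqrt (f w)) z = (inverse (sqrt (f z)) / 2) * pd i f z" if "z \<in> S" for i z
    using Suc.prems assms that by (intro pd_real_compose DERIV_real_sqrt) auto
  have "Ck_on k S (pd i (\<lambda>z. sqrt (f z)))" for i
  proof (rule Ck_on_cong[OF assms(1), where f="\<lambda>z. (inverse (sqrt (f z)) * (1/2)) * pd i f z"])
    show "Ck_on k S (\<lambda>z. inverse (sqrt (f z)) * (1 / 2) * pd i f z)"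
      using Suc.prems Suc.IH[OF Ck_on_SucD] assms(2)
      by (intro Ck_on_mult Ck_on_inverse Ck_on_const assms) (fastforce+)
  qed (use D in auto)
  moreover have "(\<lambda>w. sqrt (f w)) differentiable (at z)" if z: "z \<in> S" for z
  proof -
    have "f differentiable (at z)" using Suc.prems that by simp
    then obtain f' where "(f has_derivative f') (at z)" unfolding differentiable_def by blast
    from DERIV_compose_FDERIV[OF DERIV_real_sqrt[OF assms(2)[OF z]] this] show ?thesis
      by (auto simp: differentiable_def)
  qed
  ultimately show ?case by auto
qed (auto intro: continuous_on_real_sqrt)

lemma Ck_on_vec_nth: "Ck_on k S (\<lambda>z::real^'n::finite. z $ j)"
proof (cases k)
  case (Suc m)
  have "pd i (\<lambda>z::real^'n. z $ j) = (\<lambda>z. if i = j then 1 else 0)" for i by (rule ext) simp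
  then show ?thesis using Suc by (simp add: Ck_on_const)
qed (auto intro: continuous_intros)

text \<open>The induction generalises over \<open>f\<close> only: the chain rule differentiates
  \<open>f\<close> and leaves the inner map \<open>h\<close> in place.\<close>

lemma Ck_on_compose:
  fixes h :: "real^'m::finite \<Rightarrow> real^'n::finite" and f :: "real^'n \<Rightarrow> real"
  assumes "open S" "h ` S \<subseteq> T"
  shows "Ck_on k T f \<Longrightarrow> (\<And>j. Ck_on k S (\<lambda>w. h w $ j)) \<Longrightarrow> Ck_on k S (\<lambda>w. f (h w))"
proof (induction k arbitrary: f)
  case 0
  have "continuous_on S h"
    using 0(2) continuous_on_vec_lambda[of S "\<lambda>j w. h w $ j"] by (simp add: vec_lambda_eta)
  then show ?case using 0 assms by (auto intro: continuous_on_compose2)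
next
  case (Suc k)
  have d: "f differentiable (at (h z))" "\<And>j. (\<lambda>w. h w $ j) differentiable (at z)" if "z \<in> S" for z
    using Suc.prems that assms(2) by auto
  have "Ck_on k S (pd i (\<lambda>w. f (h w)))" for i
  proof (rule Ck_on_cong[OF assms(1)])
    show "(\<Sum>j\<in>UNIV. pd j f (h z) * pd i (\<lambda>w. h w $ j) z) = pd i (\<lambda>w. f (h w)) z" if "z \<in> S" for z
      using pd_compose(2)[OF d[OF that]] by simp
    have h: "Ck_on k S (\<lambda>w. h w $ j)" for j
      by (rule Ck_on_SucD[OF Suc.prems(2)])
    have "Ck_on k S (\<lambda>w. pd j f (h w))" for j
      by (rule Suc.IH) (use Suc.prems(1) h in auto)
    then show "Ck_on k S (\<lambda>z. \<Sum>j\<in>UNIV. pd j f (h z) * pd i (\<lambda>w. h w $ j) z)"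
      using Suc.prems by (intro Ck_on_sum Ck_on_mult assms) auto
  qed
  then show ?case using pd_compose(1)[OF d] by auto
qed

lemma smooth_on_const [intro, simp]: "smooth_on S (\<lambda>z. c)"
  by (simp add: smooth_on_def Ck_on_const)

lemma smooth_on_vec_nth [intro, simp]: "smooth_on S (\<lambda>z. z $ j)"
  by (simp add: smooth_on_def Ck_on_vec_nth)

lemma smooth_on_add: "open S \<Longrightarrow> smooth_on S f \<Longrightarrow> smooth_on S g \<Longrightarrow> smooth_on S (\<lambda>z. f z + g z)"
  by (simp add: smooth_on_def Ck_on_add)

lemma smooth_on_mult:
  fixes f g :: "real^'n::finite \<Rightarrow> real"
  shows "open S \<Longrightarrow> smooth_on S f \<Longrightarrow> smooth_on S g \<Longrightarrow> smooth_on S (\<lambda>z. f z * g z)"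
  by (simp add: smooth_on_def Ck_on_mult)

lemma smooth_on_minus:
  fixes f :: "real^'n::finite \<Rightarrow> real"
  shows "open S \<Longrightarrow> smooth_on S f \<Longrightarrow> smooth_on S (\<lambda>z. - f z)"
  by (simp add: smooth_on_def Ck_on_minus)

lemma smooth_on_diff:
  fixes f g :: "real^'n::finite \<Rightarrow> real"
  shows "open S \<Longrightarrow> smooth_on S f \<Longrightarrow> smooth_on S g \<Longrightarrow> smooth_on S (\<lambda>z. f z - g z)"
  using smooth_on_add[of S f "\<lambda>z. - g z"] smooth_on_minus[of S g] by simp

lemma smooth_on_sum:
  "open S \<Longrightarrow> finite I \<Longrightarrow> (\<And>j. j \<in> I \<Longrightarrow> smooth_on S (f j)) \<Longrightarrow> smooth_on S (\<lambda>z. \<Sum>j\<in>I. f j z)"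
  by (simp add: smooth_on_def Ck_on_sum)

lemma smooth_on_inverse:
  fixes f :: "real^'n::finite \<Rightarrow> real"
  shows "open S \<Longrightarrow> smooth_on S f \<Longrightarrow> (\<And>z. z \<in> S \<Longrightarrow> f z \<noteq> 0) \<Longrightarrow> smooth_on S (\<lambda>z. inverse (f z))"
  by (simp add: smooth_on_def Ck_on_inverse)

lemma smooth_on_divide:
  fixes f g :: "real^'n::finite \<Rightarrow> real"
  shows "open S \<Longrightarrow> smooth_on S f \<Longrightarrow> smooth_on S g \<Longrightarrow> (\<And>z. z \<in> S \<Longrightarrow> g z \<noteq> 0) \<Longrightarrow>
    smooth_on S (\<lambda>z. f z / g z)"
  by (simp add: smooth_on_mult smooth_on_inverse divide_inverse)

lemma smooth_on_power:
  fixes f :: "real^'n::finite \<Rightarrow> real"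
  shows "open S \<Longrightarrow> smooth_on S f \<Longrightarrow> smooth_on S (\<lambda>z. f z ^ m)"
  by (induction m) (auto intro: smooth_on_mult)

lemma smooth_on_prod:
  fixes f :: "'i \<Rightarrow> real^'n::finite \<Rightarrow> real"
  assumes "open S" "finite I"
  shows "(\<And>j. j \<in> I \<Longrightarrow> smooth_on S (f j)) \<Longrightarrow> smooth_on S (\<lambda>z. \<Prod>j\<in>I. f j z)"
  using assms(2) by (induction I rule: finite_induct) (auto intro: smooth_on_mult[OF assms(1)])

lemma smooth_on_exp:
  fixes f :: "real^'n::finite \<Rightarrow> real"
  shows "open S \<Longrightarrow> smooth_on S f \<Longrightarrow> smooth_on S (\<lambda>z. exp (f z))"
  by (simp add: smooth_on_def Ck_on_exp)

lemma smooth_on_sqrt: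
  fixes f :: "real^'n::finite \<Rightarrow> real"
  shows "open S \<Longrightarrow> smooth_on S f \<Longrightarrow> (\<And>z. z \<in> S \<Longrightarrow> f z > 0) \<Longrightarrow> smooth_on S (\<lambda>z. sqrt (f z))"
  by (simp add: smooth_on_def Ck_on_sqrt)

lemma smooth_on_compose:
  fixes h :: "real^'m::finite \<Rightarrow> real^'n::finite" and f :: "real^'n \<Rightarrow> real"
  shows "open S \<Longrightarrow> smooth_on T f \<Longrightarrow> (\<And>j. smooth_on S (\<lambda>w. h w $ j)) \<Longrightarrow> h ` S \<subseteq> T \<Longrightarrow>
    smooth_on S (\<lambda>w. f (h w))"
  by (simp add: smooth_on_def Ck_on_compose)

section \<open>Determinants and inverse matrices\<close>

lemma smooth_on_det:
  fixes M :: "real^'m::finite \<Rightarrow> 'n::finite \<Rightarrow> 'n \<Rightarrow> real"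
  assumes "open S" "\<And>i j. smooth_on S (\<lambda>z. M z i j)"
  shows "smooth_on S (\<lambda>z. det (\<chi> i j. M z i j))"
  unfolding det_def
  by (intro smooth_on_sum smooth_on_mult smooth_on_const smooth_on_prod assms finite finite_permutations)
    (simp add: assms)

lemma matrix_inv_eqI:
  fixes A B :: "real^'n::finite^'n"
  assumes "B ** A = mat 1"
  shows "matrix_inv A = B"
proof -
  have "invertible A" using assms by (auto simp: invertible_left_inverse)
  then have "A ** matrix_inv A = mat 1"
    unfolding invertible_def matrix_inv_def by (rule someI2_ex) simp
  then show ?thesis using assms by (metis matrix_mul_assoc matrix_mul_lid matrix_mul_rid)
qed

lemma matrix_inv_mult:
  fixes A :: "real^'n::finite^'n"
  assumes "det A \<noteq> 0"
  shows "matrix_inv A ** A = mat 1" "A ** matrix_inv A = mat 1"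
proof -
  obtain B where "B ** A = mat 1" "A ** B = mat 1"
    using assms by (auto simp: invertible_det_nz[symmetric] invertible_def)
  then show "matrix_inv A ** A = mat 1" "A ** matrix_inv A = mat 1"
    using matrix_inv_eqI by auto
qed

text \<open>Cramer's rule makes the entries of the inverse quotients of determinants; this is how
  smoothness passes from a matrix to its inverse.\<close>

lemma matrix_inv_cramer:
  fixes A :: "real^'n::finite^'n"
  assumes "det A \<noteq> 0"
  shows "matrix_inv A $ a $ b = det (\<chi> i j. if j = a then (if i = b then 1 else 0) else A $ i $ j) / det A"
proof -
  have "A *v (matrix_inv A *v axis b 1) = axis b 1"
    using matrix_inv_mult[OF assms] by (simp add: matrix_vector_mul_assoc)
  then have "(matrix_inv A *v axis b 1) $ a =
      det (\<chi> i j. if j = a then axis b 1 $ i else A $ i $ j) / det A"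
    by (subst (asm) cramer[OF assms]) simp
  then show ?thesis
    unfolding matrix_vector_mult_basis by (simp add: column_def axis_def cong: if_cong)
qed

lemma smooth_on_matrix_inv:
  fixes M :: "real^'m::finite \<Rightarrow> 'n::finite \<Rightarrow> 'n \<Rightarrow> real"
  assumes "open S" "\<And>i j. smooth_on S (\<lambda>z. M z i j)" "\<And>z. z \<in> S \<Longrightarrow> det (\<chi> i j. M z i j) \<noteq> 0"
  shows "smooth_on S (\<lambda>z. matrix_inv (\<chi> i j. M z i j) $ a $ b)"
proof (rule smooth_on_cong[OF assms(1)])
  have "smooth_on S (\<lambda>z. if j = a then (if i = b then 1 else 0) else M z i j)" for i j
    using assms by (cases "j = a"; cases "i = b") auto
  note * = smooth_on_det[OF assms(1) this]
  show "smooth_on S (\<lambda>z. det (\<chi> i j. if j = a then (if i = b then 1 else 0) else M z i j)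
      / det (\<chi> i j. M z i j))"
    using assms by (intro smooth_on_divide *) (auto intro: smooth_on_det)
  show "det (\<chi> i j. if j = a then (if i = b then 1 else 0) else M z i j) / det (\<chi> i j. M z i j)
      = matrix_inv (\<chi> i j. M z i j) $ a $ b" if "z \<in> S" for z
    using matrix_inv_cramer[OF assms(3)[OF that], of a b] by (simp cong: if_cong)
qed

lemma det_4:
  "det (A::'a::comm_ring_1^4^4) =
    A$1$1 * (A$2$2 * (A$3$3 * A$4$4 - A$3$4 * A$4$3) - A$2$3 * (A$3$2 * A$4$4 - A$3$4 * A$4$2)
             + A$2$4 * (A$3$2 * A$4$3 - A$3$3 * A$4$2))
  - A$1$2 * (A$2$1 * (A$3$3 * A$4$4 - A$3$4 * A$4$3) - A$2$3 * (A$3$1 * A$4$4 - A$3$4 * A$4$1)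
             + A$2$4 * (A$3$1 * A$4$3 - A$3$3 * A$4$1))
  + A$1$3 * (A$2$1 * (A$3$2 * A$4$4 - A$3$4 * A$4$2) - A$2$2 * (A$3$1 * A$4$4 - A$3$4 * A$4$1)
             + A$2$4 * (A$3$1 * A$4$2 - A$3$2 * A$4$1))
  - A$1$4 * (A$2$1 * (A$3$2 * A$4$3 - A$3$3 * A$4$2) - A$2$2 * (A$3$1 * A$4$3 - A$3$3 * A$4$1)
             + A$2$3 * (A$3$1 * A$4$2 - A$3$2 * A$4$1))"
proof -
  have f: "finite {2::4, 3, 4}" "1 \<notin> {2::4, 3, 4}" "finite {3::4, 4}" "2 \<notin> {3::4, 4}"
    "finite {4::4}" "3 \<notin> {4::4}"
    by auto
  show ?thesis
    unfolding det_def UNIV_4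
    unfolding sum_over_permutations_insert[OF f(1,2)]
    unfolding sum_over_permutations_insert[OF f(3,4)]
    unfolding sum_over_permutations_insert[OF f(5,6)]
    unfolding permutes_sing
    by (simp add: sign_swap_id permutation_swap_id permutation_compose sign_compose sign_id
        swap_id_eq algebra_simps)
qed

subsection \<open>Symmetry of second derivatives\<close>

lemma has_real_derivative_along_axis:
  fixes f :: "real^'n::finite \<Rightarrow> real"
  assumes "f differentiable (at (c + s *\<^sub>R axis i 1))"
  shows "((\<lambda>s. f (c + s *\<^sub>R axis i 1)) has_real_derivative pd i f (c + s *\<^sub>R axis i 1)) (at s)"
proof -
  let ?w = "c + s *\<^sub>R axis i 1"
  obtain f' where f': "(f has_derivative f') (at ?w)"
    using assms by (auto simp: differentiable_def)
  have "((\<lambda>s. c + s *\<^sub>R axis i 1) has_derivative (\<lambda>h. h *\<^sub>R axis i 1)) (at s)"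
    by (auto intro!: derivative_eq_intros)
  from has_derivative_compose[OF this f']
  have D: "((\<lambda>s. f (c + s *\<^sub>R axis i 1)) has_derivative (\<lambda>h. f' (h *\<^sub>R axis i 1))) (at s)" .
  have "f' (h *\<^sub>R axis i 1) = h * pd i f ?w" for h
    using linear_cmul[OF has_derivative_linear[OF f']] has_derivative_pd[OF f', of i] by simp
  with D show ?thesis
    by (simp add: has_field_derivative_def mult.commute[of _ "pd i f ?w"])
qed

text \<open>The mean value theorem is applied twice: in direction \<open>i\<close> to the difference
  taken in direction \<open>j\<close>, then in direction \<open>j\<close> to \<open>pd i f\<close>.
  The left side is symmetric in \<open>i\<close> and \<open>j\<close>, the right side is
  not.\<close>

lemma second_difference_mvt:
  fixes f :: "real^'n::finite \<Rightarrow> real"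
  assumes S: "ball z r \<subseteq> S" and f: "smooth_on S f" and h: "0 < h" "2 * h < r"
  shows "\<exists>w. norm (w - z) \<le> 2 * h \<and>
    f (z + h *\<^sub>R axis i 1 + h *\<^sub>R axis j 1) - f (z + h *\<^sub>R axis i 1)
      - f (z + h *\<^sub>R axis j 1) + f z = h * h * pd j (pd i f) w"
proof -
  have nrm: "norm ((z + s *\<^sub>R axis i 1 + t *\<^sub>R axis j 1) - z) \<le> 2 * h"
    if "0 \<le> s" "s \<le> h" "0 \<le> t" "t \<le> h" for s t :: real
  proof -
    have "norm (s *\<^sub>R axis i 1 + t *\<^sub>R axis j (1::real)) \<le> s + t"
      using norm_triangle_ineq[of "s *\<^sub>R axis i 1" "t *\<^sub>R axis j (1::real)"] that by simp
    then show ?thesis using that by (simp add: add.assoc)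
  qed
  have inS: "z + s *\<^sub>R axis i 1 + t *\<^sub>R axis j 1 \<in> S"
    if "0 \<le> s" "s \<le> h" "0 \<le> t" "t \<le> h" for s t :: real
  proof -
    have "dist z (z + s *\<^sub>R axis i 1 + t *\<^sub>R axis j 1) < r"
      using nrm[OF that] h by (simp only: dist_norm norm_minus_commute[of z])
    then show ?thesis using S by auto
  qed
  have "((\<lambda>s. f (z + h *\<^sub>R axis j 1 + s *\<^sub>R axis i 1) - f (z + s *\<^sub>R axis i 1)) has_real_derivative
      pd i f (z + h *\<^sub>R axis j 1 + s *\<^sub>R axis i 1) - pd i f (z + s *\<^sub>R axis i 1)) (at s)"
    if "0 \<le> s" "s \<le> h" for s
    using inS[OF that, of h] inS[OF that, of 0] h
    by (intro derivative_intros has_real_derivative_along_axis smooth_on_differentiable[OF f])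
      (auto simp: algebra_simps)
  from MVT2[OF \<open>0 < h\<close> this] obtain s where s: "0 < s" "s < h" and
    Q1: "f (z + h *\<^sub>R axis j 1 + h *\<^sub>R axis i 1) - f (z + h *\<^sub>R axis i 1) - (f (z + h *\<^sub>R axis j 1) - f z)
       = h * (pd i f (z + h *\<^sub>R axis j 1 + s *\<^sub>R axis i 1) - pd i f (z + s *\<^sub>R axis i 1))"
    by auto
  have "((\<lambda>t. pd i f (z + s *\<^sub>R axis i 1 + t *\<^sub>R axis j 1)) has_real_derivative
      pd j (pd i f) (z + s *\<^sub>R axis i 1 + t *\<^sub>R axis j 1)) (at t)"
    if "0 \<le> t" "t \<le> h" for t
    using inS[of s t] that s
    by (intro has_real_derivative_along_axis smooth_on_differentiable[OF smooth_on_pd[OF f]]) auto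
  from MVT2[OF \<open>0 < h\<close> this] obtain t where t: "0 < t" "t < h" and
    Q2: "pd i f (z + s *\<^sub>R axis i 1 + h *\<^sub>R axis j 1) - pd i f (z + s *\<^sub>R axis i 1)
       = h * pd j (pd i f) (z + s *\<^sub>R axis i 1 + t *\<^sub>R axis j 1)"
    by auto
  show ?thesis
  proof (intro exI conjI)
    show "norm ((z + s *\<^sub>R axis i 1 + t *\<^sub>R axis j 1) - z) \<le> 2 * h" using nrm s t by auto
    show "f (z + h *\<^sub>R axis i 1 + h *\<^sub>R axis j 1) - f (z + h *\<^sub>R axis i 1)
      - f (z + h *\<^sub>R axis j 1) + f z = h * h * pd j (pd i f) (z + s *\<^sub>R axis i 1 + t *\<^sub>R axis j 1)"
      using Q1 Q2 by (simp add: algebra_simps)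
  qed
qed

text \<open>Reading one second difference in both orders equates the two mixed derivatives at two
  points near \<open>z\<close>; continuity moves both points to \<open>z\<close>.\<close>

lemma pd_commute:
  fixes f :: "real^'n::finite \<Rightarrow> real"
  assumes "open S" "smooth_on S f" "z \<in> S"
  shows "pd i (pd j f) z = pd j (pd i f) z"
proof (rule ccontr)
  assume ne: "pd i (pd j f) z \<noteq> pd j (pd i f) z"
  \<comment> \<open>Half the gap: two errors below \<open>e\<close> cannot bridge it.\<close>
  define e where "e = \<bar>pd i (pd j f) z - pd j (pd i f) z\<bar> / 2"
  have e: "e > 0" using ne by (simp add: e_def)
  obtain r where r: "r > 0" "ball z r \<subseteq> S" using assms openE by blast
  have cont: "\<exists>d>0. \<forall>w\<in>S. norm (w - z) < d \<longrightarrow> \<bar>pd k (pd l f) w - pd k (pd l f) z\<bar> < e" for k l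
    using smooth_on_continuous[OF smooth_on_pd[OF smooth_on_pd[OF assms(2)]], of k l] assms(3) e
    unfolding continuous_on_iff dist_norm real_norm_def by blast
  obtain d1 where d1: "d1 > 0" "\<And>w. w \<in> S \<Longrightarrow> norm (w - z) < d1 \<Longrightarrow> \<bar>pd i (pd j f) w - pd i (pd j f) z\<bar> < e"
    using cont[of i j] by blast
  obtain d2 where d2: "d2 > 0" "\<And>w. w \<in> S \<Longrightarrow> norm (w - z) < d2 \<Longrightarrow> \<bar>pd j (pd i f) w - pd j (pd i f) z\<bar> < e"
    using cont[of j i] by blast
  \<comment> \<open>The factor 3 leaves room for intermediate points at distance up to
    \<open>2 * h\<close> from \<open>z\<close>.\<close>
  define h where "h = min r (min d1 d2) / 3"
  have h: "h > 0" "2 * h < r" "2 * h < d1" "2 * h < d2" using r d1 d2 by (auto simp: h_def)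
  obtain w1 where w1: "norm (w1 - z) \<le> 2 * h" 
    "f (z + h *\<^sub>R axis i 1 + h *\<^sub>R axis j 1) - f (z + h *\<^sub>R axis i 1)
      - f (z + h *\<^sub>R axis j 1) + f z = h * h * pd j (pd i f) w1"
    using second_difference_mvt[OF r(2) assms(2) h(1,2)] by blast
  obtain w2 where w2: "norm (w2 - z) \<le> 2 * h" 
    "f (z + h *\<^sub>R axis j 1 + h *\<^sub>R axis i 1) - f (z + h *\<^sub>R axis j 1)
      - f (z + h *\<^sub>R axis i 1) + f z = h * h * pd i (pd j f) w2"
    using second_difference_mvt[OF r(2) assms(2) h(1,2)] by blast
  have "f (z + h *\<^sub>R axis i 1 + h *\<^sub>R axis j 1) = f (z + h *\<^sub>R axis j 1 + h *\<^sub>R axis i 1)"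
    by (simp add: add.assoc add.commute add.left_commute)
  with w1 w2 have "h * h * pd j (pd i f) w1 = h * h * pd i (pd j f) w2" by linarith
  then have eq: "pd j (pd i f) w1 = pd i (pd j f) w2" using h by simp
  have "w1 \<in> S" "w2 \<in> S"
    using w1(1) w2(1) h r(2) by (auto simp: dist_norm norm_minus_commute subset_eq)
  then have "\<bar>pd j (pd i f) w1 - pd j (pd i f) z\<bar> < e" "\<bar>pd i (pd j f) w2 - pd i (pd j f) z\<bar> < e"
    using d1(2)[of w2] d2(2)[of w1] w1 w2 h by auto
  then have "\<bar>pd i (pd j f) z - pd j (pd i f) z\<bar> < 2 * e" using eq by linarith
  then show False by (simp add: e_def)
qed

subsection \<open>The inverse function theorem\<close>

text \<open>The classical theorem supplies a differentiable inverse, whose smoothness is then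
  bootstrapped. The image is cut down to a ball so that straight segments in the new coordinates
  stay inside it.\<close>

lemma smooth_inverse_function:
  fixes \<Phi> :: "real^'n::finite \<Rightarrow> real^'n"
  assumes "open U" "z0 \<in> U" and smooth: "\<And>j. smooth_on U (\<lambda>z. \<Phi> z $ j)"
    and nz: "det (\<chi> i j. pd j (\<lambda>z. \<Phi> z $ i) z0) \<noteq> 0"
  obtains V r \<Psi> where "open V" "z0 \<in> V" "V \<subseteq> U" "r > 0" "\<Phi> ` V = ball (\<Phi> z0) r" "inj_on \<Phi> V"
    "\<And>j. smooth_on (ball (\<Phi> z0) r) (\<lambda>y. \<Psi> y $ j)"
    "\<And>y. y \<in> ball (\<Phi> z0) r \<Longrightarrow> \<Psi> y \<in> V" "\<And>y. y \<in> ball (\<Phi> z0) r \<Longrightarrow> \<Phi> (\<Psi> y) = y"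
    "\<And>z. z \<in> V \<Longrightarrow> \<Psi> (\<Phi> z) = z"
proof -
  define M where "M = (\<lambda>z. \<chi> i j. pd j (\<lambda>z. \<Phi> z $ i) z)"
  \<comment> \<open>On this set the inverse Jacobian matrix is a smooth function of the
    point.\<close>
  define U2 where "U2 = {z\<in>U. det (M z) \<noteq> 0}"
  have sdet: "smooth_on U (\<lambda>z. det (M z))"
    unfolding M_def by (intro smooth_on_det assms smooth_on_pd)
  have U2: "open U2"
  proof -
    have "U2 = U \<inter> (\<lambda>z. det (M z)) -` (- {0})" by (auto simp: U2_def)
    also have "open \<dots>"
      by (rule continuous_open_preimage[OF smooth_on_continuous[OF sdet] \<open>open U\<close>]) auto
    finally show ?thesis .
  qed
  have z0: "z0 \<in> U2" using nz assms by (simp add: U2_def M_def)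
  have sub: "U2 \<subseteq> U" by (auto simp: U2_def)
  define f' where "f' = (\<lambda>z. blinfun_of_matrix (\<lambda>b c. (M z *v c) \<bullet> b))"
  have app: "blinfun_apply (f' z) v = M z *v v" for z v
  proof -
    have bl: "bounded_linear (\<lambda>v. M z *v v)" by (rule matrix_vector_mul_bounded_linear)
    have "f' z = Blinfun (\<lambda>v. M z *v v)"
      using blinfun_of_matrix_works[of "Blinfun (\<lambda>v. M z *v v)"] bounded_linear_Blinfun_apply[OF bl]
      by (simp add: f'_def)
    then show ?thesis using bounded_linear_Blinfun_apply[OF bl] by simp
  qed
  have contf': "continuous_on U2 f'"
  proof (rule continuous_on_blinfun_componentwise)
    fix b :: "real^'n"
    show "continuous_on U2 (\<lambda>z. blinfun_apply (f' z) b)"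
      unfolding app M_def matrix_vector_mult_def
      by (intro continuous_on_vec_lambda continuous_on_sum continuous_on_mult continuous_on_const)
        (simp add: smooth_on_continuous[OF smooth_on_subset[OF smooth_on_pd[OF smooth] sub]])
  qed
  have der: "(\<Phi> has_derivative blinfun_apply (f' z)) (at z)" if "z \<in> U2" for z
  proof -
    have "(\<Phi> has_derivative (\<lambda>v. \<chi> j. \<Sum>i\<in>UNIV. v $ i * pd i (\<lambda>w. \<Phi> w $ j) z)) (at z)"
      using that sub by (intro differentiable_coords smooth_on_differentiable[OF smooth]) auto
    also have "(\<lambda>v. \<chi> j. \<Sum>i\<in>UNIV. v $ i * pd i (\<lambda>w. \<Phi> w $ j) z) = blinfun_apply (f' z)"
      by (rule ext) (simp add: app matrix_vector_mult_def M_def mult.commute)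
    finally show ?thesis .
  qed
  define invf where "invf = Blinfun (\<lambda>v. matrix_inv (M z0) *v v)"
  have "blinfun_apply invf v = matrix_inv (M z0) *v v" for v
    unfolding invf_def by (simp add: bounded_linear_Blinfun_apply matrix_vector_mul_bounded_linear)
  then have inv: "invf o\<^sub>L f' z0 = id_blinfun"
    using matrix_inv_mult(1)[of "M z0"] z0
    by (intro blinfun_eqI) (simp add: app matrix_vector_mul_assoc U2_def)
  obtain U' V0 g g' where g: "open U'" "U' \<subseteq> U2" "z0 \<in> U'" "open V0" "\<Phi> z0 \<in> V0" "homeomorphism U' V0 \<Phi> g"
    "\<And>y. y \<in> V0 \<Longrightarrow> (g has_derivative (g' y)) (at y)"
    "\<And>y. y \<in> V0 \<Longrightarrow> g' y = inv (blinfun_apply (f'(g y)))"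
    by (rule inverse_function_theorem[OF U2 der contf' z0 inv]) blast+
  obtain r where r: "r > 0" "ball (\<Phi> z0) r \<subseteq> V0" using g(4,5) openE by blast
  define B where "B = ball (\<Phi> z0) r"
  have B: "open B" "B \<subseteq> V0" using r by (auto simp: B_def)
  have gU: "g y \<in> U'" "\<Phi> (g y) = y" if "y \<in> B" for y
    using g(6) that B by (auto simp: homeomorphism_def)
  have gd: "(\<lambda>y. g y $ a) differentiable (at y)" if "y \<in> B" for y a
    using bounded_linear.has_derivative[OF bounded_linear_vec_nth g(7)] that B
    unfolding differentiable_def by blast
  have gpd: "pd b (\<lambda>y. g y $ a) y = matrix_inv (M (g y)) $ a $ b" if "y \<in> B" for y a b
  proof -
    have dn: "det (M (g y)) \<noteq> 0" using gU[OF that] g(2) by (auto simp: U2_def)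
    have "g' y (axis b 1) = matrix_inv (M (g y)) *v axis b 1"
    proof -
      have 1: "M (g y) *v (matrix_inv (M (g y)) *v axis b 1) = axis b 1"
        using matrix_inv_mult[OF dn] by (simp add: matrix_vector_mul_assoc)
      have "inj (\<lambda>v. M (g y) *v v)"
        using matrix_inv_mult(1)[OF dn] by (intro inj_on_inverseI[where g="\<lambda>v. matrix_inv (M (g y)) *v v"])
          (simp add: matrix_vector_mul_assoc)
      then have "inv (\<lambda>v. M (g y) *v v) (axis b 1) = matrix_inv (M (g y)) *v axis b 1"
        using 1 by (metis inv_f_f)
      then show ?thesis using g(8) that B by (auto simp: app[abs_def])
    qed
    moreover have "pd b (\<lambda>y. g y $ a) y = g' y (axis b 1) $ a"
      using bounded_linear.has_derivative[OF bounded_linear_vec_nth g(7)] that B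
      by (intro has_derivative_pd) auto
    ultimately show ?thesis by (simp add: matrix_vector_mult_basis column_def)
  qed
  have sinv: "smooth_on U2 (\<lambda>z. matrix_inv (M z) $ a $ b)" for a b
    unfolding M_def
    by (rule smooth_on_matrix_inv[OF U2]) (use smooth_on_subset[OF smooth_on_pd[OF smooth] sub] in \<open>auto simp: U2_def M_def\<close>)
  \<comment> \<open>Bootstrap: the partial derivatives of \<open>g\<close> are the smooth entries of
    \<open>matrix_inv (M z)\<close> composed with \<open>g\<close> itself, so each order of
    smoothness of \<open>g\<close> yields the next one.\<close>
  have Ck: "Ck_on k B (\<lambda>y. g y $ a)" for k a
  proof (induction k arbitrary: a)
    case 0
    then show ?case
      by (auto intro!: continuous_at_imp_continuous_on differentiable_imp_continuous_within gd)
  next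
    case (Suc k)
    have "Ck_on k B (\<lambda>y. matrix_inv (M (g y)) $ a $ b)" for b
    proof (rule Ck_on_compose[OF B(1), where f="\<lambda>z. matrix_inv (M z) $ a $ b"])
      show "g ` B \<subseteq> U2" using gU g(2) by auto
      show "Ck_on k U2 (\<lambda>z. matrix_inv (M z) $ a $ b)" using sinv by (simp add: smooth_on_def)
    qed (rule Suc)
    then have "Ck_on k B (pd b (\<lambda>y. g y $ a))" for b
      by (rule Ck_on_cong[OF B(1), rotated]) (simp add: gpd)
    then show ?case using gd by simp
  qed
  define V where "V = g ` B"
  have V: "V = U' \<inter> \<Phi> -` B"
  proof
    show "V \<subseteq> U' \<inter> \<Phi> -` B" using gU by (auto simp: V_def)
    show "U' \<inter> \<Phi> -` B \<subseteq> V"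
    proof
      fix z assume z: "z \<in> U' \<inter> \<Phi> -` B"
      then have "g (\<Phi> z) = z" using g(6) by (auto simp: homeomorphism_def)
      then show "z \<in> V" using z unfolding V_def by (metis IntE imageI vimageE)
    qed
  qed
  have gPhi: "g (\<Phi> z) = z" if "z \<in> V" for z
    using that g(6) V by (auto simp: homeomorphism_def)
  show ?thesis
  proof (rule that[of V r g])
    show "open V" unfolding V using g(1,6) B(1)
      by (auto simp: homeomorphism_def intro!: continuous_open_preimage)
    show "z0 \<in> V" unfolding V using g r by (simp add: B_def)
    show "V \<subseteq> U" using V g(2) sub by auto
    show "\<Phi> ` V = ball (\<Phi> z0) r" using gU by (force simp: V_def B_def)
    show "inj_on \<Phi> V" using gPhi by (metis inj_on_inverseI)
    show "smooth_on (ball (\<Phi> z0) r) (\<lambda>y. g y $ j)" for j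
      using Ck by (simp add: smooth_on_def B_def)
  qed (use r gU gPhi in \<open>auto simp: B_def V_def\<close>)
qed

subsection \<open>Integration along rays and the relative Poincare lemma\<close>

text \<open>Only the coordinates in \<open>J\<close> are contracted, so the ray stays in the slice
  on which the other coordinates are constant. For \<open>J = UNIV\<close> this is the usual radial
  contraction.\<close>

definition scale_on :: "'n::finite set \<Rightarrow> real \<Rightarrow> real^'n \<Rightarrow> real^'n" where
  "scale_on J t z = (\<chi> i. if i \<in> J then t * z $ i else z $ i)"

lemma scale_on_nth [simp]: "scale_on J t z $ i = (if i \<in> J then t * z $ i else z $ i)"
  by (simp add: scale_on_def)

lemma scale_on_1 [simp]: "scale_on J 1 z = z"
  by (simp add: vec_eq_iff)

lemma scale_on_scale_on: "scale_on J s (scale_on J t z) = scale_on J (s * t) z"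
  by (simp add: vec_eq_iff)

lemma norm_scale_on_le: "0 \<le> t \<Longrightarrow> t \<le> 1 \<Longrightarrow> norm (scale_on J t z) \<le> norm z"
  by (rule norm_le_componentwise_cart) (auto simp: abs_mult intro: mult_left_le_one_le)

lemma scale_on_in_ball: "z \<in> ball 0 r \<Longrightarrow> 0 \<le> t \<Longrightarrow> t \<le> 1 \<Longrightarrow> scale_on J t z \<in> ball 0 r"
  using norm_scale_on_le[of t J z] by simp

lemma continuous_on_scale_on: "continuous_on S (\<lambda>(z, t). scale_on J t z)"
  unfolding scale_on_def case_prod_beta
proof (rule continuous_on_vec_lambda)
  fix i show "continuous_on S (\<lambda>p. if i \<in> J then snd p * fst p $ i else fst p $ i)"
    by (cases "i \<in> J") (auto intro!: continuous_intros)
qed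

lemma continuous_on_scale_on_compose:
  assumes "continuous_on (ball 0 r) f"
  shows "continuous_on (ball 0 r \<times> cbox 0 1) (\<lambda>(z, t). f (scale_on J t z))"
proof -
  have "continuous_on (ball 0 r \<times> cbox 0 1) (\<lambda>p. f (case p of (z, t) \<Rightarrow> scale_on J t z))"
    by (rule continuous_on_compose2[OF assms continuous_on_scale_on]) (auto intro: scale_on_in_ball)
  then show ?thesis by (simp add: case_prod_beta')
qed

text \<open>The weight \<open>t ^ m\<close> makes the family closed under differentiation: by the
  chain rule each derivative in a direction of \<open>J\<close> contributes one more factor
  \<open>t\<close>.\<close>

definition ray_integral :: "'n::finite set \<Rightarrow> nat \<Rightarrow> (real^'n \<Rightarrow> real) \<Rightarrow> real^'n \<Rightarrow> real" where
  "ray_integral J m f z = integral {0..1} (\<lambda>t. t ^ m * f (scale_on J t z))"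

lemma continuous_on_ray_integrand:
  assumes "continuous_on (ball 0 r) f"
  shows "continuous_on (ball 0 r \<times> cbox 0 1) (\<lambda>(z, t). t ^ m * f (scale_on J t z))"
  using continuous_on_scale_on_compose[OF assms, of J]
  by (auto simp: case_prod_beta' intro!: continuous_intros)

lemma continuous_on_ray:
  assumes "continuous_on (ball 0 r) f" "z \<in> ball 0 r"
  shows "continuous_on {0..1} (\<lambda>t. f (scale_on J t z))"
proof (rule continuous_on_compose2[OF assms(1)])
  have "continuous_on {0..1} (\<lambda>t. (\<lambda>(z, t). scale_on J t z) (z, t))"
    by (rule continuous_on_compose2[OF continuous_on_scale_on]) (auto intro!: continuous_intros)
  then show "continuous_on {0..1} (\<lambda>t. scale_on J t z)" by simp
qed (use assms scale_on_in_ball in auto)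

lemma pd_scale_on:
  "pd i (\<lambda>w. scale_on J t w $ j) z = (if i = j then if j \<in> J then t else 1 else 0)"
proof (cases "j \<in> J")
  case True
  then show ?thesis using pd_mult[of "\<lambda>w. t" z "\<lambda>w. w $ j"] by simp
qed simp

lemma ray_integral_pd:
  fixes f :: "real^'n::finite \<Rightarrow> real"
  assumes f: "Ck_on 1 (ball 0 r) f" and z: "z \<in> ball 0 r"
  shows "ray_integral J m f differentiable (at z)"
    and "pd i (ray_integral J m f) z = ray_integral J (if i \<in> J then Suc m else m) (pd i f) z"
proof -
  let ?e = "\<lambda>i. if i \<in> J then Suc m else m"
  \<comment> \<open>The derivative of the integrand in the space variable, as a bounded linear map;
    this is the form required for differentiation under the integral sign.\<close>
  define D where "D = (\<lambda>z t. \<Sum>i\<in>UNIV. (t ^ ?e i * pd i f (scale_on J t z)) *\<^sub>R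
    blinfun_inner_right (axis i (1::real)))"
  have fd: "f differentiable (at w)" "continuous_on (ball 0 r) (pd j f)" if "w \<in> ball 0 r" for w j
    using f that by auto
  have fc: "continuous_on (ball 0 r) f"
    using f Ck_on_SucD[of 0 "ball 0 r" f] by simp
  have der: "((\<lambda>x. t ^ m * f (scale_on J t x)) has_derivative blinfun_apply (D x t)) (at x within ball 0 r)"
    if "x \<in> ball 0 r" "t \<in> cbox 0 1" for x t
  proof (rule has_derivative_at_withinI)
    have d: "f differentiable (at (scale_on J t x))"
      using that scale_on_in_ball by (intro fd) auto
    have c: "(\<lambda>w. scale_on J t w $ j) differentiable (at x)" for j
      by (cases "j \<in> J") auto
    have "(\<lambda>x. f (scale_on J t x)) differentiable (at x)"
      by (rule pd_compose(1)[OF d c])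
    from differentiable_has_derivative_pd[OF this]
    moreover have "(\<Sum>j\<in>UNIV. c j * (if i = j then d j else 0)) = c i * d i" for i and c d :: "'n \<Rightarrow> real"
      by (simp add: if_distrib[where f="\<lambda>x. _ * x"] cong: if_cong)
    ultimately have "((\<lambda>x. f (scale_on J t x)) has_derivative
        (\<lambda>h. \<Sum>i\<in>UNIV. h $ i * (pd i f (scale_on J t x) * (if i \<in> J then t else 1)))) (at x)"
      unfolding pd_compose(2)[OF d c] pd_scale_on by simp
    from has_derivative_mult_right[OF this, of "t ^ m"]
    show "((\<lambda>x. t ^ m * f (scale_on J t x)) has_derivative blinfun_apply (D x t)) (at x)"
      by (rule has_derivative_eq_rhs)
        (intro ext, auto simp: D_def blinfun.sum_left blinfun.scaleR_left sum_distrib_left inner_axis' intro!: sum.cong)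
  qed
  have int: "(\<lambda>t. t ^ k * g (scale_on J t x)) integrable_on cbox 0 1"
    if "x \<in> ball 0 r" "continuous_on (ball 0 r) g" for x k and g :: "real^'n \<Rightarrow> real"
    using continuous_on_ray[OF that(2,1), of J]
    by (intro integrable_continuous) (auto intro!: continuous_intros)
  have cD: "continuous_on (ball 0 r \<times> cbox 0 1) (\<lambda>(x, t). D x t)"
    using continuous_on_ray_integrand[OF fd(2)[OF z]]
    unfolding D_def case_prod_beta' by (intro continuous_on_sum continuous_on_scaleR continuous_on_const)
  have "((\<lambda>x. integral (cbox 0 1) (\<lambda>t. t ^ m * f (scale_on J t x))) has_derivative
      integral (cbox 0 1) (D z)) (at z within ball 0 r)"
    by (rule leibniz_rule[OF der int[OF _ fc] cD z convex_ball])
  then have H: "(ray_integral J m f has_derivative integral (cbox 0 1) (D z)) (at z)"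
    using at_within_open[OF z open_ball] by (simp add: ray_integral_def[abs_def])
  then show "ray_integral J m f differentiable (at z)" by (auto simp: differentiable_def)
  have "continuous_on (cbox 0 1) (\<lambda>t. (\<lambda>(x, t). D x t) (z, t))"
    by (rule continuous_on_compose2[OF cD]) (use z in \<open>auto intro!: continuous_intros\<close>)
  then have "D z integrable_on cbox 0 1" by (intro integrable_continuous) simp
  then have "integral (cbox 0 1) (D z) (axis i 1) = integral (cbox 0 1) (\<lambda>t. D z t (axis i 1))"
    by (rule blinfun_apply_integral)
  also have "(\<lambda>t. D z t (axis i 1)) = (\<lambda>t. t ^ ?e i * pd i f (scale_on J t z))"
    by (rule ext) (simp add: D_def blinfun.sum_left blinfun.scaleR_left inner_axis_axis
        if_distrib[where f="\<lambda>x. _ * x"] cong: if_cong)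
  finally show "pd i (ray_integral J m f) z = ray_integral J (?e i) (pd i f) z"
    using has_derivative_pd[OF H] by (simp add: ray_integral_def)
qed

lemma Ck_on_ray_integral:
  "Ck_on k (ball 0 r) f \<Longrightarrow> Ck_on k (ball 0 r) (ray_integral J m f)"
proof (induction k arbitrary: f m)
  case 0
  then show ?case
    using integral_continuous_on_param[OF continuous_on_ray_integrand, of r f m J]
    by (simp add: ray_integral_def[abs_def])
next
  case (Suc k)
  have f: "Ck_on 1 (ball 0 r) f"
    by (rule Ck_on_le[OF _ Suc.prems]) simp
  have "Ck_on k (ball 0 r) (pd i (ray_integral J m f))" for i
    by (rule Ck_on_cong[OF open_ball _ Suc.IH[where m="if i \<in> J then Suc m else m"]])
      (use ray_integral_pd(2)[OF f] Suc.prems in auto)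
  then show ?case using ray_integral_pd(1)[OF f] by simp
qed

lemma smooth_on_ray_integral: "smooth_on (ball 0 r) f \<Longrightarrow> smooth_on (ball 0 r) (ray_integral J m f)"
  by (simp add: smooth_on_def Ck_on_ray_integral)

lemma has_vector_derivative_along_ray:
  fixes f :: "real^'n::finite \<Rightarrow> real"
  assumes "f differentiable (at (scale_on J t z))"
  shows "((\<lambda>t. f (scale_on J t z)) has_vector_derivative (\<Sum>j\<in>J. z $ j * pd j f (scale_on J t z)))
    (at t within T)"
proof -
  have "((\<lambda>t. scale_on J t z) has_derivative (\<lambda>h. \<chi> j. if j \<in> J then h * z $ j else 0)) (at t within T)"
  proof (subst has_derivative_componentwise_within, intro ballI)
    fix b :: "real^'n" assume "b \<in> Basis"
    then obtain i where b: "b = axis i 1" by (auto simp: Basis_vec_def)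
    show "((\<lambda>t. scale_on J t z \<bullet> b) has_derivative
        (\<lambda>h. (\<chi> j. if j \<in> J then h * z $ j else 0) \<bullet> b)) (at t within T)"
      by (cases "i \<in> J") (auto simp: b inner_axis intro!: derivative_eq_intros)
  qed
  from has_derivative_compose[OF this differentiable_has_derivative_pd[OF assms]]
  show ?thesis
    unfolding has_vector_derivative_def
    by (rule has_derivative_eq_rhs)
      (auto simp: sum_distrib_left if_distrib[where f="\<lambda>x. x * _"] sum.If_cases mult.assoc cong: if_cong)
qed

text \<open>The homotopy formula with the coordinates outside \<open>J\<close> as smooth parameters.
  Closedness turns the derivative under the integral sign into the derivative of
  \<open>t * \<theta> i\<close> along the ray, so the fundamental theorem of calculus
  applies.\<close>

lemma relative_poincare:
  fixes \<theta> :: "'n::finite \<Rightarrow> real^'n \<Rightarrow> real"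
  assumes \<theta>: "\<And>j. j \<in> J \<Longrightarrow> smooth_on (ball 0 r) (\<theta> j)"
    and closed: "\<And>i j z. i \<in> J \<Longrightarrow> j \<in> J \<Longrightarrow> z \<in> ball 0 r \<Longrightarrow> pd i (\<theta> j) z = pd j (\<theta> i) z"
  obtains f where "smooth_on (ball 0 r) f"
    "\<And>i z. i \<in> J \<Longrightarrow> z \<in> ball 0 r \<Longrightarrow> pd i f z = \<theta> i z"
proof -
  define f where "f = (\<lambda>z. \<Sum>j\<in>J. z $ j * ray_integral J 0 (\<theta> j) z)"
  have sf: "smooth_on (ball 0 r) f"
    unfolding f_def by (intro smooth_on_sum smooth_on_mult smooth_on_ray_integral \<theta>) auto
  have "pd i f z = \<theta> i z" if i: "i \<in> J" and z: "z \<in> ball 0 r" for i z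
  proof -
  have C1: "Ck_on 1 (ball 0 r) (\<theta> j)" if "j \<in> J" for j
    using \<theta>[OF that] by (simp add: smooth_on_def)
  have "pd i f z = (\<Sum>j\<in>J. pd i (\<lambda>z. z $ j * ray_integral J 0 (\<theta> j) z) z)"
    unfolding f_def
    by (rule pd_sum) (auto intro!: differentiable_mult ray_integral_pd(1)[OF C1 z])
  also have "\<dots> = (\<Sum>j\<in>J. z $ j * ray_integral J 1 (pd i (\<theta> j)) z + (if i = j then ray_integral J 0 (\<theta> j) z else 0))"
    using i by (intro sum.cong refl)
      (auto simp: pd_mult ray_integral_pd[OF C1 z])
  also have "\<dots> = (\<Sum>j\<in>J. z $ j * ray_integral J 1 (pd i (\<theta> j)) z) + ray_integral J 0 (\<theta> i) z"
    using i by (simp add: sum.distrib)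
  also have "\<dots> = \<theta> i z"
  proof -
    have sc: "scale_on J t z \<in> ball 0 r" if "t \<in> {0..1}" for t
      using scale_on_in_ball[OF z] that by simp
    have int: "(\<lambda>t. t ^ k * g (scale_on J t z)) integrable_on {0..1}"
      if "smooth_on (ball 0 r) g" for k and g :: "real^'n \<Rightarrow> real"
      using continuous_on_ray[OF smooth_on_continuous[OF that] z, of J]
      by (intro integrable_continuous_interval) (auto intro!: continuous_intros)
    have "((\<lambda>t. t * \<theta> i (scale_on J t z)) has_vector_derivative
        (t * (\<Sum>j\<in>J. z $ j * pd j (\<theta> i) (scale_on J t z)) + 1 * \<theta> i (scale_on J t z))) (at t within {0..1})"
      if "t \<in> {0..1}" for t
      using has_vector_derivative_along_ray[OF smooth_on_differentiable[OF \<theta>[OF i] sc[OF that]], of "{0..1}"]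
      by (intro has_vector_derivative_mult) auto
    from fundamental_theorem_of_calculus[OF _ this]
    have "((\<lambda>t. t * (\<Sum>j\<in>J. z $ j * pd j (\<theta> i) (scale_on J t z)) + 1 * \<theta> i (scale_on J t z))
        has_integral \<theta> i z) {0..1}" by simp
    then have "\<theta> i z = integral {0..1} (\<lambda>t. (\<Sum>j\<in>J. z $ j * (t ^ 1 * pd j (\<theta> i) (scale_on J t z))) + t ^ 0 * \<theta> i (scale_on J t z))"
      by (simp add: integral_unique sum_distrib_left algebra_simps)
    also have "\<dots> = (\<Sum>j\<in>J. z $ j * ray_integral J 1 (pd j (\<theta> i)) z) + ray_integral J 0 (\<theta> i) z"
      unfolding ray_integral_def
      by (subst integral_add integral_sum integral_mult_right;
          (intro integrable_sum integrable_on_mult_right int smooth_on_pd \<theta> i finite)?)+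
        (auto intro: i)
    also have "(\<Sum>j\<in>J. z $ j * ray_integral J 1 (pd j (\<theta> i)) z) = (\<Sum>j\<in>J. z $ j * ray_integral J 1 (pd i (\<theta> j)) z)"
      unfolding ray_integral_def using closed i sc
      by (intro sum.cong refl arg_cong2[where f="(*)"] integral_cong) auto
    finally show ?thesis by simp
  qed
  finally show "pd i f z = \<theta> i z" .
  qed
  with sf show ?thesis by (rule that)
qed

subsection \<open>Frobenius' theorem in codimension one\<close>

lemma small_gronwall:
  fixes e e' :: "real \<Rightarrow> real"
  assumes der: "\<And>t. t \<in> {0..1} \<Longrightarrow> (e has_vector_derivative e' t) (at t within {0..1})"
    and le: "\<And>t. t \<in> {0..1} \<Longrightarrow> \<bar>e' t\<bar> \<le> \<bar>e t\<bar> / 2 + c"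
    and t: "t \<in> {0..1}"
  shows "\<bar>e t\<bar> \<le> 2 * (\<bar>e 0\<bar> + c)"
proof -
  have "continuous_on {0..1} e"
    using der has_vector_derivative_continuous continuous_on_eq_continuous_within by blast
  then have "continuous_on {0..1} (\<lambda>t. \<bar>e t\<bar>)" by (intro continuous_intros)
  then obtain s where s: "s \<in> {0..1}" "\<And>t. t \<in> {0..1} \<Longrightarrow> \<bar>e t\<bar> \<le> \<bar>e s\<bar>"
    using continuous_attains_sup[of "{0..1::real}" "\<lambda>t. \<bar>e t\<bar>"] by auto
  define B where "B = \<bar>e s\<bar> / 2 + c"
  have B: "\<bar>e' t\<bar> \<le> B" if "t \<in> {0..1}" for t
    using le[OF that] s(2)[OF that] by (simp add: B_def)
  have "B \<ge> 0" using B[of 0] by simp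
  have "(e' has_integral (e s - e 0)) {0..s}"
    using s(1) by (intro fundamental_theorem_of_calculus has_vector_derivative_within_subset[OF der]) auto
  then have "norm (e s - e 0) \<le> B * measure lborel {0..s}"
    by (rule has_integral_bound_real[OF \<open>B \<ge> 0\<close> finite.emptyI]) (use B s(1) in auto)
  also have "\<dots> \<le> B" using s(1) \<open>B \<ge> 0\<close> by (simp add: mult_left_le)
  finally have "\<bar>e s\<bar> \<le> 2 * (\<bar>e 0\<bar> + c)" by (simp add: B_def)
  then show ?thesis using s(2)[OF t] by linarith
qed

section \<open>Uniform estimates on compact balls\<close>

lemma smooth_on_cball_bound:
  fixes f :: "real^'n::finite \<Rightarrow> real"
  assumes "smooth_on (ball 0 \<rho>) f" "s < \<rho>"
  obtains M where "M \<ge> 0" "\<And>w. w \<in> cball 0 s \<Longrightarrow> \<bar>f w\<bar> \<le> M"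
proof -
  have sub: "cball 0 s \<subseteq> ball (0::real^'n) \<rho>" using assms(2) by auto
  have "compact (f ` cball 0 s)"
    by (intro compact_continuous_image smooth_on_continuous[OF smooth_on_subset[OF assms(1) sub]] compact_cball)
  from compact_imp_bounded[OF this] obtain M where "\<And>w. w \<in> cball 0 s \<Longrightarrow> \<bar>f w\<bar> \<le> M"
    unfolding bounded_iff by force
  then show ?thesis by (intro that[of "max M 0"]) (auto simp: le_max_iff_disj)
qed

lemma abs_sum_components_le:
  fixes c :: "real^'n::finite"
  assumes "\<And>i. i \<in> I \<Longrightarrow> \<bar>d i\<bar> \<le> B" "B \<ge> 0"
  shows "\<bar>\<Sum>i\<in>I. c $ i * d i\<bar> \<le> real CARD('n) * norm c * B"
proof -
  have "\<bar>\<Sum>i\<in>I. c $ i * d i\<bar> \<le> (\<Sum>i\<in>I. norm c * B)"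
    by (rule order_trans[OF sum_abs]) 
      (unfold abs_mult, intro sum_mono mult_mono assms component_le_norm_cart, auto)
  also have "\<dots> \<le> (\<Sum>i\<in>(UNIV::'n set). norm c * B)"
    by (rule sum_mono2) (use assms in auto)
  finally show ?thesis by simp
qed

text \<open>The mean value inequality for \<open>f\<close> minus a linear function with coefficients
  \<open>c\<close>. The choice \<open>c = 0\<close> gives Lipschitz bounds, the choice of the
  gradient at \<open>w\<close> gives uniform differentiability.\<close>

lemma smooth_on_linearization:
  fixes f :: "real^'n::finite \<Rightarrow> real"
  assumes f: "smooth_on (ball 0 \<rho>) f" and "s < \<rho>" "w \<in> cball 0 s" "w' \<in> cball 0 s" "B \<ge> 0"
    and B: "\<And>x i. x \<in> closed_segment w w' \<Longrightarrow> \<bar>pd i f x - c i\<bar> \<le> B"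
  shows "\<bar>f w' - f w - (\<Sum>i\<in>UNIV. (w' - w) $ i * c i)\<bar> \<le> real CARD('n) * B * norm (w' - w)"
proof -
  define g where "g = (\<lambda>x. f x - (\<Sum>i\<in>UNIV. x $ i * c i))"
  define g' where "g' = (\<lambda>x h. \<Sum>i\<in>UNIV. h $ i * (pd i f x - c i))"
  have sub: "closed_segment w w' \<subseteq> ball 0 \<rho>"
    using closed_segment_subset[OF assms(3,4) convex_cball] assms(2) by auto
  have 1: "(g has_derivative g' x) (at x within closed_segment w w')" if "x \<in> closed_segment w w'" for x
  proof (rule has_derivative_at_withinI)
    have "(f has_derivative (\<lambda>h. \<Sum>i\<in>UNIV. h $ i *\<^sub>R pd i f x)) (at x)"
      using that sub by (intro differentiable_has_derivative_pd smooth_on_differentiable[OF f]) auto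
    moreover have "((\<lambda>x. \<Sum>i\<in>UNIV. x $ i * c i) has_derivative (\<lambda>h. \<Sum>i\<in>UNIV. h $ i * c i)) (at x)"
      by (intro has_derivative_sum has_derivative_mult_left has_derivative_vec_nth_at)
    ultimately have "(g has_derivative (\<lambda>h. (\<Sum>i\<in>UNIV. h $ i *\<^sub>R pd i f x) - (\<Sum>i\<in>UNIV. h $ i * c i))) (at x)"
      unfolding g_def by (rule has_derivative_diff)
    then show "(g has_derivative g' x) (at x)"
      by (simp add: g'_def right_diff_distrib sum_subtractf)
  qed
  have 2: "onorm (g' x) \<le> real CARD('n) * B" if "x \<in> closed_segment w w'" for x
  proof (rule onorm_bound)
    fix h :: "real^'n"
    have "\<bar>g' x h\<bar> \<le> real CARD('n) * norm h * B"
      unfolding g'_def by (rule abs_sum_components_le[OF B[OF that] assms(5)])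
    then show "norm (g' x h) \<le> real CARD('n) * B * norm h" by (simp add: mult_ac)
  qed (use assms(5) in simp)
  have "norm (g w' - g w) \<le> real CARD('n) * B * norm (w' - w)"
    by (rule differentiable_bound[OF convex_closed_segment 1 2]) simp_all
  moreover have "g w' - g w = f w' - f w - (\<Sum>i\<in>UNIV. (w' - w) $ i * c i)"
    by (simp add: g_def left_diff_distrib sum_subtractf)
  ultimately show ?thesis by simp
qed

lemma smooth_on_lipschitz:
  fixes f :: "real^'n::finite \<Rightarrow> real"
  assumes f: "smooth_on (ball 0 \<rho>) f" and s: "s < \<rho>"
  obtains L where "L \<ge> 0" "\<And>w w'. w \<in> cball 0 s \<Longrightarrow> w' \<in> cball 0 s \<Longrightarrow> \<bar>f w' - f w\<bar> \<le> L * norm (w' - w)"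
proof -
  have "\<exists>M\<ge>0. \<forall>w\<in>cball 0 s. \<bar>pd i f w\<bar> \<le> M" for i
    using smooth_on_cball_bound[OF smooth_on_pd[OF f] s] by metis
  then obtain M where M: "\<And>i. M i \<ge> 0" "\<And>i w. w \<in> cball 0 s \<Longrightarrow> \<bar>pd i f w\<bar> \<le> M i" by metis
  define B where "B = sum M UNIV"
  have MB: "M i \<le> B" for i unfolding B_def by (rule member_le_sum) (auto simp: M)
  have B0: "B \<ge> 0" unfolding B_def by (intro sum_nonneg) (auto simp: M)
  show ?thesis
  proof (rule that[of "real CARD('n) * B"])
    fix w w' :: "real^'n" assume w: "w \<in> cball 0 s" "w' \<in> cball 0 s"
    have "\<bar>pd i f x - 0\<bar> \<le> B" if "x \<in> closed_segment w w'" for x i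
      using closed_segment_subset[OF w convex_cball] that M(2)[of x i] MB[of i] by auto
    from smooth_on_linearization[OF f s w B0 this]
    show "\<bar>f w' - f w\<bar> \<le> real CARD('n) * B * norm (w' - w)" by simp
  qed (use B0 in simp)
qed

text \<open>The remainder is needed simultaneously at all points of a ray, so \<open>d\<close> must
  not depend on the base point; uniform continuity of the partial derivatives on the compact ball
  provides this.\<close>

lemma smooth_on_uniformly_differentiable:
  fixes f :: "real^'n::finite \<Rightarrow> real"
  assumes f: "smooth_on (ball 0 \<rho>) f" and s: "s < \<rho>" and e: "e > 0"
  obtains d where "d > 0" "\<And>w w'. w \<in> cball 0 s \<Longrightarrow> w' \<in> cball 0 s \<Longrightarrow> norm (w' - w) < d \<Longrightarrow>
    \<bar>f w' - f w - (\<Sum>i\<in>UNIV. (w' - w) $ i * pd i f w)\<bar> \<le> e * norm (w' - w)"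
proof -
  have sub: "cball 0 s \<subseteq> ball (0::real^'n) \<rho>" using s by auto
  define e1 where "e1 = e / real CARD('n)"
  have e1: "e1 > 0" using e by (simp add: e1_def)
  have "\<exists>d>0. \<forall>x\<in>cball 0 s. \<forall>w\<in>cball 0 s. norm (x - w) < d \<longrightarrow> \<bar>pd i f x - pd i f w\<bar> < e1" for i
  proof -
    have "uniformly_continuous_on (cball 0 s) (pd i f)"
      by (intro compact_uniformly_continuous smooth_on_continuous smooth_on_subset[OF smooth_on_pd[OF f] sub] compact_cball)
    then show ?thesis unfolding uniformly_continuous_on_def dist_norm real_norm_def using e1 by blast
  qed
  then obtain d where d: "\<And>i. d i > 0"
    "\<And>i x w. x \<in> cball 0 s \<Longrightarrow> w \<in> cball 0 s \<Longrightarrow> norm (x - w) < d i \<Longrightarrow> \<bar>pd i f x - pd i f w\<bar> < e1"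
    by metis
  show ?thesis
  proof (rule that[of "Min (range d)"])
    show "Min (range d) > 0" using d(1) by auto
    fix w w' :: "real^'n" assume w: "w \<in> cball 0 s" "w' \<in> cball 0 s" and n: "norm (w' - w) < Min (range d)"
    have "\<bar>pd i f x - pd i f w\<bar> \<le> e1" if x: "x \<in> closed_segment w w'" for x i
    proof -
      have "norm (x - w) \<le> norm (w' - w)"
        using segment_bound(1)[OF x] by (simp add: norm_minus_commute)
      also have "\<dots> < d i" using n by (rule less_le_trans) auto
      finally show ?thesis
        using d(2) closed_segment_subset[OF w convex_cball] x w by (intro less_imp_le) blast
    qed
    from smooth_on_linearization[OF f s w less_imp_le[OF e1] this]
    show "\<bar>f w' - f w - (\<Sum>i\<in>UNIV. (w' - w) $ i * pd i f w)\<bar> \<le> e * norm (w' - w)"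
      by (simp add: e1_def)
  qed
qed

text \<open>The point over \<open>z\<close> on the graph of an unknown function: its value
  \<open>y\<close> takes the place of coordinate \<open>k\<close>.\<close>

definition upd_nth :: "'n \<Rightarrow> real \<Rightarrow> real^'n::finite \<Rightarrow> real^'n" where
  "upd_nth k y z = (\<chi> i. if i = k then y else z $ i)"

lemma upd_nth_nth [simp]: "upd_nth k y z $ i = (if i = k then y else z $ i)"
  by (simp add: upd_nth_def)

lemma norm_upd_nth_diff: "norm (upd_nth k y z - upd_nth k y' z') \<le> \<bar>y - y'\<bar> + norm (z - z')"
proof -
  have "norm (upd_nth k y z - upd_nth k y' z') \<le> norm ((y - y') *\<^sub>R axis k 1 + (upd_nth k 0 z - upd_nth k 0 z'))"
    by (rule norm_le_componentwise_cart) (auto simp: axis_def)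
  also have "\<dots> \<le> norm ((y - y') *\<^sub>R axis k (1::real)) + norm (upd_nth k 0 z - upd_nth k 0 z')"
    by (rule norm_triangle_ineq)
  also have "norm (upd_nth k 0 z - upd_nth k 0 z') \<le> norm (z - z')"
    by (rule norm_le_componentwise_cart) auto
  finally show ?thesis by simp
qed

lemma norm_upd_nth: "norm (upd_nth k y z) \<le> \<bar>y\<bar> + norm z"
proof -
  have "upd_nth k 0 0 = 0" by (simp add: vec_eq_iff)
  then show ?thesis using norm_upd_nth_diff[of k y z 0 0] by simp
qed

lemma continuous_on_upd_nth:
  "continuous_on S y \<Longrightarrow> continuous_on S h \<Longrightarrow> continuous_on S (\<lambda>x. upd_nth k (y x) (h x))"
  unfolding upd_nth_def
proof (rule continuous_on_vec_lambda)
  fix i assume "continuous_on S y" "continuous_on S h"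
  then show "continuous_on S (\<lambda>x. if i = k then y x else h x $ i)"
    by (cases "i = k") (auto intro!: continuous_intros)
qed

text \<open>Picard's method for all initial points at once: the unknown is a function
  \<open>Z\<close> of the end point, and the equation integrates \<open>a\<close> along the ray that
  leads there. The constants are returned together with \<open>Z\<close> because the
  differentiability proof reuses them.\<close>

lemma upd_nth_ray_fixed_point:
  fixes a :: "'n::finite \<Rightarrow> real^'n \<Rightarrow> real"
  assumes smooth: "\<And>j. smooth_on (ball 0 \<rho>) (a j)" and "\<rho> > 0"
  obtains r L M Z where "0 < r" "L \<ge> 0" "M \<ge> 0" "real CARD('n) * r * L \<le> 1/2" 
    "\<And>j w w'. w \<in> cball 0 (\<rho>/2) \<Longrightarrow> w' \<in> cball 0 (\<rho>/2) \<Longrightarrow> \<bar>a j w' - a j w\<bar> \<le> L * norm (w' - w)"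
    "\<And>j w. w \<in> cball 0 (\<rho>/2) \<Longrightarrow> \<bar>a j w\<bar> \<le> M"
    "\<And>j w. w \<in> cball 0 (\<rho>/2) \<Longrightarrow> \<bar>pd k (a j) w\<bar> \<le> L"
    "continuous_on (cball 0 r) Z" 
    "\<And>z. z \<in> cball 0 r \<Longrightarrow> upd_nth k (Z z) z \<in> cball 0 (\<rho>/2)"
    "\<And>z. z \<in> cball 0 r \<Longrightarrow> Z z = z $ k +
       (\<Sum>j\<in>J. z $ j * integral {0..1} (\<lambda>t. a j (upd_nth k (Z (scale_on J t z)) (scale_on J t z))))"
proof -
  let ?K = "cball (0::real^'n) (\<rho>/2)" and ?N = "real CARD('n)"
  have "\<exists>M\<ge>0. \<forall>w\<in>?K. \<bar>a j w\<bar> \<le> M" for j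
    using smooth_on_cball_bound[OF smooth, of "\<rho>/2" j] \<open>\<rho> > 0\<close> by (smt (verit) field_sum_of_halves)
  then obtain Mj where Mj: "\<And>j. Mj j \<ge> 0" "\<And>j w. w \<in> ?K \<Longrightarrow> \<bar>a j w\<bar> \<le> Mj j" by metis
  define M where "M = sum Mj UNIV"
  have "Mj j \<le> M" for j unfolding M_def by (rule member_le_sum) (auto simp: Mj)
  then have M: "\<bar>a j w\<bar> \<le> M" if "w \<in> ?K" for j w
    using Mj(2)[OF that, of j] by (meson order_trans)
  have M0: "M \<ge> 0" unfolding M_def by (intro sum_nonneg) (auto simp: Mj)
  have "\<exists>L\<ge>0. \<forall>w\<in>?K. \<forall>w'\<in>?K. \<bar>a j w' - a j w\<bar> \<le> L * norm (w' - w)" for j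
    using smooth_on_lipschitz[OF smooth, of "\<rho>/2" j] \<open>\<rho> > 0\<close> by (smt (verit) field_sum_of_halves)
  then obtain Lj where Lj: "\<And>j. Lj j \<ge> 0" 
    "\<And>j w w'. w \<in> ?K \<Longrightarrow> w' \<in> ?K \<Longrightarrow> \<bar>a j w' - a j w\<bar> \<le> Lj j * norm (w' - w)" by metis
  have "\<exists>P\<ge>0. \<forall>w\<in>?K. \<bar>pd k (a j) w\<bar> \<le> P" for j
    using smooth_on_cball_bound[OF smooth_on_pd[OF smooth], of "\<rho>/2" k j] \<open>\<rho> > 0\<close>
    by (smt (verit) field_sum_of_halves)
  then obtain Pj where Pj: "\<And>j. Pj j \<ge> 0" "\<And>j w. w \<in> ?K \<Longrightarrow> \<bar>pd k (a j) w\<bar> \<le> Pj j" by metis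
  \<comment> \<open>One constant serves both as a Lipschitz constant of every \<open>a j\<close> and
    as a bound of every \<open>pd k (a j)\<close>.\<close>
  define L where "L = (\<Sum>j\<in>UNIV. Lj j + Pj j)"
  have LP: "Lj j + Pj j \<le> L" for j
    unfolding L_def by (rule member_le_sum) (auto simp: Lj Pj add_nonneg_nonneg)
  have "Lj j \<le> L" for j using LP[of j] Pj(1)[of j] by linarith
  then have L: "\<bar>a j w' - a j w\<bar> \<le> L * norm (w' - w)" if "w \<in> ?K" "w' \<in> ?K" for j w w'
    using Lj(2)[OF that, of j] by (meson order_trans mult_right_mono norm_ge_zero)
  have P: "\<bar>pd k (a j) w\<bar> \<le> L" if "w \<in> ?K" for j w
    using Pj(2)[OF that, of j] LP[of j] Lj(1)[of j] by linarith
  have L0: "L \<ge> 0" unfolding L_def by (intro sum_nonneg) (auto simp: Lj Pj add_nonneg_nonneg)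
  \<comment> \<open>The first bound keeps the solution within \<open>\<rho> / 4\<close>, hence its
    graph in the ball of radius \<open>\<rho> / 2\<close>; the second makes the contraction factor
    \<open>1/2\<close>.\<close>
  define r where "r = min (\<rho> / (4 * (1 + ?N * M))) (1 / (2 * (1 + ?N * L)))"
  have pos: "0 < 1 + ?N * M" "0 < 1 + ?N * L" using M0 L0 by (auto simp: add_pos_nonneg)
  have r0: "r > 0" using \<open>\<rho> > 0\<close> pos by (simp add: r_def)
  have aux: "r * c \<le> d / e" if "r \<le> d / (e * c)" "c > 0" for c d e :: real
    using mult_right_mono[OF that(1), of c] that(2) by simp
  have "r * (1 + ?N * M) \<le> \<rho> / 4" using pos by (intro aux) (auto simp: r_def)
  then have rM: "r + ?N * r * M \<le> \<rho> / 4" by (simp add: distrib_left mult_ac)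
  have "r * (1 + ?N * L) \<le> 1 / 2" using pos by (intro aux) (auto simp: r_def)
  then have rL: "?N * r * L \<le> 1/2" using r0 by (simp add: distrib_left mult_ac)
  have r4: "r \<le> \<rho> / 4" using rM M0 r0 by (smt (verit) mult_nonneg_nonneg of_nat_0_le_iff)
  \<comment> \<open>Clamping the values makes the operator defined on every continuous function,
    without a side condition on its range.\<close>
  define cl where "cl = (\<lambda>y::real. max (-(\<rho>/4)) (min (\<rho>/4) y))"
  have cl: "\<bar>cl y\<bar> \<le> \<rho>/4" "\<bar>cl y - cl y'\<bar> \<le> \<bar>y - y'\<bar>" "\<bar>y\<bar> \<le> \<rho>/4 \<Longrightarrow> cl y = y" for y y'
    using \<open>\<rho> > 0\<close> by (auto simp: cl_def max_def min_def abs_le_iff)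
  have clc: "continuous_on S (\<lambda>x. cl (h x))" if "continuous_on S h" for S and h :: "(real^'n) \<times> real \<Rightarrow> real"
    unfolding cl_def using that by (intro continuous_intros)
  have inK: "upd_nth k (cl y) z \<in> ?K" if "z \<in> cball 0 r" for y z
    using norm_upd_nth[of k "cl y" z] cl(1)[of y] that r4 by simp
  have sc: "scale_on J t z \<in> cball 0 r" if "z \<in> cball 0 r" "t \<in> {0..1}" for t z
    using norm_scale_on_le[of t J z] that by simp
  have Kb: "?K \<subseteq> ball 0 \<rho>" using \<open>\<rho> > 0\<close> by auto
  define I where "I = (\<lambda>F j z t. a j (upd_nth k (cl (F (scale_on J t z))) (scale_on J t z)))"
  define G where "G = (\<lambda>F z. z $ k + (\<Sum>j\<in>J. z $ j * integral {0..1} (I F j z)))"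
  have contI: "continuous_on (cball 0 r \<times> cbox 0 1) (\<lambda>(z, t). I F j z t)"
    if "continuous_on UNIV F" for F :: "real^'n \<Rightarrow> real" and j
    unfolding I_def case_prod_beta
  proof (rule continuous_on_compose2[OF smooth_on_continuous[OF smooth_on_subset[OF smooth Kb]]])
    have s: "continuous_on (cball 0 r \<times> cbox 0 1) (\<lambda>p. scale_on J (snd p) (fst p))"
      using continuous_on_scale_on[of _ J] by (simp add: case_prod_beta')
    have "continuous_on (cball 0 r \<times> cbox 0 1) (\<lambda>p. F (scale_on J (snd p) (fst p)))"
      by (rule continuous_on_compose2[OF that s]) auto
    then show "continuous_on (cball 0 r \<times> cbox 0 1)
        (\<lambda>p. upd_nth k (cl (F (scale_on J (snd p) (fst p)))) (scale_on J (snd p) (fst p)))"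
      by (intro continuous_on_upd_nth clc s)
  qed (use inK sc in auto)
  have contG: "continuous_on (cball 0 r) (G F)" if "continuous_on UNIV F" for F
    using integral_continuous_on_param[OF contI[OF that]]
    unfolding G_def by (auto intro!: continuous_intros)
  have intI: "I F j z integrable_on {0..1}" if "continuous_on UNIV F" "z \<in> cball 0 r" for F j z
  proof -
    have "continuous_on (cbox 0 1) (\<lambda>t. (\<lambda>(z, t). I F j z t) (z, t))"
      by (rule continuous_on_compose2[OF contI[OF that(1)]]) (use that in \<open>auto intro!: continuous_intros\<close>)
    then show ?thesis by (intro integrable_continuous_interval) simp
  qed
  \<comment> \<open>Projecting the argument onto the ball extends the operator to functions on the
    whole space, so it acts on a complete type of bounded continuous functions.\<close>
  define cp where "cp = closest_point (cball (0::real^'n) r)"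
  have cp: "cp z \<in> cball 0 r" "z \<in> cball 0 r \<Longrightarrow> cp z = z" for z
    using closest_point_in_set[of "cball 0 r" z] closest_point_self[of z "cball 0 r"] r0
    by (auto simp: cp_def)
  have cpc: "continuous_on UNIV cp"
    unfolding cp_def using r0 by (intro continuous_on_closest_point) auto
  define T where "T = (\<lambda>F :: (real^'n) \<Rightarrow>\<^sub>C real. Bcontfun (\<lambda>z. G F (cp z)))"
  have T: "apply_bcontfun (T F) = (\<lambda>z. G F (cp z))" for F
  proof -
    have c: "continuous_on (cball 0 r) (G (apply_bcontfun F))" by (rule contG) simp
    have "bounded (G F ` cball 0 r)"
      by (intro compact_imp_bounded compact_continuous_image c compact_cball)
    then have "bounded (range (\<lambda>z. G F (cp z)))"
      by (rule bounded_subset) (use cp in auto)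
    moreover have "continuous_on UNIV (\<lambda>z. G F (cp z))"
      by (rule continuous_on_compose2[OF c cpc]) (use cp in auto)
    ultimately show ?thesis
      unfolding T_def by (intro Bcontfun_inverse) (simp add: bcontfun_def)
  qed
  have "\<exists>!F. T F = F"
  proof (rule banach_fix_type[where c="1/2"], goal_cases)
    case 3
    show ?case
    proof (intro allI)
    fix F F' :: "(real^'n) \<Rightarrow>\<^sub>C real"
    have "dist (apply_bcontfun (T F) z) (apply_bcontfun (T F') z) \<le> 1/2 * dist F F'" for z
    proof -
      let ?z = "cp z"
      have "\<bar>integral {0..1} (I F j ?z) - integral {0..1} (I F' j ?z)\<bar> \<le> L * dist F F'" for j
      proof -
        have "norm (integral {0..1} (\<lambda>t. I F j ?z t - I F' j ?z t)) \<le> L * dist F F' * measure lborel {0..1::real}"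
        proof (rule has_integral_bound_real[OF _ finite.emptyI])
          show "((\<lambda>t. I F j ?z t - I F' j ?z t) has_integral integral {0..1} (\<lambda>t. I F j ?z t - I F' j ?z t)) {0..1}"
            by (intro integrable_integral integrable_diff intI cp) auto
          show "norm (I F j ?z t - I F' j ?z t) \<le> L * dist F F'" if "t \<in> {0..1} - {}" for t
          proof -
            let ?w = "scale_on J t ?z"
            have w: "?w \<in> cball 0 r" by (rule sc[OF cp(1)]) (use that in simp)
            have "\<bar>I F j ?z t - I F' j ?z t\<bar> \<le> L * norm (upd_nth k (cl (F ?w)) ?w - upd_nth k (cl (F' ?w)) ?w)"
              unfolding I_def by (rule L[OF inK[OF w] inK[OF w]])
            also have "\<dots> \<le> L * dist F F'"
            proof (rule mult_left_mono[OF _ L0])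
              have "norm (upd_nth k (cl (F ?w)) ?w - upd_nth k (cl (F' ?w)) ?w) \<le> \<bar>cl (F ?w) - cl (F' ?w)\<bar>"
                using norm_upd_nth_diff[of k "cl (F ?w)" ?w "cl (F' ?w)" ?w] by simp
              also have "\<dots> \<le> dist (F ?w) (F' ?w)" using cl(2) by (simp add: dist_real_def)
              also have "\<dots> \<le> dist F F'" by (rule dist_bounded)
              finally show "norm (upd_nth k (cl (F ?w)) ?w - upd_nth k (cl (F' ?w)) ?w) \<le> dist F F'" .
            qed
            finally show ?thesis by simp
          qed
        qed (use L0 in simp)
        then show ?thesis using intI cp by (simp add: integral_diff)
      qed
      then have "\<bar>\<Sum>j\<in>J. ?z $ j * (integral {0..1} (I F j ?z) - integral {0..1} (I F' j ?z))\<bar>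
          \<le> ?N * norm ?z * (L * dist F F')"
        by (intro abs_sum_components_le) (use L0 in auto)
      also have "\<dots> \<le> ?N * r * (L * dist F F')"
        using cp(1)[of z] L0 r0 by (intro mult_mono) auto
      also have "\<dots> = ?N * r * L * dist F F'" by simp
      also have "\<dots> \<le> 1/2 * dist F F'"
        by (rule mult_right_mono[OF rL]) simp
      finally show ?thesis
        unfolding T G_def dist_real_def by (simp add: right_diff_distrib sum_subtractf)
    qed
    then show "dist (T F) (T F') \<le> 1/2 * dist F F'" by (rule dist_bound)
    qed
  qed auto
  then obtain F where F: "T F = F" by blast
  define Z where "Z = apply_bcontfun F"
  have Z0: "Z z = G Z z" if "z \<in> cball 0 r" for z
    using T[of F] F cp(2)[OF that] unfolding Z_def by metis
  have cZ: "continuous_on S Z" for S unfolding Z_def by simp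
  \<comment> \<open>A posteriori bound: the fixed point never reaches the clamp, so it solves the
    original equation.\<close>
  have Zb: "\<bar>Z z\<bar> \<le> \<rho>/4" if z: "z \<in> cball 0 r" for z
  proof -
    have "\<bar>integral {0..1} (I Z j z)\<bar> \<le> M" for j
    proof -
      have "norm (integral {0..1} (I Z j z)) \<le> M * measure lborel {0..1::real}"
      proof (rule has_integral_bound_real[OF M0 finite.emptyI])
        show "(I Z j z has_integral integral {0..1} (I Z j z)) {0..1}"
          by (intro integrable_integral intI cZ z)
        show "norm (I Z j z t) \<le> M" if "t \<in> {0..1} - {}" for t
          unfolding I_def real_norm_def by (rule M[OF inK[OF sc[OF z]]]) (use that in simp)
      qed
      then show ?thesis by simp
    qed
    then have "\<bar>\<Sum>j\<in>J. z $ j * integral {0..1} (I Z j z)\<bar> \<le> ?N * norm z * M"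
      by (intro abs_sum_components_le M0)
    also have "\<dots> \<le> ?N * r * M" using z M0 r0 by (intro mult_mono) auto
    finally have "\<bar>\<Sum>j\<in>J. z $ j * integral {0..1} (I Z j z)\<bar> \<le> ?N * r * M" .
    moreover have "norm z \<le> r" using z by simp
    ultimately show ?thesis
      using rM component_le_norm_cart[of z k] unfolding Z0[OF z] G_def by linarith
  qed
  show ?thesis
  proof (rule that[of r L M Z])
    show "upd_nth k (Z z) z \<in> ?K" if "z \<in> cball 0 r" for z
      using inK[OF that, of "Z z"] cl(3)[OF Zb[OF that]] by simp
    show "Z z = z $ k + (\<Sum>j\<in>J. z $ j * integral {0..1} (\<lambda>t. a j (upd_nth k (Z (scale_on J t z)) (scale_on J t z))))"
      if "z \<in> cball 0 r" for z
    proof -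
      have "integral {0..1} (I Z j z) = integral {0..1} (\<lambda>t. a j (upd_nth k (Z (scale_on J t z)) (scale_on J t z)))" for j
        unfolding I_def using cl(3)[OF Zb[OF sc[OF that]]] by (intro integral_cong) simp
      then show ?thesis using Z0[OF that] by (simp add: G_def)
    qed
  qed (use r0 L0 M0 rL L M P cZ in auto)
qed

text \<open>
  The solution \<open>Z\<close> of the total differential system \<open>\<partial>\<^sub>j Z = a\<^sub>j(z, Z)\<close>, \<open>j \<noteq> k\<close>, with the
  coordinate \<open>z\<^sub>k\<close> as initial value, is found from its integral equation along the rays on which
  \<open>z\<^sub>k\<close> is constant; integrability is what extends the equation from the radial to all directions.
  The graphs of \<open>Z\<close> are the leaves of the foliation.
\<close>

lemma integrable_system_solution:
  fixes a :: "'n::finite \<Rightarrow> real^'n \<Rightarrow> real" and k :: 'n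
  defines "J \<equiv> UNIV - {k}"
  assumes smooth: "\<And>j. smooth_on (ball 0 \<rho>) (a j)" and "\<rho> > 0"
    and integrable: "\<And>i j w. i \<noteq> k \<Longrightarrow> j \<noteq> k \<Longrightarrow> w \<in> ball 0 \<rho> \<Longrightarrow>
      pd i (a j) w + a i w * pd k (a j) w = pd j (a i) w + a j w * pd k (a i) w"
  obtains r Z where "0 < r" "smooth_on (ball 0 r) Z" "Z 0 = 0"
    "\<And>z. z \<in> ball 0 r \<Longrightarrow> upd_nth k (Z z) z \<in> ball 0 \<rho>"
    "\<And>z j. z \<in> ball 0 r \<Longrightarrow> j \<noteq> k \<Longrightarrow> pd j Z z = a j (upd_nth k (Z z) z)"
    "\<And>z. z \<in> ball 0 r \<Longrightarrow> pd k Z z > 0"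
proof -
  let ?K = "cball (0::real^'n) (\<rho>/2)" and ?N = "real CARD('n)"
  obtain r L M Z where r0: "0 < r" and L0: "L \<ge> 0" and M0: "M \<ge> 0" and rL: "?N * r * L \<le> 1/2" 
    and L: "\<And>j w w'. w \<in> ?K \<Longrightarrow> w' \<in> ?K \<Longrightarrow> \<bar>a j w' - a j w\<bar> \<le> L * norm (w' - w)"
    and M: "\<And>j w. w \<in> ?K \<Longrightarrow> \<bar>a j w\<bar> \<le> M"
    and P: "\<And>j w. w \<in> ?K \<Longrightarrow> \<bar>pd k (a j) w\<bar> \<le> L"
    and Zc: "continuous_on (cball 0 r) Z" 
    and ZK: "\<And>z. z \<in> cball 0 r \<Longrightarrow> upd_nth k (Z z) z \<in> ?K"
    and Zeq: "\<And>z. z \<in> cball 0 r \<Longrightarrow> Z z = z $ k +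
       (\<Sum>j\<in>J. z $ j * integral {0..1} (\<lambda>t. a j (upd_nth k (Z (scale_on J t z)) (scale_on J t z))))"
    by (rule upd_nth_ray_fixed_point[OF smooth \<open>\<rho> > 0\<close>, where k=k and J=J]) (rule that; assumption)
  define \<Psi> where "\<Psi> = (\<lambda>z. upd_nth k (Z z) z)"
  have Kb: "?K \<subseteq> ball 0 \<rho>" using \<open>\<rho> > 0\<close> by auto
  have sub: "ball (0::real^'n) r \<subseteq> cball 0 r" by auto
  have \<Psi>K: "\<Psi> z \<in> ?K" if "z \<in> ball 0 r" for z
    using ZK[of z] that unfolding \<Psi>_def by auto
  have \<Psi>b: "\<Psi> z \<in> ball 0 \<rho>" if "z \<in> ball 0 r" for z
    using \<Psi>K[OF that] Kb by blast
  have \<Psi>c: "continuous_on (ball 0 r) \<Psi>"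
    unfolding \<Psi>_def by (intro continuous_on_upd_nth continuous_on_subset[OF Zc sub] continuous_on_id)
  have a\<Psi>c: "continuous_on (ball 0 r) (\<lambda>z. f (\<Psi> z))" if "smooth_on (ball 0 \<rho>) f" for f :: "real^'n \<Rightarrow> real"
    by (rule continuous_on_compose2[OF smooth_on_continuous[OF that] \<Psi>c]) (use \<Psi>b in auto)
  have sc: "scale_on J t z \<in> ball 0 r" if "z \<in> ball 0 r" "t \<in> {0..1}" for t z
    using scale_on_in_ball[OF that(1)] that(2) by simp
  have rayc: "continuous_on {0..1} (\<lambda>t. f (\<Psi> (scale_on J t z)))" if "smooth_on (ball 0 \<rho>) f" "z \<in> ball 0 r"
    for f :: "real^'n \<Rightarrow> real" and z
    by (rule continuous_on_ray[OF a\<Psi>c[OF that(1)] that(2)])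
  have FTC: "((\<lambda>t. integral {0..t} g) has_vector_derivative g t) (at t within {0..1})"
    if "continuous_on {0..1} g" "t \<in> {0..1}" for g :: "real \<Rightarrow> real" and t
    using integral_has_vector_derivative[OF that] .
  \<comment> \<open>The equation at the point scaled by \<open>s\<close>: a substitution turns the
    integral over the shorter ray into an integral up to \<open>s\<close> over the full one, which
    can be differentiated in \<open>s\<close>.\<close>
  have ray_eq: "Z (scale_on J s z) = z $ k + (\<Sum>j\<in>J. z $ j * integral {0..s} (\<lambda>t. a j (\<Psi> (scale_on J t z))))"
    if z: "z \<in> ball 0 r" and s: "s \<in> {0..1}" for s z
  proof -
    have "s * integral {0..1} (\<lambda>t. a j (\<Psi> (scale_on J (t * s) z))) = integral {0..s} (\<lambda>t. a j (\<Psi> (scale_on J t z)))" for j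
    proof -
      let ?g = "\<lambda>t. a j (\<Psi> (scale_on J t z))"
      have g: "continuous_on {0..1} ?g" by (rule rayc[OF smooth z])
      have "((\<lambda>t. integral {0..t * s} ?g) has_vector_derivative s * ?g (t * s)) (at t within {0..1})"
        if "t \<in> {0..1}" for t
      proof -
        have ts: "t * s \<in> {0..1}" using that s by (auto intro: mult_le_one)
        have sub: "(\<lambda>t. t * s) ` {0..1} \<subseteq> {0..1}" using s by (auto intro: mult_le_one)
        have 1: "((\<lambda>t. t * s) has_vector_derivative s) (at t within {0..1})"
          by (auto intro!: derivative_eq_intros)
        have 2: "((\<lambda>t. integral {0..t} ?g) has_vector_derivative ?g (t * s)) (at (t * s) within (\<lambda>t. t * s) ` {0..1})"
          by (rule has_vector_derivative_within_subset[OF FTC[OF g ts] sub])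
        show ?thesis using vector_diff_chain_within[OF 1 2] by (simp add: o_def)
      qed
      from fundamental_theorem_of_calculus[OF _ this]
      have "((\<lambda>t. s * ?g (t * s)) has_integral integral {0..s} ?g) {0..1}" by simp
      then have "integral {0..1} (\<lambda>t. s * ?g (t * s)) = integral {0..s} ?g" by (rule integral_unique)
      then show ?thesis by simp
    qed
    note key = this
    have 1: "(scale_on J s z) $ j * integral {0..1} (\<lambda>t. a j (\<Psi> (scale_on J (t * s) z)))
        = z $ j * integral {0..s} (\<lambda>t. a j (\<Psi> (scale_on J t z)))" if "j \<in> J" for j
      using that unfolding key[symmetric] by simp
    have 2: "(scale_on J s z) $ k = z $ k" by (simp add: J_def)
    have "Z (scale_on J s z) = (scale_on J s z) $ k +
        (\<Sum>j\<in>J. (scale_on J s z) $ j * integral {0..1} (\<lambda>t. a j (\<Psi> (scale_on J (t * s) z))))"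
      using Zeq[of "scale_on J s z"] sc[OF z s] unfolding scale_on_scale_on \<Psi>_def by auto
    then show ?thesis unfolding 2 by (simp only: 1 cong: sum.cong)
  qed
  have ray_der: "((\<lambda>s. Z (scale_on J s z)) has_vector_derivative
      (\<Sum>j\<in>J. z $ j * a j (\<Psi> (scale_on J s z)))) (at s within {0..1})"
    if z: "z \<in> ball 0 r" and s: "s \<in> {0..1}" for s z
  proof -
    have "((\<lambda>s. z $ k + (\<Sum>j\<in>J. z $ j * integral {0..s} (\<lambda>t. a j (\<Psi> (scale_on J t z))))) has_vector_derivative
      (0 + (\<Sum>j\<in>J. z $ j * a j (\<Psi> (scale_on J s z))))) (at s within {0..1})"
      by (intro has_vector_derivative_add has_vector_derivative_const has_vector_derivative_sum
          has_vector_derivative_mult_right FTC rayc smooth z s)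
    then have H: "((\<lambda>s. z $ k + (\<Sum>j\<in>J. z $ j * integral {0..s} (\<lambda>t. a j (\<Psi> (scale_on J t z))))) has_vector_derivative
      (\<Sum>j\<in>J. z $ j * a j (\<Psi> (scale_on J s z)))) (at s within {0..1})" by simp
    show ?thesis
      by (rule has_vector_derivative_transform[OF s _ H]) (rule ray_eq[OF z])
  qed
  have \<Psi>0: "Z (scale_on J 0 z) = z $ k" if "z \<in> ball 0 r" for z
    using ray_eq[OF that, of 0] by simp
  have \<Psi>nth: "\<Psi> (scale_on J t z) $ j = t * z $ j" if "j \<in> J" for j t z
    using that by (simp add: \<Psi>_def J_def)
  have \<Psi>k: "\<Psi> z $ k = Z z" for z by (simp add: \<Psi>_def)
  \<comment> \<open>Along the ray the point on the graph moves with velocity \<open>z $ j\<close> in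
    each direction \<open>j\<close> of \<open>J\<close>, and coordinate \<open>k\<close> follows
    with slope \<open>a j\<close>; so a function changes by the fields
    \<open>\<partial>\<^sub>j + a\<^sub>j \<partial>\<^sub>k\<close>.\<close>
  have ray_comp: "((\<lambda>s. f (\<Psi> (scale_on J s z))) has_vector_derivative
      (\<Sum>j\<in>J. z $ j * (pd j f (\<Psi> (scale_on J s z)) + a j (\<Psi> (scale_on J s z)) * pd k f (\<Psi> (scale_on J s z)))))
      (at s within {0..1})"
    if z: "z \<in> ball 0 r" and s: "s \<in> {0..1}" and f: "smooth_on (ball 0 \<rho>) f" for s z f
  proof -
    let ?w = "\<Psi> (scale_on J s z)"
    define A where "A = (\<Sum>j\<in>J. z $ j * a j ?w)"
    have "((\<lambda>s. \<Psi> (scale_on J s z)) has_derivative (\<lambda>h. h *\<^sub>R (\<chi> j. if j = k then A else z $ j))) (at s within {0..1})"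
    proof (subst has_derivative_componentwise_within, intro ballI)
      fix b :: "real^'n" assume "b \<in> Basis"
      then obtain i where b: "b = axis i 1" by (auto simp: Basis_vec_def)
      show "((\<lambda>s. \<Psi> (scale_on J s z) \<bullet> b) has_derivative
          (\<lambda>h. h *\<^sub>R (\<chi> j. if j = k then A else z $ j) \<bullet> b)) (at s within {0..1})"
      proof (cases "i = k")
        case True
        then show ?thesis
          using ray_der[OF z s] by (simp add: b inner_axis \<Psi>k A_def has_vector_derivative_def)
      next
        case False
        then have "i \<in> J" by (simp add: J_def)
        then show ?thesis
          using False by (auto simp: b inner_axis \<Psi>nth intro!: derivative_eq_intros)
      qed
    qed
    from has_derivative_compose[OF this differentiable_has_derivative_pd[OF smooth_on_differentiable[OF f \<Psi>b[OF sc[OF z s]]]]]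
    have "((\<lambda>s. f (\<Psi> (scale_on J s z))) has_vector_derivative
        (\<Sum>i\<in>UNIV. (if i = k then A else z $ i) * pd i f ?w)) (at s within {0..1})"
      unfolding has_vector_derivative_def
      by (rule has_derivative_eq_rhs) (auto simp: sum_distrib_left mult.assoc)
    moreover have "(\<Sum>i\<in>UNIV. (if i = k then A else z $ i) * pd i f ?w) = A * pd k f ?w + (\<Sum>i\<in>J. z $ i * pd i f ?w)"
      unfolding J_def by (subst sum.remove[of _ k]) (auto intro!: sum.cong)
    moreover have "\<dots> = (\<Sum>j\<in>J. z $ j * (pd j f ?w + a j ?w * pd k f ?w))"
      by (simp add: A_def sum_distrib_right sum.distrib distrib_left mult.assoc)
    ultimately show ?thesis by simp
  qed
  \<comment> \<open>\<open>\<Lambda> z \<delta> t\<close> is the expected change of \<open>Z\<close>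
    at the point scaled by \<open>t\<close> when \<open>z\<close> moves by \<open>\<delta>\<close>.
    \<open>E\<close> solves the variational equation with \<open>E z 0 = 1\<close> and propagates
    the change \<open>\<delta> $ k\<close> of the initial value; the other directions contribute the
    prescribed slopes times \<open>t\<close>, since the scaled point moves by
    \<open>t * \<delta> $ i\<close>.\<close>
  define \<alpha> where "\<alpha> = (\<lambda>z t. \<Sum>j\<in>J. z $ j * pd k (a j) (\<Psi> (scale_on J t z)))"
  define E where "E = (\<lambda>z t. exp (\<Sum>j\<in>J. z $ j * integral {0..t} (\<lambda>t. pd k (a j) (\<Psi> (scale_on J t z)))))"
  define \<Lambda> where "\<Lambda> = (\<lambda>z \<delta> t. E z t * \<delta> $ k + (\<Sum>i\<in>J. \<delta> $ i * (t * a i (\<Psi> (scale_on J t z)))))"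
  have E_der: "(E z has_vector_derivative \<alpha> z t * E z t) (at t within {0..1})"
    if z: "z \<in> ball 0 r" and t: "t \<in> {0..1}" for z t
  proof -
    have "((\<lambda>t. \<Sum>j\<in>J. z $ j * integral {0..t} (\<lambda>t. pd k (a j) (\<Psi> (scale_on J t z)))) has_vector_derivative \<alpha> z t)
        (at t within {0..1})"
      unfolding \<alpha>_def
      by (intro has_vector_derivative_sum has_vector_derivative_mult_right FTC rayc smooth_on_pd smooth z t)
    then have "((\<lambda>t. \<Sum>j\<in>J. z $ j * integral {0..t} (\<lambda>t. pd k (a j) (\<Psi> (scale_on J t z)))) has_real_derivative \<alpha> z t)
        (at t within {0..1})"
      by (simp add: has_real_derivative_iff_has_vector_derivative)
    from DERIV_chain2[OF DERIV_exp this] show ?thesis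
      unfolding E_def has_real_derivative_iff_has_vector_derivative by (simp add: mult.commute)
  qed
  have \<Lambda>_der: "(\<Lambda> z \<delta> has_vector_derivative (\<alpha> z t * \<Lambda> z \<delta> t + (\<Sum>i\<in>J. \<delta> $ i *
      (a i (\<Psi> (scale_on J t z)) + t * (\<Sum>j\<in>J. z $ j * pd i (a j) (\<Psi> (scale_on J t z)))))))
      (at t within {0..1})"
    if z: "z \<in> ball 0 r" and t: "t \<in> {0..1}" for z \<delta> t
  proof -
    let ?w = "\<Psi> (scale_on J t z)"
    \<comment> \<open>Integrability enters here. It exchanges the roles of \<open>i\<close> and
      \<open>j\<close>, and this makes \<open>\<Lambda>\<close> satisfy the linearised ray
      equation.\<close>
    have "(\<Sum>j\<in>J. z $ j * (pd j (a i) ?w + a j ?w * pd k (a i) ?w))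
       = (\<Sum>j\<in>J. z $ j * pd i (a j) ?w) + a i ?w * \<alpha> z t" if i: "i \<in> J" for i
    proof -
      have "(\<Sum>j\<in>J. z $ j * (pd j (a i) ?w + a j ?w * pd k (a i) ?w))
          = (\<Sum>j\<in>J. z $ j * (pd i (a j) ?w + a i ?w * pd k (a j) ?w))"
        using i integrable[OF _ _ \<Psi>b[OF sc[OF z t]]] by (intro sum.cong) (auto simp: J_def)
      then show ?thesis
        by (simp add: \<alpha>_def distrib_left sum.distrib sum_distrib_left mult_ac)
    qed
    then have "((\<lambda>t. a i (\<Psi> (scale_on J t z))) has_vector_derivative
        ((\<Sum>j\<in>J. z $ j * pd i (a j) ?w) + a i ?w * \<alpha> z t)) (at t within {0..1})" if "i \<in> J" for i
      using ray_comp[OF z t smooth[of i]] that by simp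
    then have "(\<Lambda> z \<delta> has_vector_derivative (\<alpha> z t * E z t * \<delta> $ k + (\<Sum>i\<in>J. \<delta> $ i *
        (t * ((\<Sum>j\<in>J. z $ j * pd i (a j) ?w) + a i ?w * \<alpha> z t) + 1 * a i ?w)))) (at t within {0..1})"
      unfolding \<Lambda>_def
      by (intro has_vector_derivative_add has_vector_derivative_mult_left E_der z t has_vector_derivative_sum
         has_vector_derivative_mult_right has_vector_derivative_mult has_vector_derivative_id) auto
    moreover have "\<alpha> z t * E z t * \<delta> $ k + (\<Sum>i\<in>J. \<delta> $ i *
        (t * ((\<Sum>j\<in>J. z $ j * pd i (a j) ?w) + a i ?w * \<alpha> z t) + 1 * a i ?w))
      = \<alpha> z t * \<Lambda> z \<delta> t + (\<Sum>i\<in>J. \<delta> $ i * (a i ?w + t * (\<Sum>j\<in>J. z $ j * pd i (a j) ?w)))"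
      by (simp add: \<Lambda>_def distrib_left sum.distrib sum_distrib_left mult_ac)
    ultimately show ?thesis by simp
  qed
  \<comment> \<open>Two Gronwall estimates along the ray: the first shows that the difference
    \<open>D\<close> of two solutions is of order \<open>norm \<delta>\<close>, the second that
    \<open>D - \<Lambda>\<close> is of smaller order.\<close>
  have Z_der: "(Z has_derivative (\<lambda>\<delta>. \<Lambda> z \<delta> 1)) (at z)" if z: "z \<in> ball 0 r" for z
  proof -
    \<comment> \<open>The first Gronwall estimate bounds \<open>D\<close> by
      \<open>(C - 1) * norm \<delta>\<close>; the added 1 accounts for the displacement of the other
      coordinates, so \<open>C\<close> bounds the increment of \<open>\<Psi>\<close>.\<close>
    define C where "C = 2 * (1 + (1/2 + ?N * M)) + 1"
    have C0: "C > 0" using M0 by (simp add: C_def add_pos_nonneg)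
    have nz: "norm z \<le> r" using z by simp
    have zL: "?N * norm z * L \<le> 1/2"
    proof -
      have "?N * norm z * L \<le> ?N * r * L" using nz L0 by (intro mult_right_mono mult_left_mono) auto
      then show ?thesis using rL by linarith
    qed
    have \<alpha>b: "\<bar>\<alpha> z t\<bar> \<le> 1/2" if "t \<in> {0..1}" for t
    proof -
      have "\<bar>\<alpha> z t\<bar> \<le> ?N * norm z * L"
        unfolding \<alpha>_def by (rule abs_sum_components_le[OF P[OF \<Psi>K[OF sc[OF z that]]] L0])
      then show ?thesis using zL by linarith
    qed
    define D where "D = (\<lambda>\<delta> t. Z (scale_on J t (z + \<delta>)) - Z (scale_on J t z))"
    define d\<Psi> where "d\<Psi> = (\<lambda>\<delta> t. \<Psi> (scale_on J t (z + \<delta>)) - \<Psi> (scale_on J t z))"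
    define D' where "D' = (\<lambda>\<delta> t. (\<Sum>j\<in>J. z $ j * (a j (\<Psi> (scale_on J t (z + \<delta>))) - a j (\<Psi> (scale_on J t z))))
        + (\<Sum>j\<in>J. \<delta> $ j * a j (\<Psi> (scale_on J t (z + \<delta>)))))"
    have D_der: "(D \<delta> has_vector_derivative D' \<delta> t) (at t within {0..1})"
      if \<delta>: "z + \<delta> \<in> ball 0 r" and t: "t \<in> {0..1}" for \<delta> t
    proof -
      have "(D \<delta> has_vector_derivative (\<Sum>j\<in>J. (z + \<delta>) $ j * a j (\<Psi> (scale_on J t (z + \<delta>))))
          - (\<Sum>j\<in>J. z $ j * a j (\<Psi> (scale_on J t z)))) (at t within {0..1})"
        unfolding D_def by (intro has_vector_derivative_diff ray_der z t \<delta>)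
      moreover have "(\<Sum>j\<in>J. (z + \<delta>) $ j * a j (\<Psi> (scale_on J t (z + \<delta>))))
          - (\<Sum>j\<in>J. z $ j * a j (\<Psi> (scale_on J t z))) = D' \<delta> t"
        by (simp add: D'_def distrib_right right_diff_distrib sum.distrib sum_subtractf)
      ultimately show ?thesis by simp
    qed
    have d\<Psi>_le: "norm (d\<Psi> \<delta> t) \<le> \<bar>D \<delta> t\<bar> + norm \<delta>" if t: "t \<in> {0..1}" for \<delta> t
    proof -
      have "norm (scale_on J t (z + \<delta>) - scale_on J t z) \<le> norm \<delta>"
        using t by (intro norm_le_componentwise_cart)
          (auto simp: abs_mult algebra_simps simp flip: right_diff_distrib intro: mult_left_le_one_le)
      then show ?thesis
        using norm_upd_nth_diff[of k "Z (scale_on J t (z + \<delta>))" "scale_on J t (z + \<delta>)" "Z (scale_on J t z)" "scale_on J t z"]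
        unfolding d\<Psi>_def \<Psi>_def D_def by linarith
    qed
    have adiff: "\<bar>a j (\<Psi> (scale_on J t (z + \<delta>))) - a j (\<Psi> (scale_on J t z))\<bar> \<le> L * norm (d\<Psi> \<delta> t)"
      if \<delta>: "z + \<delta> \<in> ball 0 r" and t: "t \<in> {0..1}" for \<delta> t j
      unfolding d\<Psi>_def by (rule L[OF \<Psi>K[OF sc[OF z t]] \<Psi>K[OF sc[OF \<delta> t]]])
    have D0: "D \<delta> 0 = \<delta> $ k" if \<delta>: "z + \<delta> \<in> ball 0 r" for \<delta>
      using \<Psi>0[OF z] \<Psi>0[OF \<delta>] by (simp add: D_def)
    have D_le: "\<bar>D \<delta> t\<bar> \<le> (C - 1) * norm \<delta>" if \<delta>: "z + \<delta> \<in> ball 0 r" and t: "t \<in> {0..1}" for \<delta> t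
    proof -
      have "\<bar>D' \<delta> t\<bar> \<le> \<bar>D \<delta> t\<bar> / 2 + (1/2 + ?N * M) * norm \<delta>" if t: "t \<in> {0..1}" for t
      proof -
        have "\<bar>\<Sum>j\<in>J. z $ j * (a j (\<Psi> (scale_on J t (z + \<delta>))) - a j (\<Psi> (scale_on J t z)))\<bar>
            \<le> ?N * norm z * (L * norm (d\<Psi> \<delta> t))"
          by (rule abs_sum_components_le[OF adiff[OF \<delta> t]]) (use L0 in simp)
        also have "\<dots> = ?N * norm z * L * norm (d\<Psi> \<delta> t)" by simp
        also have "\<dots> \<le> 1/2 * norm (d\<Psi> \<delta> t)" by (rule mult_right_mono[OF zL]) simp
        also have "\<dots> \<le> 1/2 * (\<bar>D \<delta> t\<bar> + norm \<delta>)" using d\<Psi>_le[OF t] by simp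
        finally have 1: "\<bar>\<Sum>j\<in>J. z $ j * (a j (\<Psi> (scale_on J t (z + \<delta>))) - a j (\<Psi> (scale_on J t z)))\<bar>
            \<le> 1/2 * (\<bar>D \<delta> t\<bar> + norm \<delta>)" .
        have 2: "\<bar>\<Sum>j\<in>J. \<delta> $ j * a j (\<Psi> (scale_on J t (z + \<delta>)))\<bar> \<le> ?N * norm \<delta> * M"
          by (rule abs_sum_components_le[OF M[OF \<Psi>K[OF sc[OF \<delta> t]]] M0])
        have 3: "1/2 * (\<bar>D \<delta> t\<bar> + norm \<delta>) + ?N * norm \<delta> * M = \<bar>D \<delta> t\<bar> / 2 + (1/2 + ?N * M) * norm \<delta>"
          by (simp add: algebra_simps)
        show ?thesis unfolding D'_def using 1 2 3 by linarith
      qed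
      from small_gronwall[OF D_der[OF \<delta>] this t]
      have "\<bar>D \<delta> t\<bar> \<le> 2 * (\<bar>\<delta> $ k\<bar> + (1/2 + ?N * M) * norm \<delta>)" by (simp add: D0[OF \<delta>])
      also have "\<dots> \<le> 2 * (norm \<delta> + (1/2 + ?N * M) * norm \<delta>)"
        using component_le_norm_cart[of \<delta> k] by simp
      also have "\<dots> = (C - 1) * norm \<delta>" by (simp add: C_def algebra_simps)
      finally show ?thesis .
    qed
    have d\<Psi>_le2: "norm (d\<Psi> \<delta> t) \<le> C * norm \<delta>" if \<delta>: "z + \<delta> \<in> ball 0 r" and t: "t \<in> {0..1}" for \<delta> t
      using d\<Psi>_le[OF t, of \<delta>] D_le[OF \<delta> t] by (simp add: left_diff_distrib)
    show ?thesis
      unfolding has_derivative_at_alt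
    proof (intro conjI allI impI)
      have 1: "bounded_linear (\<lambda>\<delta>. E z 1 * \<delta> $ k)"
        by (rule bounded_linear_const_mult[OF bounded_linear_vec_nth])
      have 2: "bounded_linear (\<lambda>\<delta>. \<delta> $ i * c)" for i :: 'n and c :: real
        by (rule bounded_linear_mult_const[OF bounded_linear_vec_nth])
      show "bounded_linear (\<lambda>\<delta>. \<Lambda> z \<delta> 1)"
        unfolding \<Lambda>_def by (rule bounded_linear_add[OF 1 bounded_linear_sum[OF 2]])
      fix e :: real assume e: "e > 0"
      \<comment> \<open>Makes the linearisation remainder at most
        \<open>e / 4 * norm \<delta>\<close>. Together with an equal share for the second-order
        term, doubled by \<open>small_gronwall\<close>, this exhausts \<open>e\<close>.\<close>
      define e1 where "e1 = e / (4 * ?N * r * C)"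
      have e1: "e1 > 0" using e r0 C0 by (simp add: e1_def)
      define close where "close = (\<lambda>j d. \<forall>w\<in>?K. \<forall>w'\<in>?K. norm (w' - w) < d \<longrightarrow>
          \<bar>a j w' - a j w - (\<Sum>i\<in>UNIV. (w' - w) $ i * pd i (a j) w)\<bar> \<le> e1 * norm (w' - w))"
      have "\<exists>d>0. close j d" for j
        by (rule smooth_on_uniformly_differentiable[OF smooth[of j], of "\<rho>/2" e1])
          (use e1 \<open>\<rho> > 0\<close> in \<open>auto simp: close_def\<close>)
      then obtain dj where dj: "\<And>j. dj j > 0" "\<And>j. close j (dj j)" by metis
      define d where "d = Min (range dj)"
      have d: "d > 0" "\<And>j. d \<le> dj j" using dj(1) by (auto simp: d_def)
      \<comment> \<open>The bounds keep \<open>z + \<delta>\<close> in the ball, the increment of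
        \<open>\<Psi>\<close> below the modulus \<open>d\<close>, and the second-order term below
        its quarter; \<open>L + 1\<close> avoids a vanishing denominator.\<close>
      define d2 where "d2 = min (r - norm z) (min (d / C) (e / (4 * ?N * (L + 1) * C)))"
      have d2: "d2 > 0" using z d C0 e L0 by (simp add: d2_def)
      show "\<exists>d>0. \<forall>y. norm (y - z) < d \<longrightarrow> norm (Z y - Z z - \<Lambda> z (y - z) 1) \<le> e * norm (y - z)"
      proof (intro exI[of _ d2] conjI allI impI d2)
        fix y assume y: "norm (y - z) < d2"
        define \<delta> where "\<delta> = y - z"
        have "norm y \<le> norm z + norm (y - z)" by (rule norm_triangle_sub)
        also have "\<dots> < r" using y by (simp add: d2_def)
        finally have \<delta>: "z + \<delta> \<in> ball 0 r" by (simp add: \<delta>_def)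
        have n\<delta>: "C * norm \<delta> < d" "4 * ?N * (L + 1) * C * norm \<delta> \<le> e"
        proof -
          have "norm \<delta> < d / C" "norm \<delta> \<le> e / (4 * ?N * (L + 1) * C)" using y by (auto simp: d2_def \<delta>_def)
          moreover have "4 * ?N * (L + 1) * C > 0" using L0 C0 by simp
          ultimately show "C * norm \<delta> < d" "4 * ?N * (L + 1) * C * norm \<delta> \<le> e"
            using C0 by (auto simp: pos_less_divide_eq pos_le_divide_eq mult.commute)
        qed
        define c where "c = ?N * norm z * (e1 * (C * norm \<delta>)) + ?N * norm \<delta> * (L * (C * norm \<delta>))"
        let ?e = "\<lambda>t. D \<delta> t - \<Lambda> z \<delta> t"
        let ?w = "\<lambda>t. \<Psi> (scale_on J t z)" and ?w' = "\<lambda>t. \<Psi> (scale_on J t (z + \<delta>))"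
        define e' where "e' = (\<lambda>t. D' \<delta> t - (\<alpha> z t * \<Lambda> z \<delta> t + (\<Sum>i\<in>J. \<delta> $ i *
          (a i (?w t) + t * (\<Sum>j\<in>J. z $ j * pd i (a j) (?w t))))))"
        have e_der: "(?e has_vector_derivative e' t) (at t within {0..1})" if t: "t \<in> {0..1}" for t
          unfolding e'_def by (intro has_vector_derivative_diff D_der \<Lambda>_der z \<delta> t)
        \<comment> \<open>The error obeys the linearised equation up to a linearisation remainder of
          the \<open>a j\<close> and a product of two small increments.\<close>
        have e'_eq: "e' t = \<alpha> z t * ?e t
            + (\<Sum>j\<in>J. z $ j * (a j (?w' t) - a j (?w t) - (\<Sum>i\<in>UNIV. d\<Psi> \<delta> t $ i * pd i (a j) (?w t))))
            + (\<Sum>j\<in>J. \<delta> $ j * (a j (?w' t) - a j (?w t)))" for t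
        proof -
          have 1: "(\<Sum>i\<in>UNIV. d\<Psi> \<delta> t $ i * pd i (a j) (?w t))
              = D \<delta> t * pd k (a j) (?w t) + (\<Sum>i\<in>J. t * \<delta> $ i * pd i (a j) (?w t))" for j
          proof -
            have "d\<Psi> \<delta> t $ k = D \<delta> t" by (simp add: d\<Psi>_def D_def \<Psi>k)
            moreover have "d\<Psi> \<delta> t $ i = t * \<delta> $ i" if "i \<in> J" for i
              using that by (simp add: d\<Psi>_def \<Psi>nth distrib_left)
            moreover have "sum F UNIV = F k + sum F J" for F :: "'n \<Rightarrow> real"
              unfolding J_def by (rule sum.remove) auto
            ultimately show ?thesis by simp
          qed
          have 2: "(\<Sum>j\<in>J. z $ j * (\<Sum>i\<in>J. t * \<delta> $ i * pd i (a j) (?w t)))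
              = (\<Sum>i\<in>J. \<delta> $ i * (t * (\<Sum>j\<in>J. z $ j * pd i (a j) (?w t))))"
            unfolding sum_distrib_left by (subst sum.swap) (simp add: mult_ac)
          have 3: "(\<Sum>j\<in>J. z $ j * (D \<delta> t * pd k (a j) (?w t))) = \<alpha> z t * D \<delta> t"
            by (simp add: \<alpha>_def sum_distrib_left mult_ac)
          show ?thesis
            unfolding 1 e'_def D'_def
            by (simp add: right_diff_distrib distrib_left sum_subtractf sum.distrib 2 3)
        qed
        have e'_le: "\<bar>e' t\<bar> \<le> \<bar>?e t\<bar> / 2 + c" if t: "t \<in> {0..1}" for t
        proof -
          have dn: "norm (d\<Psi> \<delta> t) \<le> C * norm \<delta>" by (rule d\<Psi>_le2[OF \<delta> t])
          have "\<bar>a j (?w' t) - a j (?w t) - (\<Sum>i\<in>UNIV. d\<Psi> \<delta> t $ i * pd i (a j) (?w t))\<bar> \<le> e1 * (C * norm \<delta>)" for j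
          proof -
            have "norm (?w' t - ?w t) < dj j"
              using dn n\<delta>(1) d(2)[of j] unfolding d\<Psi>_def by linarith
            then have "\<bar>a j (?w' t) - a j (?w t) - (\<Sum>i\<in>UNIV. d\<Psi> \<delta> t $ i * pd i (a j) (?w t))\<bar> \<le> e1 * norm (d\<Psi> \<delta> t)"
              using dj(2)[of j] \<Psi>K[OF sc[OF z t]] \<Psi>K[OF sc[OF \<delta> t]] unfolding close_def d\<Psi>_def by blast
            also have "\<dots> \<le> e1 * (C * norm \<delta>)" using dn e1 by (intro mult_left_mono) auto
            finally show ?thesis .
          qed
          then have 1: "\<bar>\<Sum>j\<in>J. z $ j * (a j (?w' t) - a j (?w t) - (\<Sum>i\<in>UNIV. d\<Psi> \<delta> t $ i * pd i (a j) (?w t)))\<bar>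
              \<le> ?N * norm z * (e1 * (C * norm \<delta>))"
            by (intro abs_sum_components_le) (use e1 C0 in auto)
          have "\<bar>a j (?w' t) - a j (?w t)\<bar> \<le> L * (C * norm \<delta>)" for j
            using adiff[OF \<delta> t, of j] mult_left_mono[OF dn L0] by linarith
          then have 2: "\<bar>\<Sum>j\<in>J. \<delta> $ j * (a j (?w' t) - a j (?w t))\<bar> \<le> ?N * norm \<delta> * (L * (C * norm \<delta>))"
            by (intro abs_sum_components_le) (use L0 C0 in auto)
          have "\<bar>\<alpha> z t * ?e t\<bar> \<le> 1/2 * \<bar>?e t\<bar>"
            unfolding abs_mult by (rule mult_right_mono[OF \<alpha>b[OF t]]) simp
          then show ?thesis using 1 2 unfolding e'_eq c_def by linarith
        qed
        have "?e 0 = 0" using D0[OF \<delta>] by (simp add: \<Lambda>_def E_def)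
        then have "\<bar>?e 1\<bar> \<le> 2 * c" using small_gronwall[OF e_der e'_le, of 1] by simp
        also have "2 * c \<le> e * norm \<delta>"
        proof -
          have "?N * norm z * (e1 * (C * norm \<delta>)) \<le> ?N * r * (e1 * (C * norm \<delta>))"
            using nz e1 C0 by (intro mult_right_mono mult_left_mono) auto
          also have "\<dots> = e / 4 * norm \<delta>" using r0 C0 by (simp add: e1_def)
          finally have 1: "?N * norm z * (e1 * (C * norm \<delta>)) \<le> e / 4 * norm \<delta>" .
          have "?N * L * C * norm \<delta> \<le> ?N * (L + 1) * C * norm \<delta>"
            using C0 by (intro mult_right_mono mult_left_mono) auto
          then have "?N * L * C * norm \<delta> \<le> e / 4" using n\<delta>(2) by linarith
          then have "?N * L * C * norm \<delta> * norm \<delta> \<le> e / 4 * norm \<delta>" by (rule mult_right_mono) simp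
          moreover have "?N * norm \<delta> * (L * (C * norm \<delta>)) = ?N * L * C * norm \<delta> * norm \<delta>" by simp
          ultimately have 2: "?N * norm \<delta> * (L * (C * norm \<delta>)) \<le> e / 4 * norm \<delta>" by linarith
          have "e / 4 * norm \<delta> = (e * norm \<delta>) / 4" by simp
          then show ?thesis unfolding c_def distrib_left using 1 2 by linarith
        qed
        finally show "norm (Z y - Z z - \<Lambda> z (y - z) 1) \<le> e * norm (y - z)"
          by (simp add: D_def \<delta>_def)
      qed
    qed
  qed
  have Zd: "Z differentiable (at z)" if "z \<in> ball 0 r" for z
    using Z_der[OF that] by (auto simp: differentiable_def)
  \<comment> \<open>Direction \<open>k\<close> isolates \<open>E z 1\<close>. Being an exponential
    it is positive, which will make \<open>Z\<close> a label-preserving family of graphs with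
    nonzero Jacobian.\<close>
  have pdk: "pd k Z z = exp (\<Sum>j\<in>J. z $ j * ray_integral J 0 (\<lambda>z. pd k (a j) (\<Psi> z)) z)"
    if "z \<in> ball 0 r" for z
    by (rule differentiable_pd_eqI[OF Z_der[OF that]])
      (simp add: \<Lambda>_def E_def ray_integral_def axis_def J_def)
  have pdj: "pd j Z z = a j (\<Psi> z)" if "z \<in> ball 0 r" "j \<noteq> k" for j z
    by (rule differentiable_pd_eqI[OF Z_der[OF that(1)]])
      (use that in \<open>simp add: \<Lambda>_def axis_def J_def if_distrib[where f="\<lambda>x. x * _"] cong: if_cong\<close>)
  \<comment> \<open>Bootstrap: every partial derivative of \<open>Z\<close> is expressed through
    smooth functions of \<open>\<Psi>\<close> and ray integrals of these, and \<open>\<Psi>\<close>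
    is as smooth as \<open>Z\<close>.\<close>
  have CkZ: "Ck_on m (ball 0 r) Z" for m
  proof (induction m)
    case 0
    show ?case using continuous_on_subset[OF Zc sub] by simp
  next
    case (Suc m)
    have \<Psi>Ck: "Ck_on m (ball 0 r) (\<lambda>z. \<Psi> z $ j)" for j
      by (cases "j = k") (auto simp: \<Psi>_def Suc Ck_on_vec_nth)
    have c: "Ck_on m (ball 0 r) (\<lambda>z. f (\<Psi> z))" if "smooth_on (ball 0 \<rho>) f" for f :: "real^'n \<Rightarrow> real"
      by (rule Ck_on_compose[OF open_ball, where T="ball 0 \<rho>" and h=\<Psi> and f=f])
        (use that \<Psi>b \<Psi>Ck in \<open>auto simp: smooth_on_def\<close>)
    have "Ck_on m (ball 0 r) (pd i Z)" for i
    proof (cases "i = k")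
      case True
      have "Ck_on m (ball 0 r) (\<lambda>z. exp (\<Sum>j\<in>J. z $ j * ray_integral J 0 (\<lambda>z. pd k (a j) (\<Psi> z)) z))"
        by (intro Ck_on_exp Ck_on_sum Ck_on_mult Ck_on_vec_nth Ck_on_ray_integral c smooth_on_pd smooth open_ball finite)
      then show ?thesis
        unfolding True by (rule Ck_on_cong[OF open_ball, rotated]) (simp add: pdk)
    next
      case False
      show ?thesis
        by (rule Ck_on_cong[OF open_ball _ c[OF smooth[of i]]]) (simp add: pdj[OF _ False])
    qed
    then show ?case using Zd by simp
  qed
  show ?thesis
  proof (rule that[of r Z])
    show "Z 0 = 0" using Zeq[of 0] r0 by simp
    show "upd_nth k (Z z) z \<in> ball 0 \<rho>" if "z \<in> ball 0 r" for z
      using \<Psi>b[OF that] by (simp add: \<Psi>_def)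
    show "pd j Z z = a j (upd_nth k (Z z) z)" if "z \<in> ball 0 r" "j \<noteq> k" for j z
      using pdj[OF that] by (simp add: \<Psi>_def)
  qed (use r0 CkZ pdk in \<open>auto simp: smooth_on_def\<close>)
qed

section \<open>Translation to an arbitrary centre\<close>

lemma pd_translate:
  fixes f :: "real^'n::finite \<Rightarrow> real"
  assumes "f differentiable (at (c + z))"
  shows "(\<lambda>w. f (c + w)) differentiable (at z)" "pd i (\<lambda>w. f (c + w)) z = pd i f (c + z)"
proof -
  have d: "(\<lambda>w. (c + w) $ j) differentiable (at z)" for j by simp
  show "(\<lambda>w. f (c + w)) differentiable (at z)"
    using pd_compose(1)[of f "\<lambda>w. c + w", OF assms d] .
  have "pd i (\<lambda>w. (c + w) $ j) z = (if i = j then 1 else 0)" for j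
    by (simp add: pd_add)
  then show "pd i (\<lambda>w. f (c + w)) z = pd i f (c + z)"
    using pd_compose(2)[of f "\<lambda>w. c + w", OF assms d]
    by (simp add: if_distrib[where f="\<lambda>x. _ * x"] cong: if_cong)
qed

lemma smooth_on_translate:
  fixes f :: "real^'n::finite \<Rightarrow> real"
  assumes "open S" "smooth_on T f" "\<And>w. w \<in> S \<Longrightarrow> c + w \<in> T"
  shows "smooth_on S (\<lambda>w. f (c + w))"
  by (rule smooth_on_compose[where h="\<lambda>w. c + w", OF assms(1,2)])
    (use assms in \<open>auto intro!: smooth_on_add\<close>)

lemma closed_form_exact:
  fixes \<theta> :: "real^'n::finite \<Rightarrow> 'n \<Rightarrow> real"
  assumes \<theta>: "\<And>a. smooth_on (ball z0 r) (\<lambda>z. \<theta> z a)"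
    and closed: "\<And>a b z. z \<in> ball z0 r \<Longrightarrow> pd a (\<lambda>w. \<theta> w b) z = pd b (\<lambda>w. \<theta> w a) z"
  obtains f where "smooth_on (ball z0 r) f" "\<And>a z. z \<in> ball z0 r \<Longrightarrow> pd a f z = \<theta> z a"
proof -
  have b: "z0 + w \<in> ball z0 r" if "w \<in> ball 0 r" for w
    using that by (simp add: dist_norm)
  have b': "- z0 + z \<in> ball 0 r" if "z \<in> ball z0 r" for z
    using that by (simp add: dist_norm norm_minus_commute)
  obtain f where f: "smooth_on (ball 0 r) f"
    "\<And>i z. i \<in> UNIV \<Longrightarrow> z \<in> ball 0 r \<Longrightarrow> pd i f z = \<theta> (z0 + z) i"
  proof (rule relative_poincare[of UNIV r "\<lambda>i z. \<theta> (z0 + z) i"])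
    show "smooth_on (ball 0 r) (\<lambda>z. \<theta> (z0 + z) j)" for j
      by (rule smooth_on_translate[OF open_ball \<theta> b])
    show "pd i (\<lambda>z. \<theta> (z0 + z) j) z = pd j (\<lambda>z. \<theta> (z0 + z) i) z" if "z \<in> ball 0 r" for i j z
      using closed[OF b[OF that], of i j] smooth_on_differentiable[OF \<theta> b[OF that]]
      by (simp add: pd_translate(2)[where f="\<lambda>z. \<theta> z _"])
  qed (rule that; assumption)
  show ?thesis
  proof (rule that[of "\<lambda>z. f (- z0 + z)"])
    show "smooth_on (ball z0 r) (\<lambda>z. f (- z0 + z))"
      by (rule smooth_on_translate[OF open_ball f(1) b'])
    show "pd a (\<lambda>z. f (- z0 + z)) z = \<theta> z a" if "z \<in> ball z0 r" for a z
      using f(2)[OF _ b'[OF that]] pd_translate(2)[OF smooth_on_differentiable[OF f(1) b'[OF that]]] by simp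
  qed
qed

text \<open>The components of \<open>d\<theta> \<and> l\<close> as a cyclic sum. Where
  \<open>l\<close> does not vanish, their vanishing says that \<open>\<theta>\<close> is closed
  along the kernel of \<open>l\<close>; for \<open>\<theta> = l\<close> it is the Frobenius
  condition.\<close>

definition wedge_d :: "(real^'n::finite \<Rightarrow> 'n \<Rightarrow> real) \<Rightarrow> (real^'n \<Rightarrow> 'n \<Rightarrow> real) \<Rightarrow> real^'n \<Rightarrow> 'n \<Rightarrow> 'n \<Rightarrow> 'n \<Rightarrow> real" where
  "wedge_d l \<theta> z a b c = (pd a (\<lambda>w. \<theta> w b) z - pd b (\<lambda>w. \<theta> w a) z) * l z c
     + (pd b (\<lambda>w. \<theta> w c) z - pd c (\<lambda>w. \<theta> w b) z) * l z a
     + (pd c (\<lambda>w. \<theta> w a) z - pd a (\<lambda>w. \<theta> w c) z) * l z b"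

text \<open>The leaves of \<open>l = 0\<close> are straightened, and \<open>\<theta>\<close> is then
  integrated in each slice. The neighbourhood is fixed before \<open>\<theta>\<close> because the
  statement is applied successively to \<open>p\<close>, to a multiple of \<open>q\<close> and to a
  rotated \<open>n\<close>, the later forms being built from the earlier primitives on the same
  set.\<close>

lemma leafwise_poincare:
  fixes l :: "real^'n::finite \<Rightarrow> 'n \<Rightarrow> real"
  assumes "open U" "z0 \<in> U" and l: "\<And>a. smooth_on U (\<lambda>z. l z a)" and "l z0 k \<noteq> 0"
    and frob: "\<And>z a b c. z \<in> U \<Longrightarrow> wedge_d l l z a b c = 0"
  obtains V where "open V" "z0 \<in> V" "V \<subseteq> U"
    "\<And>\<theta>. (\<And>a. smooth_on V (\<lambda>z. \<theta> z a)) \<Longrightarrow> (\<And>z a b c. z \<in> V \<Longrightarrow> wedge_d l \<theta> z a b c = 0) \<Longrightarrow>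
      \<exists>f h. smooth_on V f \<and> smooth_on V h \<and> (\<forall>z\<in>V. \<forall>a. pd a f z = \<theta> z a + h z * l z a)"
proof -
  define U1 where "U1 = U \<inter> (\<lambda>z. l z k) -` (- {0})"
  have "open U1" unfolding U1_def
    by (rule continuous_open_preimage[OF smooth_on_continuous[OF l] \<open>open U\<close>]) auto
  moreover have "z0 \<in> U1" using assms by (simp add: U1_def)
  ultimately obtain \<rho> where \<rho>: "\<rho> > 0" "ball z0 \<rho> \<subseteq> U1" using openE by blast
  have lk: "l z k \<noteq> 0" "z \<in> U" if "z \<in> ball z0 \<rho>" for z using \<rho>(2) that by (auto simp: U1_def)
  have ls: "smooth_on (ball z0 \<rho>) (\<lambda>z. l z a)" for a
    by (rule smooth_on_subset[OF l]) (use lk in auto)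
  \<comment> \<open>The slopes of the leaves as graphs over the coordinates other than
    \<open>k\<close>: the vectors \<open>\<partial>\<^sub>j + b\<^sub>j \<partial>\<^sub>k\<close>
    are annihilated by \<open>l\<close>.\<close>
  define b where "b = (\<lambda>j z. - (l z j / l z k))"
  have bs: "smooth_on (ball z0 \<rho>) (b j)" for j
    unfolding b_def using lk by (intro smooth_on_minus smooth_on_divide ls) auto
  have bd: "b j differentiable (at z)" if "z \<in> ball z0 \<rho>" for j z
    by (rule smooth_on_differentiable[OF bs that])
  have ld: "(\<lambda>z. l z a) differentiable (at z)" if "z \<in> ball z0 \<rho>" for a z
    by (rule smooth_on_differentiable[OF ls that])
  have lb: "l z j = - (b j z * l z k)" if "z \<in> ball z0 \<rho>" for j z
    using lk[OF that] by (simp add: b_def)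
  have pdl: "pd m (\<lambda>z. l z j) z = - (b j z * pd m (\<lambda>z. l z k) z + pd m (b j) z * l z k)"
    if z: "z \<in> ball z0 \<rho>" for m j z
  proof -
    have "pd m (\<lambda>z. l z j) z = pd m (\<lambda>z. - (b j z * l z k)) z"
      by (rule pd_cong[OF open_ball z lb])
    then show ?thesis
      using bd[OF z] ld[OF z] by (simp add: pd_minus pd_mult differentiable_mult)
  qed
  \<comment> \<open>The component \<open>i j k\<close> of \<open>dl \<and> l = 0\<close>, after
    division by the square of \<open>l z k\<close>, is the integrability condition for the
    slopes.\<close>
  have X: "pd i (b j) z + b i z * pd k (b j) z = pd j (b i) z + b j z * pd k (b i) z"
    if z: "z \<in> ball z0 \<rho>" for i j z
  proof -
    have "l z k * (l z k * (pd i (b j) z + b i z * pd k (b j) z - (pd j (b i) z + b j z * pd k (b i) z))) = 0"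
      using frob[OF lk(2)[OF z], of i j k] pdl[OF z, of i j] pdl[OF z, of j i] pdl[OF z, of k i] pdl[OF z, of k j]
        lb[OF z, of i] lb[OF z, of j]
      unfolding wedge_d_def by algebra
    then show ?thesis using lk(1)[OF z] by simp
  qed
  have tr: "z0 + w \<in> ball z0 \<rho>" if "w \<in> ball 0 \<rho>" for w
    using that by (simp add: dist_norm)
  obtain r Z where r: "0 < r" and Zs: "smooth_on (ball 0 r) Z" and "Z 0 = 0"
    and Z\<rho>: "\<And>z. z \<in> ball 0 r \<Longrightarrow> upd_nth k (Z z) z \<in> ball 0 \<rho>"
    and Zj: "\<And>z j. z \<in> ball 0 r \<Longrightarrow> j \<noteq> k \<Longrightarrow> pd j Z z = b j (z0 + upd_nth k (Z z) z)"
    and Zk: "\<And>z. z \<in> ball 0 r \<Longrightarrow> pd k Z z > 0"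
  proof (rule integrable_system_solution[of \<rho> "\<lambda>j w. b j (z0 + w)" k])
    show "smooth_on (ball 0 \<rho>) (\<lambda>w. b j (z0 + w))" for j
      by (rule smooth_on_translate[OF open_ball bs tr])
    show "pd i (\<lambda>w. b j (z0 + w)) w + b i (z0 + w) * pd k (\<lambda>w. b j (z0 + w)) w =
        pd j (\<lambda>w. b i (z0 + w)) w + b j (z0 + w) * pd k (\<lambda>w. b i (z0 + w)) w"
      if "w \<in> ball 0 \<rho>" for i j w
      using X[OF tr[OF that], of i j] bd[OF tr[OF that]] by (simp add: pd_translate(2))
  qed (use \<rho> in auto)
  \<comment> \<open>Coordinate \<open>k\<close> of the argument labels the leaf, the remaining ones
    are coordinates on it.\<close>
  define \<Psi> where "\<Psi> = (\<lambda>\<zeta>. z0 + upd_nth k (Z \<zeta>) \<zeta>)"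
  have \<Psi>\<rho>: "\<Psi> \<zeta> \<in> ball z0 \<rho>" if "\<zeta> \<in> ball 0 r" for \<zeta>
    unfolding \<Psi>_def by (rule tr[OF Z\<rho>[OF that]])
  have \<Psi>n: "(\<lambda>\<zeta>. \<Psi> \<zeta> $ m) = (\<lambda>\<zeta>. z0 $ m + (if m = k then Z \<zeta> else \<zeta> $ m))" for m
    by (auto simp: \<Psi>_def)
  have \<Psi>s: "smooth_on (ball 0 r) (\<lambda>\<zeta>. \<Psi> \<zeta> $ m)" for m
    unfolding \<Psi>n by (cases "m = k") (auto intro!: smooth_on_add Zs)
  have \<Psi>d: "(\<lambda>\<zeta>. \<Psi> \<zeta> $ m) differentiable (at \<zeta>)" if "\<zeta> \<in> ball 0 r" for \<zeta> m
    by (rule smooth_on_differentiable[OF \<Psi>s that])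
  have \<Psi>pd: "pd i (\<lambda>\<zeta>. \<Psi> \<zeta> $ m) \<zeta> = (if m = k then pd i Z \<zeta> else if i = m then 1 else 0)"
    if "\<zeta> \<in> ball 0 r" for i m \<zeta>
    unfolding \<Psi>n using smooth_on_differentiable[OF Zs that]
    by (cases "m = k") (auto simp: pd_add)
  \<comment> \<open>Differentiation inside a slice is differentiation along the leaf vector
    \<open>\<partial>\<^sub>i + b\<^sub>i \<partial>\<^sub>k\<close>.\<close>
  have \<Psi>pdj: "pd i (\<lambda>\<zeta>. f (\<Psi> \<zeta>)) \<zeta> = pd i f (\<Psi> \<zeta>) + b i (\<Psi> \<zeta>) * pd k f (\<Psi> \<zeta>)"
    if \<zeta>: "\<zeta> \<in> ball 0 r" and "f differentiable (at (\<Psi> \<zeta>))" "i \<noteq> k" for f i \<zeta>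
  proof -
    have "pd i (\<lambda>\<zeta>. f (\<Psi> \<zeta>)) \<zeta> = (\<Sum>m\<in>UNIV. pd m f (\<Psi> \<zeta>) * (if m = k then pd i Z \<zeta> else if i = m then 1 else 0))"
      using pd_compose(2)[where h=\<Psi>, OF that(2) \<Psi>d[OF \<zeta>]] by (simp add: \<Psi>pd[OF \<zeta>])
    also have "\<dots> = (\<Sum>m\<in>UNIV. (if m = k then pd k f (\<Psi> \<zeta>) * pd i Z \<zeta> else 0) + (if m = i then pd i f (\<Psi> \<zeta>) else 0))"
      using that(3) by (intro sum.cong) auto
    also have "\<dots> = pd k f (\<Psi> \<zeta>) * pd i Z \<zeta> + pd i f (\<Psi> \<zeta>)" by (simp add: sum.distrib)
    finally show ?thesis using Zj[OF \<zeta> that(3)] by (simp add: \<Psi>_def mult.commute)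
  qed
  have \<Psi>0: "\<Psi> 0 = z0" using \<open>Z 0 = 0\<close> by (simp add: \<Psi>_def vec_eq_iff)
  have 0: "(0::real^'n) \<in> ball 0 r" using r by simp
  \<comment> \<open>Every row of the Jacobian other than row \<open>k\<close> is a unit row, and the
    diagonal entry of row \<open>k\<close> is \<open>pd k Z 0 > 0\<close>; hence the kernel is
    trivial.\<close>
  have dn: "det (\<chi> i j. pd j (\<lambda>z. \<Psi> z $ i) 0) \<noteq> 0"
  proof -
    let ?M = "\<chi> i j. pd j (\<lambda>z. \<Psi> z $ i) (0::real^'n)"
    have "x = 0" if "?M *v x = 0" for x
    proof -
      have row: "(\<Sum>j\<in>UNIV. pd j (\<lambda>z. \<Psi> z $ i) 0 * x $ j) = 0" for i
        using that by (simp add: vec_eq_iff matrix_vector_mult_def)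
      have xi: "x $ i = 0" if "i \<noteq> k" for i
        using row[of i] that
        by (simp add: \<Psi>pd[OF 0] if_distrib[where f="\<lambda>x. x * _"] cong: if_cong)
      have "(\<Sum>j\<in>UNIV. pd j Z 0 * x $ j) = (\<Sum>j\<in>UNIV. if j = k then pd k Z 0 * x $ k else 0)"
        using xi by (intro sum.cong) auto
      then have "pd k Z 0 * x $ k = 0" using row[of k] by (simp add: \<Psi>pd[OF 0])
      then have "x $ k = 0" using Zk[OF 0] by simp
      then show "x = 0" using xi by (metis vec_eq_iff zero_index)
    qed
    then have "\<exists>B. B ** ?M = mat 1" by (simp add: matrix_left_invertible_ker)
    then have "invertible ?M" by (simp add: invertible_left_inverse)
    then show ?thesis by (simp add: invertible_det_nz)
  qed
  obtain V1 r1 \<Phi> where V1: "open V1" "0 \<in> V1" "V1 \<subseteq> ball 0 r" "r1 > 0"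
    "\<Psi> ` V1 = ball z0 r1" "inj_on \<Psi> V1"
    "\<And>j. smooth_on (ball z0 r1) (\<lambda>y. \<Phi> y $ j)"
    "\<And>y. y \<in> ball z0 r1 \<Longrightarrow> \<Phi> y \<in> V1" "\<And>y. y \<in> ball z0 r1 \<Longrightarrow> \<Psi> (\<Phi> y) = y"
    "\<And>z. z \<in> V1 \<Longrightarrow> \<Phi> (\<Psi> z) = z"
    by (rule smooth_inverse_function[of "ball 0 r" 0 \<Psi>, OF open_ball 0 \<Psi>s dn, unfolded \<Psi>0])
      (rule that; assumption)
  obtain s where s: "s > 0" "ball 0 s \<subseteq> V1" using V1(1,2) openE by blast
  have sr: "\<zeta> \<in> ball 0 r" if "\<zeta> \<in> ball 0 s" for \<zeta> :: "real^'n"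
    using that s V1(3) by blast
  have \<Phi>c: "continuous_on (ball z0 r1) \<Phi>"
    using continuous_on_vec_lambda[of "ball z0 r1" "\<lambda>j y. \<Phi> y $ j"] smooth_on_continuous[OF V1(7)]
    by (simp add: vec_lambda_eta)
  define V where "V = ball z0 r1 \<inter> \<Phi> -` ball 0 s"
  have V: "open V" unfolding V_def by (rule continuous_open_preimage[OF \<Phi>c]) auto
  have \<Psi>V: "\<Psi> \<zeta> \<in> V" if "\<zeta> \<in> ball 0 s" for \<zeta>
  proof -
    have "\<zeta> \<in> V1" using that s by blast
    then show ?thesis using that V1(5) V1(10)[of \<zeta>] unfolding V_def by blast
  qed
  have VU: "V \<subseteq> U"
  proof
    fix z assume "z \<in> V"
    then have "z = \<Psi> (\<Phi> z)" "\<Phi> z \<in> ball 0 s" using V1(9) by (auto simp: V_def)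
    then show "z \<in> U" using \<Psi>\<rho> sr lk(2) by metis
  qed
  have V\<rho>: "z \<in> ball z0 \<rho>" if "z \<in> V" for z
  proof -
    have "z = \<Psi> (\<Phi> z)" "\<Phi> z \<in> ball 0 s" using that V1(9) by (auto simp: V_def)
    then show ?thesis using \<Psi>\<rho> sr by metis
  qed
  show ?thesis
  proof (rule that[OF V _ VU])
    show "z0 \<in> V" using \<Psi>V[of 0] s \<Psi>0 by simp
    fix \<theta> :: "real^'n \<Rightarrow> 'n \<Rightarrow> real"
    assume \<theta>: "\<And>a. smooth_on V (\<lambda>z. \<theta> z a)" and closed: "\<And>z a b c. z \<in> V \<Longrightarrow> wedge_d l \<theta> z a b c = 0"
    \<comment> \<open>The value of \<open>\<theta>\<close> on the leaf vector with index
      \<open>j\<close>, which is the component of the pulled back form in a slice.\<close>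
    define \<Theta> where "\<Theta> = (\<lambda>j z. \<theta> z j + b j z * \<theta> z k)"
    have bV: "smooth_on V (b j)" for j by (rule smooth_on_subset[OF bs]) (use V\<rho> in auto)
    have \<Theta>: "smooth_on V (\<Theta> j)" for j
      unfolding \<Theta>_def by (intro smooth_on_add smooth_on_mult V \<theta> bV)
    have \<theta>d: "(\<lambda>z. \<theta> z a) differentiable (at z)" if "z \<in> V" for a z
      by (rule smooth_on_differentiable[OF \<theta> that])
    have pd\<Theta>: "pd m (\<Theta> j) z = pd m (\<lambda>z. \<theta> z j) z + (b j z * pd m (\<lambda>z. \<theta> z k) z + pd m (b j) z * \<theta> z k)"
      if "z \<in> V" for m j z
      unfolding \<Theta>_def using \<theta>d[OF that] bd[OF V\<rho>[OF that]]
      by (simp add: pd_add pd_mult differentiable_mult)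
    have \<Theta>X: "pd i (\<Theta> j) z + b i z * pd k (\<Theta> j) z = pd j (\<Theta> i) z + b j z * pd k (\<Theta> i) z"
      if z: "z \<in> V" for i j z
    proof -
      let ?d = "\<lambda>a b. pd a (\<lambda>w. \<theta> w b) z"
      have c: "(?d i j - ?d j i) * l z k + (?d j k - ?d k j) * - (b i z * l z k) + (?d k i - ?d i k) * - (b j z * l z k) = 0"
        using closed[OF z, of i j k]
        unfolding wedge_d_def lb[OF V\<rho>[OF z], of i] lb[OF V\<rho>[OF z], of j] .
      have "l z k * (pd i (\<Theta> j) z + b i z * pd k (\<Theta> j) z - (pd j (\<Theta> i) z + b j z * pd k (\<Theta> i) z))
        = ((?d i j - ?d j i) * l z k + (?d j k - ?d k j) * - (b i z * l z k) + (?d k i - ?d i k) * - (b j z * l z k))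
          + l z k * \<theta> z k * (pd i (b j) z + b i z * pd k (b j) z - (pd j (b i) z + b j z * pd k (b i) z))"
        unfolding pd\<Theta>[OF z] by (simp add: algebra_simps)
      then have "l z k * (pd i (\<Theta> j) z + b i z * pd k (\<Theta> j) z - (pd j (\<Theta> i) z + b j z * pd k (\<Theta> i) z)) = 0"
        unfolding c X[OF V\<rho>[OF z], of i j] by simp
      then show ?thesis using lk(1)[OF V\<rho>[OF z]] by simp
    qed
    obtain f0 where f0: "smooth_on (ball 0 s) f0"
      "\<And>i \<zeta>. i \<in> UNIV - {k} \<Longrightarrow> \<zeta> \<in> ball 0 s \<Longrightarrow> pd i f0 \<zeta> = \<Theta> i (\<Psi> \<zeta>)"
    proof (rule relative_poincare[of "UNIV - {k}" s "\<lambda>i \<zeta>. \<Theta> i (\<Psi> \<zeta>)"])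
      show "smooth_on (ball 0 s) (\<lambda>\<zeta>. \<Theta> j (\<Psi> \<zeta>))" for j
      proof (rule smooth_on_compose[OF open_ball \<Theta>])
        show "smooth_on (ball 0 s) (\<lambda>\<zeta>. \<Psi> \<zeta> $ m)" for m
          by (rule smooth_on_subset[OF \<Psi>s]) (use sr in blast)
      qed (use \<Psi>V in blast)
      show "pd i (\<lambda>\<zeta>. \<Theta> j (\<Psi> \<zeta>)) \<zeta> = pd j (\<lambda>\<zeta>. \<Theta> i (\<Psi> \<zeta>)) \<zeta>"
        if "i \<in> UNIV - {k}" "j \<in> UNIV - {k}" "\<zeta> \<in> ball 0 s" for i j \<zeta>
        using \<Psi>pdj[OF sr[OF that(3)] smooth_on_differentiable[OF \<Theta> \<Psi>V[OF that(3)]]] that \<Theta>X[OF \<Psi>V[OF that(3)]]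
        by simp
    qed (rule that; assumption)
    define f where "f = (\<lambda>z. f0 (\<Phi> z))"
    have f: "smooth_on V f"
      unfolding f_def
    proof (rule smooth_on_compose[OF V f0(1)])
      show "smooth_on V (\<lambda>z. \<Phi> z $ j)" for j
        by (rule smooth_on_subset[OF V1(7)]) (auto simp: V_def)
    qed (auto simp: V_def)
    have key: "pd j f z + b j z * pd k f z = \<theta> z j + b j z * \<theta> z k" if z: "z \<in> V" and j: "j \<noteq> k" for j z
    proof -
      define \<zeta> where "\<zeta> = \<Phi> z"
      have \<zeta>: "z = \<Psi> \<zeta>" "\<zeta> \<in> ball 0 s" using z V1(9) by (auto simp: V_def \<zeta>_def)
      have "pd j f0 \<zeta> = pd j (\<lambda>\<zeta>. f (\<Psi> \<zeta>)) \<zeta>"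
        by (rule pd_cong[OF open_ball \<zeta>(2)]) (use V1(10) s in \<open>auto simp: f_def\<close>)
      also have "\<dots> = pd j f z + b j z * pd k f z"
        unfolding \<zeta>(1) by (rule \<Psi>pdj[OF sr[OF \<zeta>(2)] smooth_on_differentiable[OF f] j]) (rule \<Psi>V[OF \<zeta>(2)])
      finally show ?thesis using f0(2)[of j \<zeta>] j \<zeta> by (simp add: \<Theta>_def)
    qed
    \<comment> \<open>\<open>df - \<theta>\<close> vanishes on the leaf vectors and is therefore a
      multiple of \<open>l\<close>; component \<open>k\<close> reveals the factor.\<close>
    define h where "h = (\<lambda>z. (pd k f z - \<theta> z k) / l z k)"
    have h: "smooth_on V h"
      unfolding h_def
      by (intro smooth_on_divide smooth_on_diff V smooth_on_pd f \<theta> smooth_on_subset[OF l VU]) (use lk V\<rho> in blast)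
    have fh: "pd a f z = \<theta> z a + h z * l z a" if z: "z \<in> V" for a z
    proof (cases "a = k")
      case True
      then show ?thesis using lk[OF V\<rho>[OF z]] by (simp add: h_def)
    next
      case False
      have "h z * l z a = - b a z * (pd k f z - \<theta> z k)"
        using lk[OF V\<rho>[OF z]] lb[OF V\<rho>[OF z], of a] by (simp add: h_def)
      then show ?thesis using key[OF z False] by (simp add: algebra_simps)
    qed
    show "\<exists>f h. smooth_on V f \<and> smooth_on V h \<and> (\<forall>z\<in>V. \<forall>a. pd a f z = \<theta> z a + h z * l z a)"
      by (intro exI[of _ f] exI[of _ h] conjI ballI allI f h fh)
  qed
qed

subsection \<open>Tensor calculus\<close>

lemma nabla1_cong:
  assumes "open S" "z \<in> S" "\<And>w a. w \<in> S \<Longrightarrow> \<theta> w a = \<theta>' w a"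
  shows "nabla1 g \<theta> z c a = nabla1 g \<theta>' z c a"
  unfolding nabla1_def using assms pd_cong[OF assms(1,2), of "\<lambda>y. \<theta> y a" "\<lambda>y. \<theta>' y a"] by simp

lemma nabla2_cong:
  assumes "open S" "z \<in> S" "\<And>w a b. w \<in> S \<Longrightarrow> A w a b = B w a b"
  shows "nabla2 g A z c a b = nabla2 g B z c a b"
  unfolding nabla2_def using assms pd_cong[OF assms(1,2), of "\<lambda>y. A y a b" "\<lambda>y. B y a b"] by simp

lemma nabla1_scale:
  fixes \<theta> :: "real tensor1"
  assumes "f differentiable (at z)" "\<And>a. (\<lambda>w. \<theta> w a) differentiable (at z)"
  shows "nabla1 g (\<lambda>w a. f w * \<theta> w a) z c a = pd c f z * \<theta> z a + f z * nabla1 g \<theta> z c a"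
  using assms by (simp add: nabla1_def pd_mult sum_distrib_left right_diff_distrib mult_ac)

definition tensor_prod :: "real tensor1 \<Rightarrow> real tensor1 \<Rightarrow> real tensor2" where
  "tensor_prod \<theta> \<theta>' = (\<lambda>z a b. \<theta> z a * \<theta>' z b)"

lemma nabla2_tensor_prod:
  assumes "\<And>a. (\<lambda>w. \<theta> w a) differentiable (at z)" "\<And>a. (\<lambda>w. \<theta>' w a) differentiable (at z)"
  shows "nabla2 g (tensor_prod \<theta> \<theta>') z c a b = nabla1 g \<theta> z c a * \<theta>' z b + \<theta> z a * nabla1 g \<theta>' z c b"
  using assms
  by (simp add: nabla2_def nabla1_def tensor_prod_def pd_mult sum_distrib_left sum_distrib_right algebra_simps)

lemma nabla2_add:
  fixes A B :: "real tensor2"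
  assumes "\<And>a b. (\<lambda>w. A w a b) differentiable (at z)" "\<And>a b. (\<lambda>w. B w a b) differentiable (at z)"
  shows "nabla2 g (\<lambda>w a b. A w a b + B w a b) z c a b = nabla2 g A z c a b + nabla2 g B z c a b"
  using assms by (simp add: nabla2_def pd_add sum.distrib distrib_left)

lemma nabla2_scale:
  fixes A :: "real tensor2"
  assumes "f differentiable (at z)" "\<And>a b. (\<lambda>w. A w a b) differentiable (at z)"
  shows "nabla2 g (\<lambda>w a b. f w * A w a b) z c a b = pd c f z * A z a b + f z * nabla2 g A z c a b"
  using assms by (simp add: nabla2_def pd_mult sum_distrib_left right_diff_distrib mult_ac)

lemma nabla2_wedge:
  fixes \<theta> \<theta>' :: "real tensor1"
  assumes "\<And>a. (\<lambda>w. \<theta> w a) differentiable (at z)" "\<And>a. (\<lambda>w. \<theta>' w a) differentiable (at z)"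
  shows "nabla2 g (wedge \<theta> \<theta>') z c a b =
    nabla1 g \<theta> z c a * \<theta>' z b + \<theta> z a * nabla1 g \<theta>' z c b
    - (nabla1 g \<theta> z c b * \<theta>' z a + \<theta> z b * nabla1 g \<theta>' z c a)"
  using assms
  by (simp add: nabla2_def nabla1_def wedge_def pd_diff pd_mult differentiable_mult
      sum_distrib_left sum_distrib_right sum_subtractf algebra_simps)

locale smooth_metric =
  fixes U :: "(real^4) set" and g :: "real tensor2"
  assumes open_U: "open U" and smooth_g: "\<And>a b. smooth_on U (\<lambda>z. g z a b)"
    and sym_g: "\<And>z a b. z \<in> U \<Longrightarrow> g z a b = g z b a"
    and nondegenerate: "\<And>z. z \<in> U \<Longrightarrow> det (metric_matrix g z) \<noteq> 0"
begin

lemma smooth_inv_metric: "smooth_on U (\<lambda>z. inv_metric g z a b)"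
  unfolding inv_metric_def metric_matrix_def
  by (rule smooth_on_matrix_inv[OF open_U smooth_g]) (use nondegenerate in \<open>simp add: metric_matrix_def\<close>)

lemma inv_metric_right: "z \<in> U \<Longrightarrow> (\<Sum>c\<in>UNIV. g z a c * inv_metric g z c b) = (if a = b then 1 else 0)"
  using matrix_inv_mult(2)[OF nondegenerate, of z]
  by (simp add: vec_eq_iff matrix_matrix_mult_def inv_metric_def metric_matrix_def mat_def)

lemma pd_g_sym: "z \<in> U \<Longrightarrow> pd c (\<lambda>w. g w a b) z = pd c (\<lambda>w. g w b a) z"
  by (rule pd_cong[OF open_U]) (auto simp: sym_g)

lemma christoffel_sym: "z \<in> U \<Longrightarrow> christoffel g z c a b = christoffel g z c b a"
  unfolding christoffel_def using pd_g_sym[of z _ a b] by (simp add: add.commute)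

text \<open>Koszul's formula. It contains no inverse metric, so it can be compared directly with
  derivatives of coframe forms.\<close>

lemma lower_christoffel:
  assumes z: "z \<in> U"
  shows "(\<Sum>c\<in>UNIV. g z d c * christoffel g z c a b) =
    (pd a (\<lambda>w. g w d b) z + pd b (\<lambda>w. g w d a) z - pd d (\<lambda>w. g w a b) z) / 2"
proof -
  let ?k = "\<lambda>e. pd a (\<lambda>w. g w e b) z + pd b (\<lambda>w. g w e a) z - pd e (\<lambda>w. g w a b) z"
  have "(\<Sum>c\<in>UNIV. g z d c * christoffel g z c a b) = (\<Sum>c\<in>UNIV. \<Sum>e\<in>UNIV. g z d c * inv_metric g z c e * ?k e) / 2"
    by (simp add: christoffel_def sum_distrib_left sum_divide_distrib mult_ac)
  also have "(\<Sum>c\<in>UNIV. \<Sum>e\<in>UNIV. g z d c * inv_metric g z c e * ?k e) = (\<Sum>e\<in>UNIV. (\<Sum>c\<in>UNIV. g z d c * inv_metric g z c e) * ?k e)"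
    by (subst sum.swap) (simp add: sum_distrib_right)
  also have "\<dots> = ?k d"
    by (simp add: inv_metric_right[OF z] if_distrib[where f="\<lambda>x. x * _"] cong: if_cong)
  finally show ?thesis .
qed

lemma metric_compatible:
  assumes z: "z \<in> U"
  shows "pd c (\<lambda>w. g w a b) z = (\<Sum>d\<in>UNIV. christoffel g z d c a * g z d b) + (\<Sum>d\<in>UNIV. christoffel g z d c b * g z a d)"
proof -
  have "(\<Sum>d\<in>UNIV. christoffel g z d c a * g z d b) = (\<Sum>d\<in>UNIV. g z b d * christoffel g z d c a)"
    by (simp add: sym_g[OF z, of b] mult.commute)
  moreover have "(\<Sum>d\<in>UNIV. christoffel g z d c b * g z a d) = (\<Sum>d\<in>UNIV. g z a d * christoffel g z d c b)"
    by (simp add: mult.commute)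
  ultimately show ?thesis
    unfolding lower_christoffel[OF z]
    using pd_g_sym[OF z, of _ a b] pd_g_sym[OF z, of _ b c] pd_g_sym[OF z, of _ a c] by (simp add: field_simps)
qed

lemma smooth_christoffel: "smooth_on U (\<lambda>z. christoffel g z c a b)"
  unfolding christoffel_def
  by (intro smooth_on_divide smooth_on_sum smooth_on_mult smooth_on_add smooth_on_diff smooth_on_pd
      smooth_inv_metric smooth_g open_U finite smooth_on_const) auto

lemma nabla1_antisym:
  fixes \<theta> :: "real tensor1"
  assumes "z \<in> U"
  shows "nabla1 g \<theta> z c a - nabla1 g \<theta> z a c = pd c (\<lambda>w. \<theta> w a) z - pd a (\<lambda>w. \<theta> w c) z"
  using christoffel_sym[OF assms, of _ c a] by (simp add: nabla1_def)

text \<open>Second partial derivatives of \<open>\<theta>\<close> cancel by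
  \<open>pd_commute\<close>, and the terms in \<open>nabla1\<close> that remain cancel by symmetry
  of the Christoffel symbols. Applied to coframe forms with known \<open>nabla1\<close>, it yields
  the curvature without differentiating Christoffel symbols.\<close>

lemma ricci_identity:
  fixes \<theta> :: "real tensor1"
  assumes z: "z \<in> U" and \<theta>: "\<And>a. smooth_on U (\<lambda>z. \<theta> z a)"
  shows "(\<Sum>a\<in>UNIV. \<theta> z a * riemann_up g z a b c d) =
    nabla2 g (nabla1 g \<theta>) z d c b - nabla2 g (nabla1 g \<theta>) z c d b"
proof -
  let ?\<Gamma> = "\<lambda>a b c. christoffel g z a b c"
  have d\<theta>: "(\<lambda>z. \<theta> z a) differentiable (at z)" "pd d (\<lambda>z. \<theta> z a) differentiable (at z)" for a d
    using smooth_on_differentiable[OF \<theta> z] smooth_on_differentiable[OF smooth_on_pd[OF \<theta>] z] by auto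
  have d\<Gamma>: "(\<lambda>z. christoffel g z a b c) differentiable (at z)" for a b c
    by (rule smooth_on_differentiable[OF smooth_christoffel z])
  have pdN: "pd c (\<lambda>w. nabla1 g \<theta> w d b) z = pd c (pd d (\<lambda>w. \<theta> w b)) z
      - (\<Sum>e\<in>UNIV. ?\<Gamma> e d b * pd c (\<lambda>w. \<theta> w e) z + pd c (\<lambda>w. christoffel g w e d b) z * \<theta> z e)" for c d b
    unfolding nabla1_def real_scaleR_def
    using d\<theta> d\<Gamma> by (simp add: pd_diff pd_sum pd_mult differentiable_mult differentiable_sum)
  have swap: "(\<Sum>e\<in>UNIV. ?\<Gamma> e c b * (\<Sum>f\<in>UNIV. ?\<Gamma> f d e * \<theta> z f)) = (\<Sum>f\<in>UNIV. \<theta> z f * (\<Sum>e\<in>UNIV. ?\<Gamma> f d e * ?\<Gamma> e c b))" for c d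
    unfolding sum_distrib_left by (subst sum.swap) (simp add: mult_ac)
  have N2: "nabla2 g (nabla1 g \<theta>) z c d b = pd c (pd d (\<lambda>w. \<theta> w b)) z
      - (\<Sum>e\<in>UNIV. ?\<Gamma> e d b * pd c (\<lambda>w. \<theta> w e) z) - (\<Sum>e\<in>UNIV. pd c (\<lambda>w. christoffel g w e d b) z * \<theta> z e)
      - (\<Sum>e\<in>UNIV. ?\<Gamma> e c d * nabla1 g \<theta> z e b)
      - (\<Sum>e\<in>UNIV. ?\<Gamma> e c b * pd d (\<lambda>w. \<theta> w e) z) + (\<Sum>f\<in>UNIV. \<theta> z f * (\<Sum>e\<in>UNIV. ?\<Gamma> f d e * ?\<Gamma> e c b))" for c d
    unfolding swap[symmetric] nabla2_def pdN
    by (simp add: nabla1_def right_diff_distrib sum_subtractf sum.distrib)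
  have "pd c (pd d (\<lambda>w. \<theta> w b)) z = pd d (pd c (\<lambda>w. \<theta> w b)) z"
    by (rule pd_commute[OF open_U \<theta> z])
  moreover have "(\<Sum>e\<in>UNIV. ?\<Gamma> e d c * nabla1 g \<theta> z e b) = (\<Sum>e\<in>UNIV. ?\<Gamma> e c d * nabla1 g \<theta> z e b)"
    using christoffel_sym[OF z, of _ c d] by simp
  moreover have "(\<Sum>a\<in>UNIV. \<theta> z a * riemann_up g z a b c d) =
      (\<Sum>e\<in>UNIV. pd c (\<lambda>w. christoffel g w e d b) z * \<theta> z e) - (\<Sum>e\<in>UNIV. pd d (\<lambda>w. christoffel g w e c b) z * \<theta> z e)
      + (\<Sum>f\<in>UNIV. \<theta> z f * (\<Sum>e\<in>UNIV. ?\<Gamma> f c e * ?\<Gamma> e d b)) - (\<Sum>f\<in>UNIV. \<theta> z f * (\<Sum>e\<in>UNIV. ?\<Gamma> f d e * ?\<Gamma> e c b))"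
    unfolding riemann_up_def
    by (simp add: distrib_left right_diff_distrib sum.distrib sum_subtractf mult.commute)
  ultimately show ?thesis unfolding N2 by linarith
qed

end

subsection \<open>Null coframes\<close>

lemma vector_4 [simp]:
  "(vector [w, x, y, z] :: 'a::zero^4) $ 1 = w" "(vector [w, x, y, z] :: 'a^4) $ 2 = x"
  "(vector [w, x, y, z] :: 'a^4) $ 3 = y" "(vector [w, x, y, z] :: 'a^4) $ 4 = z"
  unfolding vector_def by auto

definition coframe_matrix :: "(4 \<Rightarrow> real) \<Rightarrow> (4 \<Rightarrow> real) \<Rightarrow> (4 \<Rightarrow> real) \<Rightarrow> (4 \<Rightarrow> real) \<Rightarrow> real^4^4" where
  "coframe_matrix l n p q = vector [\<chi> a. l a, \<chi> a. n a, \<chi> a. p a, \<chi> a. q a]"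

lemma coframe_matrix_nth [simp]:
  "coframe_matrix l n p q $ 1 $ a = l a" "coframe_matrix l n p q $ 2 $ a = n a"
  "coframe_matrix l n p q $ 3 $ a = p a" "coframe_matrix l n p q $ 4 $ a = q a"
  by (simp_all add: coframe_matrix_def)

text \<open>\<open>l\<close> and \<open>n\<close> are null with product -1; \<open>p\<close> and
  \<open>q\<close> are orthonormal and orthogonal to both. The determinant condition says that
  \<open>(l, n, p, q)\<close> is positively oriented and that \<open>\<eta>\<close> is their
  exterior product.\<close>

definition null_coframe ::
    "(4 \<Rightarrow> 4 \<Rightarrow> real) \<Rightarrow> real \<Rightarrow> (4 \<Rightarrow> real) \<Rightarrow> (4 \<Rightarrow> real) \<Rightarrow> (4 \<Rightarrow> real) \<Rightarrow> (4 \<Rightarrow> real) \<Rightarrow> bool" where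
  "null_coframe G v l n p q \<longleftrightarrow>
     (\<forall>a b. G a b = p a * p b + q a * q b - l a * n b - n a * l b) \<and>
     v = det (coframe_matrix l n p q) \<and> v \<noteq> 0"

definition pair :: "(4 \<Rightarrow> real) \<Rightarrow> (4 \<Rightarrow> real) \<Rightarrow> real" where
  "pair X w = (\<Sum>a\<in>UNIV. X a * w a)"

text \<open>The determinant with columns \<open>(l\<^sub>i, n\<^sub>i, p\<^sub>i, q\<^sub>i)\<close>, expanded.\<close>

definition det4 :: "real \<Rightarrow> real \<Rightarrow> real \<Rightarrow> real \<Rightarrow> real \<Rightarrow> real \<Rightarrow> real \<Rightarrow> real \<Rightarrow>
    real \<Rightarrow> real \<Rightarrow> real \<Rightarrow> real \<Rightarrow> real \<Rightarrow> real \<Rightarrow> real \<Rightarrow> real \<Rightarrow> real" where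
  "det4 l1 n1 p1 q1 l2 n2 p2 q2 l3 n3 p3 q3 l4 n4 p4 q4 =
    l1 * (n2 * (p3 * q4 - p4 * q3) - n3 * (p2 * q4 - p4 * q2) + n4 * (p2 * q3 - p3 * q2))
  - l2 * (n1 * (p3 * q4 - p4 * q3) - n3 * (p1 * q4 - p4 * q1) + n4 * (p1 * q3 - p3 * q1))
  + l3 * (n1 * (p2 * q4 - p4 * q2) - n2 * (p1 * q4 - p4 * q1) + n4 * (p1 * q2 - p2 * q1))
  - l4 * (n1 * (p2 * q3 - p3 * q2) - n2 * (p1 * q3 - p3 * q1) + n3 * (p1 * q2 - p2 * q1))"

lemma pair_add [simp]: "pair X (\<lambda>a. w a + w' a) = pair X w + pair X w'"
  by (simp add: pair_def distrib_left sum.distrib)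

lemma pair_diff [simp]: "pair X (\<lambda>a. w a - w' a) = pair X w - pair X w'"
  by (simp add: pair_def right_diff_distrib sum_subtractf)

lemma pair_minus [simp]: "pair X (\<lambda>a. - w a) = - pair X w"
  by (simp add: pair_def sum_negf)

lemma pair_scale [simp]: "pair X (\<lambda>a. c * w a) = c * pair X w"
  by (simp add: pair_def sum_distrib_left mult_ac)

lemma pair_scale_right [simp]: "pair X (\<lambda>a. w a * c) = pair X w * c"
  by (simp add: pair_def sum_distrib_right mult_ac)

lemma pair_0 [simp]: "pair X (\<lambda>a. 0) = 0"
  by (simp add: pair_def)

lemma pair_vec_add [simp]: "pair (\<lambda>a. X a + Y a) w = pair X w + pair Y w"
  by (simp add: pair_def distrib_right sum.distrib)

lemma pair_vec_diff [simp]: "pair (\<lambda>a. X a - Y a) w = pair X w - pair Y w"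
  by (simp add: pair_def left_diff_distrib sum_subtractf)

lemma pair_vec_scale [simp]: "pair (\<lambda>a. c * X a) w = c * pair X w"
  by (simp add: pair_def sum_distrib_left mult_ac)

lemma pair_vec_scale_right [simp]: "pair (\<lambda>a. X a * c) w = c * pair X w"
  by (simp add: pair_def sum_distrib_left mult_ac)

section \<open>Frame vectors and contractions with the volume form\<close>

locale null_frame =
  fixes G :: "4 \<Rightarrow> 4 \<Rightarrow> real" and v :: real and l n p q :: "4 \<Rightarrow> real"
  assumes coframe: "null_coframe G v l n p q"
begin

text \<open>These are the coframe forms with raised index, not the dual basis: since
  \<open>l\<close> and \<open>n\<close> have product -1, raising \<open>l\<close> gives minus the
  vector dual to \<open>n\<close>, the second row. This explains the signs and the exchange of the
  columns 1 and 2.\<close>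

definition "L a = - matrix_inv (coframe_matrix l n p q) $ a $ 2"
definition "N a = - matrix_inv (coframe_matrix l n p q) $ a $ 1"
definition "P a = matrix_inv (coframe_matrix l n p q) $ a $ 3"
definition "Q a = matrix_inv (coframe_matrix l n p q) $ a $ 4"

lemma G_eq: "G a b = p a * p b + q a * q b - l a * n b - n a * l b"
  using coframe by (simp add: null_coframe_def)

lemma det_nz: "det (coframe_matrix l n p q) \<noteq> 0"
  using coframe by (auto simp: null_coframe_def)

lemma v_eq: "v = det (coframe_matrix l n p q)"
  using coframe by (simp add: null_coframe_def)

lemma pairs [simp]:
  "pair L l = 0" "pair L n = -1" "pair L p = 0" "pair L q = 0"
  "pair N l = -1" "pair N n = 0" "pair N p = 0" "pair N q = 0"
  "pair P l = 0" "pair P n = 0" "pair P p = 1" "pair P q = 0"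
  "pair Q l = 0" "pair Q n = 0" "pair Q p = 0" "pair Q q = 1"
proof -
  let ?E = "coframe_matrix l n p q"
  have *: "(\<Sum>a\<in>UNIV. ?E $ i $ a * matrix_inv ?E $ a $ j) = (if i = j then 1 else 0)" for i j
    using matrix_inv_mult(2)[OF det_nz] by (simp add: vec_eq_iff matrix_matrix_mult_def mat_def)
  show "pair L l = 0" "pair L n = -1" "pair L p = 0" "pair L q = 0"
    using *[of 1 2] *[of 2 2] *[of 3 2] *[of 4 2] by (simp_all add: pair_def L_def sum_negf mult.commute)
  show "pair N l = -1" "pair N n = 0" "pair N p = 0" "pair N q = 0"
    using *[of 1 1] *[of 2 1] *[of 3 1] *[of 4 1] by (simp_all add: pair_def N_def sum_negf mult.commute)
  show "pair P l = 0" "pair P n = 0" "pair P p = 1" "pair P q = 0"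
    using *[of 1 3] *[of 2 3] *[of 3 3] *[of 4 3] by (simp_all add: pair_def P_def mult.commute)
  show "pair Q l = 0" "pair Q n = 0" "pair Q p = 0" "pair Q q = 1"
    using *[of 1 4] *[of 2 4] *[of 3 4] *[of 4 4] by (simp_all add: pair_def Q_def mult.commute)
qed

lemma complete: "P a * p b + Q a * q b - L a * n b - N a * l b = (if a = b then 1 else 0)"
proof -
  let ?E = "coframe_matrix l n p q"
  have "(\<Sum>i\<in>UNIV. matrix_inv ?E $ a $ i * ?E $ i $ b) = (if a = b then 1 else 0)"
    using matrix_inv_mult(1)[OF det_nz] by (simp add: vec_eq_iff matrix_matrix_mult_def mat_def)
  then show ?thesis by (simp add: sum_4 L_def N_def P_def Q_def)
qed

lemma expand: "w b = pair P w * p b + pair Q w * q b - pair L w * n b - pair N w * l b"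
proof -
  have "w b = (\<Sum>a\<in>UNIV. w a * (P a * p b + Q a * q b - L a * n b - N a * l b))"
    unfolding complete by (simp add: if_distrib[where f="\<lambda>x. _ * x"] cong: if_cong)
  also have "\<dots> = pair P w * p b + pair Q w * q b - pair L w * n b - pair N w * l b"
    by (simp add: pair_def sum_distrib_right sum_distrib_left distrib_left right_diff_distrib sum.distrib
        sum_subtractf mult_ac)
  finally show ?thesis .
qed

lemma inverse_matrix:
  "matrix_inv (\<chi> a b. G a b) = (\<chi> a b. P a * P b + Q a * Q b - L a * N b - N a * L b)"
proof (rule matrix_inv_eqI)
  have "(\<Sum>c\<in>UNIV. (P a * P c + Q a * Q c - L a * N c - N a * L c) * G c b) = (if a = b then 1 else 0)" for a b
  proof -
    have "(\<Sum>c\<in>UNIV. (P a * P c + Q a * Q c - L a * N c - N a * L c) * G c b)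
        = pair (\<lambda>c. P a * P c + Q a * Q c - L a * N c - N a * L c) (\<lambda>c. p c * p b + q c * q b - l c * n b - n c * l b)"
      unfolding pair_def G_eq by (rule refl)
    also have "\<dots> = P a * p b + Q a * q b - L a * n b - N a * l b" by simp
    finally show ?thesis using complete by simp
  qed
  then show "(\<chi> a b. P a * P b + Q a * Q b - L a * N b - N a * L b) ** (\<chi> a b. G a b) = mat 1"
    by (simp add: vec_eq_iff matrix_matrix_mult_def mat_def)
qed

text \<open>By the product rule for determinants the volume form depends only on the frame
  components of its arguments, so all later duals are computed without coordinates.\<close>

lemma det_rows:
  "v * det (vector [\<chi> a. X1 a, \<chi> a. X2 a, \<chi> a. X3 a, \<chi> a. X4 a] :: real^4^4) =
    det4 (pair X1 l) (pair X1 n) (pair X1 p) (pair X1 q) (pair X2 l) (pair X2 n) (pair X2 p) (pair X2 q)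
     (pair X3 l) (pair X3 n) (pair X3 p) (pair X3 q) (pair X4 l) (pair X4 n) (pair X4 p) (pair X4 q)"
proof -
  let ?X = "coframe_matrix X1 X2 X3 X4"
  have "v * det ?X = det (coframe_matrix l n p q ** transpose ?X)"
    by (simp add: v_eq det_mul)
  also have "\<dots> = det4 (pair X1 l) (pair X1 n) (pair X1 p) (pair X1 q) (pair X2 l) (pair X2 n) (pair X2 p) (pair X2 q)
     (pair X3 l) (pair X3 n) (pair X3 p) (pair X3 q) (pair X4 l) (pair X4 n) (pair X4 p) (pair X4 q)"
    unfolding det_4 det4_def
    by (simp add: matrix_matrix_mult_def transpose_def pair_def mult.commute)
  finally show ?thesis by (simp add: coframe_matrix_def)
qed

lemma volume_form_eq:
  assumes "vol z = v"
  shows "volume_form vol z a b c d =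
    det4 (l a) (n a) (p a) (q a) (l b) (n b) (p b) (q b) (l c) (n c) (p c) (q c) (l d) (n d) (p d) (q d)"
proof -
  have ax: "(axis a 1 :: real^4) = (\<chi> i. if i = a then 1 else 0)" for a by (simp add: axis_def)
  have "pair (\<lambda>i. if i = a then 1 else 0) w = w a" for w a
    by (simp add: pair_def if_distrib[where f="\<lambda>x. x * _"] cong: if_cong)
  then show ?thesis
    unfolding volume_form_def assms ax det_rows by simp
qed

lemma sum_det4_1:
  "(\<Sum>d\<in>UNIV. X d * det4 (l d) (n d) (p d) (q d) l2 n2 p2 q2 l3 n3 p3 q3 l4 n4 p4 q4) =
    det4 (pair X l) (pair X n) (pair X p) (pair X q) l2 n2 p2 q2 l3 n3 p3 q3 l4 n4 p4 q4"
  unfolding det4_def pair_def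
  by (simp add: sum_distrib_left sum_distrib_right sum.distrib sum_subtractf algebra_simps)

lemma sum_det4_3:
  "(\<Sum>d\<in>UNIV. X d * det4 l1 n1 p1 q1 l2 n2 p2 q2 (l d) (n d) (p d) (q d) l4 n4 p4 q4) =
    det4 l1 n1 p1 q1 l2 n2 p2 q2 (pair X l) (pair X n) (pair X p) (pair X q) l4 n4 p4 q4"
  unfolding det4_def pair_def
  by (simp add: sum_distrib_left sum_distrib_right sum.distrib sum_subtractf algebra_simps)

lemma sum_det4_4:
  "(\<Sum>d\<in>UNIV. X d * det4 l1 n1 p1 q1 l2 n2 p2 q2 l3 n3 p3 q3 (l d) (n d) (p d) (q d)) =
    det4 l1 n1 p1 q1 l2 n2 p2 q2 l3 n3 p3 q3 (pair X l) (pair X n) (pair X p) (pair X q)"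
  unfolding det4_def pair_def
  by (simp add: sum_distrib_left sum_distrib_right sum.distrib sum_subtractf algebra_simps)


definition "up w a = P a * pair P w + Q a * pair Q w - L a * pair N w - N a * pair L w"

lemma up_eq: "(\<Sum>b\<in>UNIV. matrix_inv (\<chi> a b. G a b) $ a $ b * w b) = up w a"
proof -
  have "(\<Sum>b\<in>UNIV. matrix_inv (\<chi> a b. G a b) $ a $ b * w b)
      = pair (\<lambda>b. P a * P b + Q a * Q b - L a * N b - N a * L b) w"
    unfolding inverse_matrix pair_def by simp
  then show ?thesis by (simp add: up_def)
qed

lemma up_frame [simp]: "up l = L" "up n = N" "up p = P" "up q = Q"
  by (auto simp: up_def)

definition "contract2 a b R = (\<Sum>c\<in>UNIV. \<Sum>d\<in>UNIV.
  det4 (l a) (n a) (p a) (q a) (l b) (n b) (p b) (q b) (l c) (n c) (p c) (q c) (l d) (n d) (p d) (q d) * R c d)"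

lemma contract2_linear [simp]:
  "contract2 a b (\<lambda>c d. R c d + S c d) = contract2 a b R + contract2 a b S"
  "contract2 a b (\<lambda>c d. R c d - S c d) = contract2 a b R - contract2 a b S"
  by (simp_all add: contract2_def distrib_left right_diff_distrib sum.distrib sum_subtractf)

lemma contract2_scale [simp]: "contract2 a b (\<lambda>c d. k * R c d) = k * contract2 a b R"
  by (simp add: contract2_def sum_distrib_left mult_ac)

lemma contract2_prod:
  "contract2 a b (\<lambda>c d. X c * Y d) =
    det4 (l a) (n a) (p a) (q a) (l b) (n b) (p b) (q b)
      (pair X l) (pair X n) (pair X p) (pair X q) (pair Y l) (pair Y n) (pair Y p) (pair Y q)"
proof -
  have "contract2 a b (\<lambda>c d. X c * Y d) = (\<Sum>c\<in>UNIV. X c * (\<Sum>d\<in>UNIV. Y d *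
      det4 (l a) (n a) (p a) (q a) (l b) (n b) (p b) (q b) (l c) (n c) (p c) (q c) (l d) (n d) (p d) (q d)))"
    by (simp add: contract2_def sum_distrib_left mult_ac)
  then show ?thesis by (simp only: sum_det4_4 sum_det4_3)
qed

lemma contract2_prod': "contract2 a b (\<lambda>c d. X d * Y c) =
    det4 (l a) (n a) (p a) (q a) (l b) (n b) (p b) (q b)
      (pair Y l) (pair Y n) (pair Y p) (pair Y q) (pair X l) (pair X n) (pair X p) (pair X q)"
  unfolding contract2_prod[symmetric] by (simp add: mult.commute)

end

locale null_frame_at = null_frame "g z" "vol z" l n p q
  for g :: "real tensor2" and vol :: "real^4 \<Rightarrow> real" and z :: "real^4" and l n p q :: "4 \<Rightarrow> real"
begin

lemma sum_inv_metric: "(\<Sum>b\<in>UNIV. inv_metric g z a b * w b) = up w a"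
  using up_eq by (simp add: inv_metric_def metric_matrix_def)

lemma raise1_eq: "raise1 g \<theta> z = up (\<theta> z)"
  for \<theta> :: "real tensor1"
  by (rule ext) (simp add: raise1_def sum_inv_metric)

lemma raise2_eq: "raise2 g A z c d = up (\<lambda>e. up (A z e) d) c"
  for A :: "real tensor2"
proof -
  have "raise2 g A z c d = (\<Sum>e\<in>UNIV. inv_metric g z c e * (\<Sum>f\<in>UNIV. inv_metric g z d f * A z e f))"
    by (simp add: raise2_def sum_distrib_left mult_ac)
  then show ?thesis by (simp add: sum_inv_metric)
qed

lemma hodge_contract: "hodge g vol A z a b = contract2 a b (raise2 g A z) / 2"
  by (simp add: hodge_def contract2_def volume_form_eq[of vol z])

lemma raise2_frame:
  assumes "\<And>a b. A z a b = c1 * (l a * n b - l b * n a) + c2 * (l a * p b - l b * p a)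
    + c3 * (l a * q b - l b * q a) + c4 * (n a * p b - n b * p a) + c5 * (n a * q b - n b * q a)
    + c6 * (p a * q b - p b * q a)"
  shows "raise2 g A z = (\<lambda>a b. c1 * (L a * N b - N a * L b) + c2 * (L a * P b - P a * L b)
    + c3 * (L a * Q b - Q a * L b) + c4 * (N a * P b - P a * N b) + c5 * (N a * Q b - Q a * N b)
    + c6 * (P a * Q b - Q a * P b))"
proof -
  have "A z = (\<lambda>a b. c1 * (l a * n b - l b * n a) + c2 * (l a * p b - l b * p a)
    + c3 * (l a * q b - l b * q a) + c4 * (n a * p b - n b * p a) + c5 * (n a * q b - n b * q a)
    + c6 * (p a * q b - p b * q a))" using assms by blast
  then show ?thesis
    by (intro ext) (simp add: raise2_eq up_def algebra_simps)
qed

text \<open>The entries that matter most: the dual of \<open>l \<and> p\<close> is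
  \<open>- l \<and> q\<close>, and that of \<open>l \<and> q\<close> is \<open>l \<and> p\<close>. A
  duality rotation of \<open>l \<and> p\<close> is thus a rotation of the pair \<open>p\<close>,
  \<open>q\<close>.\<close>

lemma hodge_frame:
  assumes "\<And>a b. A z a b = c1 * (l a * n b - l b * n a) + c2 * (l a * p b - l b * p a)
    + c3 * (l a * q b - l b * q a) + c4 * (n a * p b - n b * p a) + c5 * (n a * q b - n b * q a)
    + c6 * (p a * q b - p b * q a)"
  shows "hodge g vol A z a b = c6 * (l a * n b - l b * n a) + c3 * (l a * p b - l b * p a)
    - c2 * (l a * q b - l b * q a) - c5 * (n a * p b - n b * p a) + c4 * (n a * q b - n b * q a)
    - c1 * (p a * q b - p b * q a)"
  using raise2_frame[of A, OF assms]
  by (simp add: hodge_contract contract2_prod contract2_prod' det4_def algebra_simps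
        add_divide_distrib diff_divide_distrib)

end

subsection \<open>Conformal Killing-Yano tensors\<close>

lemma (in smooth_metric) smooth_raise2:
  fixes A :: "real tensor2"
  assumes "\<And>a b. smooth_on U (\<lambda>z. A z a b)"
  shows "smooth_on U (\<lambda>z. raise2 g A z a b)"
  unfolding raise2_def real_scaleR_def
  by (intro smooth_on_sum smooth_on_mult open_U finite smooth_inv_metric assms)

lemma (in smooth_metric) smooth_hodge:
  assumes "\<And>a b. smooth_on U (\<lambda>z. A z a b)" "smooth_on U vol"
  shows "smooth_on U (\<lambda>z. hodge g vol A z a b)"
  unfolding hodge_def volume_form_def
  by (intro smooth_on_divide smooth_on_sum smooth_on_mult open_U finite smooth_raise2 assms smooth_on_const) auto

lemma sum_complex_comb:
  "(\<Sum>d\<in>I. k d *\<^sub>R ((of_real (x d) - \<i> * of_real (y d)) / (of_real s :: complex))) =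
    (of_real (\<Sum>d\<in>I. k d * x d) - \<i> * of_real (\<Sum>d\<in>I. k d * y d)) / of_real s"
  by (simp add: scaleR_conv_of_real sum_subtractf sum_distrib_left right_diff_distrib
      diff_divide_distrib sum_divide_distrib mult_ac)

context
  fixes g :: "real tensor2" and A B :: "real tensor2" and z :: "real^4"
  assumes dA: "\<And>a b. (\<lambda>w. A w a b) differentiable (at z)" and dB: "\<And>a b. (\<lambda>w. B w a b) differentiable (at z)"
begin

lemma pd_complex_comb:
  "pd c (\<lambda>w. (of_real (A w a b) - \<i> * of_real (B w a b)) / of_real (sqrt 2)) z =
    (of_real (pd c (\<lambda>w. A w a b) z) - \<i> * of_real (pd c (\<lambda>w. B w a b) z)) / (of_real (sqrt 2) :: complex)"
proof -
  have 1: "pd c (\<lambda>w. of_real (A w a b) / (of_real (sqrt 2) :: complex)) z = of_real (pd c (\<lambda>w. A w a b) z) / of_real (sqrt 2)"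
    "(\<lambda>w. of_real (A w a b) / (of_real (sqrt 2) :: complex)) differentiable (at z)"
  proof -
    have bl: "bounded_linear (\<lambda>x::real. of_real x / (of_real (sqrt 2) :: complex))"
      by (rule bounded_linear_compose[OF bounded_linear_divide bounded_linear_of_real])
    show "pd c (\<lambda>w. of_real (A w a b) / (of_real (sqrt 2) :: complex)) z = of_real (pd c (\<lambda>w. A w a b) z) / of_real (sqrt 2)"
      by (rule pd_bounded_linear[OF bl dA])
    show "(\<lambda>w. of_real (A w a b) / (of_real (sqrt 2) :: complex)) differentiable (at z)"
      using dA[of a b] bounded_linear.has_derivative[OF bl] unfolding differentiable_def by blast
  qed
  have 2: "pd c (\<lambda>w. \<i> * of_real (B w a b) / (of_real (sqrt 2) :: complex)) z = \<i> * of_real (pd c (\<lambda>w. B w a b) z) / of_real (sqrt 2)"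
    "(\<lambda>w. \<i> * of_real (B w a b) / (of_real (sqrt 2) :: complex)) differentiable (at z)"
  proof -
    have bl: "bounded_linear (\<lambda>x::real. \<i> * of_real x / (of_real (sqrt 2) :: complex))"
      by (rule bounded_linear_compose[OF bounded_linear_divide bounded_linear_const_mult[OF bounded_linear_of_real]])
    show "pd c (\<lambda>w. \<i> * of_real (B w a b) / (of_real (sqrt 2) :: complex)) z = \<i> * of_real (pd c (\<lambda>w. B w a b) z) / of_real (sqrt 2)"
      by (rule pd_bounded_linear[OF bl dB])
    show "(\<lambda>w. \<i> * of_real (B w a b) / (of_real (sqrt 2) :: complex)) differentiable (at z)"
      using dB[of a b] bounded_linear.has_derivative[OF bl] unfolding differentiable_def by blast
  qed
  show ?thesis
    unfolding diff_divide_distrib using pd_diff[OF 1(2) 2(2)] 1(1) 2(1) by simp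
qed

lemma nabla2_complex_comb:
  "nabla2 g (\<lambda>w a b. (of_real (A w a b) - \<i> * of_real (B w a b)) / of_real (sqrt 2)) z c a b =
    (of_real (nabla2 g A z c a b) - \<i> * of_real (nabla2 g B z c a b)) / (of_real (sqrt 2) :: complex)"
  unfolding nabla2_def pd_complex_comb sum_complex_comb
  by (simp add: diff_divide_distrib right_diff_distrib)

lemma codifferential_complex_comb:
  "codifferential g (\<lambda>w a b. (of_real (A w a b) - \<i> * of_real (B w a b)) / of_real (sqrt 2)) z b =
    (of_real (codifferential g A z b) - \<i> * of_real (codifferential g B z b)) / (of_real (sqrt 2) :: complex)"
  unfolding codifferential_def nabla2_complex_comb sum_complex_comb sum_complex_comb[where k="\<lambda>_. 1", simplified]
  by (simp add: diff_divide_distrib)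

end

lemma raise1_complex_comb:
  fixes X Y :: "real tensor1" and Z :: "complex tensor1"
  assumes "\<And>b. Z z b = (of_real (X z b) - \<i> * of_real (Y z b)) / of_real (sqrt 2)"
  shows "raise1 g Z z a = (of_real (raise1 g X z a) - \<i> * of_real (raise1 g Y z a)) / (of_real (sqrt 2) :: complex)"
  unfolding raise1_def assms sum_complex_comb by simp

text \<open>The real part of the complex equation. The sources are separate arguments because the
  imaginary part is the same equation for the dual form, with \<open>(X, Y)\<close> replaced by
  \<open>(Y, -X)\<close>.\<close>

definition cky_equation :: "real tensor2 \<Rightarrow> (real^4 \<Rightarrow> real) \<Rightarrow> real tensor2 \<Rightarrow> real tensor1 \<Rightarrow> real tensor1 \<Rightarrow> real^4 \<Rightarrow> bool" where
  "cky_equation g vol A X Y z \<longleftrightarrow> (\<forall>c a b. 3 * nabla2 g A z c a b =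
     (\<Sum>d\<in>UNIV. raise1 g X z d * (g z d a * g z c b - g z d b * g z c a))
     - (\<Sum>d\<in>UNIV. raise1 g Y z d * volume_form vol z d c a b))"

text \<open>The right side is a contraction of \<open>X - \<i> Y\<close> with
  \<open>G - \<i> \<eta>\<close>: its real part is \<open>X G - Y \<eta>\<close>, its imaginary part
  \<open>- (Y G + X \<eta>)\<close>, and the factors \<open>sqrt 2\<close> cancel.\<close>

lemma (in smooth_metric) conformal_killing_yano_iff:
  assumes vol: "smooth_on U vol"
  shows "conformal_killing_yano U g vol A \<longleftrightarrow> two_form U A \<and>
    (\<forall>z\<in>U. cky_equation g vol A (codifferential g A) (codifferential g (hodge g vol A)) z \<and>
      cky_equation g vol (hodge g vol A) (codifferential g (hodge g vol A)) (\<lambda>z a. - codifferential g A z a) z)"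
proof (cases "two_form U A")
  case False
  then show ?thesis by (simp add: conformal_killing_yano_def)
next
  case True
  let ?B = "hodge g vol A" and ?X = "codifferential g A" and ?Y = "codifferential g (hodge g vol A)"
  have sA: "smooth_on U (\<lambda>z. A z a b)" for a b using True by (simp add: two_form_def)
  have "(\<forall>c a b. 3 * nabla2 g (self_dual g vol A) z c a b =
        2 * (\<Sum>d\<in>UNIV. raise1 g (codifferential g (self_dual g vol A)) z d * self_dual_metric g vol z d c a b))
     \<longleftrightarrow> cky_equation g vol A ?X ?Y z \<and> cky_equation g vol ?B ?Y (\<lambda>z a. - ?X z a) z" if z: "z \<in> U" for z
  proof -
    have dA: "(\<lambda>w. A w a b) differentiable (at z)" for a b by (rule smooth_on_differentiable[OF sA z])
    have dB: "(\<lambda>w. ?B w a b) differentiable (at z)" for a b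
      by (rule smooth_on_differentiable[OF smooth_hodge[OF sA vol] z])
    have N: "nabla2 g (self_dual g vol A) z c a b =
        (of_real (nabla2 g A z c a b) - \<i> * of_real (nabla2 g ?B z c a b)) / of_real (sqrt 2)" for c a b
      unfolding self_dual_def by (rule nabla2_complex_comb[OF dA dB])
    have R: "raise1 g (codifferential g (self_dual g vol A)) z d =
        (of_real (raise1 g ?X z d) - \<i> * of_real (raise1 g ?Y z d)) / of_real (sqrt 2)" for d
      by (rule raise1_complex_comb) (unfold self_dual_def, rule codifferential_complex_comb[OF dA dB])
    let ?G = "\<lambda>d c a b. g z d a * g z c b - g z d b * g z c a"
    let ?V = "volume_form vol z"
    have S: "2 * (\<Sum>d\<in>UNIV. raise1 g (codifferential g (self_dual g vol A)) z d * self_dual_metric g vol z d c a b) =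
       (of_real ((\<Sum>d\<in>UNIV. raise1 g ?X z d * ?G d c a b) - (\<Sum>d\<in>UNIV. raise1 g ?Y z d * ?V d c a b))
        - \<i> * of_real ((\<Sum>d\<in>UNIV. raise1 g ?Y z d * ?G d c a b) + (\<Sum>d\<in>UNIV. raise1 g ?X z d * ?V d c a b))) / of_real (sqrt 2)"
      for c a b
    proof -
      have "2 * (raise1 g (codifferential g (self_dual g vol A)) z d * self_dual_metric g vol z d c a b) =
         (of_real (raise1 g ?X z d * ?G d c a b - raise1 g ?Y z d * ?V d c a b)
        - \<i> * of_real (raise1 g ?Y z d * ?G d c a b + raise1 g ?X z d * ?V d c a b)) / of_real (sqrt 2)" for d
        unfolding R self_dual_metric_def by (simp add: field_simps)
      then show ?thesis
        by (simp add: sum_distrib_left sum_subtractf sum.distrib sum_divide_distrib[symmetric] distrib_left)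
    qed
    have neg: "raise1 g (\<lambda>z a. - ?X z a) z d = - raise1 g ?X z d" for d
      by (simp add: raise1_def sum_negf)
    have "(3 * nabla2 g (self_dual g vol A) z c a b =
        2 * (\<Sum>d\<in>UNIV. raise1 g (codifferential g (self_dual g vol A)) z d * self_dual_metric g vol z d c a b)) \<longleftrightarrow>
      3 * nabla2 g A z c a b = (\<Sum>d\<in>UNIV. raise1 g ?X z d * ?G d c a b) - (\<Sum>d\<in>UNIV. raise1 g ?Y z d * ?V d c a b) \<and>
      3 * nabla2 g ?B z c a b = (\<Sum>d\<in>UNIV. raise1 g ?Y z d * ?G d c a b) + (\<Sum>d\<in>UNIV. raise1 g ?X z d * ?V d c a b)" for c a b
    proof -
      have cancel: "3 * (x / s) = y / s \<longleftrightarrow> 3 * x = y" if "s \<noteq> 0" for x y s :: complex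
        using that by (simp add: field_simps)
      have "complex_of_real (sqrt 2) \<noteq> 0" by simp
      note C = cancel[OF this]
      show ?thesis unfolding S N C by (auto simp: complex_eq_iff)
    qed
    then show ?thesis
      unfolding cky_equation_def neg by (simp add: sum_negf) blast
  qed
  then show ?thesis using True by (simp add: conformal_killing_yano_def)
qed

lemma (in null_frame) matrix_nondegenerate: "det (\<chi> a b. G a b) \<noteq> 0"
proof -
  have "(\<chi> a b. G a b) = transpose (coframe_matrix l n p q) ** (coframe_matrix (\<lambda>a. - n a) (\<lambda>a. - l a) p q)"
    by (simp add: vec_eq_iff matrix_matrix_mult_def transpose_def sum_4 G_eq)
  moreover have "det (coframe_matrix (\<lambda>a. - n a) (\<lambda>a. - l a) p q) = - det (coframe_matrix l n p q)"
    unfolding det_4 by (simp add: algebra_simps)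
  ultimately show ?thesis using det_nz by (simp add: det_mul)
qed

context null_frame_at
begin

lemma pair_up [simp]:
  "pair (up w) l = pair L w" "pair (up w) n = pair N w" "pair (up w) p = pair P w" "pair (up w) q = pair Q w"
  by (simp_all add: up_def[abs_def])

lemma cky_equation_iff:
  "cky_equation g vol A X Y z \<longleftrightarrow> (\<forall>c a b. 3 * nabla2 g A z c a b =
     X z a * g z c b - X z b * g z c a
     - det4 (pair L (Y z)) (pair N (Y z)) (pair P (Y z)) (pair Q (Y z))
        (l c) (n c) (p c) (q c) (l a) (n a) (p a) (q a) (l b) (n b) (p b) (q b))"
proof -
  have 1: "(\<Sum>d\<in>UNIV. raise1 g X z d * g z d a) = X z a" for a
  proof -
    have "(\<Sum>d\<in>UNIV. raise1 g X z d * g z d a) = pair (up (X z)) (\<lambda>d. p d * p a + q d * q a - l d * n a - n d * l a)"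
      unfolding pair_def raise1_eq G_eq by (rule refl)
    also have "\<dots> = pair P (X z) * p a + pair Q (X z) * q a - pair L (X z) * n a - pair N (X z) * l a" by simp
    finally show ?thesis using expand[of "X z" a] by simp
  qed
  have "(\<Sum>d\<in>UNIV. raise1 g X z d * (g z d a * g z c b - g z d b * g z c a)) = X z a * g z c b - X z b * g z c a" for a b c
  proof -
    have "(\<Sum>d\<in>UNIV. raise1 g X z d * (g z d a * g z c b - g z d b * g z c a)) =
        (\<Sum>d\<in>UNIV. raise1 g X z d * g z d a) * g z c b - (\<Sum>d\<in>UNIV. raise1 g X z d * g z d b) * g z c a"
      by (simp add: right_diff_distrib sum_subtractf sum_distrib_right mult.assoc)
    then show ?thesis unfolding 1 .
  qed
  moreover have "(\<Sum>d\<in>UNIV. raise1 g Y z d * volume_form vol z d c a b) =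
      det4 (pair L (Y z)) (pair N (Y z)) (pair P (Y z)) (pair Q (Y z))
        (l c) (n c) (p c) (q c) (l a) (n a) (p a) (q a) (l b) (n b) (p b) (q b)" for c a b
    by (simp add: raise1_eq volume_form_eq[of vol z] sum_det4_1)
  ultimately show ?thesis unfolding cky_equation_def by simp
qed

end

section \<open>Null tetrads and their connection\<close>

locale null_tetrad =
  fixes V :: "(real^4) set" and g :: "real tensor2" and vol :: "real^4 \<Rightarrow> real"
    and l n p q :: "real tensor1"
  assumes open_V: "open V"
    and smooth: "\<And>a. smooth_on V (\<lambda>z. l z a)" "\<And>a. smooth_on V (\<lambda>z. n z a)"
      "\<And>a. smooth_on V (\<lambda>z. p z a)" "\<And>a. smooth_on V (\<lambda>z. q z a)"
    and smooth_vol: "smooth_on V vol"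
    and tetrad: "\<And>z. z \<in> V \<Longrightarrow> null_coframe (g z) (vol z) (l z) (n z) (p z) (q z)"
begin

lemma frame: "z \<in> V \<Longrightarrow> null_frame_at g vol z (l z) (n z) (p z) (q z)"
  by (simp add: null_frame_at_def null_frame_def tetrad)

lemma g_eq: "z \<in> V \<Longrightarrow> g z a b = p z a * p z b + q z a * q z b - l z a * n z b - n z a * l z b"
  using tetrad by (simp add: null_coframe_def)

sublocale smooth_metric V g
proof
  show "smooth_on V (\<lambda>z. g z a b)" for a b
    by (rule smooth_on_cong[OF open_V, where f="\<lambda>z. p z a * p z b + q z a * q z b - l z a * n z b - n z a * l z b"])
      (auto intro!: smooth_on_diff smooth_on_add smooth_on_mult open_V smooth simp: g_eq)
  show "det (metric_matrix g z) \<noteq> 0" if "z \<in> V" for z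
    using null_frame.matrix_nondegenerate[of "g z"] tetrad[OF that] by (simp add: metric_matrix_def null_frame_def)
qed (auto simp: open_V g_eq)

lemma differentiable:
  assumes "z \<in> V"
  shows "(\<lambda>z. l z a) differentiable (at z)" "(\<lambda>z. n z a) differentiable (at z)"
    "(\<lambda>z. p z a) differentiable (at z)" "(\<lambda>z. q z a) differentiable (at z)"
  using assms smooth smooth_on_differentiable by blast+

lemma tetrad_compatible:
  assumes z: "z \<in> V"
  shows "nabla1 g p z c a * p z b + p z a * nabla1 g p z c b + nabla1 g q z c a * q z b + q z a * nabla1 g q z c b
    - (nabla1 g l z c a * n z b + l z a * nabla1 g n z c b) - (nabla1 g n z c a * l z b + n z a * nabla1 g l z c b) = 0"
proof -
  let ?\<Gamma> = "\<lambda>\<theta> a. \<Sum>d\<in>UNIV. christoffel g z d c a * \<theta> z d"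
  have 1: "pd c (\<lambda>w. g w a b) z = pd c (\<lambda>w. p w a * p w b + q w a * q w b - l w a * n w b - n w a * l w b) z"
    by (rule pd_cong[OF open_V z g_eq])
  have 2: "(\<Sum>d\<in>UNIV. christoffel g z d c a * g z d b) = ?\<Gamma> p a * p z b + ?\<Gamma> q a * q z b - ?\<Gamma> l a * n z b - ?\<Gamma> n a * l z b"
    for a b
    by (simp add: g_eq[OF z] distrib_left right_diff_distrib sum.distrib sum_subtractf sum_distrib_right mult.assoc)
  have 3: "(\<Sum>d\<in>UNIV. christoffel g z d c b * g z a d) = (\<Sum>d\<in>UNIV. christoffel g z d c b * g z d a)"
    using sym_g[OF z, of a] by simp
  show ?thesis
    using metric_compatible[OF z, of c a b] differentiable[OF z]
    unfolding 1 2 3 nabla1_def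
    by (simp add: pd_add pd_diff pd_mult differentiable_mult differentiable_add differentiable_diff algebra_simps)
qed

text \<open>The hypothesis is the equation with sources \<open>\<alpha> l\<close> and
  \<open>\<beta> l\<close>; the arguments \<open>0 (-1) 0 0\<close> are the pairings of
  \<open>L\<close>, \<open>N\<close>, \<open>P\<close>, \<open>Q\<close> with \<open>l\<close>. With
  metric compatibility it fixes the connection up to \<open>s\<close> and \<open>t\<close>, the
  infinitesimal null rotations about \<open>l\<close>, which preserve
  \<open>l \<and> p\<close>.\<close>

lemma connection:
  assumes z: "z \<in> V"
    and eq: "\<And>c a b. 3 * nabla2 g (wedge l p) z c a b = \<alpha> * (l z a * g z c b - l z b * g z c a)
      - \<beta> * det4 0 (-1) 0 0 (l z c) (n z c) (p z c) (q z c) (l z a) (n z a) (p z a) (q z a) (l z b) (n z b) (p z b) (q z b)"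
  obtains s t where
    "\<And>c a. nabla1 g l z c a = ((\<alpha> * p z c - \<beta> * q z c) * l z a - l z c * (\<alpha> * p z a - \<beta> * q z a)) / 3"
    "\<And>c a. nabla1 g p z c a = - \<alpha> / 3 * l z c * n z a + (\<alpha> * q z c + \<beta> * p z c) / 3 * q z a - s c * l z a"
    "\<And>c a. nabla1 g q z c a = \<beta> / 3 * l z c * n z a - (\<alpha> * q z c + \<beta> * p z c) / 3 * p z a - t c * l z a"
    "\<And>c a. nabla1 g n z c a = - (\<alpha> * p z c - \<beta> * q z c) / 3 * n z a - s c * p z a - t c * q z a"
proof -
  interpret F: null_frame_at g vol z "l z" "n z" "p z" "q z" by (rule frame[OF z])
  let ?L = "F.L" and ?N = "F.N" and ?P = "F.P" and ?Q = "F.Q"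
  have A: "pair ?P (nabla1 g l z c) = - \<alpha> / 3 * l z c \<and> pair ?Q (nabla1 g l z c) = \<beta> / 3 * l z c \<and>
    pair ?L (nabla1 g l z c) = 0 \<and> pair ?N (nabla1 g l z c) = - (\<alpha> * p z c - \<beta> * q z c) / 3 \<and>
    pair ?L (nabla1 g p z c) = \<alpha> / 3 * l z c \<and> pair ?P (nabla1 g p z c) = 0 \<and>
    pair ?Q (nabla1 g p z c) = (\<alpha> * q z c + \<beta> * p z c) / 3 \<and>
    pair ?L (nabla1 g q z c) = - \<beta> / 3 * l z c \<and> pair ?P (nabla1 g q z c) = - (\<alpha> * q z c + \<beta> * p z c) / 3 \<and>
    pair ?Q (nabla1 g q z c) = 0 \<and>
    pair ?L (nabla1 g n z c) = (\<alpha> * p z c - \<beta> * q z c) / 3 \<and> pair ?N (nabla1 g n z c) = 0 \<and>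
    pair ?P (nabla1 g n z c) = - pair ?N (nabla1 g p z c) \<and> pair ?Q (nabla1 g n z c) = - pair ?N (nabla1 g q z c)" for c
  proof -
    have C: "pair X (\<lambda>a. pair Y (\<lambda>b. nabla1 g p z c a * p z b + p z a * nabla1 g p z c b + nabla1 g q z c a * q z b + q z a * nabla1 g q z c b
    - (nabla1 g l z c a * n z b + l z a * nabla1 g n z c b) - (nabla1 g n z c a * l z b + n z a * nabla1 g l z c b))) = 0" for X Y
      unfolding tetrad_compatible[OF z] by simp
    \<comment> \<open>Only the two form indices are contracted with frame vectors; the derivative
      index \<open>c\<close> stays free.\<close>
    have E: "pair X (\<lambda>a. pair Y (\<lambda>b. 3 * (nabla1 g l z c a * p z b + l z a * nabla1 g p z c b
      - (nabla1 g l z c b * p z a + l z b * nabla1 g p z c a)))) = pair X (\<lambda>a. pair Y (\<lambda>b. 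
      \<alpha> * (l z a * g z c b - l z b * g z c a)
      - \<beta> * det4 0 (-1) 0 0 (l z c) (n z c) (p z c) (q z c) (l z a) (n z a) (p z a) (q z a) (l z b) (n z b) (p z b) (q z b)))" for X Y
    proof -
      have "3 * (nabla1 g l z c a * p z b + l z a * nabla1 g p z c b - (nabla1 g l z c b * p z a + l z b * nabla1 g p z c a))
        = \<alpha> * (l z a * g z c b - l z b * g z c a)
      - \<beta> * det4 0 (-1) 0 0 (l z c) (n z c) (p z c) (q z c) (l z a) (n z a) (p z a) (q z a) (l z b) (n z b) (p z b) (q z b)" for a b
        using eq[of c a b] nabla2_wedge[where g=g and c=c and a=a and b=b, OF differentiable(1,3)[OF z]] by simp
      then show ?thesis by (simp only:)
    qed
    have compat: "pair ?L (nabla1 g l z c) = 0" "pair ?N (nabla1 g n z c) = 0" "pair ?P (nabla1 g p z c) = 0" "pair ?Q (nabla1 g q z c) = 0"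
      "pair ?L (nabla1 g n z c) + pair ?N (nabla1 g l z c) = 0" "pair ?L (nabla1 g p z c) + pair ?P (nabla1 g l z c) = 0"
      "pair ?L (nabla1 g q z c) + pair ?Q (nabla1 g l z c) = 0" "pair ?N (nabla1 g p z c) + pair ?P (nabla1 g n z c) = 0"
      "pair ?N (nabla1 g q z c) + pair ?Q (nabla1 g n z c) = 0" "pair ?P (nabla1 g q z c) + pair ?Q (nabla1 g p z c) = 0"
      using C[of ?L ?L] C[of ?N ?N] C[of ?P ?P] C[of ?Q ?Q] C[of ?L ?N] C[of ?L ?P] C[of ?L ?Q] C[of ?N ?P] C[of ?N ?Q] C[of ?P ?Q]
      by (simp_all add: algebra_simps)
    have eqs: "3 * pair ?N (nabla1 g l z c) = - (\<alpha> * p z c - \<beta> * q z c)" "3 * pair ?L (nabla1 g p z c) = \<alpha> * l z c"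
      "3 * pair ?Q (nabla1 g l z c) = \<beta> * l z c" "3 * pair ?Q (nabla1 g p z c) = \<alpha> * q z c + \<beta> * p z c"
      using E[of ?N ?P] E[of ?L ?N] E[of ?P ?Q] E[of ?N ?Q] compat
      by (simp_all add: F.G_eq det4_def algebra_simps)
    show ?thesis using compat eqs by simp
  qed
  show ?thesis
  proof (rule that[of "\<lambda>c. pair ?N (nabla1 g p z c)" "\<lambda>c. pair ?N (nabla1 g q z c)"])
    fix c a
    show "nabla1 g l z c a = ((\<alpha> * p z c - \<beta> * q z c) * l z a - l z c * (\<alpha> * p z a - \<beta> * q z a)) / 3"
      using F.expand[of "nabla1 g l z c" a] A[of c] by (simp add: field_simps)
    show "nabla1 g p z c a = - \<alpha> / 3 * l z c * n z a + (\<alpha> * q z c + \<beta> * p z c) / 3 * q z a - pair ?N (nabla1 g p z c) * l z a"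
      using F.expand[of "nabla1 g p z c" a] A[of c] by (simp add: field_simps)
    show "nabla1 g q z c a = \<beta> / 3 * l z c * n z a - (\<alpha> * q z c + \<beta> * p z c) / 3 * p z a - pair ?N (nabla1 g q z c) * l z a"
      using F.expand[of "nabla1 g q z c" a] A[of c] by (simp add: field_simps)
    show "nabla1 g n z c a = - (\<alpha> * p z c - \<beta> * q z c) / 3 * n z a - pair ?N (nabla1 g p z c) * p z a - pair ?N (nabla1 g q z c) * q z a"
      using F.expand[of "nabla1 g n z c" a] A[of c] by (simp add: field_simps)
  qed
qed

end

subsection \<open>Curvature of the adapted tetrad\<close>

definition wdg :: "(4 \<Rightarrow> real) \<Rightarrow> (4 \<Rightarrow> real) \<Rightarrow> 4 \<Rightarrow> 4 \<Rightarrow> real" where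
  "wdg x y a b = x a * y b - x b * y a"

text \<open>A scalar times a product of two forms. The connection formulas below are written as sums
  of such terms, even with signs like \<open>+ - \<gamma> * ...\<close>, so that this rule and
  \<open>nabla2_add\<close> differentiate them.\<close>

lemma nabla2_term:
  fixes \<theta> \<theta>' :: "real tensor1"
  assumes "f differentiable (at z)" "\<And>a. (\<lambda>w. \<theta> w a) differentiable (at z)" "\<And>a. (\<lambda>w. \<theta>' w a) differentiable (at z)"
  shows "nabla2 g (\<lambda>w a b. f w * (\<theta> w a * \<theta>' w b)) z c a b =
    pd c f z * (\<theta> z a * \<theta>' z b) + f z * (nabla1 g \<theta> z c a * \<theta>' z b + \<theta> z a * nabla1 g \<theta>' z c b)"
  using nabla2_scale[of f z "tensor_prod \<theta> \<theta>'" g c a b] nabla2_tensor_prod[of \<theta> z \<theta>' g c a b] assms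
  by (simp add: tensor_prod_def differentiable_mult)

context null_frame_at
begin

definition "mtrace T = (\<Sum>c\<in>UNIV. \<Sum>a\<in>UNIV. inv_metric g z c a * T c a)"

lemma mtrace_linear [simp]:
  "mtrace (\<lambda>c a. T c a + S c a) = mtrace T + mtrace S"
  "mtrace (\<lambda>c a. T c a - S c a) = mtrace T - mtrace S"
  by (simp_all add: mtrace_def distrib_left right_diff_distrib sum.distrib sum_subtractf)

lemma mtrace_scale [simp]: "mtrace (\<lambda>c a. k * T c a) = k * mtrace T" "mtrace (\<lambda>c a. T c a * k) = k * mtrace T"
  by (simp_all add: mtrace_def sum_distrib_left mult_ac)

lemma mtrace_prod: "mtrace (\<lambda>c a. x c * y a) = pair (up y) x"
proof -
  have "mtrace (\<lambda>c a. x c * y a) = (\<Sum>c\<in>UNIV. x c * (\<Sum>a\<in>UNIV. inv_metric g z c a * y a))"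
    by (simp add: mtrace_def sum_distrib_left mult_ac)
  also have "\<dots> = pair (up y) x"
    unfolding sum_inv_metric by (simp add: pair_def mult.commute)
  finally show ?thesis .
qed

lemma codifferential_trace: "codifferential g A z b = - mtrace (\<lambda>c a. nabla2 g A z c a b)"
  for A :: "real tensor2"
  by (simp add: codifferential_def mtrace_def)

end

section \<open>Structure equations and curvature\<close>

context null_tetrad
begin

text \<open>Cartan's equations for \<open>l = du / \<omega>^2\<close>, \<open>n = dv + H du\<close>,
  \<open>p = dx / \<omega>\<close>, \<open>q = dy / \<omega>\<close>. Here
  \<open>dn = dH \<and> du\<close>, so \<open>\<mu>\<close> and \<open>\<nu>\<close> stand for
  \<open>\<omega>^3 H_x\<close> and \<open>\<omega>^3 H_y\<close>.\<close>

definition structure_equations :: "real \<Rightarrow> (real^4 \<Rightarrow> real) \<Rightarrow> (real^4 \<Rightarrow> real) \<Rightarrow> bool" where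
  "structure_equations \<gamma> \<mu> \<nu> \<longleftrightarrow> (\<forall>z\<in>V. \<forall>a b.
     pd a (\<lambda>w. l w b) z - pd b (\<lambda>w. l w a) z = - 2 * \<gamma> * wdg (p z) (l z) a b \<and>
     pd a (\<lambda>w. p w b) z - pd b (\<lambda>w. p w a) z = 0 \<and>
     pd a (\<lambda>w. q w b) z - pd b (\<lambda>w. q w a) z = - \<gamma> * wdg (p z) (q z) a b \<and>
     pd a (\<lambda>w. n w b) z - pd b (\<lambda>w. n w a) z = - \<mu> z * wdg (l z) (p z) a b - \<nu> z * wdg (l z) (q z) a b)"

text \<open>A torsion-free metric connection is unique, so it suffices to verify candidates whose
  antisymmetric parts are the structure equations. The verification takes place on Christoffel
  symbols with lowered index.\<close>

lemma adapted_connection: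
  assumes S: "structure_equations \<gamma> \<mu> \<nu>" and z: "z \<in> V"
  shows "nabla1 g l z a b = - \<gamma> * (p z a * l z b) + \<gamma> * (l z a * p z b)"
    and "nabla1 g p z a b = \<gamma> * (l z a * n z b) + \<gamma> * (n z a * l z b) + - \<gamma> * (q z a * q z b) + - \<mu> z * (l z a * l z b)"
    and "nabla1 g q z a b = \<gamma> * (q z a * p z b) + - \<nu> z * (l z a * l z b)"
    and "nabla1 g n z a b = \<gamma> * (p z a * n z b) + \<gamma> * (n z a * p z b) + - \<mu> z * (l z a * p z b) + - \<nu> z * (l z a * q z b)"
proof -
  interpret F: null_frame_at g vol z "l z" "n z" "p z" "q z" by (rule frame[OF z])
  define Nl where "Nl = (\<lambda>a b. - \<gamma> * (p z a * l z b) + \<gamma> * (l z a * p z b))"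
  define Np where "Np = (\<lambda>a b. \<gamma> * (l z a * n z b) + \<gamma> * (n z a * l z b) + - \<gamma> * (q z a * q z b) + - \<mu> z * (l z a * l z b))"
  define Nq where "Nq = (\<lambda>a b. \<gamma> * (q z a * p z b) + - \<nu> z * (l z a * l z b))"
  define Nn where "Nn = (\<lambda>a b. \<gamma> * (p z a * n z b) + \<gamma> * (n z a * p z b) + - \<mu> z * (l z a * p z b) + - \<nu> z * (l z a * q z b))"
  have pg: "pd c (\<lambda>w. g w a b) z = 
      p z a * pd c (\<lambda>w. p w b) z + pd c (\<lambda>w. p w a) z * p z b + q z a * pd c (\<lambda>w. q w b) z + pd c (\<lambda>w. q w a) z * q z b
      - (l z a * pd c (\<lambda>w. n w b) z + pd c (\<lambda>w. l w a) z * n z b) - (n z a * pd c (\<lambda>w. l w b) z + pd c (\<lambda>w. n w a) z * l z b)" for a b c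
  proof -
    have "pd c (\<lambda>w. g w a b) z = pd c (\<lambda>w. p w a * p w b + q w a * q w b - l w a * n w b - n w a * l w b) z"
      by (rule pd_cong[OF open_V z g_eq])
    then show ?thesis using differentiable[OF z]
      by (simp add: pd_add pd_diff pd_mult differentiable_mult differentiable_add differentiable_diff)
  qed
  \<comment> \<open>What the lowered Christoffel symbols must be if the four candidates are right:
    each covariant derivative is a partial derivative minus a Christoffel contraction, and
    \<open>g\<close> is a sum of products of the forms. Pairing with a frame vector then isolates
    one form.\<close>
  let ?K = "\<lambda>d. p z d * (pd a (\<lambda>w. p w b) z - Np a b) + q z d * (pd a (\<lambda>w. q w b) z - Nq a b)
      - l z d * (pd a (\<lambda>w. n w b) z - Nn a b) - n z d * (pd a (\<lambda>w. l w b) z - Nl a b)"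
  have K: "(\<Sum>c\<in>UNIV. g z d c * christoffel g z c a b) = ?K d" for d
  proof -
    have sl: "pd j (\<lambda>w. l w i) z = pd i (\<lambda>w. l w j) z + 2 * \<gamma> * wdg (p z) (l z) i j" for i j
      using S[unfolded structure_equations_def, rule_format, OF z, of i j] by linarith
    have sp: "pd j (\<lambda>w. p w i) z = pd i (\<lambda>w. p w j) z" for i j
      using S[unfolded structure_equations_def, rule_format, OF z, of i j] by linarith
    have sq: "pd j (\<lambda>w. q w i) z = pd i (\<lambda>w. q w j) z + \<gamma> * wdg (p z) (q z) i j" for i j
      using S[unfolded structure_equations_def, rule_format, OF z, of i j] by linarith
    have sn: "pd j (\<lambda>w. n w i) z = pd i (\<lambda>w. n w j) z + \<mu> z * wdg (l z) (p z) i j + \<nu> z * wdg (l z) (q z) i j" for i j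
      using S[unfolded structure_equations_def, rule_format, OF z, of i j] by linarith
    show ?thesis
      unfolding lower_christoffel[OF z] pg Nl_def Np_def Nq_def Nn_def
        sl[of b a] sl[of d a] sl[of d b] sp[of b a] sp[of d a] sp[of d b]
        sq[of b a] sq[of d a] sq[of d b] sn[of b a] sn[of d a] sn[of d b] wdg_def
      by (simp add: field_simps)
  qed
  have C: "(\<Sum>c\<in>UNIV. pair X (\<lambda>d. g z d c) * christoffel g z c a b) = pair X ?K" for X
    unfolding K[symmetric] pair_def
    by (simp add: sum_distrib_left sum_distrib_right mult.assoc) (rule sum.swap)
  have gX: "pair X (\<lambda>d. g z d c) = pair X (p z) * p z c + pair X (q z) * q z c - pair X (l z) * n z c - pair X (n z) * l z c" for X c
    by (simp add: F.G_eq)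
  show "nabla1 g l z a b = - \<gamma> * (p z a * l z b) + \<gamma> * (l z a * p z b)"
    using C[of F.L] unfolding gX by (simp add: nabla1_def Nl_def mult.commute)
  show "nabla1 g p z a b = \<gamma> * (l z a * n z b) + \<gamma> * (n z a * l z b) + - \<gamma> * (q z a * q z b) + - \<mu> z * (l z a * l z b)"
    using C[of F.P] unfolding gX by (simp add: nabla1_def Np_def mult.commute)
  show "nabla1 g q z a b = \<gamma> * (q z a * p z b) + - \<nu> z * (l z a * l z b)"
    using C[of F.Q] unfolding gX by (simp add: nabla1_def Nq_def mult.commute)
  show "nabla1 g n z a b = \<gamma> * (p z a * n z b) + \<gamma> * (n z a * p z b) + - \<mu> z * (l z a * p z b) + - \<nu> z * (l z a * q z b)"
    using C[of F.N] unfolding gX by (simp add: nabla1_def Nn_def mult.commute)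
qed

text \<open>\<open>K\<close> is the curvature tensor of constant curvature
  \<open>- \<gamma>\<^sup>2\<close>. The shifts \<open>4 * \<gamma> * \<mu> z\<close>,
  \<open>3 * \<gamma> * \<nu> z\<close> and \<open>\<gamma> * \<mu> z\<close> absorb the connection
  terms, so that \<open>hpp\<close>, \<open>hpq\<close>, \<open>hqq\<close> are exactly the
  remaining components. That the same \<open>hpq\<close> occurs in both hypotheses reflects
  \<open>d(dn) = 0\<close>.\<close>

lemma adapted_riemann:
  assumes S: "structure_equations \<gamma> \<mu> \<nu>" and z: "z \<in> V"
    and sm: "smooth_on V \<mu>" "smooth_on V \<nu>"
    and d\<mu>: "\<And>c. pd c \<mu> z = (hpp + 4 * \<gamma> * \<mu> z) * p z c + hpq * q z c + m * l z c"
    and d\<nu>: "\<And>c. pd c \<nu> z = (hpq + 3 * \<gamma> * \<nu> z) * p z c + (hqq + \<gamma> * \<mu> z) * q z c + m' * l z c"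
  defines "K \<equiv> \<lambda>x b c d. - \<gamma>\<^sup>2 * (x c * g z b d - x d * g z b c)"
    and "hp \<equiv> \<lambda>c d. hpp * wdg (l z) (p z) c d + hpq * wdg (l z) (q z) c d"
    and "hq \<equiv> \<lambda>c d. hpq * wdg (l z) (p z) c d + hqq * wdg (l z) (q z) c d"
  shows "(\<Sum>a\<in>UNIV. l z a * riemann_up g z a b c d) = K (l z) b c d"
    and "(\<Sum>a\<in>UNIV. p z a * riemann_up g z a b c d) = K (p z) b c d - l z b * hp c d"
    and "(\<Sum>a\<in>UNIV. q z a * riemann_up g z a b c d) = K (q z) b c d - l z b * hq c d"
    and "(\<Sum>a\<in>UNIV. n z a * riemann_up g z a b c d) = K (n z) b c d - p z b * hp c d - q z b * hq c d"
proof -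
  note D = differentiable[OF z]
  have dm: "\<mu> differentiable (at z)" "\<nu> differentiable (at z)"
    using smooth_on_differentiable[OF _ z] sm by auto
  note conn = adapted_connection[OF S]
  have neg: "pd c (\<lambda>w. - \<mu> w) z = - pd c \<mu> z" "pd c (\<lambda>w. - \<nu> w) z = - pd c \<nu> z" for c
    using dm by (simp_all add: pd_minus)
  note expand = nabla2_add nabla2_term D dm differentiable_add differentiable_mult differentiable_minus differentiable_const
    pd_const neg
  note simps = conn[OF z] d\<mu> d\<nu> wdg_def g_eq[OF z] power2_eq_square
  have l2: "nabla2 g (nabla1 g l) z c a b = nabla2 g (\<lambda>z a b. - \<gamma> * (p z a * l z b) + \<gamma> * (l z a * p z b)) z c a b" for a b c
    by (rule nabla2_cong[OF open_V z conn(1)])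
  have p2: "nabla2 g (nabla1 g p) z c a b = nabla2 g (\<lambda>z a b. \<gamma> * (l z a * n z b) + \<gamma> * (n z a * l z b) + - \<gamma> * (q z a * q z b) + - \<mu> z * (l z a * l z b)) z c a b" for a b c
    by (rule nabla2_cong[OF open_V z conn(2)])
  have q2: "nabla2 g (nabla1 g q) z c a b = nabla2 g (\<lambda>z a b. \<gamma> * (q z a * p z b) + - \<nu> z * (l z a * l z b)) z c a b" for a b c
    by (rule nabla2_cong[OF open_V z conn(3)])
  have n2: "nabla2 g (nabla1 g n) z c a b = nabla2 g (\<lambda>z a b. \<gamma> * (p z a * n z b) + \<gamma> * (n z a * p z b) + - \<mu> z * (l z a * p z b) + - \<nu> z * (l z a * q z b)) z c a b" for a b c
    by (rule nabla2_cong[OF open_V z conn(4)])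
  show "(\<Sum>a\<in>UNIV. l z a * riemann_up g z a b c d) = K (l z) b c d"
    unfolding ricci_identity[OF z smooth(1)] l2 K_def by (simp only: expand) (simp add: simps algebra_simps)
  show "(\<Sum>a\<in>UNIV. p z a * riemann_up g z a b c d) = K (p z) b c d - l z b * hp c d"
    unfolding ricci_identity[OF z smooth(3)] p2 K_def hp_def by (simp only: expand) (simp add: simps algebra_simps)
  show "(\<Sum>a\<in>UNIV. q z a * riemann_up g z a b c d) = K (q z) b c d - l z b * hq c d"
    unfolding ricci_identity[OF z smooth(4)] q2 K_def hq_def by (simp only: expand) (simp add: simps algebra_simps)
  show "(\<Sum>a\<in>UNIV. n z a * riemann_up g z a b c d) = K (n z) b c d - p z b * hp c d - q z b * hq c d"
    unfolding ricci_identity[OF z smooth(2)] n2 K_def hp_def hq_def by (simp only: expand) (simp add: simps algebra_simps)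
qed

end

lemma (in null_frame_at) hodge_l_wdg:
  assumes "\<And>a b. A z a b = c2 * wdg l p a b + c3 * wdg l q a b"
  shows "hodge g vol A z a b = c3 * wdg l p a b - c2 * wdg l q a b"
  using hodge_frame[of A 0 c2 c3 0 0 0 a b] assms by (simp add: wdg_def)

context null_tetrad
begin

context
  fixes \<gamma> :: real and \<mu> \<nu> :: "real^4 \<Rightarrow> real" and z :: "real^4" and hpp hpq hqq m m' :: real
  assumes S: "structure_equations \<gamma> \<mu> \<nu>" and z: "z \<in> V"
    and sm: "smooth_on V \<mu>" "smooth_on V \<nu>"
    and d\<mu>: "\<And>c. pd c \<mu> z = (hpp + 4 * \<gamma> * \<mu> z) * p z c + hpq * q z c + m * l z c"
    and d\<nu>: "\<And>c. pd c \<nu> z = (hpq + 3 * \<gamma> * \<nu> z) * p z c + (hqq + \<gamma> * \<mu> z) * q z c + m' * l z c"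
begin

interpretation F: null_frame_at g vol z "l z" "n z" "p z" "q z" by (rule frame[OF z])

lemmas riem = adapted_riemann[OF S z sm d\<mu> d\<nu>]

lemma adapted_ricci: "ricci g z b d = (hpp + hqq) * l z b * l z d + - 3 * \<gamma>\<^sup>2 * g z b d"
proof -
  let ?R = "\<lambda>\<theta> c. \<Sum>a\<in>UNIV. \<theta> a * riemann_up g z a b c d"
  \<comment> \<open>The Kronecker delta is inserted and resolved by \<open>complete\<close>, so that
    the trace becomes a sum of the four contractions in \<open>riem\<close>.\<close>
  have "ricci g z b d = (\<Sum>a\<in>UNIV. \<Sum>c\<in>UNIV. (if c = a then 1 else 0) * riemann_up g z a b c d)"
    by (simp add: ricci_def if_distrib[where f="\<lambda>x. x * _"] cong: if_cong)
  also have "\<dots> = (\<Sum>a\<in>UNIV. \<Sum>c\<in>UNIV. (F.P c * p z a + F.Q c * q z a - F.L c * n z a - F.N c * l z a) * riemann_up g z a b c d)"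
    unfolding F.complete ..
  also have "\<dots> = (\<Sum>c\<in>UNIV. F.P c * ?R (p z) c + F.Q c * ?R (q z) c - F.L c * ?R (n z) c - F.N c * ?R (l z) c)"
    by (subst sum.swap)
      (simp add: sum_distrib_left distrib_right left_diff_distrib sum.distrib sum_subtractf mult.assoc)
  also have "\<dots> = pair F.P (?R (p z)) + pair F.Q (?R (q z)) - pair F.L (?R (n z)) - pair F.N (?R (l z))"
    by (simp add: pair_def sum.distrib sum_subtractf)
  also have "\<dots> = (hpp + hqq) * l z b * l z d + - 3 * \<gamma>\<^sup>2 * g z b d"
    unfolding riem wdg_def g_eq[OF z] by (simp add: algebra_simps)
  finally show ?thesis .
qed

text \<open>As \<open>l\<close> is null, only the four copies of
  \<open>- 3 * \<gamma>\<^sup>2\<close> contribute.\<close>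

lemma adapted_scalar_curvature: "scalar_curvature g z = - 12 * \<gamma>\<^sup>2"
proof -
  have "scalar_curvature g z = F.mtrace (\<lambda>b d. (hpp + hqq) * (l z b * l z d) + - 3 * \<gamma>\<^sup>2 *
      (p z b * p z d + q z b * q z d - l z b * n z d - n z b * l z d))"
    unfolding scalar_curvature_def adapted_ricci F.mtrace_def g_eq[OF z] by (simp add: mult.assoc)
  also have "\<dots> = - 12 * \<gamma>\<^sup>2" by (simp only: F.mtrace_linear F.mtrace_scale F.mtrace_prod) simp
  finally show ?thesis .
qed

text \<open>Removing the traces cancels the constant curvature part and reduces the symmetric matrix
  with entries \<open>hpp\<close>, \<open>hpq\<close>, \<open>hqq\<close> to its trace-free
  part.\<close>

lemma adapted_weyl: "weyl g z a b c d =
    (hpp - hqq) / 2 * (wdg (l z) (p z) a b * wdg (l z) (p z) c d - wdg (l z) (q z) a b * wdg (l z) (q z) c d)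
    + hpq * (wdg (l z) (p z) a b * wdg (l z) (q z) c d + wdg (l z) (q z) a b * wdg (l z) (p z) c d)"
proof -
  let ?R = "\<lambda>\<theta>. \<Sum>e\<in>UNIV. \<theta> e * riemann_up g z e b c d"
  have "riemann g z a b c d = p z a * ?R (p z) + q z a * ?R (q z) - l z a * ?R (n z) - n z a * ?R (l z)"
    by (simp add: riemann_def g_eq[OF z] distrib_right left_diff_distrib sum.distrib sum_subtractf
        sum_distrib_left mult.assoc)
  then show ?thesis
    unfolding weyl_def adapted_ricci adapted_scalar_curvature riem wdg_def g_eq[OF z]
    by (simp add: field_simps)
qed

text \<open>A trace-free real quadratic form in \<open>l \<and> p\<close> and
  \<open>l \<and> q\<close> is the real part of a complex multiple of the square of
  \<open>l \<and> p + \<i> l \<and> q\<close>, and the self-dual projection singles out that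
  square.\<close>

lemma adapted_self_dual_weyl: "self_dual_weyl g vol z a b c d =
    ((of_real (hpp - hqq) - 2 * \<i> * of_real hpq) / 2) *
    ((of_real (wdg (l z) (p z) a b) + \<i> * of_real (wdg (l z) (q z) a b)) / of_real (sqrt 2)) *
    ((of_real (wdg (l z) (p z) c d) + \<i> * of_real (wdg (l z) (q z) c d)) / of_real (sqrt 2))"
proof -
  let ?p = "wdg (l z) (p z)" and ?q = "wdg (l z) (q z)"
  have "hodge g vol (\<lambda>w a b. weyl g w a b c d) z a b =
      (- (hpp - hqq) / 2 * ?q c d + hpq * ?p c d) * ?p a b - ((hpp - hqq) / 2 * ?p c d + hpq * ?q c d) * ?q a b"
    by (rule F.hodge_l_wdg) (simp add: adapted_weyl algebra_simps add_divide_distrib diff_divide_distrib)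
  moreover have "complex_of_real (sqrt 2) * of_real (sqrt 2) = 2"
    by (simp flip: of_real_mult)
  ultimately show ?thesis
    unfolding self_dual_weyl_def adapted_weyl
    by (simp add: field_simps complex_eq_iff)
qed

end

lemma wedge_l_derivative:
  assumes S: "structure_equations \<gamma> \<mu> \<nu>" and z: "z \<in> V"
  shows "nabla2 g (wedge l p) z c a b = - \<gamma> * (l z a * g z c b - l z b * g z c a)"
    and "nabla2 g (wedge l q) z c a b =
      - \<gamma> * (p z c * wdg (l z) (q z) a b) + \<gamma> * (l z c * wdg (p z) (q z) a b) + \<gamma> * (q z c * wdg (l z) (p z) a b)"
  by (simp_all add: nabla2_wedge differentiable[OF z] adapted_connection[OF S z] wdg_def g_eq[OF z] algebra_simps)

text \<open>The dual of \<open>l \<and> p\<close> is \<open>- l \<and> q\<close>, whose own dual is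
  \<open>- l \<and> p\<close>. Their codifferentials are 0 and \<open>3 * \<gamma>\<close> times
  \<open>l\<close>, and with these sources both real equations become algebraic identities in the
  coframe.\<close>

lemma adapted_killing_yano:
  assumes S: "structure_equations \<gamma> \<mu> \<nu>"
  shows "killing_yano V g vol (hodge g vol (wedge l p))"
proof -
  let ?C = "hodge g vol (wedge l p)"
  have C: "?C z a b = - wedge l q z a b" if "z \<in> V" for z a b
  proof -
    interpret F: null_frame_at g vol z "l z" "n z" "p z" "q z" by (rule frame[OF that])
    show ?thesis using F.hodge_l_wdg[of "wedge l p" 1 0 a b] by (simp add: wdg_def wedge_def)
  qed
  have HC: "hodge g vol ?C z a b = - wedge l p z a b" if "z \<in> V" for z a b
  proof -
    interpret F: null_frame_at g vol z "l z" "n z" "p z" "q z" by (rule frame[OF that])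
    show ?thesis using F.hodge_l_wdg[of ?C 0 "-1" a b] C[OF that] by (simp add: wdg_def wedge_def)
  qed
  have wd: "(\<lambda>w. wedge l p w a b) differentiable (at z)" "(\<lambda>w. wedge l q w a b) differentiable (at z)" if "z \<in> V" for z a b
    unfolding wedge_def using differentiable[OF that] by (auto intro: differentiable_diff differentiable_mult)
  have neg: "nabla2 g (\<lambda>z a b. - A z a b) z c a b = - nabla2 g A z c a b"
    if "\<And>a b. (\<lambda>w. A w a b) differentiable (at z)" for A :: "real tensor2" and z c a b
    using nabla2_scale[of "\<lambda>_. -1" z A g c a b] that by simp
  have nC: "nabla2 g ?C z c a b = - nabla2 g (wedge l q) z c a b" if "z \<in> V" for z c a b
    using nabla2_cong[OF open_V that C] neg[of "wedge l q", OF wd(2)[OF that]] by simp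
  have nHC: "nabla2 g (hodge g vol ?C) z c a b = - nabla2 g (wedge l p) z c a b" if "z \<in> V" for z c a b
    using nabla2_cong[OF open_V that HC] neg[of "wedge l p", OF wd(1)[OF that]] by simp
  have dC: "codifferential g ?C z b = 0" if z: "z \<in> V" for z b
  proof -
    interpret F: null_frame_at g vol z "l z" "n z" "p z" "q z" by (rule frame[OF z])
    have "codifferential g ?C z b = - F.mtrace (\<lambda>c a. \<gamma> * ((p z c * l z a) * q z b) - \<gamma> * ((p z c * q z a) * l z b)
       - (\<gamma> * ((l z c * p z a) * q z b) - \<gamma> * ((l z c * q z a) * p z b))
       - (\<gamma> * ((q z c * l z a) * p z b) - \<gamma> * ((q z c * p z a) * l z b)))"
      unfolding F.codifferential_trace nC[OF z] wedge_l_derivative[OF S z] wdg_def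
      by (simp add: algebra_simps)
    also have "\<dots> = 0" by (simp only: F.mtrace_linear F.mtrace_scale F.mtrace_prod) simp
    finally show ?thesis .
  qed
  have dHC: "codifferential g (hodge g vol ?C) z b = 3 * \<gamma> * l z b" if z: "z \<in> V" for z b
  proof -
    interpret F: null_frame_at g vol z "l z" "n z" "p z" "q z" by (rule frame[OF z])
    have "codifferential g (hodge g vol ?C) z b = - F.mtrace (\<lambda>c a. 
        \<gamma> * ((p z c * l z a) * p z b) + \<gamma> * ((q z c * l z a) * q z b) - \<gamma> * ((l z c * l z a) * n z b) - \<gamma> * ((n z c * l z a) * l z b)
       - \<gamma> * ((p z c * p z a) * l z b) - \<gamma> * ((q z c * q z a) * l z b) + \<gamma> * ((l z c * n z a) * l z b) + \<gamma> * ((n z c * l z a) * l z b))"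
      unfolding F.codifferential_trace nHC[OF z] wedge_l_derivative[OF S z] g_eq[OF z]
      by (simp add: algebra_simps)
    also have "\<dots> = 3 * \<gamma> * l z b"
      by (simp only: F.mtrace_linear F.mtrace_scale F.mtrace_prod) simp
    finally show ?thesis .
  qed
  have "two_form V ?C"
  proof -
    have "smooth_on V (\<lambda>z. wedge l p z a b)" for a b
      unfolding wedge_def by (intro smooth_on_diff smooth_on_mult open_V smooth)
    then show ?thesis
      using smooth_hodge smooth_vol C by (auto simp: two_form_def wedge_def)
  qed
  moreover have "cky_equation g vol ?C (codifferential g ?C) (codifferential g (hodge g vol ?C)) z \<and>
      cky_equation g vol (hodge g vol ?C) (codifferential g (hodge g vol ?C)) (\<lambda>z a. - codifferential g ?C z a) z" if z: "z \<in> V" for z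
  proof -
    interpret F: null_frame_at g vol z "l z" "n z" "p z" "q z" by (rule frame[OF z])
    have Y: "codifferential g (hodge g vol ?C) z = (\<lambda>b. 3 * \<gamma> * l z b)" using dHC[OF z] by auto
    have X: "codifferential g ?C z = (\<lambda>b. 0)" using dC[OF z] by auto
    show ?thesis
      unfolding F.cky_equation_iff X Y nC[OF z] nHC[OF z] wedge_l_derivative[OF S z]
      by (simp add: det4_def wdg_def algebra_simps)
  qed
  ultimately show ?thesis
    unfolding killing_yano_def conformal_killing_yano_iff[OF smooth_vol] using dC by blast
qed

lemma self_dual_wedge_l_p:
  assumes z: "z \<in> V"
  shows "self_dual g vol (wedge l p) z a b = (of_real (wdg (l z) (p z) a b) + \<i> * of_real (wdg (l z) (q z) a b)) / of_real (sqrt 2)"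
proof -
  interpret F: null_frame_at g vol z "l z" "n z" "p z" "q z" by (rule frame[OF z])
  have H: "hodge g vol (wedge l p) z a b = - wdg (l z) (q z) a b"
    using F.hodge_l_wdg[of "wedge l p" 1 0 a b] by (simp add: wdg_def wedge_def)
  show ?thesis unfolding self_dual_def H by (simp add: wdg_def wedge_def right_diff_distrib)
qed

end

subsection \<open>Curvature in adapted coordinates\<close>

lemma det_null_metric:
  assumes "\<And>a b. G a b = p a * p b + q a * q b - l a * n b - n a * l b"
  shows "det (\<chi> a b. G a b) = - (det (coframe_matrix l n p q))\<^sup>2"
proof -
  have "(\<chi> a b. G a b) = transpose (coframe_matrix l n p q) ** (coframe_matrix (\<lambda>a. - n a) (\<lambda>a. - l a) p q)"
    by (simp add: vec_eq_iff matrix_matrix_mult_def transpose_def sum_4 assms)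
  moreover have "det (coframe_matrix (\<lambda>a. - n a) (\<lambda>a. - l a) p q) = - det (coframe_matrix l n p q)"
    unfolding det_4 by (simp add: algebra_simps)
  ultimately show ?thesis by (simp add: det_mul power2_eq_square)
qed

text \<open>The metric fixes the determinant of the coframe up to sign; the orientation inequality
  selects the sign.\<close>

lemma null_coframeI:
  assumes "\<And>a b. G a b = p a * p b + q a * q b - l a * n b - n a * l b"
    and "v\<^sup>2 = - det (\<chi> a b. G a b)" "0 < v * det (coframe_matrix l n p q)"
  shows "null_coframe G v l n p q"
proof -
  have "v\<^sup>2 = (det (coframe_matrix l n p q))\<^sup>2"
    using assms(2) det_null_metric[OF assms(1)] by simp
  then have "v = det (coframe_matrix l n p q) \<or> v = - det (coframe_matrix l n p q)"
    by (simp add: power2_eq_iff)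
  moreover have "v \<noteq> - det (coframe_matrix l n p q)"
    using assms(3) by (auto simp: mult_less_0_iff zero_less_mult_iff)
  moreover have "v \<noteq> 0" using assms(3) by auto
  ultimately show ?thesis using assms(1) by (simp add: null_coframe_def)
qed

lemma det_coframe_rescale:
  "det (coframe_matrix (\<lambda>a. i\<^sup>2 * u a) (\<lambda>a. v a + k * u a) (\<lambda>a. i * x a) (\<lambda>a. i * y a)) =
    i ^ 4 * det (coframe_matrix u v x y)"
  unfolding det_4 by (simp add: algebra_simps power2_eq_square eval_nat_numeral)

lemma smooth_on_vector_3:
  assumes "smooth_on V u" "smooth_on V x" "smooth_on V y"
  shows "smooth_on V (\<lambda>z. (vector [u z, x z, y z] :: real^3) $ j)"
  using exhaust_3[of j] assms by auto

lemma smooth_on_vector_4: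
  assumes "smooth_on V u" "smooth_on V v" "smooth_on V x" "smooth_on V y"
  shows "smooth_on V (\<lambda>z. (vector [u z, v z, x z, y z] :: real^4) $ j)"
  using exhaust_4[of j] assms by auto

lemma jacobian_matrix_4:
  "(\<chi> i j. pd j (\<lambda>z. (vector [u z, v z, x z, y z] :: real^4) $ i) z)
    = coframe_matrix (differential u z) (differential v z) (differential x z) (differential y z)"
  by (simp add: vec_eq_iff forall_4 differential_def)

lemma coframe_matrix_differential:
  "coframe_matrix (differential u z) (differential v z) (differential x z) (differential y z) =
    vector [\<chi> a. pd a u z, \<chi> a. pd a v z, \<chi> a. pd a x z, \<chi> a. pd a y z]"
  by (simp add: coframe_matrix_def differential_def)

lemma dist_vector_3_4: "dist (vector [a, b, c] :: real^3) (vector [a', b', c']) = dist (vector [a, e, b, c] :: real^4) (vector [a', e, b', c'])"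
  by (simp add: dist_norm norm_vec_def L2_set_def sum_3 sum_4)

text \<open>\<open>H\<close> is known to be smooth on this image only, and derivatives of functions
  on a set behave as usual just when the set is open; the symmetry of the second derivatives of
  \<open>H\<close> relies on it.\<close>

lemma open_image_coordinates:
  assumes "oriented_coordinates V vol u v x y"
  shows "open ((\<lambda>z. vector [u z, x z, y z] :: real^3) ` V)"
proof -
  let ?h = "\<lambda>z. vector [u z, x z, y z] :: real^3" and ?\<Phi> = "\<lambda>z. vector [u z, v z, x z, y z] :: real^4"
  note O = assms[unfolded oriented_coordinates_def]
  have "\<exists>e>0. ball (?h z) e \<subseteq> ?h ` V" if z: "z \<in> V" for z
  proof -
    have oV: "open V" and sV: "smooth_on V u" "smooth_on V v" "smooth_on V x" "smooth_on V y" using O by auto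
    have dn: "det (\<chi> i j. pd j (\<lambda>z. ?\<Phi> z $ i) z) \<noteq> 0"
      unfolding jacobian_matrix_4 coframe_matrix_differential using O z by auto
    obtain W r \<Psi> where W: "open W" "z \<in> W" "W \<subseteq> V" "r > 0" "?\<Phi> ` W = ball (?\<Phi> z) r" "inj_on ?\<Phi> W"
      "\<And>j. smooth_on (ball (?\<Phi> z) r) (\<lambda>y. \<Psi> y $ j)"
      "\<And>y. y \<in> ball (?\<Phi> z) r \<Longrightarrow> \<Psi> y \<in> W" "\<And>y. y \<in> ball (?\<Phi> z) r \<Longrightarrow> ?\<Phi> (\<Psi> y) = y" "\<And>z. z \<in> W \<Longrightarrow> \<Psi> (?\<Phi> z) = z"
      by (rule smooth_inverse_function[of V z ?\<Phi>, OF oV z smooth_on_vector_4[OF sV] dn]) (rule that; assumption)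
    have "ball (?h z) r \<subseteq> ?h ` V"
    proof
      fix w assume w: "w \<in> ball (?h z) r"
      have w3: "w = vector [w $ 1, w $ 2, w $ 3]" by (simp add: vec_eq_iff forall_3)
      have "dist (?h z) w < r" using w by simp
      then have "dist (?h z) (vector [w $ 1, w $ 2, w $ 3]) < r"
        by (rule subst[OF w3, of "\<lambda>t. dist (?h z) t < r"])
      \<comment> \<open>Inserting the unchanged value of \<open>v\<close> preserves the distance, so
        the ball in the four coordinates contains a copy of the ball in three.\<close>
      then have "(vector [w $ 1, v z, w $ 2, w $ 3] :: real^4) \<in> ball (?\<Phi> z) r"
        unfolding dist_vector_3_4[of _ _ _ _ _ _ "v z"] mem_ball .
      then have "(vector [w $ 1, v z, w $ 2, w $ 3] :: real^4) \<in> ?\<Phi> ` W" unfolding W(5) .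
      then obtain z' where z': "vector [w $ 1, v z, w $ 2, w $ 3] = ?\<Phi> z'" "z' \<in> W" by (rule imageE)
      have "u z' = w $ 1" "x z' = w $ 2" "y z' = w $ 3"
        using arg_cong[OF z'(1), of "\<lambda>t. t $ 1"] arg_cong[OF z'(1), of "\<lambda>t. t $ 3"] arg_cong[OF z'(1), of "\<lambda>t. t $ 4"]
        by simp_all
      then have "w = ?h z'" by (simp add: vec_eq_iff forall_3)
      moreover have "z' \<in> V" using z'(2) W(3) by (rule rev_subsetD)
      ultimately show "w \<in> ?h ` V" by (rule image_eqI)
    qed
    with W(4) show ?thesis by (intro exI[of _ r] conjI)
  qed
  then show ?thesis unfolding open_contains_ball by (auto simp del: subset_iff)
qed

section \<open>The tetrad of given adapted coordinates\<close>

context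
  fixes V :: "(real^4) set" and g :: "real tensor2" and vol :: "real^4 \<Rightarrow> real" and \<gamma> :: real
    and u v x y :: "real^4 \<Rightarrow> real" and H :: "real^3 \<Rightarrow> real"
  assumes adapted: "adapted_coordinates V g vol \<gamma> u v x y H" and smooth_vol: "smooth_on V vol"
    and vol_square: "\<And>z. z \<in> V \<Longrightarrow> (vol z)\<^sup>2 = - det (metric_matrix g z)"
begin

definition "ac_h z = (vector [u z, x z, y z] :: real^3)"
definition "ac_omega z = 1 + \<gamma> * x z"
definition "ac_l z a = differential u z a / ac_omega z ^ 2"
definition "ac_p z a = differential x z a / ac_omega z"
definition "ac_q z a = differential y z a / ac_omega z"
definition "ac_n z a = differential v z a + H (ac_h z) * differential u z a"
definition "ac_mu z = ac_omega z ^ 3 * pd 2 H (ac_h z)"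
definition "ac_nu z = ac_omega z ^ 3 * pd 3 H (ac_h z)"

lemma ac_open: "open V" and ac_smooth: "smooth_on V u" "smooth_on V v" "smooth_on V x" "smooth_on V y"
  and ac_smooth_H: "smooth_on (ac_h ` V) H" and ac_nz: "z \<in> V \<Longrightarrow> ac_omega z \<noteq> 0"
  using adapted unfolding adapted_coordinates_def oriented_coordinates_def ac_h_def[abs_def] ac_omega_def by auto

lemma ac_open_h: "open (ac_h ` V)"
  using open_image_coordinates adapted unfolding adapted_coordinates_def ac_h_def[abs_def] by blast

lemma ac_smooth_compose:
  fixes f :: "real^3 \<Rightarrow> real"
  assumes "smooth_on (ac_h ` V) f"
  shows "smooth_on V (\<lambda>z. f (ac_h z))"
  by (rule smooth_on_compose[OF ac_open assms])
    (auto simp: ac_h_def intro!: smooth_on_vector_3 ac_smooth)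

lemma ac_pd_compose:
  fixes f :: "real^3 \<Rightarrow> real"
  assumes "smooth_on (ac_h ` V) f" "z \<in> V"
  shows "pd c (\<lambda>z. f (ac_h z)) z = pd 1 f (ac_h z) * pd c u z + pd 2 f (ac_h z) * pd c x z + pd 3 f (ac_h z) * pd c y z"
proof -
  have d: "(\<lambda>z. ac_h z $ j) differentiable (at z)" for j
    unfolding ac_h_def by (rule smooth_on_differentiable[OF smooth_on_vector_3[OF ac_smooth(1,3,4)] assms(2)])
  have "f differentiable (at (ac_h z))" using smooth_on_differentiable[OF assms(1)] assms(2) by blast
  from pd_compose(2)[OF this d] show ?thesis by (simp add: sum_3) (simp add: ac_h_def)
qed

lemma ac_smooth_omega: "smooth_on V ac_omega"
  unfolding ac_omega_def[abs_def] by (intro smooth_on_add smooth_on_mult smooth_on_const ac_open ac_smooth)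

lemma ac_pd_omega: "z \<in> V \<Longrightarrow> pd c ac_omega z = \<gamma> * pd c x z"
  unfolding ac_omega_def[abs_def]
  using smooth_on_differentiable[OF ac_smooth(3)] by (simp add: pd_add pd_mult differentiable_mult)

lemma ac_tetrad: "null_tetrad V g vol ac_l ac_n ac_p ac_q"
proof
  show "open V" by (rule ac_open)
  show "smooth_on V (\<lambda>z. ac_l z a)" "smooth_on V (\<lambda>z. ac_n z a)" "smooth_on V (\<lambda>z. ac_p z a)" "smooth_on V (\<lambda>z. ac_q z a)" for a
    unfolding ac_l_def ac_n_def ac_p_def ac_q_def differential_def
    by (intro smooth_on_divide smooth_on_add smooth_on_mult smooth_on_power smooth_on_pd ac_smooth ac_open
        ac_smooth_omega ac_smooth_compose[OF ac_smooth_H]; simp add: ac_nz)+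
  show "smooth_on V vol" by (rule smooth_vol)
  fix z assume z: "z \<in> V"
  show "null_coframe (g z) (vol z) (ac_l z) (ac_n z) (ac_p z) (ac_q z)"
  proof (rule null_coframeI)
    show "g z a b = ac_p z a * ac_p z b + ac_q z a * ac_q z b - ac_l z a * ac_n z b - ac_n z a * ac_l z b" for a b
    proof -
      have G: "g z a b = inverse ((ac_omega z)\<^sup>2) * (- (pd a u z * pd b v z + pd a v z * pd b u z)
         - 2 * H (ac_h z) * pd a u z * pd b u z + pd a x z * pd b x z + pd a y z * pd b y z)"
        using adapted z unfolding adapted_coordinates_def ac_omega_def ac_h_def by blast
      show ?thesis unfolding G using ac_nz[OF z]
        by (simp add: ac_l_def ac_n_def ac_p_def ac_q_def differential_def power2_eq_square field_simps)
    qed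
    show "(vol z)\<^sup>2 = - det (\<chi> a b. g z a b)" using vol_square[OF z] by (simp add: metric_matrix_def)
    have "coframe_matrix (ac_l z) (ac_n z) (ac_p z) (ac_q z) =
      coframe_matrix (\<lambda>a. (1 / ac_omega z)\<^sup>2 * differential u z a) (\<lambda>a. differential v z a + H (ac_h z) * differential u z a)
        (\<lambda>a. 1 / ac_omega z * differential x z a) (\<lambda>a. 1 / ac_omega z * differential y z a)"
      by (simp add: ac_l_def[abs_def] ac_n_def[abs_def] ac_p_def[abs_def] ac_q_def[abs_def] power_divide)
    then have "det (coframe_matrix (ac_l z) (ac_n z) (ac_p z) (ac_q z)) = (1 / ac_omega z) ^ 4 *
        det (coframe_matrix (differential u z) (differential v z) (differential x z) (differential y z))"
      by (simp only: det_coframe_rescale)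
    moreover have "0 < vol z * det (coframe_matrix (differential u z) (differential v z) (differential x z) (differential y z))"
      using adapted z unfolding coframe_matrix_differential adapted_coordinates_def oriented_coordinates_def by blast
    moreover have "(1 / ac_omega z) ^ 4 > 0" using ac_nz[OF z] by (simp add: zero_less_power_eq)
    ultimately show "0 < vol z * det (coframe_matrix (ac_l z) (ac_n z) (ac_p z) (ac_q z))"
      by (simp add: mult.left_commute[of "vol z"] del: power_divide)
  qed
qed

interpretation T: null_tetrad V g vol ac_l ac_n ac_p ac_q by (rule ac_tetrad)

lemma ac_structure: "T.structure_equations \<gamma> ac_mu ac_nu"
  unfolding T.structure_equations_def
proof (intro ballI allI conjI)
  fix z a b assume z: "z \<in> V"
  note nz = ac_nz[OF z]
  note dO = smooth_on_differentiable[OF ac_smooth_omega z]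
  have du: "pd b u differentiable (at z)" "pd b v differentiable (at z)" "pd b x differentiable (at z)" "pd b y differentiable (at z)" for b
    using ac_smooth smooth_on_pd smooth_on_differentiable z by blast+
  note comm = pd_commute[OF ac_open ac_smooth(1) z, of b a] pd_commute[OF ac_open ac_smooth(2) z, of b a]
    pd_commute[OF ac_open ac_smooth(3) z, of b a] pd_commute[OF ac_open ac_smooth(4) z, of b a]
  have pw: "pd c (\<lambda>w. ac_omega w ^ 2) z = 2 * ac_omega z * (\<gamma> * pd c x z)" for c
    unfolding power2_eq_square using pd_mult[OF dO dO, of c] ac_pd_omega[OF z] by simp
  have d2: "(\<lambda>w. ac_omega w ^ 2) differentiable (at z)"
    unfolding power2_eq_square by (rule differentiable_mult[OF dO dO])
  have pl: "pd i (\<lambda>w. ac_l w j) z = (pd i (pd j u) z * ac_omega z ^ 2 - pd j u z * (2 * ac_omega z * (\<gamma> * pd i x z))) / (ac_omega z ^ 2)\<^sup>2" for i j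
    unfolding ac_l_def differential_def using pd_divide[OF du(1) d2] pw nz by simp
  show "pd a (\<lambda>w. ac_l w b) z - pd b (\<lambda>w. ac_l w a) z = - 2 * \<gamma> * wdg (ac_p z) (ac_l z) a b"
    unfolding pl comm(1) unfolding ac_l_def ac_p_def differential_def wdg_def
    using nz by (simp add: field_simps power2_eq_square)
  have pp: "pd i (\<lambda>w. pd j f w / ac_omega w) z = (pd i (pd j f) z * ac_omega z - pd j f z * (\<gamma> * pd i x z)) / (ac_omega z)\<^sup>2"
    if "pd j f differentiable (at z)" for i j f
    using pd_divide[OF that dO nz] ac_pd_omega[OF z] by simp
  show "pd a (\<lambda>w. ac_p w b) z - pd b (\<lambda>w. ac_p w a) z = 0"
    unfolding ac_p_def differential_def pp[OF du(3)] comm(3) by (simp add: field_simps)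
  show "pd a (\<lambda>w. ac_q w b) z - pd b (\<lambda>w. ac_q w a) z = - \<gamma> * wdg (ac_p z) (ac_q z) a b"
    unfolding ac_q_def ac_p_def differential_def pp[OF du(4)] comm(4) wdg_def using nz
    by (simp add: field_simps power2_eq_square)
  have dH: "(\<lambda>z. H (ac_h z)) differentiable (at z)"
    by (rule smooth_on_differentiable[OF ac_smooth_compose[OF ac_smooth_H] z])
  have pn: "pd i (\<lambda>w. ac_n w j) z = pd i (pd j v) z + (H (ac_h z) * pd i (pd j u) z +
      (pd 1 H (ac_h z) * pd i u z + pd 2 H (ac_h z) * pd i x z + pd 3 H (ac_h z) * pd i y z) * pd j u z)" for i j
    unfolding ac_n_def differential_def
    using du dH by (simp add: pd_add pd_mult differentiable_mult ac_pd_compose[OF ac_smooth_H z])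
  show "pd a (\<lambda>w. ac_n w b) z - pd b (\<lambda>w. ac_n w a) z = - ac_mu z * wdg (ac_l z) (ac_p z) a b - ac_nu z * wdg (ac_l z) (ac_q z) a b"
    unfolding pn comm(1,2) unfolding ac_l_def ac_p_def ac_q_def ac_mu_def ac_nu_def differential_def wdg_def
    using nz by (simp add: field_simps power2_eq_square power3_eq_cube)
qed

lemma ac_smooth_mu_nu: "smooth_on V ac_mu" "smooth_on V ac_nu"
  unfolding ac_mu_def[abs_def] ac_nu_def[abs_def]
  by (intro smooth_on_mult smooth_on_power ac_open ac_smooth_omega ac_smooth_compose[OF smooth_on_pd[OF ac_smooth_H]])+

text \<open>The shape matches \<open>adapted_riemann\<close> and so identifies
  \<open>hpp = \<omega>^4 H_xx - \<gamma> \<omega>^3 H_x\<close>,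
  \<open>hqq = \<omega>^4 H_yy - \<gamma> \<omega>^3 H_x\<close>,
  \<open>hpq = \<omega>^4 H_xy\<close>. The sum \<open>hpp + hqq\<close> is \<open>\<sigma>\<close>;
  in \<open>hpp - hqq\<close> the first derivatives cancel, which gives
  \<open>\<psi>\<close>.\<close>

lemma ac_pd_mu_nu:
  assumes z: "z \<in> V"
  shows "pd c ac_mu z = ((ac_omega z ^ 4 * pd 2 (pd 2 H) (ac_h z) - \<gamma> * ac_omega z ^ 3 * pd 2 H (ac_h z)) + 4 * \<gamma> * ac_mu z) * ac_p z c
      + ac_omega z ^ 4 * pd 3 (pd 2 H) (ac_h z) * ac_q z c + ac_omega z ^ 5 * pd 1 (pd 2 H) (ac_h z) * ac_l z c"
    and "pd c ac_nu z = (ac_omega z ^ 4 * pd 3 (pd 2 H) (ac_h z) + 3 * \<gamma> * ac_nu z) * ac_p z c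
      + ((ac_omega z ^ 4 * pd 3 (pd 3 H) (ac_h z) - \<gamma> * ac_omega z ^ 3 * pd 2 H (ac_h z)) + \<gamma> * ac_mu z) * ac_q z c
      + ac_omega z ^ 5 * pd 1 (pd 3 H) (ac_h z) * ac_l z c"
proof -
  note nz = ac_nz[OF z]
  note dO = smooth_on_differentiable[OF ac_smooth_omega z]
  have d2: "(\<lambda>w. ac_omega w * ac_omega w) differentiable (at z)" by (rule differentiable_mult[OF dO dO])
  have p3: "pd c (\<lambda>w. ac_omega w ^ 3) z = 3 * ac_omega z ^ 2 * (\<gamma> * pd c x z)"
    unfolding power3_eq_cube using pd_mult[OF d2 dO, of c] pd_mult[OF dO dO, of c] ac_pd_omega[OF z]
    by (simp add: power2_eq_square algebra_simps)
  have d3: "(\<lambda>w. ac_omega w ^ 3) differentiable (at z)"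
    unfolding power3_eq_cube by (rule differentiable_mult[OF d2 dO])
  note sH = smooth_on_pd[OF ac_smooth_H]
  have dH: "(\<lambda>z. pd i H (ac_h z)) differentiable (at z)" for i
    by (rule smooth_on_differentiable[OF ac_smooth_compose[OF sH] z])
  have co: "pd c x z = ac_omega z * ac_p z c" "pd c y z = ac_omega z * ac_q z c" "pd c u z = ac_omega z ^ 2 * ac_l z c"
    using nz by (simp_all add: ac_l_def ac_p_def ac_q_def differential_def)
  have pw: "ac_omega z ^ 4 = ac_omega z * ac_omega z ^ 3" "ac_omega z ^ 5 = ac_omega z ^ 2 * ac_omega z ^ 3"
    "ac_omega z ^ 2 * (\<gamma> * (ac_omega z * k)) = \<gamma> * ac_omega z ^ 3 * k" for k
    by (simp_all add: eval_nat_numeral)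
  have comm: "pd 2 (pd 3 H) (ac_h z) = pd 3 (pd 2 H) (ac_h z)"
    using z by (intro pd_commute[OF ac_open_h ac_smooth_H]) auto
  show "pd c ac_mu z = ((ac_omega z ^ 4 * pd 2 (pd 2 H) (ac_h z) - \<gamma> * ac_omega z ^ 3 * pd 2 H (ac_h z)) + 4 * \<gamma> * ac_mu z) * ac_p z c
      + ac_omega z ^ 4 * pd 3 (pd 2 H) (ac_h z) * ac_q z c + ac_omega z ^ 5 * pd 1 (pd 2 H) (ac_h z) * ac_l z c"
    unfolding ac_mu_def[abs_def] pd_mult[OF d3 dH] p3 ac_pd_compose[OF sH z] co mult.assoc[of 3] pw
    by (simp add: algebra_simps)
  show "pd c ac_nu z = (ac_omega z ^ 4 * pd 3 (pd 2 H) (ac_h z) + 3 * \<gamma> * ac_nu z) * ac_p z c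
      + ((ac_omega z ^ 4 * pd 3 (pd 3 H) (ac_h z) - \<gamma> * ac_omega z ^ 3 * pd 2 H (ac_h z)) + \<gamma> * ac_mu z) * ac_q z c
      + ac_omega z ^ 5 * pd 1 (pd 3 H) (ac_h z) * ac_l z c"
    unfolding ac_nu_def[abs_def] ac_mu_def pd_mult[OF d3 dH] p3 ac_pd_compose[OF sH z] comm co mult.assoc[of 3] pw
    by (simp add: algebra_simps)
qed

text \<open>The statement concerns arbitrary adapted coordinates, not only those constructed from a
  Killing-Yano tensor, so everything is derived from the coordinate form of the metric.\<close>

lemma adapted_coordinates_properties:
  "let \<omega> = (\<lambda>z. 1 + \<gamma> * x z);
                l = (\<lambda>z a. differential u z a / \<omega> z ^ 2);
                p = (\<lambda>z a. differential x z a / \<omega> z);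
                q = (\<lambda>z a. differential y z a / \<omega> z);
                m = (\<lambda>z a. (complex_of_real (p z a) + \<i> * complex_of_real (q z a))
                             / complex_of_real (sqrt 2));
                F = wedge l p;
                FF = self_dual g vol F;
                h = (\<lambda>z. vector [u z, x z, y z] :: real^3);
                H\<^sub>x = (\<lambda>z. pd 2 H (h z));
                H\<^sub>x\<^sub>x = (\<lambda>z. pd 2 (pd 2 H) (h z));
                H\<^sub>y\<^sub>y = (\<lambda>z. pd 3 (pd 3 H) (h z));
                H\<^sub>x\<^sub>y = (\<lambda>z. pd 3 (pd 2 H) (h z));
                \<sigma> = (\<lambda>z. \<omega> z ^ 4 * (H\<^sub>x\<^sub>x z + H\<^sub>y\<^sub>y z) - 2 * \<gamma> * \<omega> z ^ 3 * H\<^sub>x z);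
                \<Lambda> = - 3 * \<gamma>\<^sup>2;
                \<psi> = (\<lambda>z. complex_of_real (\<omega> z ^ 4) *
                       (complex_of_real (H\<^sub>x\<^sub>x z - H\<^sub>y\<^sub>y z) - 2 * \<i> * complex_of_real (H\<^sub>x\<^sub>y z)))
            in killing_yano V g vol (hodge g vol F) \<and>
               (\<forall>z\<in>V. \<forall>a b. F z a b = wedge (differential u) (differential x) z a b / \<omega> z ^ 3) \<and>
               (\<forall>z\<in>V. \<forall>a b. FF z a b = wedge (\<lambda>z a. complex_of_real (l z a)) m z a b) \<and>
               (\<forall>z\<in>V. \<forall>a b. ricci g z a b = \<sigma> z * l z a * l z b + \<Lambda> * g z a b) \<and>
               (\<forall>z\<in>V. \<forall>a b c d. self_dual_weyl g vol z a b c d =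
                   \<psi> z / 2 * FF z a b * FF z c d)"
proof -
  have e: "(\<lambda>z a. differential u z a / (1 + \<gamma> * x z) ^ 2) = ac_l"
    "(\<lambda>z a. differential x z a / (1 + \<gamma> * x z)) = ac_p" "(\<lambda>z a. differential y z a / (1 + \<gamma> * x z)) = ac_q"
    by (simp_all add: ac_l_def ac_p_def ac_q_def ac_omega_def fun_eq_iff)
  have eh: "vector [u z, x z, y z] = ac_h z" and eo: "1 + \<gamma> * x z = ac_omega z" for z
    by (simp_all add: ac_h_def ac_omega_def)
  have 2: "wedge ac_l ac_p z a b = wedge (differential u) (differential x) z a b / ac_omega z ^ 3" if "z \<in> V" for z a b
    using ac_nz[OF that] by (simp add: wedge_def ac_l_def ac_p_def field_simps eval_nat_numeral)
  have 3: "self_dual g vol (wedge ac_l ac_p) z a b = wedge (\<lambda>z a. complex_of_real (ac_l z a))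
      (\<lambda>z a. (complex_of_real (ac_p z a) + \<i> * complex_of_real (ac_q z a)) / complex_of_real (sqrt 2)) z a b" if "z \<in> V" for z a b
    unfolding T.self_dual_wedge_l_p[OF that]
    by (simp add: wdg_def wedge_def add_divide_distrib diff_divide_distrib algebra_simps)
  have 4: "ricci g z a b = (ac_omega z ^ 4 * (pd 2 (pd 2 H) (ac_h z) + pd 3 (pd 3 H) (ac_h z)) - 2 * \<gamma> * ac_omega z ^ 3 * pd 2 H (ac_h z))
      * ac_l z a * ac_l z b + - 3 * \<gamma>\<^sup>2 * g z a b" if z: "z \<in> V" for z a b
    unfolding T.adapted_ricci[OF ac_structure z ac_smooth_mu_nu ac_pd_mu_nu[OF z]] by (simp add: algebra_simps)
  have 5: "self_dual_weyl g vol z a b c d = complex_of_real (ac_omega z ^ 4) *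
      (complex_of_real (pd 2 (pd 2 H) (ac_h z) - pd 3 (pd 3 H) (ac_h z)) - 2 * \<i> * complex_of_real (pd 3 (pd 2 H) (ac_h z))) / 2
      * self_dual g vol (wedge ac_l ac_p) z a b * self_dual g vol (wedge ac_l ac_p) z c d" if z: "z \<in> V" for z a b c d
  proof -
    have "complex_of_real ((ac_omega z ^ 4 * pd 2 (pd 2 H) (ac_h z) - \<gamma> * ac_omega z ^ 3 * pd 2 H (ac_h z))
        - (ac_omega z ^ 4 * pd 3 (pd 3 H) (ac_h z) - \<gamma> * ac_omega z ^ 3 * pd 2 H (ac_h z)))
        - 2 * \<i> * complex_of_real (ac_omega z ^ 4 * pd 3 (pd 2 H) (ac_h z)) =
      complex_of_real (ac_omega z ^ 4) * (complex_of_real (pd 2 (pd 2 H) (ac_h z) - pd 3 (pd 3 H) (ac_h z))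
        - 2 * \<i> * complex_of_real (pd 3 (pd 2 H) (ac_h z)))"
      by (simp add: right_diff_distrib)
    then show ?thesis
      unfolding T.adapted_self_dual_weyl[OF ac_structure z ac_smooth_mu_nu ac_pd_mu_nu[OF z]] T.self_dual_wedge_l_p[OF z]
      by (simp only:)
  qed
  show ?thesis
    unfolding Let_def unfolding e unfolding eh eo unfolding ac_l_def[symmetric] ac_p_def[symmetric] ac_q_def[symmetric]
    by (intro conjI ballI allI T.adapted_killing_yano[OF ac_structure] 2 3 4 5)
qed

end

subsection \<open>Normal form of a null two-form at a point\<close>

lemma null_coframe_boost_rotate:
  assumes "null_coframe G v l n p q" "k \<noteq> 0" "c\<^sup>2 + s\<^sup>2 = 1"
  shows "null_coframe G v (\<lambda>a. k * l a) (\<lambda>a. n a / k) (\<lambda>a. c * p a + s * q a) (\<lambda>a. - s * p a + c * q a)"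
proof -
  have "(c * p a + s * q a) * (c * p b + s * q b) + (- s * p a + c * q a) * (- s * p b + c * q b)
      = (c\<^sup>2 + s\<^sup>2) * (p a * p b + q a * q b)" for a b
    by (simp add: algebra_simps power2_eq_square)
  moreover have "det (coframe_matrix (\<lambda>a. k * l a) (\<lambda>a. n a / k) (\<lambda>a. c * p a + s * q a) (\<lambda>a. - s * p a + c * q a))
      = (k * (1 / k)) * (c\<^sup>2 + s\<^sup>2) * det (coframe_matrix l n p q)"
    unfolding det_4 divide_inverse by (simp add: algebra_simps power2_eq_square)
  ultimately show ?thesis using assms by (simp add: null_coframe_def)
qed

text \<open>A null rotation about \<open>l\<close>: the quadratic coefficient of \<open>l\<close>
  keeps the new \<open>n\<close> null. Both \<open>l \<and> p\<close> and \<open>l \<and> q\<close>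
  are unchanged.\<close>

lemma null_coframe_null_rotation:
  assumes "null_coframe G v l n p q"
  shows "null_coframe G v l (\<lambda>a. n a + y1 * p a + y2 * q a + (y1\<^sup>2 + y2\<^sup>2) / 2 * l a)
    (\<lambda>a. p a + y1 * l a) (\<lambda>a. q a + y2 * l a)"
proof -
  have "det (coframe_matrix l (\<lambda>a. n a + y1 * p a + y2 * q a + (y1\<^sup>2 + y2\<^sup>2) / 2 * l a)
    (\<lambda>a. p a + y1 * l a) (\<lambda>a. q a + y2 * l a)) = det (coframe_matrix l n p q)" (is "det ?E = _")
  proof -
    let ?R = "vector [vector [1, 0, 0, 0], vector [(y1\<^sup>2 + y2\<^sup>2) / 2, 1, y1, y2], vector [y1, 0, 1, 0], vector [y2, 0, 0, 1]] :: real^4^4"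
    have "?E = ?R ** coframe_matrix l n p q"
      by (simp add: vec_eq_iff forall_4 matrix_matrix_mult_def sum_4)
    moreover have "det ?R = 1" by (simp add: det_4)
    ultimately show ?thesis by (simp add: det_mul)
  qed
  moreover have "(p a + y1 * l a) * (p b + y1 * l b) + (q a + y2 * l a) * (q b + y2 * l b)
      - l a * (n b + y1 * p b + y2 * q b + (y1\<^sup>2 + y2\<^sup>2) / 2 * l b)
      - (n a + y1 * p a + y2 * q a + (y1\<^sup>2 + y2\<^sup>2) / 2 * l a) * l b
      = p a * p b + q a * q b - l a * n b - n a * l b" for a b
    by (simp add: field_simps power2_eq_square)
  ultimately show ?thesis using assms by (simp add: null_coframe_def)
qed

lemma null_coframe_swap:
  assumes "null_coframe G v l n p q"
  shows "null_coframe G v n l p (\<lambda>a. - q a)"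
proof -
  have "det (coframe_matrix n l p (\<lambda>a. - q a)) = det (coframe_matrix l n p q)"
    unfolding det_4 by (simp add: algebra_simps)
  then show ?thesis using assms by (simp add: null_coframe_def)
qed

lemma null_coframe_null_rotation':
  assumes "null_coframe G v l n p q"
  shows "null_coframe G v (\<lambda>a. l a + y1 * p a + y2 * q a + (y1\<^sup>2 + y2\<^sup>2) / 2 * n a) n
    (\<lambda>a. p a + y1 * n a) (\<lambda>a. q a + y2 * n a)"
  using null_coframe_swap[OF null_coframe_null_rotation[OF null_coframe_swap[OF assms], of y1 "- y2"]]
  by (simp add: add.commute)

lemma lorentzian_null_coframe:
  assumes "lorentzian (\<chi> a b. G a b)" "v\<^sup>2 = - det (\<chi> a b. G a b)"
  obtains l n p q where "null_coframe G v l n p q"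
proof -
  let ?M = "\<chi> a b. G a b" and ?e = "(\<chi> i j. if i = j then (if i = 1 then -1 else 1) else 0) :: real^4^4"
  obtain X :: "real^4^4" where X: "invertible X" "transpose X ** ?M ** X = ?e"
    using assms(1) unfolding lorentzian_def by blast
  have dX: "det X \<noteq> 0" using X(1) by (simp add: invertible_det_nz)
  have "det ?e = -1" by (simp add: det_4)
  then have "det X * det ?M * det X = -1" using arg_cong[OF X(2), of det] by (simp add: det_mul)
  then have dM: "det ?M \<noteq> 0" by auto
  define R where "R = matrix_inv X"
  note XR = matrix_inv_mult[OF dX, folded R_def]
  have "transpose R ** (transpose X ** ?M ** X) ** R = (transpose R ** transpose X) ** ?M ** (X ** R)"
    by (simp add: matrix_mul_assoc)
  also have "\<dots> = ?M" by (simp add: matrix_transpose_mul[symmetric] XR transpose_mat)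
  finally have "?M = transpose R ** ?e ** R" unfolding X(2) by simp
  then have "?M $ a $ b = (transpose R ** ?e ** R) $ a $ b" for a b by simp
  then have G: "G a b = R $ 2 $ a * R $ 2 $ b + R $ 3 $ a * R $ 3 $ b + R $ 4 $ a * R $ 4 $ b - R $ 1 $ a * R $ 1 $ b" for a b
    by (simp add: matrix_matrix_mult_def transpose_def sum_4)
  define l where "l = (\<lambda>a. (R $ 1 $ a + R $ 2 $ a) / 2)"
  define n where "n = (\<lambda>a. R $ 1 $ a - R $ 2 $ a)"
  define p where "p = (\<lambda>a. R $ 3 $ a)"
  define q where "q = (\<lambda>a. R $ 4 $ a)"
  have G2: "G a b = p a * p b + q a * q b - l a * n b - n a * l b" for a b
    unfolding G l_def n_def p_def q_def by (simp add: field_simps)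
  have v0: "v\<^sup>2 = (det (coframe_matrix l n p q))\<^sup>2" "v \<noteq> 0"
    using assms(2) det_null_metric[OF G2] dM by auto
  \<comment> \<open>If the orientation is wrong, reversing \<open>q\<close> corrects it without
    affecting the metric.\<close>
  show ?thesis
  proof (cases "v = det (coframe_matrix l n p q)")
    case True
    then show ?thesis using that[of l n p q] G2 v0 by (simp add: null_coframe_def)
  next
    case False
    then have "v = - det (coframe_matrix l n p q)" using v0(1) by (auto simp: power2_eq_iff)
    also have "\<dots> = det (coframe_matrix l n p (\<lambda>a. - q a))" unfolding det_4 by (simp add: algebra_simps)
    finally show ?thesis using that[of l n p "\<lambda>a. - q a"] G2 v0 by (simp add: null_coframe_def)
  qed
qed

lemma (in null_frame) antisymmetric_expansion:
  assumes "\<And>a b. A a b = - A b a"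
  obtains c1 c2 c3 c4 c5 c6 where "\<And>a b. A a b = c1 * (l a * n b - l b * n a) + c2 * (l a * p b - l b * p a)
    + c3 * (l a * q b - l b * q a) + c4 * (n a * p b - n b * p a) + c5 * (n a * q b - n b * q a)
    + c6 * (p a * q b - p b * q a)"
proof -
  define T where "T = (\<lambda>X Y. pair X (\<lambda>a. pair Y (A a)))"
  have T: "T X Y = - T Y X" for X Y
  proof -
    have "T X Y = (\<Sum>a\<in>UNIV. \<Sum>b\<in>UNIV. X a * (Y b * A a b))"
      by (simp add: T_def pair_def sum_distrib_left)
    also have "\<dots> = (\<Sum>a\<in>UNIV. \<Sum>b\<in>UNIV. - (X a * (Y b * A b a)))"
    proof (intro sum.cong refl)
      show "X a * (Y b * A a b) = - (X a * (Y b * A b a))" for a b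
        by (subst assms) simp
    qed
    also have "\<dots> = - T Y X"
      by (subst sum.swap) (simp add: T_def pair_def sum_distrib_left sum_negf mult_ac)
    finally show ?thesis .
  qed
  have T0: "T X X = 0" for X using T[of X X] by simp
  have e: "pair Y (A a) = T P Y * p a + T Q Y * q a - T L Y * n a - T N Y * l a" for Y a
    unfolding T_def by (rule expand)
  have "A a b = T N L * (l a * n b - l b * n a) + - T N P * (l a * p b - l b * p a)
    + - T N Q * (l a * q b - l b * q a) + - T L P * (n a * p b - n b * p a) + - T L Q * (n a * q b - n b * q a)
    + T P Q * (p a * q b - p b * q a)" for a b
    using expand[of "A a" b] unfolding e T0
    by (simp add: T[of L N] T[of P N] T[of Q N] T[of P L] T[of Q L] T[of Q P] algebra_simps)
  then show ?thesis by (rule that)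
qed

text \<open>The two quadratic relations are the real and imaginary parts of nullity. A null rotation
  about \<open>n\<close> removes every component except those along \<open>l \<and> p\<close> and
  \<open>l \<and> q\<close>; a rotation of \<open>p\<close>, \<open>q\<close> and a boost then merge
  these two into one.\<close>

lemma null_coframe_adapted_aux:
  assumes N: "null_coframe G v l n p q"
    and A: "\<And>a b. A a b = c1 * (l a * n b - l b * n a) + c2 * (l a * p b - l b * p a)
    + c3 * (l a * q b - l b * q a) + c4 * (n a * p b - n b * p a) + c5 * (n a * q b - n b * q a)
    + c6 * (p a * q b - p b * q a)"
    and null: "2 * (c2 * c4 + c3 * c5) + c1\<^sup>2 - c6\<^sup>2 = 0" "c2 * c5 - c3 * c4 = c1 * c6"
    and nz: "c2 \<noteq> 0 \<or> c3 \<noteq> 0"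
  obtains l' n' p' q' where "null_coframe G v l' n' p' q'" "\<And>a b. A a b = wdg l' p' a b"
proof -
  define k where "k = sqrt (c2\<^sup>2 + c3\<^sup>2)"
  have k2: "k\<^sup>2 = c2\<^sup>2 + c3\<^sup>2" by (simp add: k_def)
  have pos: "c2\<^sup>2 + c3\<^sup>2 \<noteq> 0" using nz by (simp add: sum_power2_eq_zero_iff)
  have k: "k \<noteq> 0" using pos k2 by auto
  \<comment> \<open>The rotation parameters solve \<open>c1 = c2 * y1 + c3 * y2\<close> and
    \<open>c6 = c3 * y1 - c2 * y2\<close>, a linear system whose determinant is
    \<open>c2\<^sup>2 + c3\<^sup>2\<close> up to sign.\<close>
  define y1 where "y1 = (c2 * c1 + c3 * c6) / (c2\<^sup>2 + c3\<^sup>2)"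
  define y2 where "y2 = (c3 * c1 - c2 * c6) / (c2\<^sup>2 + c3\<^sup>2)"
  have y: "(c2\<^sup>2 + c3\<^sup>2) * y1 = c2 * c1 + c3 * c6" "(c2\<^sup>2 + c3\<^sup>2) * y2 = c3 * c1 - c2 * c6"
    using pos by (simp_all add: y1_def y2_def)
  have "(c2\<^sup>2 + c3\<^sup>2) * (c1 - (c2 * y1 + c3 * y2)) = 0" "(c2\<^sup>2 + c3\<^sup>2) * (c6 - (c3 * y1 - c2 * y2)) = 0"
    using y by algebra+
  then have c16: "c1 = c2 * y1 + c3 * y2" "c6 = c3 * y1 - c2 * y2" using pos by auto
  \<comment> \<open>The nullity relations are linear in \<open>c4\<close> and \<open>c5\<close>, so
    they determine both.\<close>
  have "(c2\<^sup>2 + c3\<^sup>2) * (2 * c4 - (c2 * (y2\<^sup>2 - y1\<^sup>2) - 2 * c3 * y1 * y2)) = 0"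
    "(c2\<^sup>2 + c3\<^sup>2) * (2 * c5 - (c3 * (y1\<^sup>2 - y2\<^sup>2) - 2 * c2 * y1 * y2)) = 0"
    using null unfolding c16 by algebra+
  then have c45: "c4 = (c2 * (y2\<^sup>2 - y1\<^sup>2) - 2 * c3 * y1 * y2) / 2" "c5 = (c3 * (y1\<^sup>2 - y2\<^sup>2) - 2 * c2 * y1 * y2) / 2"
    using pos by auto
  have W: "wdg (\<lambda>a. k * L a) (\<lambda>a. c2 / k * P a + c3 / k * Q a) a b
      = L a * (c2 * P b + c3 * Q b) - L b * (c2 * P a + c3 * Q a)" for L P Q a b
    using k by (simp add: wdg_def field_simps)
  let ?l = "\<lambda>a. l a + y1 * p a + y2 * q a + (y1\<^sup>2 + y2\<^sup>2) / 2 * n a"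
  let ?p = "\<lambda>a. p a + y1 * n a" and ?q = "\<lambda>a. q a + y2 * n a"
  have "(c2 / k)\<^sup>2 + (c3 / k)\<^sup>2 = 1"
    unfolding power_divide add_divide_distrib[symmetric] k2 using pos by (rule divide_self)
  from null_coframe_boost_rotate[OF null_coframe_null_rotation'[OF N, of y1 y2] k this]
  show ?thesis
  proof (rule that)
    show "A a b = wdg (\<lambda>a. k * ?l a) (\<lambda>a. c2 / k * ?p a + c3 / k * ?q a) a b" for a b
    proof -
      have "wdg (\<lambda>a. k * ?l a) (\<lambda>a. c2 / k * ?p a + c3 / k * ?q a) a b
          = ?l a * (c2 * ?p b + c3 * ?q b) - ?l b * (c2 * ?p a + c3 * ?q a)"
        by (rule W)
      also have "\<dots> = A a b"
        unfolding A c45 unfolding c16 by (simp add: field_simps power2_eq_square)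
      finally show ?thesis by simp
    qed
  qed
qed

text \<open>If the components along \<open>l \<and> p\<close> and \<open>l \<and> q\<close> both
  vanish, nullity forces \<open>c1 = c6 = 0\<close>, and exchanging \<open>l\<close> with
  \<open>n\<close> leads back to the other case.\<close>

lemma (in null_frame) null_coframe_adapted:
  assumes A: "\<And>a b. A a b = c1 * (l a * n b - l b * n a) + c2 * (l a * p b - l b * p a)
    + c3 * (l a * q b - l b * q a) + c4 * (n a * p b - n b * p a) + c5 * (n a * q b - n b * q a)
    + c6 * (p a * q b - p b * q a)"
    and null: "2 * (c2 * c4 + c3 * c5) + c1\<^sup>2 - c6\<^sup>2 = 0" "c2 * c5 - c3 * c4 = c1 * c6"
    and nz: "A a0 b0 \<noteq> 0"
  obtains l' n' p' q' where "null_coframe G v l' n' p' q'" "\<And>a b. A a b = wdg l' p' a b"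
proof (cases "c2 \<noteq> 0 \<or> c3 \<noteq> 0")
  case True
  show ?thesis by (rule null_coframe_adapted_aux[OF coframe A null True]) (rule that)
next
  case False
  then have c23: "c2 = 0" "c3 = 0" by auto
  have "c1\<^sup>2 = c6\<^sup>2" "c1 * c6 = 0" using null c23 by auto
  then have c16: "c1 = 0" "c6 = 0" by auto
  have "c4 \<noteq> 0 \<or> c5 \<noteq> 0" using nz A[of a0 b0] c23 c16 by auto
  then have nz': "c4 \<noteq> 0 \<or> - c5 \<noteq> 0" by simp
  show ?thesis
  proof (rule null_coframe_adapted_aux[OF null_coframe_swap[OF coframe] _ _ _ nz'])
    show "A a b = 0 * (n a * l b - n b * l a) + c4 * (n a * p b - n b * p a)
    + - c5 * (n a * - q b - n b * - q a) + 0 * (l a * p b - l b * p a) + 0 * (l a * - q b - l b * - q a)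
    + 0 * (p a * - q b - p b * - q a)" for a b
      unfolding A c23 c16 by (simp add: algebra_simps)
  qed (auto intro: that)
qed

lemma (in null_frame_at) frame_inner:
  assumes A: "\<And>a b. A a b = c1 * (l a * n b - l b * n a) + c2 * (l a * p b - l b * p a)
    + c3 * (l a * q b - l b * q a) + c4 * (n a * p b - n b * p a) + c5 * (n a * q b - n b * q a)
    + c6 * (p a * q b - p b * q a)"
    and R: "R = (\<lambda>a b. d1 * (L a * N b - N a * L b) + d2 * (L a * P b - P a * L b)
    + d3 * (L a * Q b - Q a * L b) + d4 * (N a * P b - P a * N b) + d5 * (N a * Q b - Q a * N b)
    + d6 * (P a * Q b - Q a * P b))"
  shows "(\<Sum>a\<in>UNIV. \<Sum>b\<in>UNIV. A a b * R a b) = - 2 * (c2 * d4 + c4 * d2 + c3 * d5 + c5 * d3) - 2 * c1 * d1 + 2 * c6 * d6"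
proof -
  define \<Phi> where "\<Phi> = (\<lambda>R. \<Sum>a\<in>UNIV. \<Sum>b\<in>UNIV. A a b * R a b)"
  have lin: "\<Phi> (\<lambda>a b. R a b + S a b) = \<Phi> R + \<Phi> S" "\<Phi> (\<lambda>a b. R a b - S a b) = \<Phi> R - \<Phi> S" for R S
    by (simp_all add: \<Phi>_def distrib_left right_diff_distrib sum.distrib sum_subtractf)
  have scale: "\<Phi> (\<lambda>a b. k * R a b) = k * \<Phi> R" for k R
    by (simp add: \<Phi>_def sum_distrib_left mult_ac)
  have prod: "\<Phi> (\<lambda>a b. X a * Y b) = pair X (\<lambda>a. pair Y (A a))" for X Y
    by (simp add: \<Phi>_def pair_def sum_distrib_left mult_ac)
  have Aeq: "A = (\<lambda>a b. c1 * (l a * n b - l b * n a) + c2 * (l a * p b - l b * p a)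
    + c3 * (l a * q b - l b * q a) + c4 * (n a * p b - n b * p a) + c5 * (n a * q b - n b * q a)
    + c6 * (p a * q b - p b * q a))" using A by blast
  have "\<Phi> R = - 2 * (c2 * d4 + c4 * d2 + c3 * d5 + c5 * d3) - 2 * c1 * d1 + 2 * c6 * d6"
    unfolding R lin scale prod Aeq by (simp add: algebra_simps)
  then show ?thesis by (simp add: \<Phi>_def)
qed

text \<open>Nullity splits into two real conditions: \<open>A\<close> and its dual have equal
  squares, and their inner product vanishes. In a frame these are the quadratic relations between
  the six components.\<close>

lemma null_two_form_coframe:
  assumes "spacetime U g vol" "two_form U A" "null_two_form U g vol A" "z \<in> U"
  obtains l n p q where "null_coframe (g z) (vol z) l n p q" "\<And>a b. A z a b = wdg l p a b"
proof -
  have "lorentzian (\<chi> a b. g z a b)" "(vol z)\<^sup>2 = - det (\<chi> a b. g z a b)"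
    using assms(1,4) by (auto simp: spacetime_def metric_matrix_def)
  then obtain l n p q where N: "null_coframe (g z) (vol z) l n p q" by (rule lorentzian_null_coframe)
  interpret F: null_frame_at g vol z l n p q by unfold_locales (rule N)
  have anti: "A z a b = - A z b a" for a b using assms(2,4) unfolding two_form_def by blast
  obtain c1 c2 c3 c4 c5 c6 where A: "\<And>a b. A z a b = c1 * (l a * n b - l b * n a) + c2 * (l a * p b - l b * p a)
    + c3 * (l a * q b - l b * q a) + c4 * (n a * p b - n b * p a) + c5 * (n a * q b - n b * q a)
    + c6 * (p a * q b - p b * q a)"
    by (rule F.antisymmetric_expansion[of "A z", OF anti]) (rule that)
  let ?B = "hodge g vol A"
  have B: "?B z a b = c6 * (l a * n b - l b * n a) + c3 * (l a * p b - l b * p a)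
    + - c2 * (l a * q b - l b * q a) + - c5 * (n a * p b - n b * p a) + c4 * (n a * q b - n b * q a)
    + - c1 * (p a * q b - p b * q a)" for a b
    using F.hodge_frame[of A, OF A] by simp
  let ?SA = "raise2 g A z" and ?SB = "raise2 g ?B z"
  have SD: "raise2 g (self_dual g vol A) z a b = (of_real (?SA a b) - \<i> * of_real (?SB a b)) / of_real (sqrt 2)" for a b
    unfolding raise2_def self_dual_def sum_complex_comb sum_complex_comb[where k="\<lambda>_. 1", simplified] by simp
  have E: "self_dual g vol A z a b * raise2 g (self_dual g vol A) z a b
      = (of_real (A z a b * ?SA a b - ?B z a b * ?SB a b) - \<i> * of_real (A z a b * ?SB a b + ?B z a b * ?SA a b)) / 2" for a b
  proof -
    have "complex_of_real (sqrt 2) * of_real (sqrt 2) = 2" by (simp flip: of_real_mult)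
    moreover have pm: "((x - \<i> * y) / s) * ((X - \<i> * Y) / s) = (x * X - y * Y - \<i> * (x * Y + y * X)) / (s * s)" for x y X Y s :: complex
    proof -
      have "(x - \<i> * y) * (X - \<i> * Y) = x * X - \<i> * (x * Y) - \<i> * (y * X) + (\<i> * \<i>) * (y * Y)"
        by (simp only: left_diff_distrib right_diff_distrib mult_ac) (simp add: algebra_simps)
      also have "\<dots> = x * X - y * Y - \<i> * (x * Y + y * X)" by (simp add: algebra_simps)
      finally show ?thesis by simp
    qed
    ultimately show ?thesis unfolding SD unfolding self_dual_def pm by simp
  qed
  have "(\<Sum>a\<in>UNIV. \<Sum>b\<in>UNIV. self_dual g vol A z a b * raise2 g (self_dual g vol A) z a b)
     = (of_real ((\<Sum>a\<in>UNIV. \<Sum>b\<in>UNIV. A z a b * ?SA a b) - (\<Sum>a\<in>UNIV. \<Sum>b\<in>UNIV. ?B z a b * ?SB a b))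
      - \<i> * of_real ((\<Sum>a\<in>UNIV. \<Sum>b\<in>UNIV. A z a b * ?SB a b) + (\<Sum>a\<in>UNIV. \<Sum>b\<in>UNIV. ?B z a b * ?SA a b))) / 2"
    unfolding E by (simp add: sum_divide_distrib[symmetric] sum_subtractf sum.distrib sum_distrib_left distrib_left)
  moreover have "(\<Sum>a\<in>UNIV. \<Sum>b\<in>UNIV. self_dual g vol A z a b * raise2 g (self_dual g vol A) z a b) = 0"
    using assms(3,4) unfolding null_two_form_def by blast
  ultimately have "(\<Sum>a\<in>UNIV. \<Sum>b\<in>UNIV. A z a b * ?SA a b) - (\<Sum>a\<in>UNIV. \<Sum>b\<in>UNIV. ?B z a b * ?SB a b) = 0"
    "(\<Sum>a\<in>UNIV. \<Sum>b\<in>UNIV. A z a b * ?SB a b) + (\<Sum>a\<in>UNIV. \<Sum>b\<in>UNIV. ?B z a b * ?SA a b) = 0"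
    by (simp_all add: complex_eq_iff)
  then have null: "2 * (c2 * c4 + c3 * c5) + c1\<^sup>2 - c6\<^sup>2 = 0" "c2 * c5 - c3 * c4 = c1 * c6"
    unfolding F.frame_inner[OF A F.raise2_frame[of A, OF A]] F.frame_inner[OF B F.raise2_frame[of ?B, OF B]]
      F.frame_inner[OF A F.raise2_frame[of ?B, OF B]] F.frame_inner[OF B F.raise2_frame[of A, OF A]]
    by (simp_all add: power2_eq_square algebra_simps)
  obtain a0 b0 where nz: "A z a0 b0 \<noteq> 0" using assms(3,4) unfolding null_two_form_def by blast
  show ?thesis by (rule F.null_coframe_adapted[of "A z", OF A null nz]) (rule that)
qed

section \<open>A smooth tetrad adapted to a null two-form\<close>

lemma spacetime_smooth_metric:
  assumes "spacetime U g vol"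
  shows "smooth_metric U g"
proof
  fix z assume z: "z \<in> U"
  have "lorentzian (\<chi> a b. g z a b)" "(vol z)\<^sup>2 = - det (\<chi> a b. g z a b)"
    using assms z by (auto simp: spacetime_def metric_matrix_def)
  then obtain l n p q where N: "null_coframe (g z) (vol z) l n p q" by (rule lorentzian_null_coframe)
  interpret F: null_frame "g z" "vol z" l n p q by unfold_locales (rule N)
  show "g z a b = g z b a" for a b by (simp add: F.G_eq)
  show "det (metric_matrix g z) \<noteq> 0" using F.matrix_nondegenerate by (simp add: metric_matrix_def)
qed (use assms in \<open>auto simp: spacetime_def\<close>)

text \<open>For \<open>A = l \<and> p\<close> this is \<open>l \<otimes> l\<close>: it yields
  \<open>l\<close> up to sign by a smooth formula in \<open>A\<close>.\<close>

definition two_form_square :: "real tensor2 \<Rightarrow> real tensor2 \<Rightarrow> real tensor2" where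
  "two_form_square g A = (\<lambda>z a b. \<Sum>c\<in>UNIV. A z a c * (\<Sum>d\<in>UNIV. inv_metric g z c d * A z b d))"

lemma two_form_square_eq:
  assumes N: "null_coframe (g z) (vol z) l n p q" and A: "\<And>a b. A z a b = wdg l p a b"
  shows "two_form_square g A z a b = l a * l b"
proof -
  interpret F: null_frame_at g vol z l n p q by unfold_locales (rule N)
  have Ab: "A z b = (\<lambda>d. l b * p d - l d * p b)" for b using A by (auto simp: wdg_def)
  have "two_form_square g A z a b = pair (\<lambda>c. F.up (A z b) c) (A z a)"
    unfolding two_form_square_def pair_def F.sum_inv_metric by (simp add: mult.commute)
  also have "\<dots> = l a * l b" unfolding Ab F.up_def by simp
  finally show ?thesis .
qed

text \<open>The coframes found at single points need not fit together smoothly. The freedom is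
  removed by the conditions \<open>l z j > 0\<close> and \<open>p z j = q z j = 0\<close> for a
  fixed index \<open>j\<close>; with these, each form is an explicit smooth function of
  \<open>g\<close>, \<open>A\<close> and its dual, and the pointwise coframe serves only for
  verification.\<close>

lemma local_null_tetrad:
  assumes st: "spacetime U g vol" and A: "two_form U A" and null: "null_two_form U g vol A" and z0: "z0 \<in> U"
  obtains r l n p q j where "r > 0" "ball z0 r \<subseteq> U" "null_tetrad (ball z0 r) g vol l n p q"
    "\<And>z a b. z \<in> ball z0 r \<Longrightarrow> A z a b = wedge l p z a b" "\<And>z. z \<in> ball z0 r \<Longrightarrow> l z j \<noteq> 0"
proof -
  interpret M: smooth_metric U g by (rule spacetime_smooth_metric[OF st])
  have sA: "smooth_on U (\<lambda>z. A z a b)" for a b using A by (simp add: two_form_def)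
  have svol: "smooth_on U vol" using st by (simp add: spacetime_def)
  define T where "T = two_form_square g A"
  have sT: "smooth_on U (\<lambda>z. T z a b)" for a b
    unfolding T_def two_form_square_def by (intro smooth_on_sum smooth_on_mult M.open_U finite sA M.smooth_inv_metric)
  note T = two_form_square_eq[where A=A and g=g and vol=vol, folded T_def]
  obtain l0 n0 p0 q0 where N0: "null_coframe (g z0) (vol z0) l0 n0 p0 q0" "\<And>a b. A z0 a b = wdg l0 p0 a b"
    by (rule null_two_form_coframe[OF st A null z0]) (rule that)
  obtain a0 b0 where "A z0 a0 b0 \<noteq> 0" using null z0 unfolding null_two_form_def by blast
  then have "l0 a0 \<noteq> 0 \<or> l0 b0 \<noteq> 0" using N0(2)[of a0 b0] by (auto simp: wdg_def)
  then obtain j where "l0 j \<noteq> 0" by blast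
  then have Tj: "T z0 j j > 0" unfolding T[OF N0] by (simp flip: power2_eq_square)
  define W where "W = U \<inter> (\<lambda>z. T z j j) -` {0<..}"
  have "open W" unfolding W_def
    by (rule continuous_open_preimage[OF smooth_on_continuous[OF sT] M.open_U]) auto
  moreover have "z0 \<in> W" using z0 Tj by (simp add: W_def)
  ultimately obtain r where r: "r > 0" "ball z0 r \<subseteq> W" using openE by blast
  let ?B = "ball z0 r"
  have BU: "?B \<subseteq> U" and BT: "T z j j > 0" if "z \<in> ?B" for z using r(2) that by (auto simp: W_def)
  have BU': "?B \<subseteq> U" using r(2) by (auto simp: W_def)
  define l where "l = (\<lambda>z a. T z a j / sqrt (T z j j))"
  \<comment> \<open>Row \<open>j\<close> of \<open>l \<and> p\<close> divided by
    \<open>l z j\<close> is \<open>p\<close> up to a multiple of \<open>l\<close>, chosen so that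
    component \<open>j\<close> vanishes. The next line does the same with the dual, which is
    \<open>- l \<and> q\<close>.\<close>
  define p where "p = (\<lambda>z a. A z j a / l z j)"
  define q where "q = (\<lambda>z a. - hodge g vol A z j a / l z j)"
  define S where "S = (\<lambda>z a b. g z a b - p z a * p z b - q z a * q z b)"
  \<comment> \<open>\<open>S\<close> must equal \<open>- (l \<otimes> n + n \<otimes> l)\<close>;
    its component \<open>j j\<close> gives \<open>n z j\<close>, and row \<open>j\<close> then gives
    the rest.\<close>
  define n where "n = (\<lambda>z a. - (S z j a - S z j j / (2 * l z j) * l z a) / l z j)"
  have lj: "l z j = sqrt (T z j j)" "l z j \<noteq> 0" if "z \<in> ?B" for z
    using BT[OF that] by (simp_all add: l_def real_div_sqrt)
  note sub = smooth_on_subset[OF _ BU']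
  have sl: "smooth_on ?B (\<lambda>z. l z a)" for a
  proof -
    have "sqrt (T z j j) \<noteq> 0" if "z \<in> ?B" for z using BT[OF that] by simp
    then show ?thesis
      unfolding l_def by (intro smooth_on_divide smooth_on_sqrt sub[OF sT] open_ball BT)
  qed
  have sp: "smooth_on ?B (\<lambda>z. p z a)" for a
    unfolding p_def using lj by (intro smooth_on_divide sl sub[OF sA] open_ball) auto
  have sq: "smooth_on ?B (\<lambda>z. q z a)" for a
    unfolding q_def using lj by (intro smooth_on_divide smooth_on_minus sl sub[OF M.smooth_hodge[OF sA svol]] open_ball) auto
  have sS: "smooth_on ?B (\<lambda>z. S z a b)" for a b
    unfolding S_def by (intro smooth_on_diff smooth_on_mult sp sq sub[OF M.smooth_g] open_ball)
  have sn: "smooth_on ?B (\<lambda>z. n z a)" for a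
    unfolding n_def using lj
    by (intro smooth_on_divide smooth_on_minus smooth_on_diff smooth_on_mult sl sS smooth_on_const open_ball) auto
  have key: "null_coframe (g z) (vol z) (l z) (n z) (p z) (q z) \<and> (\<forall>a b. A z a b = wedge l p z a b)" if z: "z \<in> ?B" for z
  proof -
    obtain l1 n1 p1 q1 where N1: "null_coframe (g z) (vol z) l1 n1 p1 q1" "\<And>a b. A z a b = wdg l1 p1 a b"
      by (rule null_two_form_coframe[OF st A null]) (use BU' z in blast, rule that)
    interpret F: null_frame_at g vol z l1 n1 p1 q1 by unfold_locales (rule N1)
    note T1 = T[OF N1]
    \<comment> \<open>Reversing both \<open>l1\<close> and \<open>p1\<close> keeps their wedge; this
      sign makes component \<open>j\<close> of \<open>l\<close> positive. Reversing
      \<open>q1\<close> as well preserves the orientation.\<close>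
    define e where "e = sgn (l1 j)"
    have l1j: "l1 j \<noteq> 0" using BT[OF z] T1 by auto
    have e: "e * e = 1" "e \<noteq> 0" "l1 j = e * \<bar>l1 j\<bar>" using l1j by (auto simp: e_def sgn_if)
    have ee: "e * (e * x) = x" for x using e(1) by (simp flip: mult.assoc)
    have sq: "sqrt (T z j j) = \<bar>l1 j\<bar>" unfolding T1 by simp
    have l: "l z a = e * l1 a" for a
    proof -
      have "l z a = l1 a * l1 j / \<bar>l1 j\<bar>" unfolding l_def sq T1 by simp
      also have "\<dots> = e * l1 a" using l1j by (simp add: e_def sgn_if abs_if)
      finally show ?thesis .
    qed
    have p: "p z a = e * p1 a + - (p1 j / l1 j) * (e * l1 a)" for a
      unfolding p_def l N1(2) wdg_def using l1j e by (simp add: field_simps ee)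
    have H: "hodge g vol A z j a = - wdg l1 q1 j a" for a
      using F.hodge_l_wdg[of A 1 0 j a] N1(2) by simp
    have q: "q z a = e * q1 a + - (q1 j / l1 j) * (e * l1 a)" for a
      unfolding q_def l H wdg_def using l1j e by (simp add: field_simps ee)
    have "e\<^sup>2 + 0\<^sup>2 = 1" using e by (simp add: power2_eq_square)
    from null_coframe_null_rotation[OF null_coframe_boost_rotate[OF N1(1) e(2) this], of "- (p1 j / l1 j)" "- (q1 j / l1 j)"]
    obtain n' where N: "null_coframe (g z) (vol z) (l z) n' (p z) (q z)"
      unfolding l[abs_def] p[abs_def] q[abs_def] by simp
    have S': "S z a b = - (l z a * n' b + n' a * l z b)" for a b
      using N unfolding S_def null_coframe_def by auto
    have "n z a = n' a" for a
      unfolding n_def S' using lj(2)[OF z] by (simp add: field_simps)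
    then have "n z = n'" by blast
    moreover have "A z a b = wedge l p z a b" for a b
    proof -
      have "wedge l p z a b = (e * e) * wdg l1 p1 a b"
        unfolding wedge_def l p wdg_def by (simp add: algebra_simps)
      then show ?thesis using e N1(2) by simp
    qed
    ultimately show ?thesis using N by simp
  qed
  show ?thesis
  proof (rule that[OF r(1) BU'])
    show "null_tetrad ?B g vol l n p q"
      using key sl sn sp sq sub[OF svol] by unfold_locales auto
    show "A z a b = wedge l p z a b" if "z \<in> ?B" for z a b using key[OF that] by blast
    show "l z j \<noteq> 0" if "z \<in> ball z0 r" for z by (rule lj(2)[OF that])
  qed
qed

subsection \<open>Reduction of the conformal Killing-Yano equation\<close>

lemma (in smooth_metric) smooth_codifferential:
  fixes A :: "real tensor2"
  assumes "\<And>a b. smooth_on U (\<lambda>z. A z a b)"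
  shows "smooth_on U (\<lambda>z. codifferential g A z b)"
  unfolding codifferential_def nabla2_def real_scaleR_def
  by (intro smooth_on_minus smooth_on_diff smooth_on_sum smooth_on_mult open_U finite smooth_on_pd[OF assms]
      smooth_christoffel smooth_inv_metric assms)

lemma pd_zero_constant:
  fixes f :: "real^'n::finite \<Rightarrow> real"
  assumes "open V" "convex V" "smooth_on V f" "\<And>z i. z \<in> V \<Longrightarrow> pd i f z = 0"
  obtains c where "\<And>z. z \<in> V \<Longrightarrow> f z = c"
proof -
  have "(f has_derivative (\<lambda>h. 0)) (at z within V)" if z: "z \<in> V" for z
    using differentiable_has_derivative_pd[OF smooth_on_differentiable[OF assms(3) z]] assms(4)[OF z]
    by (simp add: has_derivative_at_withinI)
  then obtain c where "\<forall>z\<in>V. f z = c" using has_derivative_zero_constant[OF assms(2), of f] by blast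
  then show ?thesis using that by blast
qed

context null_tetrad
begin

text \<open>Contracting one form index with \<open>L\<close> removes the unknown derivatives of
  \<open>p\<close>. What is left is \<open>X_L = Y_L = 0\<close>, \<open>X_P = - Y_Q\<close> and
  \<open>X_Q = Y_P\<close>, and then the \<open>P Q\<close> component of
  \<open>X \<and> Y = 0\<close> is a vanishing sum of two squares.\<close>

lemma cky_sources:
  assumes z: "z \<in> V" and eq: "cky_equation g vol (wedge l p) X Y z" and par: "\<And>a b. wedge X Y z a b = 0"
  obtains \<alpha> \<beta> where "\<And>a. X z a = \<alpha> * l z a" "\<And>a. Y z a = \<beta> * l z a"
proof -
  interpret F: null_frame_at g vol z "l z" "n z" "p z" "q z" by (rule frame[OF z])
  let ?L = "F.L" and ?N = "F.N" and ?P = "F.P" and ?Q = "F.Q"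
  have LL: "pair ?L (nabla1 g l z c) = 0" for c
  proof -
    have "pair ?L (\<lambda>a. pair ?L (\<lambda>b. nabla1 g p z c a * p z b + p z a * nabla1 g p z c b + nabla1 g q z c a * q z b + q z a * nabla1 g q z c b
    - (nabla1 g l z c a * n z b + l z a * nabla1 g n z c b) - (nabla1 g n z c a * l z b + n z a * nabla1 g l z c b))) = 0"
      unfolding tetrad_compatible[OF z] by simp
    then show ?thesis by simp
  qed
  have E: "pair S (\<lambda>c. pair ?L (\<lambda>a. pair R (\<lambda>b. 3 * (nabla1 g l z c a * p z b + l z a * nabla1 g p z c b
      - (nabla1 g l z c b * p z a + l z b * nabla1 g p z c a))))) = pair S (\<lambda>c. pair ?L (\<lambda>a. pair R (\<lambda>b. 
      X z a * g z c b - X z b * g z c a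
     - det4 (pair ?L (Y z)) (pair ?N (Y z)) (pair ?P (Y z)) (pair ?Q (Y z))
        (l z c) (n z c) (p z c) (q z c) (l z a) (n z a) (p z a) (q z a) (l z b) (n z b) (p z b) (q z b))))" for R S
  proof -
    have "3 * (nabla1 g l z c a * p z b + l z a * nabla1 g p z c b - (nabla1 g l z c b * p z a + l z b * nabla1 g p z c a))
      = X z a * g z c b - X z b * g z c a
     - det4 (pair ?L (Y z)) (pair ?N (Y z)) (pair ?P (Y z)) (pair ?Q (Y z))
        (l z c) (n z c) (p z c) (q z c) (l z a) (n z a) (p z a) (q z a) (l z b) (n z b) (p z b) (q z b)" for a b c
      using eq[unfolded F.cky_equation_iff, rule_format, of c a b]
        nabla2_wedge[where g=g and c=c and a=a and b=b, OF differentiable(1,3)[OF z]] by simp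
    then show ?thesis by (simp only:)
  qed
  have PQ: "pair ?P (\<lambda>a. pair ?Q (\<lambda>b. X z a * Y z b - X z b * Y z a)) = 0"
    using par unfolding wedge_def by simp
  have 1: "pair ?L (X z) = 0" "pair ?L (Y z) = 0" "pair ?P (X z) = - pair ?Q (Y z)" "pair ?Q (X z) = pair ?P (Y z)"
    using E[of ?P ?P] E[of ?Q ?P] E[of ?N ?P] E[of ?N ?Q] LL
    by (simp_all add: F.G_eq det4_def algebra_simps)
  have "pair ?P (X z) * pair ?Q (Y z) - pair ?Q (X z) * pair ?P (Y z) = 0"
    using PQ by (simp add: mult.commute)
  then have "(pair ?Q (Y z))\<^sup>2 + (pair ?P (Y z))\<^sup>2 = 0" unfolding 1 power2_eq_square by linarith
  then have "pair ?Q (Y z) = 0" "pair ?P (Y z) = 0" by (simp_all add: sum_power2_eq_zero_iff)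
  then show ?thesis
    using that[of "- pair ?N (X z)" "- pair ?N (Y z)"] F.expand[of "X z"] F.expand[of "Y z"] 1 by simp
qed

lemma cky_equation_null_sources:
  assumes z: "z \<in> V" and eq: "cky_equation g vol A X Y z"
    and X: "\<And>a. X z a = \<alpha> * l z a" and Y: "\<And>a. Y z a = \<beta> * l z a"
  shows "3 * nabla2 g A z c a b = \<alpha> * (l z a * g z c b - l z b * g z c a)
    - \<beta> * det4 0 (-1) 0 0 (l z c) (n z c) (p z c) (q z c) (l z a) (n z a) (p z a) (q z a) (l z b) (n z b) (p z b) (q z b)"
proof -
  interpret F: null_frame_at g vol z "l z" "n z" "p z" "q z" by (rule frame[OF z])
  have "Y z = (\<lambda>a. \<beta> * l z a)" using Y by blast
  then have "pair F.L (Y z) = 0" "pair F.N (Y z) = - \<beta>" "pair F.P (Y z) = 0" "pair F.Q (Y z) = 0"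
    by simp_all
  then show ?thesis
    using eq[unfolded F.cky_equation_iff, rule_format, of c a b] by (simp add: X det4_def algebra_simps)
qed

text \<open>If \<open>X = f l\<close> and \<open>l\<close> are both Killing, the symmetrised product
  of \<open>df\<close> and \<open>l\<close> vanishes. Its \<open>j j\<close> component gives
  \<open>pd j f z = 0\<close>, and then its \<open>c j\<close> components give
  \<open>df = 0\<close>.\<close>

lemma killing_multiple_of_l:
  assumes V: "convex V" and j: "\<And>z. z \<in> V \<Longrightarrow> l z j \<noteq> 0"
    and kl: "\<And>z c a. z \<in> V \<Longrightarrow> nabla1 g l z c a + nabla1 g l z a c = 0"
    and X: "\<And>a. smooth_on V (\<lambda>z. X z a)" "\<And>z. z \<in> V \<Longrightarrow> \<exists>\<alpha>. \<forall>a. X z a = \<alpha> * l z a"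
    and kX: "\<And>z a b. z \<in> V \<Longrightarrow> nabla1 g X z a b + nabla1 g X z b a = 0"
  obtains \<alpha> where "\<And>z a. z \<in> V \<Longrightarrow> X z a = \<alpha> * l z a"
proof -
  define f where "f = (\<lambda>z. X z j / l z j)"
  have sf: "smooth_on V f" unfolding f_def by (rule smooth_on_divide[OF open_V X(1) smooth(1) j])
  have Xf: "X z a = f z * l z a" if z: "z \<in> V" for z a
  proof -
    obtain \<alpha> where \<alpha>: "X z a = \<alpha> * l z a" for a using X(2)[OF z] by blast
    show ?thesis unfolding f_def \<alpha>[of j] \<alpha>[of a] using j[OF z] by simp
  qed
  have "pd c f z = 0" if z: "z \<in> V" for z c
  proof -
    have "nabla1 g X z c a = nabla1 g (\<lambda>w a. f w * l w a) z c a" for c a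
      by (rule nabla1_cong[OF open_V z Xf])
    then have N: "nabla1 g X z c a = pd c f z * l z a + f z * nabla1 g l z c a" for c a
      using nabla1_scale[where g=g and c=c and a=a, OF smooth_on_differentiable[OF sf z] differentiable(1)[OF z]] by simp
    have K: "pd c f z * l z a + pd a f z * l z c = 0" for c a
    proof -
      have "pd c f z * l z a + pd a f z * l z c + f z * (nabla1 g l z c a + nabla1 g l z a c) = 0"
        using kX[OF z, of c a] unfolding N by (simp add: algebra_simps)
      then show ?thesis unfolding kl[OF z] by simp
    qed
    have "pd j f z = 0" using K[of j j] j[OF z] by simp
    then show ?thesis using K[of c j] j[OF z] by simp
  qed
  then obtain \<alpha> where "\<And>z. z \<in> V \<Longrightarrow> f z = \<alpha>" using pd_zero_constant[OF open_V V sf] by blast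
  then show ?thesis using that[of \<alpha>] Xf by simp
qed

lemma cky_constant_sources:
  assumes V: "convex V" and j: "\<And>z. z \<in> V \<Longrightarrow> l z j \<noteq> 0"
    and eq: "\<And>z. z \<in> V \<Longrightarrow> cky_equation g vol (wedge l p) X Y z"
    and par: "\<And>z a b. z \<in> V \<Longrightarrow> wedge X Y z a b = 0"
    and X: "\<And>a. smooth_on V (\<lambda>z. X z a)" "\<And>z a b. z \<in> V \<Longrightarrow> nabla1 g X z a b + nabla1 g X z b a = 0"
    and Y: "\<And>a. smooth_on V (\<lambda>z. Y z a)" "\<And>z a b. z \<in> V \<Longrightarrow> nabla1 g Y z a b + nabla1 g Y z b a = 0"
  obtains \<alpha> \<beta> where "\<And>z a. z \<in> V \<Longrightarrow> X z a = \<alpha> * l z a" "\<And>z a. z \<in> V \<Longrightarrow> Y z a = \<beta> * l z a"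
proof -
  have src: "(\<exists>\<alpha>. \<forall>a. X z a = \<alpha> * l z a) \<and> (\<exists>\<beta>. \<forall>a. Y z a = \<beta> * l z a) \<and>
      (\<forall>c a. nabla1 g l z c a + nabla1 g l z a c = 0)" if z: "z \<in> V" for z
  proof -
    obtain \<alpha> \<beta> where ab: "\<And>a. X z a = \<alpha> * l z a" "\<And>a. Y z a = \<beta> * l z a"
      by (rule cky_sources[OF z eq[OF z] par[OF z]]) (rule that; assumption)
    obtain s t where kl:
      "\<And>c a. nabla1 g l z c a = ((\<alpha> * p z c - \<beta> * q z c) * l z a - l z c * (\<alpha> * p z a - \<beta> * q z a)) / 3"
      by (rule connection[OF z cky_equation_null_sources[OF z eq[OF z] ab]]) (rule that; assumption)
    have "nabla1 g l z c a + nabla1 g l z a c = 0" for c a unfolding kl by (simp add: field_simps)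
    then show ?thesis using ab by blast
  qed
  have kl: "nabla1 g l z c a + nabla1 g l z a c = 0" and sX: "\<exists>\<alpha>. \<forall>a. X z a = \<alpha> * l z a"
    and sY: "\<exists>\<alpha>. \<forall>a. Y z a = \<alpha> * l z a" if "z \<in> V" for z c a
    using src[OF that] by auto
  obtain \<alpha> where \<alpha>: "\<And>z a. z \<in> V \<Longrightarrow> X z a = \<alpha> * l z a"
    by (rule killing_multiple_of_l[OF V j kl X(1) sX X(2)]) (assumption+, erule that)
  obtain \<beta> where \<beta>: "\<And>z a. z \<in> V \<Longrightarrow> Y z a = \<beta> * l z a"
    by (rule killing_multiple_of_l[OF V j kl Y(1) sY Y(2)]) (assumption+, erule that)
  show ?thesis by (rule that[OF \<alpha> \<beta>])
qed

end

section \<open>The constant of the space-time\<close>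

locale cky_null_spacetime =
  fixes U :: "(real^4) set" and g A :: "real tensor2" and vol :: "real^4 \<Rightarrow> real"
  assumes spacetime: "spacetime U g vol"
    and cky: "conformal_killing_yano U g vol A"
    and null: "null_two_form U g vol A"
    and killing_X: "killing U g (codifferential g A)"
    and killing_Y: "killing U g (codifferential g (hodge g vol A))"
    and parallel: "\<forall>z\<in>U. \<forall>a b. wedge (codifferential g A) (codifferential g (hodge g vol A)) z a b = 0"
begin

sublocale smooth_metric U g by (rule spacetime_smooth_metric[OF spacetime])

abbreviation "X \<equiv> codifferential g A"
abbreviation "Y \<equiv> codifferential g (hodge g vol A)"

lemma smooth_vol: "smooth_on U vol"
  using spacetime by (simp add: spacetime_def)

lemma two_form_A: "two_form U A"
  using cky by (simp add: conformal_killing_yano_def)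

lemma smooth_A: "smooth_on U (\<lambda>z. A z a b)"
  using two_form_A by (simp add: two_form_def)

lemma cky_equations:
  assumes "z \<in> U"
  shows "cky_equation g vol A X Y z" "cky_equation g vol (hodge g vol A) Y (\<lambda>z a. - X z a) z"
  using cky assms unfolding conformal_killing_yano_iff[OF smooth_vol] by auto

lemma tetrad_with_constant_sources:
  assumes z0: "z0 \<in> U"
  obtains r l n p q j \<alpha> \<beta> where "r > 0" "ball z0 r \<subseteq> U" "null_tetrad (ball z0 r) g vol l n p q"
    "\<And>z a b. z \<in> ball z0 r \<Longrightarrow> A z a b = wedge l p z a b" "\<And>z. z \<in> ball z0 r \<Longrightarrow> l z j \<noteq> 0"
    "\<And>z a. z \<in> ball z0 r \<Longrightarrow> X z a = \<alpha> * l z a" "\<And>z a. z \<in> ball z0 r \<Longrightarrow> Y z a = \<beta> * l z a"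
proof -
  obtain r l n p q j where r: "r > 0" and sub: "ball z0 r \<subseteq> U" and T: "null_tetrad (ball z0 r) g vol l n p q"
    and A: "\<And>z a b. z \<in> ball z0 r \<Longrightarrow> A z a b = wedge l p z a b" and j: "\<And>z. z \<in> ball z0 r \<Longrightarrow> l z j \<noteq> 0"
    by (rule local_null_tetrad[OF spacetime two_form_A null z0]) (rule that; assumption)
  interpret T: null_tetrad "ball z0 r" g vol l n p q by (rule T)
  have eq: "cky_equation g vol (wedge l p) X Y z" if z: "z \<in> ball z0 r" for z
    using cky_equations(1)[of z] z sub nabla2_cong[OF open_ball z A] unfolding cky_equation_def by auto
  have par: "wedge X Y z a b = 0" if "z \<in> ball z0 r" for z a b
    using that sub parallel by blast
  have sX: "smooth_on (ball z0 r) (\<lambda>z. X z a)" for a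
    by (rule smooth_on_subset[OF smooth_codifferential[OF smooth_A] sub])
  have sY: "smooth_on (ball z0 r) (\<lambda>z. Y z a)" for a
    by (rule smooth_on_subset[OF smooth_codifferential[OF smooth_hodge[OF smooth_A smooth_vol]] sub])
  have kX: "nabla1 g X z a b + nabla1 g X z b a = 0" if "z \<in> ball z0 r" for z a b
    using that sub killing_X unfolding killing_def by blast
  have kY: "nabla1 g Y z a b + nabla1 g Y z b a = 0" if "z \<in> ball z0 r" for z a b
    using that sub killing_Y unfolding killing_def by blast
  obtain \<alpha> \<beta> where ab: "\<And>z a. z \<in> ball z0 r \<Longrightarrow> X z a = \<alpha> * l z a" "\<And>z a. z \<in> ball z0 r \<Longrightarrow> Y z a = \<beta> * l z a"
    by (rule T.cky_constant_sources[OF convex_ball j eq par sX kX sY kY]) (assumption+, erule that)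
  show ?thesis by (rule that[OF r sub T A j ab])
qed

text \<open>
  In terms of \<open>X = \<alpha> l\<close> and \<open>Y = \<beta> l\<close> this is \<open>\<alpha>\<^sup>2 + \<beta>\<^sup>2\<close>, a globally defined
  function.
\<close>

definition "source_norm z = (\<Sum>a\<in>UNIV. (X z a)\<^sup>2 + (Y z a)\<^sup>2) / (\<Sum>a\<in>UNIV. two_form_square g A z a a)"

lemma source_norm_eq:
  assumes "null_tetrad V g vol l n p q" "z \<in> V" "\<And>a b. A z a b = wedge l p z a b" "l z j \<noteq> 0"
    "\<And>a. X z a = \<alpha> * l z a" "\<And>a. Y z a = \<beta> * l z a"
  shows "source_norm z = \<alpha>\<^sup>2 + \<beta>\<^sup>2"
proof -
  interpret T: null_tetrad V g vol l n p q by (rule assms(1))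
  have S: "two_form_square g A z a a = (l z a)\<^sup>2" for a
    using two_form_square_eq[of g z vol "l z" "n z" "p z" "q z" A a a, OF T.tetrad[OF assms(2)]] assms(3)
    by (simp add: wdg_def wedge_def power2_eq_square)
  have "(l z j)\<^sup>2 \<le> (\<Sum>a\<in>UNIV. (l z a)\<^sup>2)" by (rule member_le_sum) auto
  then have nz: "(\<Sum>a\<in>UNIV. (l z a)\<^sup>2) \<noteq> 0" using assms(4) by auto
  have "(\<Sum>a\<in>UNIV. (X z a)\<^sup>2 + (Y z a)\<^sup>2) = (\<Sum>a\<in>UNIV. (\<alpha>\<^sup>2 + \<beta>\<^sup>2) * (l z a)\<^sup>2)"
    by (simp add: assms(5,6) power_mult_distrib distrib_right)
  also have "\<dots> = (\<alpha>\<^sup>2 + \<beta>\<^sup>2) * (\<Sum>a\<in>UNIV. (l z a)\<^sup>2)" by (simp only: sum_distrib_left)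
  finally show ?thesis using nz by (simp add: source_norm_def S)
qed

text \<open>The local constants \<open>\<alpha>\<close> and \<open>\<beta>\<close> vary with the
  tetrad, but this function does not, and being locally constant it is constant on the connected
  \<open>U\<close>. Therefore one \<open>\<gamma>\<close> serves all points.\<close>

lemma source_norm_constant:
  obtains c where "\<And>z. z \<in> U \<Longrightarrow> source_norm z = c"
proof -
  have loc: "\<forall>\<^sub>F w in at z within U. source_norm z = source_norm w" if z: "z \<in> U" for z
  proof -
    obtain r l n p q j \<alpha> \<beta> where r: "r > 0" and sub: "ball z r \<subseteq> U" and T: "null_tetrad (ball z r) g vol l n p q"
      and A: "\<And>w a b. w \<in> ball z r \<Longrightarrow> A w a b = wedge l p w a b" and j: "\<And>w. w \<in> ball z r \<Longrightarrow> l w j \<noteq> 0"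
      and X: "\<And>w a. w \<in> ball z r \<Longrightarrow> X w a = \<alpha> * l w a" and Y: "\<And>w a. w \<in> ball z r \<Longrightarrow> Y w a = \<beta> * l w a"
      by (rule tetrad_with_constant_sources[OF z]) (rule that; assumption)
    have "source_norm w = \<alpha>\<^sup>2 + \<beta>\<^sup>2" if "w \<in> ball z r" for w
      by (rule source_norm_eq[OF T that A[OF that] j[OF that] X[OF that] Y[OF that]])
    then show ?thesis
      unfolding eventually_at using r by (intro exI[of _ r]) (auto simp: dist_commute)
  qed
  have "connected U" using spacetime by (simp add: spacetime_def)
  then have *: "source_norm z = source_norm w" if "z \<in> U" "w \<in> U" for z w
    using connected_local_const[OF _ that] loc by blast
  show ?thesis
  proof (cases "U = {}")
    case True
    then show ?thesis using that by blast
  next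
    case False
    then obtain w where "w \<in> U" by blast
    then show ?thesis using that[of "source_norm w"] * by blast
  qed
qed

lemma adapted_tetrad:
  obtains \<gamma> where "\<gamma> \<ge> 0" "\<And>z0. z0 \<in> U \<Longrightarrow> \<exists>r l n p q j. r > 0 \<and> ball z0 r \<subseteq> U \<and>
    null_tetrad (ball z0 r) g vol l n p q \<and> (\<forall>z\<in>ball z0 r. l z j \<noteq> 0) \<and>
    (\<forall>z\<in>ball z0 r. \<forall>c a b. nabla2 g (wedge l p) z c a b = - \<gamma> * (l z a * g z c b - l z b * g z c a))"
proof -
  obtain k where k: "\<And>z. z \<in> U \<Longrightarrow> source_norm z = k" by (rule source_norm_constant) (rule that; assumption)
  \<comment> \<open>Arranged so that
    \<open>9 * \<gamma>\<^sup>2 = \<alpha>\<^sup>2 + \<beta>\<^sup>2\<close>; the absolute value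
    covers an empty \<open>U\<close>, for which \<open>k\<close> is arbitrary.\<close>
  define \<gamma> where "\<gamma> = sqrt \<bar>k\<bar> / 3"
  have "\<exists>r l n p q j. r > 0 \<and> ball z0 r \<subseteq> U \<and>
    null_tetrad (ball z0 r) g vol l n p q \<and> (\<forall>z\<in>ball z0 r. l z j \<noteq> 0) \<and>
    (\<forall>z\<in>ball z0 r. \<forall>c a b. nabla2 g (wedge l p) z c a b = - \<gamma> * (l z a * g z c b - l z b * g z c a))"
    if z0: "z0 \<in> U" for z0
  proof -
    obtain r l n p q j \<alpha> \<beta> where r: "r > 0" and sub: "ball z0 r \<subseteq> U" and T: "null_tetrad (ball z0 r) g vol l n p q"
      and A: "\<And>w a b. w \<in> ball z0 r \<Longrightarrow> A w a b = wedge l p w a b" and j: "\<And>w. w \<in> ball z0 r \<Longrightarrow> l w j \<noteq> 0"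
      and X: "\<And>w a. w \<in> ball z0 r \<Longrightarrow> X w a = \<alpha> * l w a" and Y: "\<And>w a. w \<in> ball z0 r \<Longrightarrow> Y w a = \<beta> * l w a"
      by (rule tetrad_with_constant_sources[OF z0]) (rule that; assumption)
    interpret T: null_tetrad "ball z0 r" g vol l n p q by (rule T)
    have zb: "z0 \<in> ball z0 r" using r by simp
    have "k = \<alpha>\<^sup>2 + \<beta>\<^sup>2"
      using source_norm_eq[OF T zb A[OF zb] j[OF zb] X[OF zb] Y[OF zb]] k[OF z0] by simp
    then have g9: "9 * \<gamma>\<^sup>2 = \<alpha>\<^sup>2 + \<beta>\<^sup>2" by (simp add: \<gamma>_def power_divide)
    \<comment> \<open>Cosine and sine of the duality rotation that takes the sources
      \<open>(\<alpha>, \<beta>)\<close> to \<open>(- 3 * \<gamma>, 0)\<close>. For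
      \<open>\<gamma> = 0\<close> both sources vanish and the trivial rotation serves.\<close>
    obtain c s where cs: "c\<^sup>2 + s\<^sup>2 = 1" "c * \<alpha> - s * \<beta> = - 3 * \<gamma>" "c * \<beta> + s * \<alpha> = 0"
    proof (cases "\<gamma> = 0")
      case True
      then have "\<alpha> = 0" "\<beta> = 0" using g9 by (simp_all add: sum_power2_eq_zero_iff)
      then show ?thesis using that[of 1 0] True by simp
    next
      case False
      have "(- \<alpha> / (3 * \<gamma>))\<^sup>2 + (\<beta> / (3 * \<gamma>))\<^sup>2 = (\<alpha>\<^sup>2 + \<beta>\<^sup>2) / (9 * \<gamma>\<^sup>2)"
        by (simp add: power_divide power_mult_distrib add_divide_distrib)
      also have "\<dots> = 1" unfolding g9[symmetric] using False by simp
      finally have 1: "(- \<alpha> / (3 * \<gamma>))\<^sup>2 + (\<beta> / (3 * \<gamma>))\<^sup>2 = 1" .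
      have "- \<alpha> / (3 * \<gamma>) * \<alpha> - \<beta> / (3 * \<gamma>) * \<beta> = - (\<alpha>\<^sup>2 + \<beta>\<^sup>2) / (3 * \<gamma>)"
        by (simp add: power2_eq_square add_divide_distrib diff_divide_distrib)
      also have "\<dots> = - 3 * \<gamma>" unfolding g9[symmetric] using False by (simp add: power2_eq_square)
      finally have 2: "- \<alpha> / (3 * \<gamma>) * \<alpha> - \<beta> / (3 * \<gamma>) * \<beta> = - 3 * \<gamma>" .
      show ?thesis by (rule that[OF 1 2]) simp
    qed
    define p' q' where "p' = (\<lambda>z a. c * p z a + s * q z a)" and "q' = (\<lambda>z a. - s * p z a + c * q z a)"
    have T': "null_tetrad (ball z0 r) g vol l n p' q'"
    proof
      show "null_coframe (g z) (vol z) (l z) (n z) (p' z) (q' z)" if "z \<in> ball z0 r" for z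
        using null_coframe_boost_rotate[OF T.tetrad[OF that] _ cs(1), of 1] by (simp add: p'_def q'_def)
      show "smooth_on (ball z0 r) (\<lambda>z. p' z a)" "smooth_on (ball z0 r) (\<lambda>z. q' z a)" for a
        unfolding p'_def q'_def by (intro smooth_on_add smooth_on_mult smooth_on_const T.smooth open_ball)+
    qed (auto intro: T.smooth T.smooth_vol)
    have "nabla2 g (wedge l p') z e a b = - \<gamma> * (l z a * g z e b - l z b * g z e a)" if z: "z \<in> ball z0 r" for z e a b
    proof -
      have zU: "z \<in> U" using z sub by blast
      have H: "hodge g vol A w a b = - wedge l q w a b" if "w \<in> ball z0 r" for w a b
      proof -
        interpret F: null_frame_at g vol w "l w" "n w" "p w" "q w" by (rule T.frame[OF that])
        show ?thesis using F.hodge_l_wdg[of A 1 0 a b] A[OF that] by (simp add: wdg_def wedge_def)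
      qed
      \<comment> \<open>Rotating \<open>p\<close> and \<open>q\<close> amounts to a duality rotation
        of \<open>A\<close> with constant coefficients, so its covariant derivative combines the two
        real equations.\<close>
      have W: "wedge l p' w a b = c * A w a b + (- s) * hodge g vol A w a b" if "w \<in> ball z0 r" for w a b
        unfolding H[OF that] A[OF that] by (simp add: wedge_def p'_def algebra_simps)
      have dA: "(\<lambda>w. A w a b) differentiable (at z)" for a b
        by (rule smooth_on_differentiable[OF smooth_A zU])
      have dB: "(\<lambda>w. hodge g vol A w a b) differentiable (at z)" for a b
        by (rule smooth_on_differentiable[OF smooth_hodge[OF smooth_A smooth_vol] zU])
      have "nabla2 g (wedge l p') z e a b = nabla2 g (\<lambda>w a b. c * A w a b + (- s) * hodge g vol A w a b) z e a b"
        by (rule nabla2_cong[OF open_ball z W])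
      also have "\<dots> = nabla2 g (\<lambda>w a b. c * A w a b) z e a b + nabla2 g (\<lambda>w a b. (- s) * hodge g vol A w a b) z e a b"
        by (rule nabla2_add) (intro differentiable_mult differentiable_const dA dB)+
      also have "\<dots> = c * nabla2 g A z e a b - s * nabla2 g (hodge g vol A) z e a b"
        using nabla2_scale[where f="\<lambda>w. c" and A=A and z=z and g=g and c=e and a=a and b=b, OF differentiable_const dA]
          nabla2_scale[where f="\<lambda>w. - s" and A="hodge g vol A" and z=z and g=g and c=e and a=a and b=b, OF differentiable_const dB] by simp
      finally have N: "nabla2 g (wedge l p') z e a b = c * nabla2 g A z e a b - s * nabla2 g (hodge g vol A) z e a b" .
      let ?W = "l z a * g z e b - l z b * g z e a"
      let ?D = "det4 0 (-1) 0 0 (l z e) (n z e) (p z e) (q z e) (l z a) (n z a) (p z a) (q z a) (l z b) (n z b) (p z b) (q z b)"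
      have mX: "- X z a = - \<alpha> * l z a" for a using X[OF z] by simp
      have "3 * nabla2 g A z e a b = \<alpha> * ?W - \<beta> * ?D"
        by (rule T.cky_equation_null_sources[OF z cky_equations(1)[OF zU] X[OF z] Y[OF z]])
      moreover have "3 * nabla2 g (hodge g vol A) z e a b = \<beta> * ?W - (- \<alpha>) * ?D"
        by (rule T.cky_equation_null_sources[OF z cky_equations(2)[OF zU] Y[OF z] mX])
      moreover have "c * (\<alpha> * ?W - \<beta> * ?D) - s * (\<beta> * ?W - (- \<alpha>) * ?D) = (c * \<alpha> - s * \<beta>) * ?W - (c * \<beta> + s * \<alpha>) * ?D"
        by (simp only: left_diff_distrib right_diff_distrib distrib_right mult_minus_left minus_minus mult_ac) simp
      ultimately have "3 * nabla2 g (wedge l p') z e a b = (c * \<alpha> - s * \<beta>) * ?W - (c * \<beta> + s * \<alpha>) * ?D"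
        unfolding N by algebra
      then show ?thesis unfolding cs by simp
    qed
    then show ?thesis using r sub T' j by blast
  qed
  moreover have "\<gamma> \<ge> 0" by (simp add: \<gamma>_def)
  ultimately show ?thesis using that by blast
qed

end

subsection \<open>Integration of the structure equations\<close>

definition exterior_d :: "real tensor1 \<Rightarrow> real tensor2" where
  "exterior_d \<theta> = (\<lambda>z c a. pd c (\<lambda>w. \<theta> w a) z - pd a (\<lambda>w. \<theta> w c) z)"

lemma exterior_d_scale:
  assumes "f differentiable (at z)" "\<And>a. (\<lambda>w. \<theta> w a) differentiable (at z)"
  shows "exterior_d (\<lambda>w a. f w * \<theta> w a) z c a = pd c f z * \<theta> z a - pd a f z * \<theta> z c + f z * exterior_d \<theta> z c a"
  using assms by (simp add: exterior_d_def pd_mult algebra_simps)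

lemma exterior_d_closed:
  assumes S: "open S" "smooth_on S f" "z \<in> S" and eq: "\<And>w a. w \<in> S \<Longrightarrow> \<theta> w a = pd a f w"
  shows "exterior_d \<theta> z c a = 0"
proof -
  have "pd c (\<lambda>w. \<theta> w a) z = pd c (pd a f) z" for c a by (rule pd_cong[OF S(1,3) eq])
  then show ?thesis using pd_commute[OF S, of c a] by (simp add: exterior_d_def)
qed

lemma exterior_d_cong:
  assumes "open S" "z \<in> S" "\<And>w a. w \<in> S \<Longrightarrow> \<theta> w a = \<theta>' w a"
  shows "exterior_d \<theta> z c a = exterior_d \<theta>' z c a"
proof -
  have "pd c (\<lambda>w. \<theta> w a) z = pd c (\<lambda>w. \<theta>' w a) z" for c a by (rule pd_cong[OF assms(1,2,3)])
  then show ?thesis by (simp add: exterior_d_def)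
qed

lemma wedge_d_eq: "wedge_d l \<theta> z a b c = exterior_d \<theta> z a b * l z c + exterior_d \<theta> z b c * l z a + exterior_d \<theta> z c a * l z b"
  by (simp add: wedge_d_def exterior_d_def)

locale adapted_null_tetrad = null_tetrad V g vol l n p q
  for V g vol l n p q +
  fixes \<gamma> :: real
  assumes nabla_lp: "\<And>z c a b. z \<in> V \<Longrightarrow> nabla2 g (wedge l p) z c a b = - \<gamma> * (l z a * g z c b - l z b * g z c a)"
begin

text \<open>The antisymmetric part of \<open>connection\<close> for
  \<open>\<alpha> = - 3 * \<gamma>\<close> and \<open>\<beta> = 0\<close>; \<open>s\<close> and
  \<open>t\<close> are still unknown.\<close>

lemma exterior_derivatives:
  assumes z: "z \<in> V"
  obtains s t where
    "\<And>c a. exterior_d l z c a = - 2 * \<gamma> * (p z c * l z a - p z a * l z c)"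
    "\<And>c a. exterior_d p z c a = \<gamma> * (l z c * n z a - l z a * n z c) - (s c * l z a - s a * l z c)"
    "\<And>c a. exterior_d q z c a = \<gamma> * (q z c * p z a - q z a * p z c) - (t c * l z a - t a * l z c)"
    "\<And>c a. exterior_d n z c a = \<gamma> * (p z c * n z a - p z a * n z c) - (s c * p z a - s a * p z c) - (t c * q z a - t a * q z c)"
proof -
  have eq: "3 * nabla2 g (wedge l p) z c a b = (- 3 * \<gamma>) * (l z a * g z c b - l z b * g z c a)
      - 0 * det4 0 (-1) 0 0 (l z c) (n z c) (p z c) (q z c) (l z a) (n z a) (p z a) (q z a) (l z b) (n z b) (p z b) (q z b)" for c a b
    using nabla_lp[OF z, of c a b] by simp
  obtain s t where N:
    "\<And>c a. nabla1 g l z c a = (((- 3 * \<gamma>) * p z c - 0 * q z c) * l z a - l z c * ((- 3 * \<gamma>) * p z a - 0 * q z a)) / 3"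
    "\<And>c a. nabla1 g p z c a = - (- 3 * \<gamma>) / 3 * l z c * n z a + ((- 3 * \<gamma>) * q z c + 0 * p z c) / 3 * q z a - s c * l z a"
    "\<And>c a. nabla1 g q z c a = 0 / 3 * l z c * n z a - ((- 3 * \<gamma>) * q z c + 0 * p z c) / 3 * p z a - t c * l z a"
    "\<And>c a. nabla1 g n z c a = - ((- 3 * \<gamma>) * p z c - 0 * q z c) / 3 * n z a - s c * p z a - t c * q z a"
    by (rule connection[OF z eq]) (rule that; assumption)
  have E: "exterior_d \<theta> z c a = nabla1 g \<theta> z c a - nabla1 g \<theta> z a c" for \<theta> c a
    unfolding nabla1_antisym[OF z] exterior_d_def by (rule refl)
  show ?thesis
    by (rule that[of s t]) (unfold E N, simp_all add: algebra_simps diff_divide_distrib)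
qed

lemma exterior_d_l: "z \<in> V \<Longrightarrow> exterior_d l z c a = - 2 * \<gamma> * (p z c * l z a - p z a * l z c)"
  by (rule exterior_derivatives)

lemma wedge_d_l: "z \<in> V \<Longrightarrow> wedge_d l l z a b c = 0"
  by (simp add: wedge_d_eq exterior_d_l algebra_simps)

lemma wedge_d_p:
  assumes "z \<in> V"
  shows "wedge_d l p z a b c = 0"
proof -
  obtain s t where "\<And>c a. exterior_d p z c a = \<gamma> * (l z c * n z a - l z a * n z c) - (s c * l z a - s a * l z c)"
    by (rule exterior_derivatives[OF assms]) (rule that; assumption)
  then show ?thesis unfolding wedge_d_eq by (simp only:) (simp add: algebra_simps)
qed

lemma null_rotation:
  assumes W: "open W" "W \<subseteq> V" "smooth_on W f1" "smooth_on W f2"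
  shows "adapted_null_tetrad W g vol l
    (\<lambda>z a. n z a + f1 z * p z a + f2 z * q z a + ((f1 z)\<^sup>2 + (f2 z)\<^sup>2) / 2 * l z a)
    (\<lambda>z a. p z a + f1 z * l z a) (\<lambda>z a. q z a + f2 z * l z a) \<gamma>"
proof
  note s = smooth[THEN smooth_on_subset[OF _ W(2)]]
  show "smooth_on W (\<lambda>z. n z a + f1 z * p z a + f2 z * q z a + ((f1 z)\<^sup>2 + (f2 z)\<^sup>2) / 2 * l z a)" for a
    unfolding power2_eq_square by (intro smooth_on_add smooth_on_mult smooth_on_divide smooth_on_const s W) simp
  show "smooth_on W (\<lambda>z. p z a + f1 z * l z a)" "smooth_on W (\<lambda>z. q z a + f2 z * l z a)" for a
    by (intro smooth_on_add smooth_on_mult s W)+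
  show "smooth_on W (\<lambda>z. l z a)" for a by (rule s)
  show "smooth_on W vol" by (rule smooth_on_subset[OF smooth_vol W(2)])
  fix z assume "z \<in> W"
  then have z: "z \<in> V" using W by blast
  show "null_coframe (g z) (vol z) (l z)
    (\<lambda>a. n z a + f1 z * p z a + f2 z * q z a + ((f1 z)\<^sup>2 + (f2 z)\<^sup>2) / 2 * l z a)
    (\<lambda>a. p z a + f1 z * l z a) (\<lambda>a. q z a + f2 z * l z a)"
    by (rule null_coframe_null_rotation[OF tetrad[OF z]])
  have "wedge l (\<lambda>z a. p z a + f1 z * l z a) = wedge l p"
    by (intro ext) (simp add: wedge_def algebra_simps)
  then show "nabla2 g (wedge l (\<lambda>z a. p z a + f1 z * l z a)) z c a b = - \<gamma> * (l z a * g z c b - l z b * g z c a)" for c a b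
    using nabla_lp[OF z, of c a b] by simp
qed (rule W)

text \<open>Modulo \<open>l\<close>, \<open>dq = - \<gamma> p \<and> q\<close> and
  \<open>p = d\<phi>\<close>, so the factor \<open>exp (\<gamma> * \<phi>)\<close> makes
  \<open>q\<close> closed along the leaves.\<close>

lemma wedge_d_exp_q:
  assumes z: "z \<in> V" and \<phi>: "smooth_on V \<phi>" "\<And>a. pd a \<phi> z = p z a + f * l z a"
  shows "wedge_d l (\<lambda>w a. exp (\<gamma> * \<phi> w) * q w a) z a b c = 0"
proof -
  have d\<phi>: "\<phi> differentiable (at z)" by (rule smooth_on_differentiable[OF \<phi>(1) z])
  have D: "((\<lambda>t. exp (\<gamma> * t)) has_real_derivative exp (\<gamma> * \<phi> z) * \<gamma>) (at (\<phi> z))"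
    by (auto intro!: derivative_eq_intros)
  have pd: "pd a (\<lambda>w. exp (\<gamma> * \<phi> w)) z = exp (\<gamma> * \<phi> z) * \<gamma> * (p z a + f * l z a)" for a
    unfolding pd_real_compose[OF D d\<phi>] \<phi>(2) by (rule refl)
  have dd: "(\<lambda>w. exp (\<gamma> * \<phi> w)) differentiable (at z)"
    by (rule smooth_on_differentiable[OF _ z]) (intro smooth_on_exp smooth_on_mult smooth_on_const open_V \<phi>(1))
  obtain s t where q: "\<And>c a. exterior_d q z c a = \<gamma> * (q z c * p z a - q z a * p z c) - (t c * l z a - t a * l z c)"
    by (rule exterior_derivatives[OF z]) (rule that; assumption)
  show ?thesis
    unfolding wedge_d_eq exterior_d_scale[where \<theta>=q, OF dd differentiable(4)[OF z]] pd q
    by (simp add: algebra_simps)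
qed

text \<open>Exactness of \<open>p\<close> and of \<open>exp (\<gamma> * \<phi>) q\<close> determines
  \<open>s\<close> and \<open>t\<close> up to multiples of \<open>l\<close>, and these multiples are
  all that remains in \<open>dn\<close>. In particular \<open>dn\<close> is a multiple of
  \<open>l\<close>, and it has no \<open>l \<and> n\<close> component.\<close>

lemma wedge_d_n:
  assumes z: "z \<in> V" and j: "l z j \<noteq> 0"
    and \<phi>: "smooth_on V \<phi>" "\<And>z a. z \<in> V \<Longrightarrow> pd a \<phi> z = p z a"
    and y: "smooth_on V y" "\<And>z a. z \<in> V \<Longrightarrow> pd a y z = exp (\<gamma> * \<phi> z) * q z a"
  obtains \<mu> \<nu> where "\<And>c a. exterior_d n z c a = \<mu> * (l z a * p z c - l z c * p z a) + \<nu> * (l z a * q z c - l z c * q z a)"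
proof -
  obtain s t where d:
    "\<And>c a. exterior_d p z c a = \<gamma> * (l z c * n z a - l z a * n z c) - (s c * l z a - s a * l z c)"
    "\<And>c a. exterior_d q z c a = \<gamma> * (q z c * p z a - q z a * p z c) - (t c * l z a - t a * l z c)"
    "\<And>c a. exterior_d n z c a = \<gamma> * (p z c * n z a - p z a * n z c) - (s c * p z a - s a * p z c) - (t c * q z a - t a * q z c)"
    by (rule exterior_derivatives[OF z]) (rule that; assumption)
  have p0: "exterior_d p z c a = 0" for c a
    by (rule exterior_d_closed[OF open_V \<phi>(1) z]) (simp add: \<phi>(2))
  have d\<phi>: "\<phi> differentiable (at z)" by (rule smooth_on_differentiable[OF \<phi>(1) z])
  have D: "((\<lambda>t. exp (\<gamma> * t)) has_real_derivative exp (\<gamma> * \<phi> z) * \<gamma>) (at (\<phi> z))"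
    by (auto intro!: derivative_eq_intros)
  have pd: "pd a (\<lambda>w. exp (\<gamma> * \<phi> w)) z = exp (\<gamma> * \<phi> z) * \<gamma> * p z a" for a
    unfolding pd_real_compose[OF D d\<phi>] \<phi>(2)[OF z] by (rule refl)
  have dd: "(\<lambda>w. exp (\<gamma> * \<phi> w)) differentiable (at z)"
    by (rule smooth_on_differentiable[OF _ z]) (intro smooth_on_exp smooth_on_mult smooth_on_const open_V \<phi>(1))
  have "exterior_d (\<lambda>w a. exp (\<gamma> * \<phi> w) * q w a) z c a = 0" for c a
    by (rule exterior_d_closed[OF open_V y(1) z]) (simp add: y(2))
  then have "exp (\<gamma> * \<phi> z) * (\<gamma> * (p z c * q z a - p z a * q z c) + exterior_d q z c a) = 0" for c a
    unfolding exterior_d_scale[where \<theta>=q, OF dd differentiable(4)[OF z]] pd by (simp add: algebra_simps)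
  then have q0: "exterior_d q z c a = - \<gamma> * (p z c * q z a - p z a * q z c)" for c a by (simp add: eq_neg_iff_add_eq_0 add.commute)
  \<comment> \<open>\<open>dp = 0\<close> makes \<open>s + \<gamma> n\<close> proportional to
    \<open>l\<close>, and the known \<open>dq\<close> makes \<open>t\<close> proportional to
    \<open>l\<close>; the factors are read off at the index \<open>j\<close>, where \<open>l\<close>
    does not vanish.\<close>
  define \<mu> where "\<mu> = (s j + \<gamma> * n z j) / l z j"
  define \<nu> where "\<nu> = t j / l z j"
  have s: "s c = - \<gamma> * n z c + \<mu> * l z c" for c
  proof -
    have "(s c + \<gamma> * n z c) * l z j = (s j + \<gamma> * n z j) * l z c"
      using d(1)[of c j] unfolding p0 by (simp add: algebra_simps)
    then show ?thesis using j by (simp add: \<mu>_def field_simps)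
  qed
  have t: "t c = \<nu> * l z c" for c
  proof -
    have "t c * l z j = t j * l z c" using d(2)[of c j] unfolding q0 by (simp add: algebra_simps)
    then show ?thesis using j by (simp add: \<nu>_def field_simps)
  qed
  show ?thesis
    by (rule that[of \<mu> \<nu>]) (unfold d(3) s t, simp add: algebra_simps)
qed

end

locale integrable_tetrad = adapted_null_tetrad V g vol l n p q \<gamma> for V g vol l n p q \<gamma> +
  fixes \<phi> y v :: "real^4 \<Rightarrow> real" and f :: "real^4 \<Rightarrow> real"
  assumes smooth_\<phi>: "smooth_on V \<phi>" and d\<phi>: "\<And>z a. z \<in> V \<Longrightarrow> pd a \<phi> z = p z a"
    and smooth_y: "smooth_on V y" and dy: "\<And>z a. z \<in> V \<Longrightarrow> pd a y z = exp (\<gamma> * \<phi> z) * q z a"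
    and smooth_v: "smooth_on V v" and smooth_f: "smooth_on V f"
    and dv: "\<And>z a. z \<in> V \<Longrightarrow> pd a v z = n z a + f z * l z a"

lemma (in null_tetrad) null_tetrad_restrict:
  assumes "open W" "W \<subseteq> V"
  shows "null_tetrad W g vol l n p q"
  by unfold_locales (use assms tetrad in \<open>auto intro: smooth_on_subset smooth smooth_vol\<close>)

lemma (in adapted_null_tetrad) adapted_null_tetrad_restrict:
  assumes "open W" "W \<subseteq> V"
  shows "adapted_null_tetrad W g vol l n p q \<gamma>"
  using null_tetrad_restrict[OF assms] nabla_lp assms(2)
  by (auto simp: adapted_null_tetrad_def adapted_null_tetrad_axioms_def)

lemma (in integrable_tetrad) integrable_tetrad_restrict:
  assumes "open W" "W \<subseteq> V"
  shows "integrable_tetrad W g vol l n p q \<gamma> \<phi> y v f"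
  using adapted_null_tetrad_restrict[OF assms] d\<phi> dy dv assms(2)
  by (auto simp: integrable_tetrad_def integrable_tetrad_axioms_def
      intro: smooth_on_subset smooth_\<phi> smooth_y smooth_v smooth_f)

text \<open>A null rotation shifts \<open>p\<close> and \<open>q\<close> by independent multiples of
  \<open>l\<close>. Both primitives along the leaves are therefore found first, and one rotation
  removes both remainders; \<open>n\<close> comes last because the rotation changes it.\<close>

lemma (in adapted_null_tetrad) integrable_tetrad:
  assumes z0: "z0 \<in> V" and j: "\<And>z. z \<in> V \<Longrightarrow> l z j \<noteq> 0"
  obtains W n' p' q' \<phi> y v f where "open W" "z0 \<in> W" "W \<subseteq> V"
    "integrable_tetrad W g vol l n' p' q' \<gamma> \<phi> y v f"
proof -
  obtain W where W: "open W" "z0 \<in> W" "W \<subseteq> V"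
    and poincare: "\<And>\<theta>. (\<And>a. smooth_on W (\<lambda>z. \<theta> z a)) \<Longrightarrow> (\<And>z a b c. z \<in> W \<Longrightarrow> wedge_d l \<theta> z a b c = 0) \<Longrightarrow>
      \<exists>f h. smooth_on W f \<and> smooth_on W h \<and> (\<forall>z\<in>W. \<forall>a. pd a f z = \<theta> z a + h z * l z a)"
    by (rule leafwise_poincare[OF open_V z0 smooth(1) j[OF z0] wedge_d_l]) (assumption, erule that[rotated 3], assumption+)
  note sW = smooth_on_subset[OF _ W(3)]
  have WV: "z \<in> V" if "z \<in> W" for z using W(3) that by blast
  obtain \<phi> f1 where \<phi>: "smooth_on W \<phi>" "smooth_on W f1" "\<And>z a. z \<in> W \<Longrightarrow> pd a \<phi> z = p z a + f1 z * l z a"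
    using poincare[of p, OF sW[OF smooth(3)] wedge_d_p[OF WV]] by blast
  interpret A: adapted_null_tetrad W g vol l n p q \<gamma>
    by (rule adapted_null_tetrad_restrict[OF W(1,3)])
  define \<omega> where "\<omega> = (\<lambda>z. exp (\<gamma> * \<phi> z))"
  have \<omega>: "smooth_on W \<omega>" "\<omega> z \<noteq> 0" for z
    unfolding \<omega>_def by (intro smooth_on_exp smooth_on_mult smooth_on_const W(1) \<phi>(1)) simp
  have sq: "smooth_on W (\<lambda>z. \<omega> z * q z a)" for a by (intro smooth_on_mult \<omega>(1) A.smooth W(1))
  have wq: "wedge_d l (\<lambda>w a. \<omega> w * q w a) z a b c = 0" if "z \<in> W" for z a b c
    unfolding \<omega>_def by (rule A.wedge_d_exp_q[OF that \<phi>(1) \<phi>(3)[OF that]])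
  obtain y f2 where y: "smooth_on W y" "smooth_on W f2" "\<And>z a. z \<in> W \<Longrightarrow> pd a y z = \<omega> z * q z a + f2 z * l z a"
    using poincare[of "\<lambda>z a. \<omega> z * q z a", OF sq wq] by blast
  \<comment> \<open>The division is due to \<open>dy = \<omega> q + f2 l\<close>, which has to
    become \<open>\<omega>\<close> times the rotated \<open>q\<close>.\<close>
  define F2 where "F2 = (\<lambda>z. f2 z / \<omega> z)"
  have F2: "smooth_on W F2" unfolding F2_def by (rule smooth_on_divide[OF W(1) y(2) \<omega>(1) \<omega>(2)])
  define n' p' q' where "n' = (\<lambda>z a. n z a + f1 z * p z a + F2 z * q z a + ((f1 z)\<^sup>2 + (F2 z)\<^sup>2) / 2 * l z a)"
    and "p' = (\<lambda>z a. p z a + f1 z * l z a)" and "q' = (\<lambda>z a. q z a + F2 z * l z a)"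
  interpret B: adapted_null_tetrad W g vol l n' p' q' \<gamma>
    unfolding n'_def p'_def q'_def by (rule A.null_rotation[OF W(1) subset_refl \<phi>(2) F2])
  have \<phi>': "pd a \<phi> z = p' z a" if "z \<in> W" for z a using \<phi>(3)[OF that] by (simp add: p'_def)
  have y': "pd a y z = exp (\<gamma> * \<phi> z) * q' z a" if "z \<in> W" for z a
  proof -
    have "exp (\<gamma> * \<phi> z) = \<omega> z" by (simp add: \<omega>_def)
    then show ?thesis
      unfolding y(3)[OF that] q'_def F2_def using \<omega>(2)[of z] by (simp only:) (simp add: field_simps)
  qed
  have wn: "wedge_d l n' z a b c = 0" if z: "z \<in> W" for z a b c
  proof -
    obtain \<mu> \<nu> where "\<And>c a. exterior_d n' z c a = \<mu> * (l z a * p' z c - l z c * p' z a) + \<nu> * (l z a * q' z c - l z c * q' z a)"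
      by (rule B.wedge_d_n[OF z j[OF WV[OF z]] \<phi>(1) \<phi>' y(1) y']) (assumption+, erule that)
    then show ?thesis unfolding wedge_d_eq by (simp only:) (simp add: algebra_simps)
  qed
  obtain v f where v: "smooth_on W v" "smooth_on W f" "\<And>z a. z \<in> W \<Longrightarrow> pd a v z = n' z a + f z * l z a"
    using poincare[of n', OF B.smooth(2) wn] by blast
  have "integrable_tetrad W g vol l n' p' q' \<gamma> \<phi> y v f"
    by unfold_locales (use \<phi>(1) \<phi>' y(1) y' v in auto)
  with W show ?thesis by (rule that)
qed

section \<open>The functions entering the coordinate form\<close>

context integrable_tetrad
begin

definition "\<omega> z = exp (\<gamma> * \<phi> z)"

text \<open>The integral of \<open>exp (\<gamma> * t)\<close> for \<open>t\<close> from 0 to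
  \<open>\<phi> z\<close>, in closed form; it gives \<open>dx = \<omega> p\<close> also in the limit
  case \<open>\<gamma> = 0\<close>.\<close>

definition "x z = (if \<gamma> = 0 then \<phi> z else (\<omega> z - 1) / \<gamma>)"

text \<open>From \<open>dv = n + f l\<close> and \<open>du = \<omega>^2 l\<close> one has
  \<open>n = dv - (f / \<omega>^2) du\<close>.\<close>

definition "h z = - f z / (\<omega> z)\<^sup>2"

lemma \<omega>_pos: "\<omega> z > 0"
  by (simp add: \<omega>_def)

lemma smooth_\<omega>: "smooth_on V \<omega>"
  unfolding \<omega>_def[abs_def] by (intro smooth_on_exp smooth_on_mult smooth_on_const open_V smooth_\<phi>)

lemma \<omega>_x: "\<omega> z = 1 + \<gamma> * x z"
  by (simp add: x_def \<omega>_def)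

lemma d\<omega>:
  assumes "z \<in> V"
  shows "pd a \<omega> z = \<gamma> * \<omega> z * p z a"
proof -
  have D: "((\<lambda>t. exp (\<gamma> * t)) has_real_derivative exp (\<gamma> * \<phi> z) * \<gamma>) (at (\<phi> z))"
    by (auto intro!: derivative_eq_intros)
  show ?thesis
    using pd_real_compose[OF D smooth_on_differentiable[OF smooth_\<phi> assms], of a] d\<phi>[OF assms, of a]
    by (simp add: \<omega>_def[abs_def])
qed

lemma smooth_x: "smooth_on V x"
proof (cases "\<gamma> = 0")
  case True
  have "x = \<phi>" unfolding x_def[abs_def] by (simp add: True)
  then show ?thesis using smooth_\<phi> by simp
next
  case False
  have "smooth_on V (\<lambda>z. (\<omega> z - 1) / \<gamma>)"
    by (intro smooth_on_divide smooth_on_diff smooth_on_const open_V smooth_\<omega> False)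
  with False show ?thesis by (simp add: x_def[abs_def])
qed

lemma dx:
  assumes z: "z \<in> V"
  shows "pd a x z = \<omega> z * p z a"
proof (cases "\<gamma> = 0")
  case True
  have "x = \<phi>" "\<omega> z = 1" unfolding x_def[abs_def] \<omega>_def by (simp_all add: True)
  then show ?thesis using d\<phi>[OF z] by simp
next
  case False
  have "pd a \<omega> z = pd a (\<lambda>z. 1 + \<gamma> * x z) z" by (simp add: \<omega>_x[abs_def])
  also have "\<dots> = \<gamma> * pd a x z"
    using smooth_on_differentiable[OF smooth_x z] by (simp add: pd_add pd_mult)
  finally show ?thesis using False unfolding d\<omega>[OF z] by simp
qed

lemma smooth_h: "smooth_on V h"
  unfolding h_def[abs_def]
  by (intro smooth_on_divide smooth_on_minus smooth_on_power open_V smooth_f smooth_\<omega>) (simp add: \<omega>_def)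

text \<open>\<open>dl = - 2 \<gamma> p \<and> l\<close> is balanced by
  \<open>d(\<omega>^2) = 2 \<gamma> \<omega>^2 p\<close>.\<close>

lemma exterior_d_\<omega>l:
  assumes z: "z \<in> V"
  shows "exterior_d (\<lambda>w a. (\<omega> w)\<^sup>2 * l w a) z c a = 0"
proof -
  note dd = smooth_on_differentiable[OF smooth_\<omega> z]
  have "pd c (\<lambda>w. (\<omega> w)\<^sup>2) z = 2 * \<gamma> * (\<omega> z)\<^sup>2 * p z c" for c
    unfolding power2_eq_square by (simp add: pd_mult[OF dd dd] d\<omega>[OF z])
  moreover have "(\<lambda>w. (\<omega> w)\<^sup>2) differentiable (at z)" using dd by (simp add: differentiable_power)
  ultimately show ?thesis
    using exterior_d_scale[where \<theta>=l and f="\<lambda>w. (\<omega> w)\<^sup>2" and z=z and c=c and a=a] differentiable(1)[OF z]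
    by (simp add: exterior_d_l[OF z] algebra_simps)
qed

end

text \<open>With respect to \<open>u, v, x, y\<close>, the metric is that of the theorem with \<open>H\<close> replaced by \<open>h\<close>.\<close>

locale integrable_tetrad_u = integrable_tetrad V g vol l n p q \<gamma> \<phi> y v f for V g vol l n p q \<gamma> \<phi> y v f +
  fixes u :: "real^4 \<Rightarrow> real"
  assumes smooth_u: "smooth_on V u" and du: "\<And>z a. z \<in> V \<Longrightarrow> pd a u z = (\<omega> z)\<^sup>2 * l z a"
begin

lemma tetrad_differentials:
  assumes "z \<in> V"
  shows "l z a = (inverse (\<omega> z))\<^sup>2 * pd a u z" "n z a = pd a v z + h z * pd a u z"
    "p z a = inverse (\<omega> z) * pd a x z" "q z a = inverse (\<omega> z) * pd a y z"
  using \<omega>_pos[of z] du[OF assms, of a] dv[OF assms, of a] dx[OF assms, of a] dy[OF assms, of a]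
  by (simp_all add: h_def \<omega>_def[symmetric] power_inverse field_simps)

lemma metric_coordinates:
  assumes z: "z \<in> V"
  shows "g z a b = inverse ((1 + \<gamma> * x z)\<^sup>2) *
        (- (pd a u z * pd b v z + pd a v z * pd b u z) - 2 * h z * pd a u z * pd b u z
         + pd a x z * pd b x z + pd a y z * pd b y z)"
  unfolding g_eq[OF z] \<omega>_x[symmetric] tetrad_differentials[OF z]
  by (simp add: algebra_simps power2_eq_square)

lemma orientation:
  assumes z: "z \<in> V"
  shows "0 < vol z * det (coframe_matrix (differential u z) (differential v z) (differential x z) (differential y z))"
proof -
  let ?d = "det (coframe_matrix (differential u z) (differential v z) (differential x z) (differential y z))"
  interpret F: null_frame "g z" "vol z" "l z" "n z" "p z" "q z" using tetrad[OF z] by (simp add: null_frame_def)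
  have "l z = (\<lambda>a. (inverse (\<omega> z))\<^sup>2 * differential u z a)" "n z = (\<lambda>a. differential v z a + h z * differential u z a)"
    "p z = (\<lambda>a. inverse (\<omega> z) * differential x z a)" "q z = (\<lambda>a. inverse (\<omega> z) * differential y z a)"
    by (simp_all add: tetrad_differentials[OF z] differential_def fun_eq_iff)
  then have v: "vol z = inverse (\<omega> z) ^ 4 * ?d"
    using F.v_eq by (simp only: det_coframe_rescale)
  have "?d \<noteq> 0" using v F.v_eq F.det_nz by auto
  then have "0 < inverse (\<omega> z) ^ 4 * (?d * ?d)" using \<omega>_pos[of z] by (simp add: zero_less_mult_iff neq_iff disj_commute)
  then show ?thesis unfolding v by (simp add: mult.assoc)
qed

text \<open>\<open>dn = dh \<and> du\<close> contains the term \<open>k2 dv \<and> du\<close>, the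
  only one with an \<open>l \<and> n\<close> component, and \<open>wedge_d_n\<close> excludes such a
  component.\<close>

lemma h_independent_of_v:
  assumes z: "z \<in> V" and j: "l z j \<noteq> 0"
    and eq: "\<And>a. pd a h z = k1 * pd a u z + k2 * pd a v z + k3 * pd a x z + k4 * pd a y z"
  shows "k2 = 0"
proof -
  interpret F: null_frame_at g vol z "l z" "n z" "p z" "q z" by (rule frame[OF z])
  obtain \<mu> \<nu> where dn: "\<And>c a. exterior_d n z c a = \<mu> * (l z a * p z c - l z c * p z a) + \<nu> * (l z a * q z c - l z c * q z a)"
    by (rule wedge_d_n[OF z j smooth_\<phi> d\<phi> smooth_y dy]) (assumption+, erule that)
  have dh: "h differentiable (at z)" by (rule smooth_on_differentiable[OF smooth_h z])
  have du': "(\<lambda>w. pd a u w) differentiable (at z)" for a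
    by (rule smooth_on_differentiable[OF smooth_on_pd[OF smooth_u] z])
  have "exterior_d n z c a = exterior_d (\<lambda>w a. pd a v w + h w * pd a u w) z c a" for c a
    by (rule exterior_d_cong[OF open_V z tetrad_differentials(2)])
  moreover have "exterior_d (\<lambda>w a. pd a v w + h w * pd a u w) z c a
      = exterior_d (\<lambda>w a. pd a v w) z c a + exterior_d (\<lambda>w a. h w * pd a u w) z c a" for c a
    using smooth_on_differentiable[OF smooth_on_pd[OF smooth_v] z] dh du'
    by (simp add: exterior_d_def pd_add)
  moreover have "exterior_d (\<lambda>w a. pd a v w) z c a = 0" "exterior_d (\<lambda>w a. pd a u w) z c a = 0" for c a
    by (rule exterior_d_closed[OF open_V _ z]; (rule smooth_v smooth_u | rule refl))+
  ultimately have "pd c h z * pd a u z - pd a h z * pd c u z =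
      \<mu> * (l z a * p z c - l z c * p z a) + \<nu> * (l z a * q z c - l z c * q z a)" for c a
    using dn[of c a] exterior_d_scale[where f=h and \<theta>="\<lambda>w a. pd a u w" and z=z and c=c and a=a, OF dh du'] by simp
  \<comment> \<open>Pairing with \<open>L\<close> and \<open>N\<close> isolates the
    \<open>l \<and> n\<close> component.\<close>
  then have "pair F.L (\<lambda>c. pair F.N (\<lambda>a. pd c h z * pd a u z - pd a h z * pd c u z)) =
      pair F.L (\<lambda>c. pair F.N (\<lambda>a. \<mu> * (l z a * p z c - l z c * p z a) + \<nu> * (l z a * q z c - l z c * q z a)))"
    by simp
  then have "k2 * (\<omega> z)\<^sup>2 = 0"
    unfolding eq by (simp add: du[OF z] dv[OF z] dx[OF z] dy[OF z] \<omega>_def[symmetric] algebra_simps)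
  then show ?thesis using \<omega>_pos[of z] by simp
qed

end

section \<open>From the function \<open>h\<close> to a function \<open>H\<close> of three
  variables\<close>

lemma pd_zero_constant_line:
  fixes F :: "real^'n::finite \<Rightarrow> real"
  assumes F: "smooth_on (ball c r) F" and F0: "\<And>w. w \<in> ball c r \<Longrightarrow> pd i F w = 0"
    and w: "w \<in> ball c r" "w + t *\<^sub>R axis i 1 \<in> ball c r"
  shows "F (w + t *\<^sub>R axis i 1) = F w"
proof -
  define S where "S = (\<lambda>s. w + s *\<^sub>R axis i 1) -` ball c r"
  have "convex S" unfolding convex_alt
  proof (intro ballI allI impI)
    fix s1 s2 k :: real assume s: "s1 \<in> S" "s2 \<in> S" and k: "0 \<le> k \<and> k \<le> 1"
    have "w + ((1 - k) *\<^sub>R s1 + k *\<^sub>R s2) *\<^sub>R axis i 1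
        = (1 - k) *\<^sub>R (w + s1 *\<^sub>R axis i 1) + k *\<^sub>R (w + s2 *\<^sub>R axis i 1)"
      by (simp add: vec_eq_iff algebra_simps)
    also have "\<dots> \<in> ball c r"
      by (rule convexD_alt[OF convex_ball]) (use s k in \<open>auto simp: S_def\<close>)
    finally show "(1 - k) *\<^sub>R s1 + k *\<^sub>R s2 \<in> S" by (simp add: S_def)
  qed
  moreover have "((\<lambda>s. F (w + s *\<^sub>R axis i 1)) has_real_derivative 0) (at s within S)" if "s \<in> S" for s
  proof -
    have b: "w + s *\<^sub>R axis i 1 \<in> ball c r" using that by (simp add: S_def)
    have "((\<lambda>s. F (w + s *\<^sub>R axis i 1)) has_real_derivative pd i F (w + s *\<^sub>R axis i 1)) (at s)"
      by (rule has_real_derivative_along_axis[OF smooth_on_differentiable[OF F b]])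
    then show ?thesis unfolding F0[OF b] by (rule has_field_derivative_at_within)
  qed
  ultimately obtain k where k: "\<forall>s\<in>S. F (w + s *\<^sub>R axis i 1) = k"
    using has_field_derivative_zero_constant[of S "\<lambda>s. F (w + s *\<^sub>R axis i 1)"] by blast
  have "t \<in> S" "0 \<in> S" using w by (simp_all add: S_def)
  then show ?thesis using k[rule_format, of t] k[rule_format, of 0] by simp
qed

context integrable_tetrad_u
begin

lemma adapted_coordinates_exist:
  assumes z0: "z0 \<in> V" and j: "\<And>z. z \<in> V \<Longrightarrow> l z j \<noteq> 0"
  obtains W H where "z0 \<in> W" "W \<subseteq> V" "adapted_coordinates W g vol \<gamma> u v x y H"
proof -
  let ?\<Phi> = "\<lambda>z. vector [u z, v z, x z, y z] :: real^4" and ?k = "\<lambda>z. vector [u z, x z, y z] :: real^3"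
  note s\<Phi> = smooth_on_vector_4[OF smooth_u smooth_v smooth_x smooth_y]
  have dn: "det (\<chi> i j. pd j (\<lambda>z. ?\<Phi> z $ i) z0) \<noteq> 0"
    unfolding jacobian_matrix_4 using orientation[OF z0] by auto
  obtain W r \<Psi> where W: "open W" "z0 \<in> W" "W \<subseteq> V" "r > 0" "?\<Phi> ` W = ball (?\<Phi> z0) r" "inj_on ?\<Phi> W"
      "\<And>j. smooth_on (ball (?\<Phi> z0) r) (\<lambda>w. \<Psi> w $ j)"
      "\<And>w. w \<in> ball (?\<Phi> z0) r \<Longrightarrow> \<Psi> w \<in> W" "\<And>w. w \<in> ball (?\<Phi> z0) r \<Longrightarrow> ?\<Phi> (\<Psi> w) = w" "\<And>z. z \<in> W \<Longrightarrow> \<Psi> (?\<Phi> z) = z"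
    by (rule smooth_inverse_function[of V z0 ?\<Phi>, OF open_V z0 s\<Phi> dn]) (rule that; assumption)
  let ?B = "ball (?\<Phi> z0) r"
  have WV: "z \<in> V" if "z \<in> W" for z using that W(3) by blast
  have \<Phi>B: "?\<Phi> z \<in> ?B" if "z \<in> W" for z using imageI[OF that, of ?\<Phi>] unfolding W(5) .
  have O: "oriented_coordinates W vol u v x y"
    unfolding oriented_coordinates_def coframe_matrix_differential[symmetric]
  proof (intro conjI ballI)
    show "open W" "inj_on ?\<Phi> W" by (rule W)+
    show "smooth_on W u" "smooth_on W v" "smooth_on W x" "smooth_on W y"
      by (rule smooth_on_subset[OF _ W(3)], rule smooth_u smooth_v smooth_x smooth_y)+
  qed (rule orientation[OF WV])
  define F where "F = (\<lambda>w. h (\<Psi> w))"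
  have sF: "smooth_on ?B F"
    unfolding F_def by (rule smooth_on_compose[OF open_ball smooth_h W(7)]) (use W(8) WV in auto)
  have hF: "h z = F (?\<Phi> z)" if "z \<in> W" for z using W(10)[OF that] by (simp add: F_def)
  \<comment> \<open>\<open>F\<close> is \<open>h\<close> in the coordinates
    \<open>u, v, x, y\<close>; its partial derivatives are the coefficients of \<open>dh\<close> in
    the coordinate differentials.\<close>
  have F0: "pd 2 F w = 0" if w: "w \<in> ?B" for w
  proof -
    define z where "z = \<Psi> w"
    have zW: "z \<in> W" unfolding z_def by (rule W(8)[OF w])
    have \<Phi>z: "?\<Phi> z = w" unfolding z_def by (rule W(9)[OF w])
    have d: "(\<lambda>z. ?\<Phi> z $ j) differentiable (at z)" for j by (rule smooth_on_differentiable[OF s\<Phi> WV[OF zW]])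
    have dF: "F differentiable (at (?\<Phi> z))" unfolding \<Phi>z by (rule smooth_on_differentiable[OF sF w])
    have "pd a h z = pd 1 F w * pd a u z + pd 2 F w * pd a v z + pd 3 F w * pd a x z + pd 4 F w * pd a y z" for a
    proof -
      have "pd a h z = pd a (\<lambda>z. F (?\<Phi> z)) z" by (rule pd_cong[OF W(1) zW hF])
      also have "\<dots> = (\<Sum>j\<in>UNIV. pd j F (?\<Phi> z) * pd a (\<lambda>z. ?\<Phi> z $ j) z)" by (rule pd_compose(2)[OF dF d])
      finally show ?thesis unfolding \<Phi>z by (simp add: sum_4)
    qed
    then show ?thesis by (rule h_independent_of_v[OF WV[OF zW] j[OF WV[OF zW]]])
  qed
  \<comment> \<open>The value of \<open>v\<close> is frozen at that of the centre: this can only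
    bring a point closer to the centre of the ball, so \<open>H\<close> is defined over the whole
    image.\<close>
  define H where "H = (\<lambda>w::real^3. F (vector [w $ 1, v z0, w $ 2, w $ 3]))"
  have c: "vector [u z, v z0, x z, y z] \<in> ?B" if "z \<in> W" for z
  proof -
    have "dist (?k z0) (?k z) \<le> dist (?\<Phi> z0) (?\<Phi> z)"
      by (simp add: dist_norm norm_vec_def L2_set_def sum_3 sum_4)
    also have "\<dots> < r" using \<Phi>B[OF that] by simp
    finally show ?thesis unfolding dist_vector_3_4[of _ _ _ _ _ _ "v z0"] mem_ball .
  qed
  have Hk: "H (?k z) = h z" if z: "z \<in> W" for z
  proof -
    have e: "vector [u z, v z0, x z, y z] = ?\<Phi> z + (v z0 - v z) *\<^sub>R axis 2 1"
      by (simp add: vec_eq_iff forall_4 axis_def)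
    have "F (?\<Phi> z + (v z0 - v z) *\<^sub>R axis 2 1) = F (?\<Phi> z)"
      by (rule pd_zero_constant_line[OF sF F0 \<Phi>B[OF z]]) (assumption, use c[OF z] in \<open>simp only: e\<close>)
    then show ?thesis unfolding hF[OF z] H_def e[symmetric] by simp
  qed
  have "smooth_on (?k ` W) H"
    unfolding H_def
  proof (rule smooth_on_compose[OF open_image_coordinates[OF O] sF])
    show "smooth_on (?k ` W) (\<lambda>w. (vector [w $ 1, v z0, w $ 2, w $ 3] :: real^4) $ j)" for j
      by (rule smooth_on_vector_4) auto
    show "(\<lambda>w. vector [w $ 1, v z0, w $ 2, w $ 3] :: real^4) ` ?k ` W \<subseteq> ?B" using c by auto
  qed
  moreover have "1 + \<gamma> * x z \<noteq> 0" for z using \<omega>_pos[of z] \<omega>_x[of z] by simp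
  ultimately have "adapted_coordinates W g vol \<gamma> u v x y H"
    unfolding adapted_coordinates_def using O metric_coordinates[OF WV] Hk by simp
  with W(2,3) show ?thesis by (rule that)
qed

end

lemma (in adapted_null_tetrad) adapted_coordinates_exist:
  assumes z0: "z0 \<in> V" and j: "\<And>z. z \<in> V \<Longrightarrow> l z j \<noteq> 0"
  obtains W u v x y H where "z0 \<in> W" "W \<subseteq> V" "adapted_coordinates W g vol \<gamma> u v x y H"
proof -
  obtain W' n' p' q' \<phi> y v f where W': "open W'" "z0 \<in> W'" "W' \<subseteq> V"
    and I': "integrable_tetrad W' g vol l n' p' q' \<gamma> \<phi> y v f"
    by (rule integrable_tetrad[OF z0 j]) (assumption, (rule that; assumption))
  \<comment> \<open>On a ball the closed form \<open>\<omega>^2 l\<close> has a primitive, the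
    coordinate \<open>u\<close>.\<close>
  obtain r where r: "r > 0" "ball z0 r \<subseteq> W'" by (rule openE[OF W'(1,2)])
  interpret I: integrable_tetrad "ball z0 r" g vol l n' p' q' \<gamma> \<phi> y v f
    by (rule integrable_tetrad.integrable_tetrad_restrict[OF I' open_ball r(2)])
  have s: "smooth_on (ball z0 r) (\<lambda>z. (I.\<omega> z)\<^sup>2 * l z a)" for a
    by (intro smooth_on_mult smooth_on_power I.smooth_\<omega> I.smooth open_ball)
  have c: "pd a (\<lambda>w. (I.\<omega> w)\<^sup>2 * l w b) z = pd b (\<lambda>w. (I.\<omega> w)\<^sup>2 * l w a) z" if "z \<in> ball z0 r" for a b z
    using I.exterior_d_\<omega>l[OF that, of a b] by (simp add: exterior_d_def)
  obtain u where u: "smooth_on (ball z0 r) u" "\<And>a z. z \<in> ball z0 r \<Longrightarrow> pd a u z = (I.\<omega> z)\<^sup>2 * l z a"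
    by (rule closed_form_exact[where \<theta>="\<lambda>z a. (I.\<omega> z)\<^sup>2 * l z a", OF s c]) (assumption, erule that[rotated], assumption)
  interpret J: integrable_tetrad_u "ball z0 r" g vol l n' p' q' \<gamma> \<phi> y v f u
    by unfold_locales (use u in auto)
  have BV: "ball z0 r \<subseteq> V" by (rule order_trans[OF r(2) W'(3)])
  have zb: "z0 \<in> ball z0 r" using r(1) by simp
  obtain W H where W: "z0 \<in> W" "W \<subseteq> ball z0 r" "adapted_coordinates W g vol \<gamma> u v I.x y H"
    by (rule J.adapted_coordinates_exist[OF zb j[OF subsetD[OF BV]]]) (assumption, (rule that; assumption))
  show ?thesis by (rule that[OF W(1) order_trans[OF W(2) BV] W(3)])
qed

theorem theorem2:
  fixes U :: "(real^4) set" and g A :: "real tensor2" and vol :: "real^4 \<Rightarrow> real"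
  assumes "spacetime U g vol"
    and "conformal_killing_yano U g vol A"
    and "null_two_form U g vol A"
    and "killing U g (codifferential g A)"
    and "killing U g (codifferential g (hodge g vol A))"
    and "\<forall>z\<in>U. \<forall>a b. wedge (codifferential g A) (codifferential g (hodge g vol A)) z a b = 0"
  shows "(\<exists>\<gamma>\<ge>0. \<forall>z\<in>U. \<exists>V u v x y H.
            z \<in> V \<and> V \<subseteq> U \<and> adapted_coordinates V g vol \<gamma> u v x y H) \<and>
         (\<forall>\<gamma> V u v x y H. V \<subseteq> U \<and> adapted_coordinates V g vol \<gamma> u v x y H \<longrightarrow>
           (let \<omega> = (\<lambda>z. 1 + \<gamma> * x z);
                l = (\<lambda>z a. differential u z a / \<omega> z ^ 2);
                p = (\<lambda>z a. differential x z a / \<omega> z);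
                q = (\<lambda>z a. differential y z a / \<omega> z);
                m = (\<lambda>z a. (complex_of_real (p z a) + \<i> * complex_of_real (q z a))
                             / complex_of_real (sqrt 2));
                F = wedge l p;
                FF = self_dual g vol F;
                h = (\<lambda>z. vector [u z, x z, y z] :: real^3);
                H\<^sub>x = (\<lambda>z. pd 2 H (h z));
                H\<^sub>x\<^sub>x = (\<lambda>z. pd 2 (pd 2 H) (h z));
                H\<^sub>y\<^sub>y = (\<lambda>z. pd 3 (pd 3 H) (h z));
                H\<^sub>x\<^sub>y = (\<lambda>z. pd 3 (pd 2 H) (h z));
                \<sigma> = (\<lambda>z. \<omega> z ^ 4 * (H\<^sub>x\<^sub>x z + H\<^sub>y\<^sub>y z) - 2 * \<gamma> * \<omega> z ^ 3 * H\<^sub>x z);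
                \<Lambda> = - 3 * \<gamma>\<^sup>2;
                \<psi> = (\<lambda>z. complex_of_real (\<omega> z ^ 4) *
                       (complex_of_real (H\<^sub>x\<^sub>x z - H\<^sub>y\<^sub>y z) - 2 * \<i> * complex_of_real (H\<^sub>x\<^sub>y z)))
            in killing_yano V g vol (hodge g vol F) \<and>
               (\<forall>z\<in>V. \<forall>a b. F z a b = wedge (differential u) (differential x) z a b / \<omega> z ^ 3) \<and>
               (\<forall>z\<in>V. \<forall>a b. FF z a b = wedge (\<lambda>z a. complex_of_real (l z a)) m z a b) \<and>
               (\<forall>z\<in>V. \<forall>a b. ricci g z a b = \<sigma> z * l z a * l z b + \<Lambda> * g z a b) \<and>
               (\<forall>z\<in>V. \<forall>a b c d. self_dual_weyl g vol z a b c d =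
                   \<psi> z / 2 * FF z a b * FF z c d)))"
proof -
  interpret cky_null_spacetime U g A vol using assms by unfold_locales
  obtain \<gamma> where \<gamma>: "\<gamma> \<ge> 0" and T: "\<And>z0. z0 \<in> U \<Longrightarrow> \<exists>r l n p q j. r > 0 \<and> ball z0 r \<subseteq> U \<and>
    null_tetrad (ball z0 r) g vol l n p q \<and> (\<forall>z\<in>ball z0 r. l z j \<noteq> 0) \<and>
    (\<forall>z\<in>ball z0 r. \<forall>c a b. nabla2 g (wedge l p) z c a b = - \<gamma> * (l z a * g z c b - l z b * g z c a))"
    by (rule adapted_tetrad) (erule that[rotated], assumption)
  have "\<exists>V u v x y H. z0 \<in> V \<and> V \<subseteq> U \<and> adapted_coordinates V g vol \<gamma> u v x y H" if z0: "z0 \<in> U" for z0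
  proof -
    obtain r l n p q j where r: "r > 0" "ball z0 r \<subseteq> U" and N: "null_tetrad (ball z0 r) g vol l n p q"
      and j: "\<forall>z\<in>ball z0 r. l z j \<noteq> 0"
      and eq: "\<forall>z\<in>ball z0 r. \<forall>c a b. nabla2 g (wedge l p) z c a b = - \<gamma> * (l z a * g z c b - l z b * g z c a)"
      using T[OF z0] by (elim exE conjE) (rule that; assumption)
    interpret N: adapted_null_tetrad "ball z0 r" g vol l n p q \<gamma>
      using N eq by (auto simp: adapted_null_tetrad_def adapted_null_tetrad_axioms_def)
    have zb: "z0 \<in> ball z0 r" using r by simp
    obtain W u v x y H where W: "z0 \<in> W" "W \<subseteq> ball z0 r" "adapted_coordinates W g vol \<gamma> u v x y H"
      by (rule N.adapted_coordinates_exist[OF zb j[rule_format]]) (assumption, (rule that; assumption))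
    have "W \<subseteq> U" using W(2) r(2) by (rule order_trans)
    with W(1,3) show ?thesis by (intro exI conjI)
  qed
  with \<gamma> have coordinates: "\<exists>\<gamma>\<ge>0. \<forall>z\<in>U. \<exists>V u v x y H. z \<in> V \<and> V \<subseteq> U \<and> adapted_coordinates V g vol \<gamma> u v x y H"
    by (intro exI[of _ \<gamma>] conjI ballI)
  have vol: "smooth_on V vol" "\<And>z. z \<in> V \<Longrightarrow> (vol z)\<^sup>2 = - det (metric_matrix g z)" if "V \<subseteq> U" for V
    using assms(1) that smooth_on_subset by (auto simp: spacetime_def)
  show ?thesis
    by (rule conjI[OF coordinates], intro allI impI, elim conjE, rule adapted_coordinates_properties)
      (assumption, rule vol(1), assumption, (rule vol(2); assumption))
qed

end
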